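(* Assume the Generalised Riemann Hypothesis. For every $\varepsilon>0$ there is a constant $C_\varepsilon>0$ such that the following holds for every $N\ge 1$. If $A\subseteq\{1,2,\dots,N\}$ and the difference set $A-A=\{a-a':a,a'\in A\}$ contains no element of the form $p+1$ with $p$ a prime, then $|A|\le C_\varepsilon N^{\frac{89}{90}+\varepsilon}$. (In other words, $|A|\ll N^{\frac{89}{90}+o(1)}$.)
   Context: The Generalised Riemann Hypothesis (GRH) is the assertion that for every Dirichlet character $\chi$ (including the trivial one, which gives the Riemann zeta function), all zeros of $L(s,\chi)$ in the strip $0<\operatorname{Re}(s)<1$ lie on the line $\operatorname{Re}(s)=1/2$. *)

theory Defs
  imports "HOL-Complex_Analysis.Complex_Analysis"
begin

text \<open>
  All characters modulo \<open>q\<close> are meant, primitive or not. The principal character modulo 1 is the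
  constant 1, whose L-function is the Riemann zeta function.
\<close>

definition dirichlet_character :: "nat \<Rightarrow> (int \<Rightarrow> complex) \<Rightarrow> bool" where
  "dirichlet_character q chi \<longleftrightarrow>
     q \<ge> 1 \<and>
     (\<forall>m n. chi (m * n) = chi m * chi n) \<and>
     (\<forall>n. chi (n + int q) = chi n) \<and>
     (\<forall>n. chi n \<noteq> 0 \<longleftrightarrow> coprime n (int q))"

definition continues_dirichlet_series :: "(int \<Rightarrow> complex) \<Rightarrow> (complex \<Rightarrow> complex) \<Rightarrow> bool" where
  "continues_dirichlet_series chi F \<longleftrightarrow>
     F nicely_meromorphic_on UNIV \<and>
     (\<forall>s. Re s > 1 \<longrightarrow> (\<lambda>n. chi (int (Suc n)) / of_nat (Suc n) powr s) sums F s)"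

text \<open>
  \<open>L(s, chi)\<close> is the meromorphic continuation to the complex plane of the Dirichlet series
  \<open>\<Sum>\<^sub>n chi(n) n\<^sup>-\<^sup>s\<close>. Being nicely meromorphic fixes the value at a pole to be 0, so that the
  continuation is a unique function. The only pole that occurs is at \<open>s = 1\<close>, for principal
  \<open>chi\<close>, hence outside the strip considered below.
\<close>

definition dirichlet_L :: "(int \<Rightarrow> complex) \<Rightarrow> complex \<Rightarrow> complex" where
  "dirichlet_L chi = (THE F. continues_dirichlet_series chi F)"

lemma continues_dirichlet_series_unique:
  assumes F: "continues_dirichlet_series chi F" and G: "continues_dirichlet_series chi G"
  shows "F = G"
proof
  fix z :: complex
  define D where "D = remove_sings (\<lambda>s. F s - G s)"
  have nF: "F nicely_meromorphic_on UNIV" and nG: "G nicely_meromorphic_on UNIV"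
    using F G by (auto simp: continues_dirichlet_series_def)
  have mero: "(\<lambda>s. F s - G s) meromorphic_on UNIV"
    using nF nG by (auto simp: nicely_meromorphic_on_def intro!: meromorphic_intros)
  have nD: "D nicely_meromorphic_on UNIV"
    unfolding D_def using mero by (rule remove_sings_nicely_meromorphic)
  have eq: "F s - G s = 0" if "Re s > 1" for s
    using F G that by (auto simp: continues_dirichlet_series_def intro: sums_unique2)
  have op: "open {s. Re s > 1}"
    by (rule open_halfspace_Re_gt)
  have D0: "D s = 0" if "Re s > 1" for s
  proof -
    have "\<forall>\<^sub>F w in at s. F w - G w = 0"
      using eventually_at_in_open'[OF op, of s] that eq by (auto elim!: eventually_mono)
    hence "((\<lambda>s. F s - G s) \<longlongrightarrow> 0) (at s)"
      by (rule tendsto_eventually)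
    thus ?thesis
      unfolding D_def by (rule remove_sings_eqI)
  qed
  have "D constant_on UNIV"
  proof (rule constant_on_extend_nicely_meromorphic_on[OF nD])
    show "D constant_on {s. Re s > 1}"
      using D0 by (auto simp: constant_on_def)
    have "2 \<in> {s :: complex. Re s > 1}" by simp
    thus "{s :: complex. Re s > 1} \<noteq> {}" by blast
  qed (auto simp: op)
  then obtain c where c: "\<And>s. D s = c"
    by (auto simp: constant_on_def)
  have Dz: "D s = 0" for s
    using D0[of 2] c by simp
  have "\<forall>\<^sub>F w in at z. D w = F w - G w"
    unfolding D_def
    by (rule eventually_remove_sings_eq_at, rule meromorphic_on_isolated_singularity)
       (use mero in \<open>auto intro: meromorphic_on_subset\<close>)
  hence ev: "\<forall>\<^sub>F w in at z. F w = G w"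
    by eventually_elim (simp add: Dz)
  show "F z = G z"
  proof (cases "is_pole F z")
    case True
    hence "is_pole G z"
      using ev is_pole_cong[OF ev refl] by simp
    thus ?thesis
      using True nF nG by (metis UNIV_I is_pole_zero_at_nicely_mero)
  next
    case False
    hence "\<not> is_pole G z"
      using is_pole_cong[OF ev refl] by simp
    hence "F \<midarrow>z\<rightarrow> F z" "G \<midarrow>z\<rightarrow> G z"
      using False nF nG by (auto simp: nicely_meromorphic_on_def)
    moreover from this(2) have "F \<midarrow>z\<rightarrow> G z"
      using tendsto_cong[OF ev] by simp
    ultimately show ?thesis
      by (intro tendsto_unique[of "at z" F]) auto
  qed
qed

lemma dirichlet_L_eqI: "continues_dirichlet_series chi F \<Longrightarrow> dirichlet_L chi = F"
  unfolding dirichlet_L_def by (blast intro: continues_dirichlet_series_unique)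

definition generalised_riemann_hypothesis :: bool where
  "generalised_riemann_hypothesis \<longleftrightarrow>
     (\<forall>q chi. dirichlet_character q chi \<longrightarrow>
        (\<forall>s. 0 < Re s \<and> Re s < 1 \<and> dirichlet_L chi s = 0 \<longrightarrow> Re s = 1 / 2))"

definition difference_set :: "int set \<Rightarrow> int set" where
  "difference_set A = {a - a' | a a'. a \<in> A \<and> a' \<in> A}"

end

theory Submission
  imports Defs "HOL-Number_Theory.Totient" "HOL-Number_Theory.Prime_Powers" "HOL-Real_Asymp.Real_Asymp"
begin

text \<open>
  Let \<open>e(x) = exp(2 \<pi> i x)\<close> (written \<open>ee x\<close>) and let \<open>S(\<theta>) = \<Sum> w(n) e((n + 1) \<theta>)\<close>, where the real weights
  \<open>w(n)\<close> live on the primes \<open>n < N\<close>. If no \<open>n + 1\<close> with \<open>n\<close> prime is a difference of two elements of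
  \<open>A \<subseteq> {1..N}\<close>, then orthogonality modulo \<open>M = 2 N + 1\<close> gives \<open>\<Sum>\<^sub>r S(r/M) |\<Sum>\<^sub>a e(a r/M)|\<^sup>2 = 0\<close>, the sums
  over \<open>r\<close> modulo \<open>M\<close> and \<open>a\<close> in \<open>A\<close>. The term \<open>r = 0\<close> is \<open>S(0) |A|\<^sup>2\<close>; if \<open>Re S \<ge> -E\<close> everywhere, Parseval
  bounds the others below by \<open>-E M |A|\<close>, and hence \<open>|A| \<le> M E / S(0)\<close> (\<open>card_le_of_exponential_sum\<close>). It remains to
  find weights with \<open>S(0)\<close> of size \<open>N\<^sup>2\<close> whose sum is nowhere more negative than a constant times \<open>N\<close> to the
  power \<open>179/90 = 2 - 1/90\<close>; this is \<open>sieved_prime_sum_lower\<close>.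

  The plain choice \<open>w(n) = (N - n) log n\<close> fails. Near a fraction \<open>a/q\<close> its sum is the average of
  \<open>e(a (u + 1)/q)\<close> over the units \<open>u\<close> modulo \<open>q\<close>, times a kernel of nonnegative real part, and this average
  can be negative of size \<open>1/\<phi>(q)\<close>. The remedy is to multiply by \<open>W(n + 1)\<close>, where \<open>W\<close> is the sum, over all sets \<open>P\<close>
  of odd primes with product at most \<open>R\<close> (the 60th root of \<open>N\<close>), of \<open>\<Prod>\<^sub>l\<^sub>\<in>\<^sub>P local_weight l\<close>. The local weight
  at \<open>l\<close> satisfies three requirements.

  \<^item> Its mean over \<open>u + 1\<close>, for \<open>u\<close> a unit modulo \<open>l\<close>, is zero. Therefore a set \<open>P\<close> contributes to the main
    term at \<open>a/q\<close> only if all its primes divide \<open>q\<close> (\<open>unit_average_zero\<close>), and in particular only the empty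
    set contributes to \<open>S(0)\<close>.

  \<^item> For \<open>v\<close> not congruent to 1, the factor \<open>1 + local_weight l v\<close> equals \<open>1 - 1/l\<close> times
    \<open>H(v) = 1 + 2 [l | v] - [l | v - 1] - [l | v + 1]\<close>; and \<open>H\<close> vanishes at \<open>v = 1\<close>. If \<open>q \<le> R\<close>, all subsets
    of the odd primes of \<open>q\<close> occur, the sum over \<open>P\<close> factorises, and the zero of \<open>H\<close> absorbs the condition
    that \<open>v - 1\<close> is a unit. Since \<open>H\<close> has nonnegative Fourier coefficients, the resulting complete
    sum modulo \<open>q\<close> is nonnegative (\<open>sum_unit_average_nonneg\<close>).

  \<^item> It is a combination of boundedly many indicators of progressions modulo divisors of \<open>l\<close>. This gives the
    bound \<open>24\<^sup>k / q\<close> for the main coefficient, \<open>k\<close> being the number of prime factors of \<open>q\<close>; if \<open>q > R\<close>,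
    this is at most a constant times \<open>q\<close> to the power \<open>-2/3\<close>, hence times \<open>N\<close> to the power \<open>-1/90\<close>.

  The Riemann Hypothesis controls the error. For a character modulo \<open>m\<close>, the smoothed prime sum
  \<open>\<Sum>\<^sub>p (x - p) log p \<chi>(p)\<close> over \<open>p \<le> x\<close> is \<open>\<delta> x\<^sup>2/2\<close>, where \<open>\<delta>\<close> is 1 or 0 according to whether \<open>\<chi>\<close> is principal, up to
  \<open>O(log(m + 2))\<close> times \<open>x\<close> to the power \<open>31/20\<close> (\<open>prime_character_sum_GRH\<close>). Expanding a function of period
  \<open>m\<close> into characters costs a factor \<open>\<surd>m\<close>, by Parseval, and a double summation by parts inserts the
  oscillation \<open>e(n \<beta>)\<close>, where \<open>\<theta> = a/q + \<beta>\<close> comes from Dirichlet's approximation theorem with \<open>q\<close> at most \<open>N\<close> to the power \<open>4/5\<close>.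
  The exponents add up to less than \<open>2 - 1/90\<close> (\<open>error_term_bound\<close>).

  The character sums require the classical theory: the continuation of \<open>L(s, \<chi>)\<close> to \<open>Re s > 0\<close>
  with a polynomial bound, its nonvanishing on \<open>Re s = 1\<close>, an estimate for \<open>L'/L\<close> on \<open>Re s \<ge> 11/20\<close> by the
  theorem of Borel and Caratheodory, and a Perron formula for the Riesz mean \<open>\<Sum> a(n) (x - n)\<close>,
  whose line of integration is moved to \<open>Re s = 11/20\<close>.
\<close>

section \<open>Dirichlet characters\<close>

lemma char_cong:
  assumes "dirichlet_character q chi" "[a = b] (mod int q)"
  shows "chi a = chi b"
proof -
  have per: "chi (n + int q) = chi n" for n
    using assms by (auto simp: dirichlet_character_def)
  have k: "chi (n + int k * int q) = chi n" for n k
  proof (induction k)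
    case (Suc k)
    have "chi (n + int (Suc k) * int q) = chi ((n + int k * int q) + int q)"
      by (simp add: algebra_simps)
    also have "\<dots> = chi n"
      using Suc per by metis
    finally show ?case .
  qed auto
  obtain c where c: "b = a + int q * c"
    using assms(2) by (metis cong_iff_lin)
  show ?thesis
  proof (cases "c \<ge> 0")
    case True
    then show ?thesis using k[of a "nat c"] c by (simp add: algebra_simps)
  next
    case False
    then show ?thesis using k[of b "nat (-c)"] c by (simp add: algebra_simps)
  qed
qed

lemma char_mult: "dirichlet_character q chi \<Longrightarrow> chi (m * n) = chi m * chi n"
  by (auto simp: dirichlet_character_def)

lemma char_nz_iff: "dirichlet_character q chi \<Longrightarrow> chi n \<noteq> 0 \<longleftrightarrow> coprime n (int q)"
  by (auto simp: dirichlet_character_def)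

lemma char_one: assumes "dirichlet_character q chi" shows "chi 1 = 1"
proof -
  have "chi 1 \<noteq> 0" using char_nz_iff[OF assms, of 1] by simp
  moreover have "chi 1 = chi 1 * chi 1" using char_mult[OF assms, of 1 1] by simp
  ultimately show ?thesis by simp
qed

lemma char_power: "dirichlet_character q chi \<Longrightarrow> chi (a ^ k) = chi a ^ k"
  by (induction k) (auto simp: char_one char_mult)

text \<open>
  Two powers of \<open>a\<close> are congruent by the pigeonhole principle, and \<open>a\<close> can
  be cancelled.
\<close>

lemma exists_power_cong_1:
  assumes "q \<ge> (1::nat)" "coprime a (int q)"
  shows "\<exists>k>0. [a ^ k = 1] (mod int q)"
proof -
  have "\<not> inj_on (\<lambda>k. a ^ k mod int q) (UNIV :: nat set)"
  proof
    assume inj: "inj_on (\<lambda>k. a ^ k mod int q) (UNIV :: nat set)"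
    have "range (\<lambda>k. a ^ k mod int q) \<subseteq> {0..<int q}"
      using assms by auto
    hence "finite (range (\<lambda>k. a ^ k mod int q))" by (rule finite_subset) simp
    from finite_imageD[OF this inj] show False by simp
  qed
  then obtain i j where ij: "i < j" "a ^ i mod int q = a ^ j mod int q"
    unfolding inj_on_def by (metis nat_neq_iff)
  have "[a ^ i * 1 = a ^ i * a ^ (j - i)] (mod int q)"
    using ij by (simp add: cong_def flip: power_add)
  hence "[1 = a ^ (j - i)] (mod int q)"
    using assms(2) by (subst (asm) cong_mult_lcancel) auto
  thus ?thesis using ij(1) by (intro exI[of _ "j - i"]) (auto simp: cong_sym)
qed

lemma char_root_of_unity:
  assumes "dirichlet_character q chi" "coprime a (int q)"
  shows "\<exists>k>0. chi a ^ k = 1"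
proof -
  have "q \<ge> 1" using assms by (auto simp: dirichlet_character_def)
  then obtain k where k: "k > 0" "[a ^ k = 1] (mod int q)"
    using exists_power_cong_1 assms by blast
  have "chi (a ^ k) = chi 1" by (rule char_cong[OF assms(1) k(2)])
  thus ?thesis using k char_power[OF assms(1)] char_one[OF assms(1)] by auto
qed

lemma norm_char:
  assumes "dirichlet_character q chi"
  shows "norm (chi a) = (if coprime a (int q) then 1 else 0)"
proof (cases "coprime a (int q)")
  case True
  obtain k where "k > 0" "chi a ^ k = 1" using char_root_of_unity[OF assms True] by blast
  hence "norm (chi a) ^ k = 1" by (simp flip: norm_power)
  hence "norm (chi a) = 1" using \<open>k > 0\<close> power_eq_imp_eq_base[of "norm (chi a)" k 1] by simp
  thus ?thesis using True by simp
next
  case False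
  thus ?thesis using char_nz_iff[OF assms, of a] by auto
qed

lemma norm_char_le: "dirichlet_character q chi \<Longrightarrow> norm (chi a) \<le> 1"
  by (simp add: norm_char)

text \<open>
  A character of a subgroup of the units modulo \<open>q\<close>, in the encoding of
  \<open>dirichlet_character\<close>: the subgroup is a union \<open>H\<close> of residue classes of
  integers. Closure under inverses is automatic since every unit has finite order.
\<close>

definition partial_char :: "nat \<Rightarrow> int set \<Rightarrow> (int \<Rightarrow> complex) \<Rightarrow> bool" where
  "partial_char q H \<psi> \<longleftrightarrow> 1 \<in> H \<and> (\<forall>x\<in>H. coprime x (int q)) \<and>
     (\<forall>x\<in>H. \<forall>y\<in>H. x * y \<in> H \<and> \<psi> (x * y) = \<psi> x * \<psi> y) \<and> (\<forall>x\<in>H. \<psi> x \<noteq> 0) \<and>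
     (\<forall>x y. x \<in> H \<longrightarrow> [x = y] (mod int q) \<longrightarrow> y \<in> H \<and> \<psi> y = \<psi> x)"

lemma partial_charD:
  assumes "partial_char q H \<psi>"
  shows "1 \<in> H" "x \<in> H \<Longrightarrow> coprime x (int q)" "x \<in> H \<Longrightarrow> y \<in> H \<Longrightarrow> x * y \<in> H"
    "x \<in> H \<Longrightarrow> y \<in> H \<Longrightarrow> \<psi> (x * y) = \<psi> x * \<psi> y" "x \<in> H \<Longrightarrow> \<psi> x \<noteq> 0"
    "x \<in> H \<Longrightarrow> [x = y] (mod int q) \<Longrightarrow> y \<in> H"
    "x \<in> H \<Longrightarrow> [x = y] (mod int q) \<Longrightarrow> \<psi> y = \<psi> x"
proof -
  note A = assms[unfolded partial_char_def]
  show "1 \<in> H" using A by (rule conjunct1)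
  note A = conjunct2[OF A]
  show "x \<in> H \<Longrightarrow> coprime x (int q)" using conjunct1[OF A] by (rule bspec)
  note A = conjunct2[OF A]
  show "x \<in> H \<Longrightarrow> y \<in> H \<Longrightarrow> x * y \<in> H" "x \<in> H \<Longrightarrow> y \<in> H \<Longrightarrow> \<psi> (x * y) = \<psi> x * \<psi> y"
    using conjunct1[OF A] by blast+
  note A = conjunct2[OF A]
  show "x \<in> H \<Longrightarrow> \<psi> x \<noteq> 0" using conjunct1[OF A] by (rule bspec)
  note A = conjunct2[OF A]
  show "x \<in> H \<Longrightarrow> [x = y] (mod int q) \<Longrightarrow> y \<in> H"
    "x \<in> H \<Longrightarrow> [x = y] (mod int q) \<Longrightarrow> \<psi> y = \<psi> x"
    using A[THEN spec, THEN spec, of x y] by simp_all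
qed

text \<open>
  The standard step in extending characters of a finite abelian group. If \<open>k\<close> is least
  with \<open>g\<^sup>k \<in> H\<close>, every element of the subgroup generated by \<open>H\<close>
  and \<open>g\<close> is \<open>h g\<^sup>j\<close> with a unique \<open>j < k\<close>, and any
  \<open>k\<close>-th root \<open>w\<close> of \<open>\<psi>(g\<^sup>k)\<close> is an admissible
  value at \<open>g\<close>.
\<close>

lemma partial_char_extend:
  assumes q: "q \<ge> 1" and pc: "partial_char q H \<psi>" and g: "coprime g (int q)"
    and k: "k > 0" "g ^ k \<in> H" "\<And>j. 0 < j \<Longrightarrow> j < k \<Longrightarrow> g ^ j \<notin> H"
    and w: "w ^ k = \<psi> (g ^ k)"
  shows "\<exists>H' \<psi>'. partial_char q H' \<psi>' \<and> H \<subseteq> H' \<and> g \<in> H' \<and> (\<forall>x\<in>H. \<psi>' x = \<psi> x) \<and> \<psi>' g = w"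
proof -
  have H1: "1 \<in> H" and Hco: "\<And>x. x \<in> H \<Longrightarrow> coprime x (int q)"
    and Hm: "\<And>x y. x \<in> H \<Longrightarrow> y \<in> H \<Longrightarrow> x * y \<in> H"
    and \<psi>m: "\<And>x y. x \<in> H \<Longrightarrow> y \<in> H \<Longrightarrow> \<psi> (x * y) = \<psi> x * \<psi> y"
    and \<psi>0: "\<And>x. x \<in> H \<Longrightarrow> \<psi> x \<noteq> 0"
    and Hc: "\<And>x y. x \<in> H \<Longrightarrow> [x = y] (mod int q) \<Longrightarrow> y \<in> H"
    and \<psi>c: "\<And>x y. x \<in> H \<Longrightarrow> [x = y] (mod int q) \<Longrightarrow> \<psi> y = \<psi> x"
    by (fact partial_charD[OF pc])+
  have \<psi>1: "\<psi> 1 = 1" using \<psi>m[OF H1 H1] \<psi>0[OF H1] by simp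
  have Hp: "x ^ n \<in> H" if "x \<in> H" for x n
    by (induction n) (auto simp: H1 Hm that)
  have \<psi>p: "\<psi> (x ^ n) = \<psi> x ^ n" if "x \<in> H" for x n
    by (induction n) (auto simp: \<psi>1 \<psi>m that Hp)
  have inv: "\<exists>y\<in>H. [x * y = 1] (mod int q)" if x: "x \<in> H" for x
  proof -
    obtain n where n: "n > 0" "[x ^ n = 1] (mod int q)"
      using exists_power_cong_1[OF q Hco[OF x]] by blast
    have "x * x ^ (n - 1) = x ^ n" using n(1) by (cases n) auto
    thus ?thesis using n(2) Hp[OF x, of "n - 1"] by metis
  qed
  have div: "k dvd j" if j: "g ^ j \<in> H" for j
  proof -
    obtain y where y: "y \<in> H" "[(g ^ k) ^ (j div k) * y = 1] (mod int q)"
      using inv[OF Hp[OF k(2)]] by blast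
    have "g ^ j = (g ^ k) ^ (j div k) * g ^ (j mod k)"
      by (simp flip: power_mult power_add)
    hence "g ^ j * y = g ^ (j mod k) * ((g ^ k) ^ (j div k) * y)" by simp
    hence "[g ^ j * y = g ^ (j mod k) * 1] (mod int q)"
      using cong_scalar_left[OF y(2), of "g ^ (j mod k)"] by metis
    hence "g ^ (j mod k) \<in> H" using Hc[OF Hm[OF j y(1)]] by simp
    hence "j mod k = 0" using k(3)[of "j mod k"] k(1) by (metis gr0I mod_less_divisor)
    thus ?thesis by auto
  qed
  have wd_le: "w ^ i * \<psi> h = w ^ j * \<psi> h'"
    if h: "h \<in> H" "h' \<in> H" and c: "[g ^ i * h = g ^ j * h'] (mod int q)" and ij: "i \<le> j" for i j h h'
  proof -
    have "[g ^ i * h = g ^ i * (g ^ (j - i) * h')] (mod int q)"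
      using c ij by (simp flip: power_add mult.assoc)
    hence c': "[h = g ^ (j - i) * h'] (mod int q)"
      using g by (subst (asm) cong_mult_lcancel) auto
    obtain y where y: "y \<in> H" "[h' * y = 1] (mod int q)" using inv[OF h(2)] by blast
    have "[h * y = g ^ (j - i) * h' * y] (mod int q)" using c' by (rule cong_scalar_right)
    also have "g ^ (j - i) * h' * y = g ^ (j - i) * (h' * y)" by simp
    also have "[\<dots> = g ^ (j - i) * 1] (mod int q)" using y(2) by (rule cong_scalar_left)
    finally have gH: "g ^ (j - i) \<in> H" using Hc[OF Hm[OF h(1) y(1)]] by simp
    then obtain d where d: "j - i = k * d" using div by blast
    have "w ^ (j - i) = \<psi> (g ^ (j - i))"
      unfolding d using w \<psi>p[OF k(2)] by (simp add: power_mult)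
    moreover have "\<psi> h = \<psi> (g ^ (j - i) * h')"
      using \<psi>c[OF h(1) c'] by simp
    ultimately have "\<psi> h = w ^ (j - i) * \<psi> h'" using \<psi>m[OF gH h(2)] by simp
    thus ?thesis using ij by (simp flip: power_add mult.assoc)
  qed
  have wd: "w ^ i * \<psi> h = w ^ j * \<psi> h'"
    if h: "h \<in> H" "h' \<in> H" and c: "[g ^ i * h = g ^ j * h'] (mod int q)" for i j h h'
  proof (cases "i \<le> j")
    case True thus ?thesis using wd_le[OF h c] by simp
  next
    case False thus ?thesis using wd_le[OF h(2,1) cong_sym[OF c]] by simp
  qed
  define H' where "H' = {x. \<exists>j::nat. \<exists>h\<in>H. [x = g ^ j * h] (mod int q)}"
  define \<psi>' where "\<psi>' x = (SOME z. \<exists>j h. h \<in> H \<and> [x = g ^ j * h] (mod int q) \<and> z = w ^ j * \<psi> h)" for x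
  have \<psi>': "\<psi>' x = w ^ j * \<psi> h" if "h \<in> H" "[x = g ^ j * h] (mod int q)" for x j h
  proof -
    have "\<exists>z. \<exists>j h. h \<in> H \<and> [x = g ^ j * h] (mod int q) \<and> z = w ^ j * \<psi> h" using that by blast
    hence "\<exists>j h. h \<in> H \<and> [x = g ^ j * h] (mod int q) \<and> \<psi>' x = w ^ j * \<psi> h"
      unfolding \<psi>'_def by (rule someI_ex)
    then obtain j' h' where "h' \<in> H" "[x = g ^ j' * h'] (mod int q)" "\<psi>' x = w ^ j' * \<psi> h'" by blast
    thus ?thesis using wd[of h' h j' j] that by (metis cong_sym cong_trans)
  qed
  have sub: "x \<in> H'" "\<psi>' x = \<psi> x" if "x \<in> H" for x
  proof -
    have c: "[x = g ^ 0 * x] (mod int q)" by simp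
    show "x \<in> H'" unfolding H'_def using that c by blast
    show "\<psi>' x = \<psi> x" using \<psi>'[OF that c] by simp
  qed
  have cg: "[g = g ^ 1 * 1] (mod int q)" by simp
  have gH': "g \<in> H'" unfolding H'_def using H1 cg by blast
  have g\<psi>': "\<psi>' g = w" using \<psi>'[OF H1 cg] \<psi>1 by simp
  have w0: "w \<noteq> 0" using w \<psi>0[OF k(2)] k(1) by (metis power_0_left not_gr0)
  have "partial_char q H' \<psi>'"
    unfolding partial_char_def
  proof (intro conjI ballI allI impI)
    show "1 \<in> H'" using sub H1 by blast
  next
    fix x assume "x \<in> H'"
    then obtain j h where jh: "h \<in> H" "[x = g ^ j * h] (mod int q)" unfolding H'_def by blast
    have "coprime (g ^ j * h) (int q)" using g Hco[OF jh(1)] by simp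
    thus "coprime x (int q)" using jh(2) by (metis coprime_iff_gcd_eq_1 cong_gcd_eq)
    show "\<psi>' x \<noteq> 0" using \<psi>'[OF jh] w0 \<psi>0[OF jh(1)] by simp
  next
    fix x y assume "x \<in> H'" "y \<in> H'"
    then obtain j h j' h' where jh: "h \<in> H" "[x = g ^ j * h] (mod int q)"
      "h' \<in> H" "[y = g ^ j' * h'] (mod int q)" unfolding H'_def by blast
    have c: "[x * y = g ^ (j + j') * (h * h')] (mod int q)"
      using cong_mult[OF jh(2,4)] by (simp add: power_add mult_ac)
    show "x * y \<in> H'" unfolding H'_def using c Hm[OF jh(1,3)] by blast
    show "\<psi>' (x * y) = \<psi>' x * \<psi>' y"
      using \<psi>'[OF Hm[OF jh(1,3)] c] \<psi>'[OF jh(1,2)] \<psi>'[OF jh(3,4)] \<psi>m[OF jh(1,3)]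
      by (simp add: power_add)
  next
    fix x y assume "x \<in> H'" and xy: "[x = y] (mod int q)"
    then obtain j h where jh: "h \<in> H" "[x = g ^ j * h] (mod int q)" unfolding H'_def by blast
    have c: "[y = g ^ j * h] (mod int q)" using xy jh(2) by (metis cong_sym cong_trans)
    show "y \<in> H'" unfolding H'_def using jh(1) c by blast
    show "\<psi>' y = \<psi>' x" using \<psi>'[OF jh(1) c] \<psi>'[OF jh] by simp
  qed
  thus ?thesis using sub gH' g\<psi>' by blast
qed

lemma least_power_in:
  assumes "q \<ge> (1::nat)" "coprime g (int q)" "partial_char q H \<psi>"
  obtains k where "k > 0" "g ^ k \<in> H" "\<And>j. 0 < j \<Longrightarrow> j < k \<Longrightarrow> g ^ j \<notin> H"
proof -
  obtain n where n: "n > 0" "[g ^ n = 1] (mod int q)" using exists_power_cong_1 assms by blast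
  have "g ^ n \<in> H" using partial_charD(1,6)[OF assms(3)] cong_sym[OF n(2)] by blast
  hence ex: "\<exists>n. n > 0 \<and> g ^ n \<in> H" using n(1) by blast
  define k where "k = (LEAST n. n > 0 \<and> g ^ n \<in> H)"
  have "k > 0 \<and> g ^ k \<in> H" unfolding k_def by (rule LeastI_ex[OF ex])
  moreover have "g ^ j \<notin> H" if "0 < j" "j < k" for j
    using not_less_Least[of j "\<lambda>n. n > 0 \<and> g ^ n \<in> H"] that unfolding k_def by blast
  ultimately show ?thesis using that by blast
qed

text \<open>
  Adjoin the missing units one at a time; the number of residues outside \<open>H\<close> decreases.
\<close>

lemma partial_char_extends_to_character:
  assumes "q \<ge> 1" "partial_char q H \<psi>"
  shows "\<exists>chi. dirichlet_character q chi \<and> (\<forall>x\<in>H. chi x = \<psi> x)"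
  using assms(2)
proof (induction "card ({0..<int q} - H)" arbitrary: H \<psi> rule: less_induct)
  case less
  note pc = less.prems
  show ?case
  proof (cases "\<forall>g. coprime g (int q) \<longrightarrow> g \<in> H")
    case True
    hence H: "x \<in> H \<longleftrightarrow> coprime x (int q)" for x
      using partial_charD(2)[OF pc] True by blast
    define chi where "chi n = (if coprime n (int q) then \<psi> n else 0)" for n
    have "dirichlet_character q chi"
      unfolding dirichlet_character_def
    proof (intro conjI allI)
      show "chi (m * n) = chi m * chi n" for m n
        using partial_charD(4)[OF pc, unfolded H] by (auto simp: chi_def)
      show "chi (n + int q) = chi n" for n
      proof -
        have c: "coprime (n + int q) (int q) \<longleftrightarrow> coprime n (int q)"
          by (simp only: coprime_iff_gcd_eq_1 gcd_add1)
        have nq: "[n = n + int q] (mod int q)" by (simp add: cong_def)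
        show ?thesis
        proof (cases "coprime n (int q)")
          case True
          have "\<psi> (n + int q) = \<psi> n" by (rule partial_charD(7)[OF pc _ nq]) (simp only: H True)
          thus ?thesis using True c by (simp only: chi_def if_True)
        next
          case False
          thus ?thesis using c by (simp only: chi_def if_False)
        qed
      qed
      show "chi n \<noteq> 0 \<longleftrightarrow> coprime n (int q)" for n
        using partial_charD(5)[OF pc, unfolded H] by (auto simp: chi_def)
    qed (use assms in auto)
    moreover have "\<forall>x\<in>H. chi x = \<psi> x"
    proof
      fix x assume "x \<in> H"
      hence "coprime x (int q)" by (simp only: H)
      thus "chi x = \<psi> x" by (simp only: chi_def if_True)
    qed
    ultimately show ?thesis by blast
  next
    case False
    then obtain g where g: "coprime g (int q)" "g \<notin> H" by blast
    obtain k where k: "k > 0" "g ^ k \<in> H" "\<And>j. 0 < j \<Longrightarrow> j < k \<Longrightarrow> g ^ j \<notin> H"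
      using least_power_in[OF assms(1) g(1) pc] by blast
    obtain w where w: "w ^ k = \<psi> (g ^ k)"
      using exists_complex_root[of k "\<psi> (g ^ k)" thesis] k(1) by (metis not_gr0)
    obtain H' \<psi>' where H': "partial_char q H' \<psi>'" "H \<subseteq> H'" "g \<in> H'" "\<forall>x\<in>H. \<psi>' x = \<psi> x"
      using partial_char_extend[OF assms(1) pc g(1) k w] by blast
    have gm: "[g = g mod int q] (mod int q)" by (simp add: cong_def)
    have "g mod int q \<in> H'" using partial_charD(6)[OF H'(1,3) gm] .
    moreover have "g mod int q \<notin> H"
      using partial_charD(6)[OF pc _ cong_sym[OF gm]] g(2) by blast
    moreover have "g mod int q \<in> {0..<int q}" using assms(1) by auto
    ultimately have "{0..<int q} - H' \<subset> {0..<int q} - H" using H'(2) by blast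
    hence "card ({0..<int q} - H') < card ({0..<int q} - H)"
      by (intro psubset_card_mono) auto
    from less.hyps[OF this H'(1)] obtain chi where chi: "dirichlet_character q chi" "\<forall>x\<in>H'. chi x = \<psi>' x" by blast
    have "chi x = \<psi> x" if "x \<in> H" for x using chi(2) H'(2,4) that by (metis subsetD)
    thus ?thesis using chi(1) by blast
  qed
qed

text \<open>
  Send \<open>a\<close> to a nontrivial root of unity whose order divides that of \<open>a\<close>,
  and extend this character of the group generated by \<open>a\<close>.
\<close>

lemma exists_character_neq_1:
  assumes "q \<ge> 1" "coprime a (int q)" "\<not> [a = 1] (mod int q)"
  shows "\<exists>chi. dirichlet_character q chi \<and> chi a \<noteq> 1"
proof -
  define H where "H = {x. [x = 1] (mod int q)}"
  have pc: "partial_char q H (\<lambda>_. 1)"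
    unfolding partial_char_def
  proof (intro conjI ballI allI impI)
    show "coprime x (int q)" if "x \<in> H" for x
    proof -
      have "[1 = x] (mod int q)" using that by (simp add: H_def cong_sym)
      from cong_imp_coprime[OF this] show ?thesis by simp
    qed
    show "x * y \<in> H" if "x \<in> H" "y \<in> H" for x y
      using cong_mult[of x 1 "int q" y 1] that by (simp add: H_def)
    show "y \<in> H" if "x \<in> H" "[x = y] (mod int q)" for x y
      using cong_trans[OF cong_sym[OF that(2)], of 1] that(1) by (simp add: H_def)
  qed (simp_all add: H_def)
  obtain k where k: "k > 0" "a ^ k \<in> H" "\<And>j. 0 < j \<Longrightarrow> j < k \<Longrightarrow> a ^ j \<notin> H"
    using least_power_in[OF assms(1,2) pc] by blast
  have "k \<noteq> 1" using k(2) assms(3) by (auto simp: H_def)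
  hence k2: "k \<ge> 2" using k(1) by linarith
  define w where "w = cis (2 * pi / real k)"
  have wk: "w ^ k = 1" using k(1) by (simp add: w_def Complex.DeMoivre flip: cis_2pi)
  have "w \<noteq> 1"
    using complex_root_unity_eq_1[of k 1] k2 by (simp add: w_def cis_conv_exp mult_ac)
  have "w ^ k = (\<lambda>_. 1) (a ^ k)" using wk by simp
  from partial_char_extend[OF assms(1) pc assms(2) k this]
  obtain H' \<psi>' where H': "partial_char q H' \<psi>'" "a \<in> H'" "\<psi>' a = w"
    by blast
  obtain chi where chi: "dirichlet_character q chi" "\<forall>x\<in>H'. chi x = \<psi>' x"
    using partial_char_extends_to_character[OF assms(1) H'(1)] by blast
  have "chi a = w" using chi(2) H' by metis
  thus ?thesis using chi(1) \<open>w \<noteq> 1\<close> by metis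
qed

definition unit_residues :: "nat \<Rightarrow> int set" where
  "unit_residues q = {a \<in> {0..<int q}. coprime a (int q)}"

definition characters :: "nat \<Rightarrow> (int \<Rightarrow> complex) set" where
  "characters q = {chi. dirichlet_character q chi}"

definition principal_char :: "nat \<Rightarrow> int \<Rightarrow> complex" where
  "principal_char q n = (if coprime n (int q) then 1 else 0)"

lemma finite_unit_residues [simp]: "finite (unit_residues q)"
  unfolding unit_residues_def by (rule finite_subset[of _ "{0..<int q}"]) auto

lemma coprime_add_modulus: "coprime (n + int q) (int q) \<longleftrightarrow> coprime n (int q)"
  by (simp only: coprime_iff_gcd_eq_1 gcd_add1)

lemma coprime_mod_modulus: "q \<ge> 1 \<Longrightarrow> coprime (n mod int q) (int q) \<longleftrightarrow> coprime n (int q)"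
  by (simp add: coprime_iff_gcd_eq_1 gcd.commute gcd_red_int[symmetric])

lemma mod_in_unit_residues: "q \<ge> 1 \<Longrightarrow> coprime n (int q) \<Longrightarrow> n mod int q \<in> unit_residues q"
  by (simp add: unit_residues_def coprime_mod_modulus)

lemma unit_residues_nonempty: "q \<ge> 1 \<Longrightarrow> card (unit_residues q) > 0"
  using mod_in_unit_residues[of q 1] by (auto simp: card_gt_0_iff)

lemma dirichlet_character_principal: "q \<ge> 1 \<Longrightarrow> dirichlet_character q (principal_char q)"
  by (auto simp: dirichlet_character_def principal_char_def coprime_add_modulus)

lemma dirichlet_character_mult:
  "dirichlet_character q chi \<Longrightarrow> dirichlet_character q psi \<Longrightarrow> dirichlet_character q (\<lambda>n. psi n * chi n)"
  unfolding dirichlet_character_def by (simp add: mult_ac)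

lemma char_eqI:
  assumes "dirichlet_character q chi" "dirichlet_character q psi"
    and "\<And>a. a \<in> {0..<int q} \<Longrightarrow> chi a = psi a"
  shows "chi = psi"
proof
  fix n
  have q: "q \<ge> 1" using assms by (simp add: dirichlet_character_def)
  have c: "[n = n mod int q] (mod int q)" by (simp add: cong_def)
  have "chi (n mod int q) = psi (n mod int q)" using q by (intro assms(3)) auto
  thus "chi n = psi n" using char_cong[OF assms(1) c] char_cong[OF assms(2) c] by simp
qed

text \<open>
  A character is determined by its values on one period, and each value is 0 or a root of unity of
  bounded order.
\<close>

lemma finite_characters: "finite (characters q)"
proof (cases "q \<ge> 1")
  case True
  have "\<exists>S. finite S \<and> (\<forall>chi\<in>characters q. chi a \<in> S)" for a
  proof (cases "coprime a (int q)")
    case co: True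
    obtain k where k: "k > 0" "[a ^ k = 1] (mod int q)"
      using exists_power_cong_1[OF True co] by blast
    have "chi a \<in> {z. z ^ k = 1}" if "chi \<in> characters q" for chi
    proof -
      have chi: "dirichlet_character q chi" using that by (simp add: characters_def)
      show ?thesis using char_cong[OF chi k(2)] char_power[OF chi] char_one[OF chi] by simp
    qed
    moreover have "finite {z::complex. z ^ k = 1}"
      using k(1) by (intro finite_roots_unity) auto
    ultimately show ?thesis by blast
  next
    case False
    hence "\<forall>chi\<in>characters q. chi a \<in> {0}" using char_nz_iff by (auto simp: characters_def)
    thus ?thesis by (intro exI[of _ "{0}"]) auto
  qed
  then obtain S where S: "\<And>a. finite (S a)" "\<And>a chi. chi \<in> characters q \<Longrightarrow> chi a \<in> S a"
    by metis
  have "inj_on (\<lambda>chi. restrict chi {0..<int q}) (characters q)"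
  proof (rule inj_onI)
    fix chi psi assume *: "chi \<in> characters q" "psi \<in> characters q"
      "restrict chi {0..<int q} = restrict psi {0..<int q}"
    have "chi a = psi a" if "a \<in> {0..<int q}" for a
      using fun_cong[OF *(3), of a] that by simp
    thus "chi = psi" using * char_eqI[of q chi psi] by (simp add: characters_def)
  qed
  moreover have "(\<lambda>chi. restrict chi {0..<int q}) ` characters q \<subseteq> PiE {0..<int q} S"
    using S(2) by auto
  hence "finite ((\<lambda>chi. restrict chi {0..<int q}) ` characters q)"
    by (rule finite_subset) (auto intro!: finite_PiE S(1))
  ultimately show ?thesis by (rule finite_imageD[rotated])
next
  case False
  hence "characters q = {}" by (auto simp: characters_def dirichlet_character_def)
  thus ?thesis by simp
qed

text \<open>
  Multiplication by a unit permutes the unit residues.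
\<close>

lemma sum_unit_residues_mult:
  assumes q: "q \<ge> 1" and b: "coprime b (int q)"
    and f: "\<And>x y. [x = y] (mod int q) \<Longrightarrow> f x = f y"
  shows "(\<Sum>a\<in>unit_residues q. f (b * a)) = (\<Sum>a\<in>unit_residues q. f a :: complex)"
proof -
  define h where "h a = (b * a) mod int q" for a
  have inj: "inj_on h (unit_residues q)"
  proof (rule inj_onI)
    fix x y assume *: "x \<in> unit_residues q" "y \<in> unit_residues q" "h x = h y"
    have "[b * x = b * y] (mod int q)" using *(3) by (simp add: h_def cong_def)
    hence "[x = y] (mod int q)" using b by (subst (asm) cong_mult_lcancel) auto
    thus "x = y" using * by (auto simp: unit_residues_def cong_def)
  qed
  have "h ` unit_residues q \<subseteq> unit_residues q"
  proof
    fix y assume "y \<in> h ` unit_residues q"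
    then obtain x where x: "x \<in> unit_residues q" "y = h x" by blast
    have "coprime (b * x) (int q)" using b x(1) by (simp add: unit_residues_def)
    thus "y \<in> unit_residues q" unfolding x(2) h_def by (rule mod_in_unit_residues[OF q])
  qed
  hence im: "h ` unit_residues q = unit_residues q"
    by (intro endo_inj_surj inj finite_unit_residues)
  have "(\<Sum>a\<in>unit_residues q. f a) = (\<Sum>a\<in>h ` unit_residues q. f a)" by (simp add: im)
  also have "\<dots> = (\<Sum>a\<in>unit_residues q. f (h a))" by (rule sum.reindex_cong[OF inj refl refl])
  also have "\<dots> = (\<Sum>a\<in>unit_residues q. f (b * a))"
    by (intro sum.cong refl f) (simp add: h_def cong_def)
  finally show ?thesis by simp
qed

lemma nonprincipal_char_exists:
  assumes "dirichlet_character q chi" "chi \<noteq> principal_char q"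
  shows "\<exists>b. coprime b (int q) \<and> chi b \<noteq> 1"
proof (rule ccontr)
  assume *: "\<not> ?thesis"
  have "chi n = principal_char q n" for n
    using * char_nz_iff[OF assms(1), of n] by (auto simp: principal_char_def)
  thus False using assms(2) by blast
qed

text \<open>
  Orthogonality: if \<open>\<chi>(b) \<noteq> 1\<close>, the substitution \<open>a \<mapsto> b
  a\<close> multiplies the sum by \<open>\<chi>(b)\<close>.
\<close>

lemma sum_char_unit_residues:
  assumes chi: "dirichlet_character q chi"
  shows "(\<Sum>a\<in>unit_residues q. chi a) =
    (if chi = principal_char q then of_nat (card (unit_residues q)) else 0)"
proof (cases "chi = principal_char q")
  case True
  have "(\<Sum>a\<in>unit_residues q. chi a) = (\<Sum>a\<in>unit_residues q. 1)"
    unfolding True by (intro sum.cong) (auto simp: unit_residues_def principal_char_def)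
  thus ?thesis using True by simp
next
  case False
  then obtain b where b: "coprime b (int q)" "chi b \<noteq> 1"
    using nonprincipal_char_exists[OF chi] by blast
  have q: "q \<ge> 1" using chi by (simp add: dirichlet_character_def)
  have "chi b * (\<Sum>a\<in>unit_residues q. chi a) = (\<Sum>a\<in>unit_residues q. chi a)"
    using sum_unit_residues_mult[OF q b(1), of chi] char_cong[OF chi]
    by (simp add: char_mult[OF chi] sum_distrib_left)
  hence "(chi b - 1) * (\<Sum>a\<in>unit_residues q. chi a) = 0" by (simp add: algebra_simps)
  thus ?thesis using b(2) False by simp
qed

text \<open>
  The dual orthogonality, by multiplying with a character that separates \<open>a\<close> from 1.
\<close>

lemma sum_characters_at:
  assumes q: "q \<ge> 1" and a: "coprime a (int q)" "\<not> [a = 1] (mod int q)"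
  shows "(\<Sum>chi\<in>characters q. chi a) = 0"
proof -
  obtain psi where psi: "dirichlet_character q psi" "psi a \<noteq> 1"
    using exists_character_neq_1[OF q a] by blast
  define h where "h chi = (\<lambda>n. psi n * chi n)" for chi :: "int \<Rightarrow> complex"
  have inj: "inj_on h (characters q)"
  proof (rule inj_onI)
    fix x y assume *: "x \<in> characters q" "y \<in> characters q" "h x = h y"
    have ch: "dirichlet_character q x" "dirichlet_character q y" using * by (auto simp: characters_def)
    show "x = y"
    proof
      fix n
      have "psi n * x n = psi n * y n" using fun_cong[OF *(3), of n] by (simp add: h_def)
      thus "x n = y n"
        using char_nz_iff[OF psi(1), of n] char_nz_iff[OF ch(1), of n] char_nz_iff[OF ch(2), of n]
        by (cases "coprime n (int q)") auto
    qed
  qed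
  have "h ` characters q \<subseteq> characters q"
    using dirichlet_character_mult[OF _ psi(1)] by (auto simp: h_def characters_def)
  hence im: "h ` characters q = characters q"
    by (intro endo_inj_surj inj finite_characters)
  have "(\<Sum>chi\<in>characters q. chi a) = (\<Sum>chi\<in>h ` characters q. chi a)" by (simp add: im)
  also have "\<dots> = (\<Sum>chi\<in>characters q. h chi a)" by (rule sum.reindex_cong[OF inj refl refl])
  also have "\<dots> = psi a * (\<Sum>chi\<in>characters q. chi a)" by (simp add: h_def sum_distrib_left)
  finally have "(psi a - 1) * (\<Sum>chi\<in>characters q. chi a) = 0" by (simp add: algebra_simps)
  thus ?thesis using psi(2) by simp
qed

text \<open>
  Count \<open>\<Sum>\<^sub>\<chi> \<Sum>\<^sub>a \<chi>(a)\<close> in both orders: only the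
  principal character, respectively only \<open>a = 1\<close>, survives.
\<close>

lemma card_characters:
  assumes q: "q \<ge> 1" shows "card (characters q) = card (unit_residues q)"
proof -
  have "(\<Sum>chi\<in>characters q. \<Sum>a\<in>unit_residues q. chi a) =
        (\<Sum>chi\<in>characters q. if chi = principal_char q then of_nat (card (unit_residues q)) else 0)"
    by (intro sum.cong refl sum_char_unit_residues) (simp add: characters_def)
  also have "\<dots> = of_nat (card (unit_residues q))"
    using dirichlet_character_principal[OF q] characters_def[of q]
    sum.delta[OF finite_characters[of q], of "principal_char q" "\<lambda>_. of_nat (card (unit_residues q))"]
    by simp
  finally have 1: "(\<Sum>chi\<in>characters q. \<Sum>a\<in>unit_residues q. chi a) = of_nat (card (unit_residues q))" .
  have "(\<Sum>chi\<in>characters q. chi a) = (if a = 1 mod int q then of_nat (card (characters q)) else 0)"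
    if a: "a \<in> unit_residues q" for a
  proof (cases "a = 1 mod int q")
    case True
    hence c: "[a = 1] (mod int q)" by (simp add: cong_def)
    have "(\<Sum>chi\<in>characters q. chi a) = (\<Sum>chi\<in>characters q. 1)"
    proof (intro sum.cong refl)
      fix chi assume "chi \<in> characters q"
      hence chi: "dirichlet_character q chi" by (simp add: characters_def)
      show "chi a = 1" using char_cong[OF chi c] char_one[OF chi] by simp
    qed
    thus ?thesis using True by simp
  next
    case False
    hence "\<not> [a = 1] (mod int q)" using a by (auto simp: cong_def unit_residues_def)
    thus ?thesis using False sum_characters_at[OF q] a by (auto simp: unit_residues_def)
  qed
  hence "(\<Sum>a\<in>unit_residues q. \<Sum>chi\<in>characters q. chi a) =
     (\<Sum>a\<in>unit_residues q. if a = 1 mod int q then of_nat (card (characters q)) else 0)"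
    by (intro sum.cong refl) auto
  also have "\<dots> = of_nat (card (characters q))"
    using mod_in_unit_residues[OF q, of 1] by simp
  finally have "(of_nat (card (characters q)) :: complex) = of_nat (card (unit_residues q))"
    using 1 by (subst (asm) sum.swap) simp
  thus ?thesis by (simp only: of_nat_eq_iff)
qed

lemma character_orthogonality:
  assumes q: "q \<ge> 1" and u: "coprime u (int q)" and v: "coprime v (int q)"
  shows "(\<Sum>chi\<in>characters q. cnj (chi v) * chi u) =
           (if [u = v] (mod int q) then of_nat (card (unit_residues q)) else 0)"
proof -
  obtain k where k: "k > 0" "[v ^ k = 1] (mod int q)"
    using exists_power_cong_1[OF q v] by blast
  define w where "w = v ^ (k - 1)"
  have wv: "[w * v = 1] (mod int q)" using k by (cases k) (auto simp: w_def mult_ac)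
  have cw: "coprime w (int q)" using v by (simp add: w_def)
  have eq: "cnj (chi v) * chi u = chi (w * u)" if "chi \<in> characters q" for chi
  proof -
    have chi: "dirichlet_character q chi" using that by (simp add: characters_def)
    have "chi w * chi v = 1" using char_cong[OF chi wv] char_one[OF chi] char_mult[OF chi] by simp
    moreover have "chi v * cnj (chi v) = 1"
      using norm_char[OF chi, of v] v by (simp add: complex_norm_square[symmetric])
    ultimately have "cnj (chi v) = chi w"
      by (metis mult.assoc mult.commute mult_1)
    thus ?thesis using char_mult[OF chi] by simp
  qed
  have "(\<Sum>chi\<in>characters q. cnj (chi v) * chi u) = (\<Sum>chi\<in>characters q. chi (w * u))"
    by (intro sum.cong refl eq)
  also have "\<dots> = (if [u = v] (mod int q) then of_nat (card (unit_residues q)) else 0)"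
  proof (cases "[u = v] (mod int q)")
    case True
    have "[w * u = w * v] (mod int q)" using True by (rule cong_scalar_left)
    hence c: "[w * u = 1] (mod int q)" using wv by (rule cong_trans)
    have "(\<Sum>chi\<in>characters q. chi (w * u)) = (\<Sum>chi\<in>characters q. 1)"
    proof (intro sum.cong refl)
      fix chi assume "chi \<in> characters q"
      hence chi: "dirichlet_character q chi" by (simp add: characters_def)
      show "chi (w * u) = 1" using char_cong[OF chi c] char_one[OF chi] by simp
    qed
    thus ?thesis using True card_characters[OF q] by simp
  next
    case False
    have "\<not> [w * u = 1] (mod int q)"
    proof
      assume "[w * u = 1] (mod int q)"
      hence "[w * u = w * v] (mod int q)" using wv by (metis cong_sym cong_trans)
      hence "[u = v] (mod int q)" using cw by (subst (asm) cong_mult_lcancel) auto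
      thus False using False by simp
    qed
    thus ?thesis using False sum_characters_at[OF q, of "w * u"] cw u by simp
  qed
  finally show ?thesis .
qed

definition char_coeff :: "nat \<Rightarrow> (int \<Rightarrow> complex) \<Rightarrow> (int \<Rightarrow> complex) \<Rightarrow> complex" where
  "char_coeff q c chi = (\<Sum>v\<in>unit_residues q. c v * cnj (chi v)) / of_nat (card (unit_residues q))"

lemma char_expansion:
  assumes q: "q \<ge> 1" and c: "\<And>x y. [x = y] (mod int q) \<Longrightarrow> c x = c y" and u: "coprime u (int q)"
  shows "c u = (\<Sum>chi\<in>characters q. char_coeff q c chi * chi u)"
proof -
  define \<phi> where "\<phi> = card (unit_residues q)"
  have \<phi>: "\<phi> > 0" using unit_residues_nonempty[OF q] by (simp add: \<phi>_def)
  have um: "u mod int q \<in> unit_residues q" using mod_in_unit_residues[OF q u] .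
  have "of_nat \<phi> * (\<Sum>chi\<in>characters q. char_coeff q c chi * chi u) =
     (\<Sum>chi\<in>characters q. \<Sum>v\<in>unit_residues q. c v * (cnj (chi v) * chi u))"
  proof (subst sum_distrib_left, intro sum.cong refl)
    fix chi assume "chi \<in> characters q"
    have "of_nat \<phi> * (char_coeff q c chi * chi u) = (\<Sum>v\<in>unit_residues q. c v * cnj (chi v)) * chi u"
      using \<phi> by (simp add: char_coeff_def \<phi>_def[symmetric])
    thus "of_nat \<phi> * (char_coeff q c chi * chi u) =
        (\<Sum>v\<in>unit_residues q. c v * (cnj (chi v) * chi u))"
      by (simp add: sum_distrib_right mult.assoc)
  qed
  also have "\<dots> = (\<Sum>v\<in>unit_residues q. c v * (\<Sum>chi\<in>characters q. cnj (chi v) * chi u))"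
    by (subst sum.swap) (simp add: sum_distrib_left)
  also have "\<dots> = (\<Sum>v\<in>unit_residues q. if v = u mod int q then c v * of_nat \<phi> else 0)"
  proof (intro sum.cong refl)
    fix v assume v: "v \<in> unit_residues q"
    have "[u = v] (mod int q) \<longleftrightarrow> v = u mod int q"
      using v by (auto simp: cong_def unit_residues_def)
    thus "c v * (\<Sum>chi\<in>characters q. cnj (chi v) * chi u) =
      (if v = u mod int q then c v * of_nat \<phi> else 0)"
      using character_orthogonality[OF q u, of v] v by (simp add: unit_residues_def \<phi>_def)
  qed
  also have "\<dots> = c (u mod int q) * of_nat \<phi>" using um by simp
  also have "c (u mod int q) = c u" by (rule c) (simp add: cong_def)
  finally show ?thesis using \<phi> by simp
qed

text \<open>
  Expand the squares and apply orthogonality of the characters at pairs of units.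
\<close>

lemma char_coeff_parseval:
  assumes q: "q \<ge> 1"
  shows "(\<Sum>chi\<in>characters q. (norm (char_coeff q c chi))\<^sup>2) =
    (\<Sum>v\<in>unit_residues q. (norm (c v))\<^sup>2) / card (unit_residues q)"
proof -
  define \<phi> where "\<phi> = card (unit_residues q)"
  have \<phi>: "\<phi> > 0" using unit_residues_nonempty[OF q] by (simp add: \<phi>_def)
  have sq: "of_nat \<phi> ^ 2 * complex_of_real ((norm (char_coeff q c chi))\<^sup>2) =
     (\<Sum>v\<in>unit_residues q. \<Sum>u\<in>unit_residues q. c v * cnj (c u) * (cnj (chi v) * chi u))" for chi
  proof -
    have "of_nat \<phi> ^ 2 * complex_of_real ((norm (char_coeff q c chi))\<^sup>2) =
      (of_nat \<phi> * char_coeff q c chi) * cnj (of_nat \<phi> * char_coeff q c chi)"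
      by (simp only: complex_norm_square complex_cnj_mult complex_cnj_of_nat) (simp add: power2_eq_square mult_ac)
    also have "of_nat \<phi> * char_coeff q c chi = (\<Sum>v\<in>unit_residues q. c v * cnj (chi v))"
      using \<phi> by (simp add: char_coeff_def \<phi>_def)
    finally show ?thesis by (simp add: sum_product mult_ac)
  qed
  have "of_nat \<phi> ^ 2 * complex_of_real (\<Sum>chi\<in>characters q. (norm (char_coeff q c chi))\<^sup>2) =
    (\<Sum>chi\<in>characters q. \<Sum>v\<in>unit_residues q. \<Sum>u\<in>unit_residues q. c v * cnj (c u) * (cnj (chi v) * chi u))"
    by (simp only: of_real_sum sum_distrib_left sq)
  also have "\<dots> = (\<Sum>v\<in>unit_residues q. \<Sum>u\<in>unit_residues q. c v * cnj (c u) *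
       (\<Sum>chi\<in>characters q. cnj (chi v) * chi u))"
    by (subst sum.swap, intro sum.cong refl, subst sum.swap) (simp add: sum_distrib_left)
  also have "\<dots> = (\<Sum>v\<in>unit_residues q. \<Sum>u\<in>unit_residues q. if u = v then c v * cnj (c u) * of_nat \<phi> else 0)"
  proof (intro sum.cong refl)
    fix v u assume uv: "v \<in> unit_residues q" "u \<in> unit_residues q"
    have "[u = v] (mod int q) \<longleftrightarrow> u = v"
      using uv by (auto simp: cong_def unit_residues_def)
    thus "c v * cnj (c u) * (\<Sum>chi\<in>characters q. cnj (chi v) * chi u) =
      (if u = v then c v * cnj (c u) * of_nat \<phi> else 0)"
      using character_orthogonality[OF q, of u v] uv by (simp add: unit_residues_def \<phi>_def)
  qed
  also have "\<dots> = (\<Sum>v\<in>unit_residues q. c v * cnj (c v) * of_nat \<phi>)" by simp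
  also have "\<dots> = of_nat \<phi> * complex_of_real (\<Sum>v\<in>unit_residues q. (norm (c v))\<^sup>2)"
    by (simp only: of_real_sum complex_norm_square sum_distrib_left) (simp add: mult_ac)
  finally have "complex_of_real (real \<phi> ^ 2 * (\<Sum>chi\<in>characters q. (norm (char_coeff q c chi))\<^sup>2)) =
     complex_of_real (real \<phi> * (\<Sum>v\<in>unit_residues q. (norm (c v))\<^sup>2))" by simp
  hence "real \<phi> ^ 2 * (\<Sum>chi\<in>characters q. (norm (char_coeff q c chi))\<^sup>2) =
     real \<phi> * (\<Sum>v\<in>unit_residues q. (norm (c v))\<^sup>2)" by (simp only: of_real_eq_iff)
  thus ?thesis using \<phi> by (simp add: \<phi>_def[symmetric] power2_eq_square field_simps)
qed

text \<open>
  Cauchy--Schwarz and Parseval: there are as many characters as units, so the sum of the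
  coefficients loses only a square root over their mean square.
\<close>

lemma sum_norm_char_coeff_le:
  assumes q: "q \<ge> 1" and B: "\<And>v. norm (c v) \<le> B"
  shows "(\<Sum>chi\<in>characters q. norm (char_coeff q c chi)) \<le> B * sqrt (real q)"
proof -
  define \<phi> where "\<phi> = card (unit_residues q)"
  have \<phi>: "\<phi> > 0" using unit_residues_nonempty[OF q] by (simp add: \<phi>_def)
  have B0: "B \<ge> 0" using B[of 0] norm_ge_zero order_trans by blast
  have "\<phi> \<le> card {0..<int q}" unfolding \<phi>_def unit_residues_def by (intro card_mono) auto
  hence \<phi>q: "\<phi> \<le> q" by simp
  have "(\<Sum>v\<in>unit_residues q. (norm (c v))\<^sup>2) \<le> (\<Sum>v\<in>unit_residues q. B\<^sup>2)"
    by (intro sum_mono power_mono B) auto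
  hence 1: "(\<Sum>v\<in>unit_residues q. (norm (c v))\<^sup>2) / \<phi> \<le> B\<^sup>2"
    using \<phi> by (simp add: \<phi>_def[symmetric] field_simps)
  have "(\<Sum>chi\<in>characters q. norm (char_coeff q c chi))\<^sup>2 \<le>
     (\<Sum>chi\<in>characters q. (norm (char_coeff q c chi))\<^sup>2) * card (characters q)"
    by (rule sum_squared_le_sum_of_squares) 
  also have "\<dots> \<le> B\<^sup>2 * real q"
    using 1 \<phi>q unfolding char_coeff_parseval[OF q] card_characters[OF q] \<phi>_def[symmetric]
    by (intro mult_mono) (auto intro!: divide_nonneg_nonneg sum_nonneg)
  also have "\<dots> = (B * sqrt (real q))\<^sup>2" by (simp add: power_mult_distrib)
  finally show ?thesis by (rule power2_le_imp_le) (use B0 in auto)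
qed

section \<open>Continuation of L-functions\<close>

text \<open>
  The \<open>k\<close>-th forward difference of \<open>z \<mapsto> z\<^sup>-\<^sup>s\<close>. Each
  difference improves the decay by one power of \<open>z\<close>; this is what makes repeated
  summation by parts continue a Dirichlet series.
\<close>

primrec powr_diff :: "nat \<Rightarrow> complex \<Rightarrow> complex \<Rightarrow> complex" where
  "powr_diff 0 s z = z powr (- s)"
| "powr_diff (Suc k) s z = powr_diff k s (z + 1) - powr_diff k s z"

lemma powr_diff_deriv:
  assumes "Re z > 0"
  shows "(powr_diff k s has_field_derivative (- s * powr_diff k (s + 1) z)) (at z)"
  using assms
proof (induction k arbitrary: z)
  case 0
  hence "z \<notin> \<real>\<^sub>\<le>\<^sub>0" by (auto simp: complex_nonpos_Reals_iff)
  from has_field_derivative_powr[OF this, of "-s"] show ?case by simp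
next
  case (Suc k)
  have 1: "(powr_diff k s has_field_derivative (- s * powr_diff k (s + 1) z)) (at z)"
    using Suc by simp
  have "Re (z + 1) > 0" using Suc.prems by simp
  hence "(powr_diff k s has_field_derivative (- s * powr_diff k (s + 1) (z + 1))) (at (z + 1))"
    by (rule Suc.IH)
  hence "((\<lambda>z. powr_diff k s (z + 1)) has_field_derivative (- s * powr_diff k (s + 1) (z + 1))) (at z)"
    by (simp only: DERIV_shift)
  from DERIV_diff[OF this 1] show ?case by (simp add: algebra_simps)
qed

lemma powr_diff_holomorphic: "z \<noteq> 0 \<Longrightarrow> (\<lambda>s. powr_diff k s z) holomorphic_on A"
proof (induction k arbitrary: z)
  case 0
  show ?case by (auto intro!: holomorphic_intros)
next
  case (Suc k)
  have *: "(\<lambda>s. powr_diff k s w) holomorphic_on A" for w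
    by (induction k arbitrary: w) (auto intro!: holomorphic_intros)
  show ?case by (auto intro!: holomorphic_intros *)
qed

text \<open>
  Induction on \<open>k\<close> with the mean value inequality, since differentiating in
  \<open>z\<close> replaces \<open>s\<close> by \<open>s + 1\<close> and produces the factor
  \<open>-s\<close>.
\<close>

lemma norm_powr_diff_le:
  assumes "x > 0" "Re s + real k \<ge> 0"
  shows "norm (powr_diff k s (of_real x)) \<le> (\<Prod>i<k. norm (s + of_nat i)) * x powr (- Re s - real k)"
  using assms
proof (induction k arbitrary: s x)
  case 0
  thus ?case by (simp add: norm_powr_real_powr)
next
  case (Suc k)
  define S where "S = closed_segment (complex_of_real x) (of_real (x + 1))"
  define B where "B = norm s * ((\<Prod>i<k. norm (s + 1 + of_nat i)) * x powr (- Re s - 1 - real k))"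
  have S: "\<exists>y. z = of_real y \<and> x \<le> y" if "z \<in> S" for z
    using that unfolding S_def closed_segment_of_real by (auto simp: closed_segment_eq_real_ivl)
  have "norm (powr_diff k s (of_real (x + 1)) - powr_diff k s (of_real x)) \<le>
          B * norm (of_real (x + 1) - complex_of_real x)"
  proof (rule field_differentiable_bound[of S _ "\<lambda>z. - s * powr_diff k (s + 1) z"])
    show "convex S" by (simp add: S_def)
    fix z assume "z \<in> S"
    then obtain y where y: "z = of_real y" "x \<le> y" using S by blast
    show "(powr_diff k s has_field_derivative - s * powr_diff k (s + 1) z) (at z within S)"
      by (rule has_field_derivative_at_within, rule powr_diff_deriv) (use y Suc.prems in auto)
    have "norm (powr_diff k (s + 1) z) \<le> (\<Prod>i<k. norm (s + 1 + of_nat i)) * y powr (- Re (s + 1) - real k)"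
      unfolding y(1) using y Suc.prems by (intro Suc.IH) auto
    also have "\<dots> \<le> (\<Prod>i<k. norm (s + 1 + of_nat i)) * x powr (- Re s - 1 - real k)"
      using y Suc.prems by (intro mult_left_mono prod_nonneg) (auto intro!: powr_mono2')
    finally show "norm (- s * powr_diff k (s + 1) z) \<le> B"
      unfolding B_def by (simp add: norm_mult mult_left_mono)
  qed (auto simp: S_def)
  also have "B * norm (of_real (x + 1) - complex_of_real x) = B" by simp
  also have "B = (\<Prod>i<Suc k. norm (s + of_nat i)) * x powr (- Re s - real (Suc k))"
    unfolding B_def by (subst prod.lessThan_Suc_shift) (simp add: algebra_simps)
  finally show ?case by simp
qed

lemma norm_powr_diff_nat_le:
  assumes "Re s + real k \<ge> 0"
  shows "norm (powr_diff k s (of_nat (Suc n))) \<le>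
           (\<Prod>i<k. norm (s + of_nat i)) * real (Suc n) powr (- Re s - real k)"
  using norm_powr_diff_le[of "real (Suc n)" s k] assms by simp

lemma summable_Suc_powr: "s < -1 \<Longrightarrow> summable (\<lambda>n. real (Suc n) powr s)"
  using summable_Suc_iff[of "\<lambda>n. real n powr s"] summable_real_powr_iff[of s] by simp

lemma powr_diff_series_summable:
  assumes h: "\<And>n. norm (h n) \<le> B" and s: "Re s > 1 - real j"
  shows "summable (\<lambda>n. norm (h n * powr_diff j s (of_nat (Suc n))))"
proof (rule summable_comparison_test'[where N = 0])
  show "summable (\<lambda>n. B * (\<Prod>i<j. norm (s + of_nat i)) * real (Suc n) powr (- Re s - real j))"
    using s by (intro summable_mult summable_Suc_powr) auto
  have B0: "B \<ge> 0" using h[of 0] norm_ge_zero order_trans by blast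
  fix n :: nat
  have "norm (h n * powr_diff j s (of_nat (Suc n))) \<le>
     B * ((\<Prod>i<j. norm (s + of_nat i)) * real (Suc n) powr (- Re s - real j))"
    unfolding norm_mult using s by (intro mult_mono h norm_powr_diff_nat_le) (auto simp: B0)
  thus "norm (norm (h n * powr_diff j s (of_nat (Suc n)))) \<le>
     B * (\<Prod>i<j. norm (s + of_nat i)) * real (Suc n) powr (- Re s - real j)"
    by (simp add: mult.assoc)
qed

lemma norm_powr_diff_series_le:
  assumes h: "\<And>n. norm (h n) \<le> B" and s: "Re s > 1 - real j" and \<sigma>: "\<sigma> > 1 - real j" "Re s \<ge> \<sigma>"
  shows "norm (\<Sum>n. h n * powr_diff j s (of_nat (Suc n))) \<le>
     B * (\<Prod>i<j. norm (s + of_nat i)) * (\<Sum>n. real (Suc n) powr (- \<sigma> - real j))"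
proof -
  have B0: "B \<ge> 0" using h[of 0] norm_ge_zero order_trans by blast
  have le: "norm (h n * powr_diff j s (of_nat (Suc n))) \<le>
     B * (\<Prod>i<j. norm (s + of_nat i)) * real (Suc n) powr (- \<sigma> - real j)" for n
  proof -
    have "norm (h n * powr_diff j s (of_nat (Suc n))) \<le>
       B * ((\<Prod>i<j. norm (s + of_nat i)) * real (Suc n) powr (- Re s - real j))"
      unfolding norm_mult using s by (intro mult_mono h norm_powr_diff_nat_le) (auto simp: B0)
    also have "\<dots> \<le> B * ((\<Prod>i<j. norm (s + of_nat i)) * real (Suc n) powr (- \<sigma> - real j))"
      using \<sigma> by (intro mult_left_mono powr_mono B0 prod_nonneg) auto
    finally show ?thesis by (simp add: mult.assoc)
  qed
  have sm: "summable (\<lambda>n. real (Suc n) powr (- \<sigma> - real j))"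
    using \<sigma> by (intro summable_Suc_powr) auto
  have "norm (\<Sum>n. h n * powr_diff j s (of_nat (Suc n))) \<le>
      (\<Sum>n. norm (h n * powr_diff j s (of_nat (Suc n))))"
    by (rule summable_norm[OF powr_diff_series_summable[OF h s]])
  also have "\<dots> \<le> (\<Sum>n. B * (\<Prod>i<j. norm (s + of_nat i)) * real (Suc n) powr (- \<sigma> - real j))"
    by (rule suminf_le[OF le powr_diff_series_summable[OF h s] summable_mult[OF sm]])
  also have "\<dots> = B * (\<Prod>i<j. norm (s + of_nat i)) * (\<Sum>n. real (Suc n) powr (- \<sigma> - real j))"
    by (rule suminf_mult[OF sm])
  finally show ?thesis .
qed

lemma open_Re_gt: "open {s :: complex. Re s > c}"
  by (rule open_halfspace_Re_gt)

text \<open>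
  A locally uniform limit of holomorphic functions, by the majorant
  \<open>n\<^sup>-\<^sup>\<sigma>\<^sup>-\<^sup>j\<close> on half-planes.
\<close>

lemma powr_diff_series_holomorphic:
  assumes h: "\<And>n. norm (h n) \<le> B"
  shows "(\<lambda>s. \<Sum>n. h n * powr_diff j s (of_nat (Suc n))) holomorphic_on {s. Re s > 1 - real j}"
proof -
  let ?S = "{s :: complex. Re s > 1 - real j}"
  let ?f = "\<lambda>n s. h n * powr_diff j s (of_nat (Suc n))"
  have B0: "B \<ge> 0" using h[of 0] norm_ge_zero order_trans by blast
  have hol: "?f n holomorphic_on ?S" for n
    using of_nat_neq_0[where 'a = complex, of n] by (intro holomorphic_intros powr_diff_holomorphic)
  have "\<exists>g g'. \<forall>x\<in>?S. ((\<lambda>n. ?f n x) sums g x) \<and> ((\<lambda>n. deriv (?f n) x) sums g' x) \<and>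
           (g has_field_derivative g' x) (at x)"
  proof (rule series_and_derivative_comparison_local[OF open_Re_gt])
    show "(?f n has_field_derivative deriv (?f n) x) (at x)" if "x \<in> ?S" for n x
      using hol[of n] open_Re_gt that by (rule holomorphic_derivI)
  next
    fix s0 assume s0: "s0 \<in> ?S"
    define d where "d = (Re s0 - (1 - real j)) / 2"
    have d: "d > 0" using s0 by (simp add: d_def)
    define P where "P = (\<Prod>i<j. norm s0 + d + real i)"
    define H where "H n = B * (P * real (Suc n) powr (- (Re s0 - d) - real j))" for n
    have "summable H" unfolding H_def
      using d by (intro summable_mult summable_Suc_powr) (auto simp: d_def field_simps)
    moreover have "norm (?f n y) \<le> H n" if y: "y \<in> ball s0 d \<inter> ?S" for n y
    proof -
      have n1: "norm (y - s0) < d" using y by (simp add: dist_norm norm_minus_commute)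
      have n2: "Re y \<ge> Re s0 - d" using abs_Re_le_cmod[of "y - s0"] n1 by simp
      have n3: "norm y \<le> norm s0 + d" using n1 norm_triangle_ineq2[of y s0] by simp
      have P: "(\<Prod>i<j. norm (y + of_nat i)) \<le> P"
        unfolding P_def
      proof (intro prod_mono conjI)
        fix i show "norm (y + of_nat i) \<le> norm s0 + d + real i"
          using norm_triangle_ineq[of y "of_nat i"] n3 by simp
      qed auto
      have P0: "P \<ge> 0" unfolding P_def using d by (intro prod_nonneg) auto
      have "norm (?f n y) \<le> B * ((\<Prod>i<j. norm (y + of_nat i)) * real (Suc n) powr (- Re y - real j))"
        unfolding norm_mult using y by (intro mult_mono h norm_powr_diff_nat_le) (auto simp: B0)
      also have "\<dots> \<le> H n"
        unfolding H_def using n2 P P0 by (intro mult_left_mono mult_mono powr_mono B0) auto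
      finally show ?thesis .
    qed
    ultimately show "\<exists>d h. 0 < d \<and> summable h \<and>
        (\<forall>\<^sub>F n in sequentially. \<forall>y\<in>ball s0 d \<inter> ?S. norm (?f n y) \<le> h n)"
      using d by (intro exI[of _ d] exI[of _ H] conjI always_eventually allI ballI) auto
  qed
  then obtain g g' where g: "\<And>x. x \<in> ?S \<Longrightarrow> (\<lambda>n. ?f n x) sums g x"
    "\<And>x. x \<in> ?S \<Longrightarrow> (g has_field_derivative g' x) (at x)" by blast
  have "g holomorphic_on ?S"
    using g(2) by (auto simp: holomorphic_on_open[OF open_Re_gt])
  moreover have "(\<Sum>n. ?f n x) = g x" if "x \<in> ?S" for x using sums_unique[OF g(1)[OF that]] by simp
  ultimately show ?thesis by (subst holomorphic_cong[OF refl, of _ _ g]) auto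
qed

lemma powr_diff_series_sums:
  assumes h: "\<And>n. norm (h n) \<le> B" and s: "Re s > 1 - real j"
  shows "(\<lambda>n. h n * powr_diff j s (of_nat (Suc n))) sums (\<Sum>n. h n * powr_diff j s (of_nat (Suc n)))"
  by (intro summable_sums summable_norm_cancel[OF powr_diff_series_summable[OF h s]])

lemma summation_by_parts_powr_diff:
  assumes g: "\<And>n. norm (g n) \<le> B" and s: "Re s > 1 - real j"
  shows "(\<lambda>n. (g (Suc n) - g n) * powr_diff j s (of_nat (Suc n))) sums
     (- (g 0 * powr_diff j s 1) - (\<Sum>n. g (Suc n) * powr_diff (Suc j) s (of_nat (Suc n))))"
proof -
  let ?D = "\<lambda>n. powr_diff j s (of_nat (Suc n))"
  have "(\<lambda>n. g n * ?D n) \<longlonglongrightarrow> 0"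
    using summable_LIMSEQ_zero[OF summable_norm_cancel[OF powr_diff_series_summable[OF g s]]] .
  hence 1: "(\<lambda>n. g (Suc n) * ?D (Suc n) - g n * ?D n) sums (0 - g 0 * ?D 0)"
    by (rule telescope_sums)
  have 2: "(\<lambda>n. g (Suc n) * powr_diff (Suc j) s (of_nat (Suc n))) sums
     (\<Sum>n. g (Suc n) * powr_diff (Suc j) s (of_nat (Suc n)))"
    by (rule powr_diff_series_sums[OF g]) (use s in auto)
  have eq: "(g (Suc n) * ?D (Suc n) - g n * ?D n) - g (Suc n) * powr_diff (Suc j) s (of_nat (Suc n)) =
     (g (Suc n) - g n) * ?D n" for n
  proof -
    have "of_nat (Suc (Suc n)) = of_nat (Suc n) + (1::complex)" by simp
    hence "powr_diff (Suc j) s (of_nat (Suc n)) = ?D (Suc n) - ?D n" by (simp only: powr_diff.simps)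
    thus ?thesis by (simp only:) (simp only: algebra_simps)
  qed
  from sums_diff[OF 1 2] show ?thesis unfolding eq by simp
qed

lemma periodic_mod:
  fixes f :: "nat \<Rightarrow> 'a"
  assumes "\<And>n. f (n + q) = f n" shows "f n = f (n mod q)"
proof -
  have "f (m + k * q) = f m" for m k
  proof (induction k)
    case (Suc k)
    have "f (m + Suc k * q) = f ((m + k * q) + q)" by (simp add: algebra_simps)
    thus ?case using Suc assms by simp
  qed auto
  from this[of "n mod q" "n div q"] show ?thesis by simp
qed

lemma periodic_bounded:
  fixes f :: "nat \<Rightarrow> complex"
  assumes "\<And>n. f (n + q) = f n" "q \<ge> 1" "\<And>n. n < q \<Longrightarrow> norm (f n) \<le> B"
  shows "norm (f n) \<le> B"
  using periodic_mod[of f q n] assms by simp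

lemma periodic_bounded_ex:
  fixes f :: "nat \<Rightarrow> complex"
  assumes "\<And>n. f (n + q) = f n" "q \<ge> 1"
  shows "\<exists>B. \<forall>n. norm (f n) \<le> B"
proof -
  have "norm (f n) \<le> (\<Sum>n<q. norm (f n))" for n
    by (rule periodic_bounded[of f q, OF assms]) (auto intro: member_le_sum)
  thus ?thesis by blast
qed

lemma partial_sums_periodic:
  fixes f :: "nat \<Rightarrow> complex"
  assumes f: "\<And>n. f (n + q) = f n" "(\<Sum>n<q. f n) = 0"
  shows "(\<Sum>m<n + q. f m) = (\<Sum>m<n. f m)"
  by (induction n) (use f in auto)

text \<open>
  Partial sums of a mean-zero periodic function are periodic; subtracting their mean makes them
  mean-zero again, so that the process can be repeated.
\<close>

lemma periodic_antidifference:
  fixes f :: "nat \<Rightarrow> complex"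
  assumes f: "\<And>n. f (n + q) = f n" "(\<Sum>n<q. f n) = 0" and q: "q \<ge> 1"
  obtains g where "\<And>n. g (n + q) = g n" "(\<Sum>n<q. g n) = 0" "\<And>n. f n = g (Suc n) - g n"
proof -
  define G where "G n = (\<Sum>m<n. f m)" for n
  define c where "c = (\<Sum>n<q. G n) / of_nat q"
  have "G (n + q) = G n" for n unfolding G_def by (rule partial_sums_periodic[of f q, OF f])
  moreover have "(\<Sum>n<q. G n - c) = 0" using q by (simp add: sum_subtractf c_def)
  moreover have "f n = (G (Suc n) - c) - (G n - c)" for n by (simp add: G_def)
  ultimately show ?thesis by (intro that[of "\<lambda>n. G n - c"]) auto
qed

text \<open>
  \<open>K\<close> summations by parts, each of which moves the half-plane of convergence by one to
  the left.
\<close>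

lemma mean_zero_series_continuation:
  fixes f :: "nat \<Rightarrow> complex"
  assumes "\<And>n. f (n + q) = f n" "(\<Sum>n<q. f n) = 0" "q \<ge> 1"
  shows "\<exists>F. F holomorphic_on {s. Re s > 1 - real j - real K} \<and>
    (\<forall>s. Re s > 1 - real j \<longrightarrow> (\<lambda>n. f n * powr_diff j s (of_nat (Suc n))) sums F s)"
  using assms
proof (induction K arbitrary: f j)
  case 0
  obtain B where B: "\<And>n. norm (f n) \<le> B" using periodic_bounded_ex[of f q, OF 0(1,3)] by blast
  show ?case
    using powr_diff_series_holomorphic[of f B j, OF B] powr_diff_series_sums[of f B, OF B]
    by (intro exI[of _ "\<lambda>s. \<Sum>n. f n * powr_diff j s (of_nat (Suc n))"]) simp
next
  case (Suc K)
  obtain g where g: "\<And>n. g (n + q) = g n" "(\<Sum>n<q. g n) = 0" "\<And>n. f n = g (Suc n) - g n"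
    using periodic_antidifference[of f q, OF Suc.prems] by metis
  obtain B where B: "\<And>n. norm (g n) \<le> B" using periodic_bounded_ex[of g q, OF g(1) Suc.prems(3)] by blast
  have "(\<Sum>n<q. g (Suc n)) = 0"
  proof -
    have "(\<Sum>n<q. g (Suc n)) = (\<Sum>n<q. f n + g n)" using g(3) by simp
    thus ?thesis using g(2) Suc.prems(2) by (simp add: sum.distrib)
  qed
  moreover have "g (Suc (n + q)) = g (Suc n)" for n using g(1)[of "Suc n"] by simp
  ultimately obtain F where F: "F holomorphic_on {s. Re s > 1 - real (Suc j) - real K}"
    "\<And>s. Re s > 1 - real (Suc j) \<Longrightarrow> (\<lambda>n. g (Suc n) * powr_diff (Suc j) s (of_nat (Suc n))) sums F s"
    using Suc.IH[of "\<lambda>n. g (Suc n)" "Suc j"] Suc.prems(3) by blast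
  define F' where "F' s = - (g 0 * powr_diff j s 1) - F s" for s
  have "F' holomorphic_on {s. Re s > 1 - real j - real (Suc K)}"
    unfolding F'_def
  proof (intro holomorphic_intros powr_diff_holomorphic)
    show "F holomorphic_on {s. Re s > 1 - real j - real (Suc K)}"
      by (rule holomorphic_on_subset[OF F(1)]) auto
  qed auto
  moreover have "(\<lambda>n. f n * powr_diff j s (of_nat (Suc n))) sums F' s" if s: "Re s > 1 - real j" for s
  proof -
    have "F s = (\<Sum>n. g (Suc n) * powr_diff (Suc j) s (of_nat (Suc n)))"
      by (rule sums_unique[OF F(2)]) (use s in auto)
    thus ?thesis using summation_by_parts_powr_diff[of g B, OF B s] unfolding F'_def g(3) by simp
  qed
  ultimately show ?case by blast
qed

lemma halfplane_identity:
  assumes "f holomorphic_on {s. Re s > c}" "g holomorphic_on {s. Re s > c}" "c \<le> 1"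
    and "\<And>s. Re s > 1 \<Longrightarrow> f s = g s" and "Re s > c"
  shows "f s = g s"
proof (rule analytic_continuation_open[of "{s. Re s > 1}" "{s. Re s > c}" f g])
  have "(2::complex) \<in> {s. Re s > 1}" by simp
  thus "{s :: complex. Re s > 1} \<noteq> {}" by blast
  show "connected {s :: complex. Re s > c}"
    by (intro convex_connected convex_halfspace_Re_gt)
qed (use assms open_Re_gt in auto)

text \<open>
  Glue the continuations to the half-planes \<open>Re s > 1 - K\<close>, which agree by the identity
  theorem.
\<close>

lemma mean_zero_series_entire:
  fixes f :: "nat \<Rightarrow> complex"
  assumes f: "\<And>n. f (n + q) = f n" "(\<Sum>n<q. f n) = 0" "q \<ge> 1"
  shows "\<exists>F. F holomorphic_on UNIV \<and> (\<forall>s. Re s > 1 \<longrightarrow> (\<lambda>n. f n * of_nat (Suc n) powr (-s)) sums F s)"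
proof -
  have "\<forall>K. \<exists>F. F holomorphic_on {s. Re s > 1 - real K} \<and>
     (\<forall>s. Re s > 1 \<longrightarrow> (\<lambda>n. f n * of_nat (Suc n) powr (-s)) sums F s)"
    using mean_zero_series_continuation[of f q, OF f, of 0] by simp
  then obtain F where F: "\<And>K. F K holomorphic_on {s. Re s > 1 - real K}"
     "\<And>K s. Re s > 1 \<Longrightarrow> (\<lambda>n. f n * of_nat (Suc n) powr (-s)) sums F K s" by metis
  have eq1: "F K s = F L s" if "Re s > 1 - real K" "K \<le> L" for K L s
  proof (rule halfplane_identity[of "F K" "1 - real K" "F L" s])
    show "F L holomorphic_on {s. Re s > 1 - real K}"
      by (rule holomorphic_on_subset[OF F(1)[of L]]) (use that in auto)
    show "F K s = F L s" if "Re s > 1" for s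
      by (rule sums_unique2[OF F(2)[OF that] F(2)[OF that]])
    show "1 - real K \<le> 1" by simp
    show "F K holomorphic_on {s. Re s > 1 - real K}" by (rule F(1))
    show "Re s > 1 - real K" by (rule that(1))
  qed
  have eq: "F K s = F L s" if "Re s > 1 - real K" "Re s > 1 - real L" for K L s
  proof (cases "K \<le> L")
    case True
    show ?thesis by (rule eq1[OF that(1) True])
  next
    case False
    hence "L \<le> K" by simp
    from eq1[OF that(2) this] show ?thesis by (rule sym)
  qed
  define G where "G s = F (nat \<lceil>2 - Re s\<rceil>) s" for s
  have G: "G s = F K s" if "Re s > 1 - real K" for K s
    unfolding G_def by (rule eq) (use that in \<open>linarith, simp\<close>)
  have "G holomorphic_on (\<Union>K\<in>UNIV. {s. Re s > 1 - real K})"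
  proof (rule holomorphic_on_UN_open)
    show "G holomorphic_on {s. Re s > 1 - real K}" for K
      using F(1)[of K] by (subst holomorphic_cong[OF refl, of _ _ "F K"]) (auto simp: G)
  qed (rule open_Re_gt)
  also have "(\<Union>K\<in>UNIV. {s. Re s > 1 - real K}) = UNIV"
  proof -
    have "\<exists>K. Re s > 1 - real K" for s
      using reals_Archimedean2[of "1 - Re s"] by (auto simp: algebra_simps)
    thus ?thesis by auto
  qed
  finally have "G holomorphic_on UNIV" .
  moreover have "(\<lambda>n. f n * of_nat (Suc n) powr (-s)) sums G s" if "Re s > 1" for s
    using F(2)[OF that, of 0] G[of 0 s] that by simp
  ultimately show ?thesis by blast
qed

text \<open>
  This is \<open>\<zeta>(3/2)\<close>, the constant in the bounds on \<open>Re s \<ge> 1/2\<close>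
  obtained from one summation by parts.
\<close>

definition zeta_three_halves :: real where
  "zeta_three_halves = (\<Sum>n. real (Suc n) powr (- 3 / 2))"

lemma summable_three_halves: "summable (\<lambda>n. real (Suc n) powr (- 3 / 2))"
  by (rule summable_Suc_powr) auto

lemma zeta_three_halves_ge_1: "zeta_three_halves \<ge> 1"
proof -
  have "(\<Sum>n<1. real (Suc n) powr (- 3 / 2)) \<le> zeta_three_halves"
    unfolding zeta_three_halves_def by (rule sum_le_suminf[OF summable_three_halves]) auto
  thus ?thesis by simp
qed

text \<open>
  The coefficients of the alternating zeta function. They have period 2 and mean zero, which gives
  the continuation of \<open>\<zeta>\<close> to the whole plane as a quotient.
\<close>

definition eta_coeff :: "nat \<Rightarrow> complex" where "eta_coeff n = (-1) ^ n"

text \<open>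
  Subtract twice the even-indexed part, which is \<open>2\<^sup>1\<^sup>-\<^sup>s
  \<zeta>(s)\<close>.
\<close>

lemma eta_zeta_relation:
  assumes s: "Re s > 1" and Z: "(\<lambda>n. of_nat (Suc n) powr (-s)) sums Z"
  shows "(\<lambda>n. eta_coeff n * of_nat (Suc n) powr (-s)) sums ((1 - 2 powr (1 - s)) * Z)"
proof -
  define e where "e n = (if odd n then 2 * of_nat (Suc n) powr (-s) else 0 :: complex)" for n
  have "(\<lambda>n. e (2 * n + 1)) sums (2 powr (1 - s) * Z)"
  proof -
    have "e (2 * n + 1) = 2 powr (1 - s) * of_nat (Suc n) powr (-s)" for n
    proof -
      have "of_nat (Suc (2 * n + 1)) = (of_real 2 * of_real (real (Suc n)) :: complex)" by simp
      hence "of_nat (Suc (2 * n + 1)) powr (-s) = (of_real 2 powr (-s) * of_real (real (Suc n)) powr (-s) :: complex)"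
        by (simp only:) (rule powr_times_real; simp)
      moreover have "2 * (2 :: complex) powr (-s) = 2 powr (1 - s)"
        by (simp add: powr_diff powr_minus divide_inverse)
      ultimately show ?thesis by (simp add: e_def mult.assoc[symmetric])
    qed
    thus ?thesis using sums_mult[OF Z, of "2 powr (1 - s)"] by simp
  qed
  moreover have "strict_mono (\<lambda>n::nat. 2 * n + 1)" by (rule strict_monoI) auto
  moreover have "e n = 0" if "n \<notin> range (\<lambda>n::nat. 2 * n + 1)" for n
    using that by (auto simp: e_def elim!: oddE)
  ultimately have "e sums (2 powr (1 - s) * Z)"
    using sums_mono_reindex[of "\<lambda>n. 2 * n + 1" e] by blast
  from sums_diff[OF Z this]
  have "(\<lambda>n. of_nat (Suc n) powr (-s) - e n) sums ((1 - 2 powr (1 - s)) * Z)"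
    by (simp add: algebra_simps)
  moreover have "of_nat (Suc n) powr (-s) - e n = eta_coeff n * of_nat (Suc n) powr (-s)" for n
    by (auto simp: e_def eta_coeff_def)
  ultimately show ?thesis by simp
qed

lemma zeta_summable:
  assumes "Re s > 1" shows "summable (\<lambda>n. norm (of_nat (Suc n) powr (-s) :: complex))"
  using powr_diff_series_summable[of "\<lambda>_. 1" 1 0 s] assms by simp

lemma eta_entire:
  "\<exists>E. E holomorphic_on UNIV \<and> (\<forall>s. Re s > 1 \<longrightarrow> (\<lambda>n. eta_coeff n * of_nat (Suc n) powr (-s)) sums E s)"
  by (rule mean_zero_series_entire[of eta_coeff 2]) (auto simp: eta_coeff_def numeral_2_eq_2)

text \<open>
  A summand of \<open>(s - 1) \<zeta>(s) - 1\<close> after comparison of the series with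
  \<open>\<integral> x\<^sup>-\<^sup>s dx = [x\<^sup>1\<^sup>-\<^sup>s / (1 - s)]\<close>.
\<close>

definition zeta_term :: "nat \<Rightarrow> complex \<Rightarrow> complex" where
  "zeta_term n s = (s - 1) * of_nat (Suc n) powr (-s) + (of_nat (Suc (Suc n)) powr (1 - s) - of_nat (Suc n) powr (1 - s))"

text \<open>
  The mean value inequality, applied on \<open>[n + 1, n + 2]\<close> to
  \<open>z\<^sup>-\<^sup>s\<close> and then to the function whose increment is the term.
\<close>

lemma norm_zeta_term_le:
  assumes s: "Re s \<ge> 0"
  shows "norm (zeta_term n s) \<le> norm (s - 1) * norm s * real (Suc n) powr (- Re s - 1)"
proof -
  define x where "x = real (Suc n)"
  have x: "x > 0" by (simp add: x_def)
  define S where "S = closed_segment (complex_of_real x) (of_real (x + 1))"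
  have S: "\<exists>y. z = of_real y \<and> x \<le> y \<and> y \<le> x + 1" if "z \<in> S" for z
    using that unfolding S_def closed_segment_of_real by (auto simp: closed_segment_eq_real_ivl)
  define B where "B = norm s * x powr (- Re s - 1)"
  have xS: "of_real x \<in> S" "of_real (x + 1) \<in> S" by (auto simp: S_def)
  have nonpos: "z \<notin> \<real>\<^sub>\<le>\<^sub>0" if "z \<in> S" for z
    using S[OF that] x by (auto simp: complex_nonpos_Reals_iff)
  have 1: "norm (z powr (-s) - of_real x powr (-s)) \<le> B" if z: "z \<in> S" for z
  proof -
    have "norm (z powr (-s) - of_real x powr (-s)) \<le> B * norm (z - of_real x)"
    proof (rule field_differentiable_bound[of S _ "\<lambda>z. - s * z powr (- s - 1)"])
      fix w assume w: "w \<in> S"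
      show "((\<lambda>z. z powr - s) has_field_derivative - s * w powr (- s - 1)) (at w within S)"
        by (rule has_field_derivative_at_within, rule has_field_derivative_powr, rule nonpos[OF w])
      obtain y where y: "w = of_real y" "x \<le> y" using S[OF w] by blast
      have "norm (w powr (- s - 1)) = y powr (- Re s - 1)"
        using y x by (simp add: norm_powr_real_powr)
      also have "\<dots> \<le> x powr (- Re s - 1)" using x y s by (intro powr_mono2') auto
      finally show "norm (- s * w powr (- s - 1)) \<le> B"
        unfolding B_def by (simp add: norm_mult mult_left_mono)
    qed (use z xS in \<open>auto simp: S_def\<close>)
    also have "\<dots> \<le> B * 1"
    proof (rule mult_left_mono)
      obtain y where y: "z = of_real y" "x \<le> y" "y \<le> x + 1" using S[OF z] by blast
      have "norm (z - of_real x) = \<bar>y - x\<bar>" unfolding y(1) by (metis norm_of_real of_real_diff)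
      thus "norm (z - of_real x) \<le> 1" using y by simp
    qed (simp add: B_def)
    finally show ?thesis by simp
  qed
  define h where "h z = (s - 1) * z * of_real x powr (-s) + z powr (1 - s)" for z
  have "norm (h (of_real (x + 1)) - h (of_real x)) \<le> (norm (s - 1) * B) * norm (of_real (x + 1) - complex_of_real x)"
  proof (rule field_differentiable_bound[of S _ "\<lambda>z. (s - 1) * (of_real x powr (-s) - z powr (-s))"])
    fix w assume w: "w \<in> S"
    have d1: "((\<lambda>z. z powr (1 - s)) has_field_derivative ((1 - s) * w powr (1 - s - 1))) (at w)"
      by (rule has_field_derivative_powr[OF nonpos[OF w]])
    have d2: "((\<lambda>z. (s - 1) * of_real x powr (-s) * z) has_field_derivative ((s - 1) * of_real x powr (-s) * 1)) (at w)"
      by (rule DERIV_cmult[OF DERIV_ident])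
    have "h = (\<lambda>z. (s - 1) * of_real x powr (-s) * z + z powr (1 - s))"
      by (simp add: h_def fun_eq_iff mult_ac)
    hence "(h has_field_derivative ((s - 1) * of_real x powr (-s) * 1 + (1 - s) * w powr (1 - s - 1))) (at w)"
      using DERIV_add[OF d2 d1] by (simp only:)
    moreover have "1 - s - 1 = - s" by simp
    ultimately have "(h has_field_derivative ((s - 1) * of_real x powr (-s) * 1 + (1 - s) * w powr (- s))) (at w)"
      by (simp only:)
    hence "(h has_field_derivative (s - 1) * (of_real x powr (-s) - w powr (-s))) (at w)"
      by (simp add: algebra_simps)
    thus "(h has_field_derivative (s - 1) * (of_real x powr (-s) - w powr (-s))) (at w within S)"
      by (rule has_field_derivative_at_within)
    show "norm ((s - 1) * (of_real x powr (-s) - w powr (-s))) \<le> norm (s - 1) * B"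
      unfolding norm_mult using 1[OF w] by (intro mult_left_mono) (auto simp: norm_minus_commute)
  qed (use xS in \<open>auto simp: S_def\<close>)
  also have "h (of_real (x + 1)) - h (of_real x) = zeta_term n s"
    by (simp add: h_def zeta_term_def x_def algebra_simps)
  finally show ?thesis by (simp add: B_def x_def mult.assoc)
qed

lemma zeta_term_at_1: "zeta_term n 1 = 0"
  using of_nat_neq_0[where 'a = complex, of n] of_nat_neq_0[where 'a = complex, of "Suc n"]
  unfolding zeta_term_def by (simp del: of_nat_Suc)

text \<open>
  This is \<open>(s - 1) \<zeta>(s)\<close> on the half-plane \<open>Re s > 0\<close>.
\<close>

definition zeta_reg :: "complex \<Rightarrow> complex" where
  "zeta_reg s = 1 + (\<Sum>n. zeta_term n s)"

lemma zeta_reg_summable: "Re s > 0 \<Longrightarrow> summable (\<lambda>n. norm (zeta_term n s))"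
proof -
  assume s: "Re s > 0"
  have "summable (\<lambda>n. norm (s - 1) * norm s * real (Suc n) powr (- Re s - 1))"
    using s by (intro summable_mult summable_Suc_powr) simp
  moreover have "norm (norm (zeta_term n s)) \<le> norm (s - 1) * norm s * real (Suc n) powr (- Re s - 1)" for n
    using norm_zeta_term_le[of s n] s by (simp del: of_nat_Suc)
  ultimately show ?thesis by (rule summable_comparison_test')
qed

lemma zeta_reg_holomorphic: "zeta_reg holomorphic_on {s. Re s > 0}"
proof -
  let ?S = "{s :: complex. Re s > 0}"
  have hol: "zeta_term n holomorphic_on ?S" for n
    unfolding zeta_term_def using of_nat_neq_0[where 'a = complex] by (intro holomorphic_intros)
  have "\<exists>g g'. \<forall>x\<in>?S. ((\<lambda>n. zeta_term n x) sums g x) \<and> ((\<lambda>n. deriv (zeta_term n) x) sums g' x) \<and>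
           (g has_field_derivative g' x) (at x)"
  proof (rule series_and_derivative_comparison_local[OF open_Re_gt])
    show "(zeta_term n has_field_derivative deriv (zeta_term n) x) (at x)" if "x \<in> ?S" for n x
      using hol[of n] open_Re_gt that by (rule holomorphic_derivI)
  next
    fix s0 assume s0: "s0 \<in> ?S"
    define d where "d = Re s0 / 2"
    have d: "d > 0" using s0 by (simp add: d_def)
    define H where "H n = (norm s0 + d + 1) * (norm s0 + d) * real (Suc n) powr (- (Re s0 - d) - 1)" for n
    have "summable H" unfolding H_def
      using d by (intro summable_mult summable_Suc_powr) (auto simp: d_def field_simps)
    moreover have "norm (zeta_term n y) \<le> H n" if y: "y \<in> ball s0 d \<inter> ?S" for n y
    proof -
      have n1: "norm (y - s0) < d" using y by (simp add: dist_norm norm_minus_commute)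
      have n2: "Re y \<ge> Re s0 - d" using abs_Re_le_cmod[of "y - s0"] n1 by simp
      have n3: "norm y \<le> norm s0 + d" using n1 norm_triangle_ineq2[of y s0] by simp
      have n4: "norm (y - 1) \<le> norm s0 + d + 1" using n3 norm_triangle_ineq4[of y 1] by simp
      have "norm (zeta_term n y) \<le> norm (y - 1) * norm y * real (Suc n) powr (- Re y - 1)"
        using y by (intro norm_zeta_term_le) auto
      also have "\<dots> \<le> H n"
        unfolding H_def using n2 n3 n4 d by (intro mult_mono powr_mono) auto
      finally show ?thesis .
    qed
    ultimately show "\<exists>d h. 0 < d \<and> summable h \<and>
        (\<forall>\<^sub>F n in sequentially. \<forall>y\<in>ball s0 d \<inter> ?S. norm (zeta_term n y) \<le> h n)"
      using d by (intro exI[of _ d] exI[of _ H] conjI always_eventually allI ballI) auto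
  qed
  then obtain g g' where g: "\<And>x. x \<in> ?S \<Longrightarrow> (\<lambda>n. zeta_term n x) sums g x"
    "\<And>x. x \<in> ?S \<Longrightarrow> (g has_field_derivative g' x) (at x)" by blast
  have "g holomorphic_on ?S"
    using g(2) by (auto simp: holomorphic_on_open[OF open_Re_gt])
  hence "(\<lambda>x. 1 + g x) holomorphic_on ?S" by (intro holomorphic_intros)
  moreover have "zeta_reg x = 1 + g x" if "x \<in> ?S" for x
    using sums_unique[OF g(1)[OF that]] by (simp add: zeta_reg_def)
  ultimately show ?thesis by (subst holomorphic_cong[OF refl, of _ _ "\<lambda>x. 1 + g x"]) auto
qed

lemma zeta_reg_at_1: "zeta_reg 1 = 1"
  by (simp add: zeta_reg_def zeta_term_at_1)

lemma norm_zeta_reg_le: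
  assumes s: "Re s \<ge> 1 / 2"
  shows "norm (zeta_reg s) \<le> 1 + norm (s - 1) * norm s * zeta_three_halves"
proof -
  have "norm (\<Sum>n. zeta_term n s) \<le> (\<Sum>n. norm (zeta_term n s))"
    using s by (intro summable_norm zeta_reg_summable) auto
  also have "\<dots> \<le> (\<Sum>n. norm (s - 1) * norm s * real (Suc n) powr (- 3 / 2))"
  proof (rule suminf_le)
    fix n
    have "norm (zeta_term n s) \<le> norm (s - 1) * norm s * real (Suc n) powr (- Re s - 1)"
      using s by (intro norm_zeta_term_le) auto
    also have "\<dots> \<le> norm (s - 1) * norm s * real (Suc n) powr (- 3 / 2)"
      using s by (intro mult_left_mono powr_mono) auto
    finally show "norm (zeta_term n s) \<le> norm (s - 1) * norm s * real (Suc n) powr (- 3 / 2)" .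
    show "summable (\<lambda>n. norm (zeta_term n s))" using s by (intro zeta_reg_summable) simp
    show "summable (\<lambda>n. norm (s - 1) * norm s * real (Suc n) powr (- 3 / 2))"
      by (intro summable_mult summable_three_halves)
  qed
  also have "\<dots> = norm (s - 1) * norm s * zeta_three_halves"
    unfolding zeta_three_halves_def by (rule suminf_mult[OF summable_three_halves])
  finally show ?thesis
    unfolding zeta_reg_def using norm_triangle_ineq[of 1 "\<Sum>n. zeta_term n s"] by simp
qed

text \<open>
  The differences \<open>(n + 2)\<^sup>1\<^sup>-\<^sup>s - (n + 1)\<^sup>1\<^sup>-\<^sup>s\<close>
  telescope to \<open>-1\<close>, which cancels the leading 1.
\<close>

lemma zeta_reg_eq:
  assumes s: "Re s > 1" and Z: "(\<lambda>n. of_nat (Suc n) powr (-s)) sums Z"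
  shows "zeta_reg s = (s - 1) * Z"
proof -
  have "norm (of_nat (Suc n) powr (1 - s) :: complex) = real (Suc n) powr (1 - Re s)" for n
    using norm_powr_real_powr[of "of_nat (Suc n)" "1 - s"] by simp
  moreover have "(\<lambda>n. real (Suc n) powr (1 - Re s)) \<longlonglongrightarrow> 0"
  proof -
    have "(\<lambda>n. real n powr (1 - Re s)) \<longlonglongrightarrow> 0"
      by (rule tendsto_neg_powr[OF _ filterlim_real_sequentially]) (use s in simp)
    from LIMSEQ_Suc[OF this] show ?thesis .
  qed
  ultimately have "(\<lambda>n. norm (of_nat (Suc n) powr (1 - s) :: complex)) \<longlonglongrightarrow> 0"
    by (simp only:)
  hence "(\<lambda>n. of_nat (Suc n) powr (1 - s) :: complex) \<longlonglongrightarrow> 0"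
    by (rule tendsto_norm_zero_cancel)
  from telescope_sums[OF this]
  have "(\<lambda>n. of_nat (Suc (Suc n)) powr (1 - s) - of_nat (Suc n) powr (1 - s) :: complex) sums (-1)" by simp
  from sums_add[OF sums_mult[OF Z, of "s - 1"] this]
  have "(\<lambda>n. zeta_term n s) sums ((s - 1) * Z - 1)" unfolding zeta_term_def by simp
  from sums_unique[OF this, symmetric] show ?thesis by (simp add: zeta_reg_def)
qed

lemma norm_2_powr: "norm ((2::complex) powr z) = 2 powr Re z"
  using norm_powr_real_powr[of 2 z] by simp

lemma one_minus_2_powr_nonzero: "Re s \<noteq> 1 \<Longrightarrow> 1 - (2::complex) powr (1 - s) \<noteq> 0"
proof
  assume s: "Re s \<noteq> 1" and "1 - (2::complex) powr (1 - s) = 0"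
  hence "norm ((2::complex) powr (1 - s)) = 1" by simp
  hence "2 powr (1 - Re s) = 1" by (simp add: norm_2_powr)
  thus False using s by (simp add: powr_eq_one_iff_gen)
qed

text \<open>
  Both sides are holomorphic on \<open>Re s > 0\<close> and agree on \<open>Re s > 1\<close>.
\<close>

lemma eta_eq_zeta_reg:
  assumes E: "E holomorphic_on UNIV" "\<And>s. Re s > 1 \<Longrightarrow> (\<lambda>n. eta_coeff n * of_nat (Suc n) powr (-s)) sums E s"
    and s: "Re s > 0"
  shows "(s - 1) * E s = (1 - 2 powr (1 - s)) * zeta_reg s"
proof (rule halfplane_identity[of "\<lambda>s. (s - 1) * E s" 0 "\<lambda>s. (1 - 2 powr (1 - s)) * zeta_reg s" s])
  show "(\<lambda>s. (s - 1) * E s) holomorphic_on {s. Re s > 0}"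
    by (intro holomorphic_intros holomorphic_on_subset[OF E(1)]) auto
  show "(\<lambda>s. (1 - 2 powr (1 - s)) * zeta_reg s) holomorphic_on {s. Re s > 0}"
    by (intro holomorphic_intros zeta_reg_holomorphic)
  fix s :: complex assume s: "Re s > 1"
  define Z where "Z = (\<Sum>n. of_nat (Suc n) powr (-s) :: complex)"
  have Z: "(\<lambda>n. of_nat (Suc n) powr (-s)) sums Z"
    unfolding Z_def by (intro summable_sums summable_norm_cancel[OF zeta_summable[OF s]])
  have "E s = (1 - 2 powr (1 - s)) * Z"
    by (rule sums_unique2[OF E(2)[OF s] eta_zeta_relation[OF s Z]])
  thus "(s - 1) * E s = (1 - 2 powr (1 - s)) * zeta_reg s"
    using zeta_reg_eq[OF s Z] by simp
qed (use s in auto)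

text \<open>
  One summation by parts represents the continuation on \<open>Re s > 0\<close>; the partial sums of
  one period are at most \<open>2 q\<close>.
\<close>

lemma mean_zero_series_bound:
  fixes f :: "nat \<Rightarrow> complex"
  assumes f: "\<And>n. f (n + q) = f n" "(\<Sum>n<q. f n) = 0" "q \<ge> 1" and b: "\<And>n. norm (f n) \<le> 2"
    and F: "F holomorphic_on UNIV" "\<And>s. Re s > 1 \<Longrightarrow> (\<lambda>n. f n * of_nat (Suc n) powr (-s)) sums F s"
    and s: "Re s \<ge> 1 / 2"
  shows "norm (F s) \<le> 2 * real q * norm s * zeta_three_halves"
proof -
  define G where "G n = (\<Sum>m<n. f m)" for n
  have Gp: "G (n + q) = G n" for n unfolding G_def by (rule partial_sums_periodic[of f q, OF f(1,2)])
  have GB: "norm (G n) \<le> 2 * real q" for n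
  proof (rule periodic_bounded[of G q, OF Gp f(3)])
    fix n assume n: "n < q"
    have "norm (G n) \<le> (\<Sum>m<n. 2)" unfolding G_def by (rule sum_norm_le) (rule b)
    thus "norm (G n) \<le> 2 * real q" using n by simp
  qed
  define H where "H s = - (\<Sum>n. G (Suc n) * powr_diff 1 s (of_nat (Suc n)))" for s
  have "F s = H s"
  proof (rule halfplane_identity[of F 0 H s])
    show "F holomorphic_on {s. Re s > 0}" by (rule holomorphic_on_subset[OF F(1)]) auto
    show "H holomorphic_on {s. Re s > 0}"
      using powr_diff_series_holomorphic[of "\<lambda>n. G (Suc n)" "2 * real q" 1, OF GB]
      unfolding H_def by (intro holomorphic_intros) simp
    fix s :: complex assume s: "Re s > 1"
    have "(\<lambda>n. (G (Suc n) - G n) * powr_diff 0 s (of_nat (Suc n))) sums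
       (- (G 0 * powr_diff 0 s 1) - (\<Sum>n. G (Suc n) * powr_diff (Suc 0) s (of_nat (Suc n))))"
      by (rule summation_by_parts_powr_diff[of G "2 * real q", OF GB]) (use s in simp)
    hence "(\<lambda>n. f n * of_nat (Suc n) powr (-s)) sums H s"
      by (simp add: G_def H_def)
    from sums_unique2[OF F(2)[OF s] this] show "F s = H s" .
  qed (use s in auto)
  also have "norm (H s) \<le> 2 * real q * (\<Prod>i<1. norm (s + of_nat i)) * (\<Sum>n. real (Suc n) powr (- (1 / 2) - real 1))"
    unfolding H_def norm_minus_cancel using s by (intro norm_powr_diff_series_le[of "\<lambda>n. G (Suc n)"] GB) auto
  finally show ?thesis by (simp add: zeta_three_halves_def)
qed

text \<open>
  The order of the pole of \<open>L(s, \<chi>)\<close> at 1.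
\<close>

definition pole_order :: "nat \<Rightarrow> (int \<Rightarrow> complex) \<Rightarrow> nat" where
  "pole_order q chi = (if chi = principal_char q then 1 else 0)"

definition Lser :: "(int \<Rightarrow> complex) \<Rightarrow> complex \<Rightarrow> complex" where
  "Lser chi s = (\<Sum>n. chi (int n) * of_nat n powr (-s))"

definition Dser :: "(int \<Rightarrow> complex) \<Rightarrow> complex \<Rightarrow> complex" where
  "Dser chi s = (\<Sum>n. mangoldt n * chi (int n) * of_nat n powr (-s))"

lemma sum_char_period:
  assumes chi: "dirichlet_character q chi"
  shows "(\<Sum>n<q. chi (int (Suc n))) = (\<Sum>a\<in>unit_residues q. chi a)"
proof -
  have "[int q = int 0] (mod int q)" by (simp add: cong_def)
  hence "chi (int q) = chi (int 0)" by (rule char_cong[OF chi])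
  moreover have "chi (int 0) + (\<Sum>n<q. chi (int (Suc n))) = (\<Sum>n<q. chi (int n)) + chi (int q)"
    by (simp only: sum.lessThan_Suc_shift[of "\<lambda>n. chi (int n)" q, symmetric] sum.lessThan_Suc)
  ultimately have "(\<Sum>n<q. chi (int (Suc n))) = (\<Sum>n<q. chi (int n))" by simp
  also have "\<dots> = (\<Sum>a\<in>int ` {..<q}. chi a)" by (simp add: sum.reindex inj_on_def)
  also have "int ` {..<q} = {0..<int q}" using image_int_atLeastLessThan[of 0 q] by (simp add: lessThan_atLeast0)
  also have "(\<Sum>a\<in>{0..<int q}. chi a) = (\<Sum>a\<in>unit_residues q. chi a)"
    using char_nz_iff[OF chi] by (intro sum.mono_neutral_right) (auto simp: unit_residues_def)
  finally show ?thesis .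
qed

lemma sums_Suc_0: "f 0 = (0::complex) \<Longrightarrow> (\<lambda>n. f (Suc n)) sums c \<Longrightarrow> f sums c"
  using sums_Suc_iff[of f c] by simp

text \<open>
  Split \<open>\<chi> = f\<^sub>0 + \<mu>\<close> into a mean-zero periodic function and its mean
  \<open>\<mu>\<close>, which is nonzero exactly for principal \<open>\<chi>\<close>. The first part
  yields an entire series, the second a multiple of \<open>\<zeta>\<close>. Multiplying by \<open>s
  - 1\<close> in the principal case gives one function \<open>f\<close>, holomorphic on \<open>Re s
  > 0\<close>, with which all characters can be treated alike; its relation to
  \<open>dirichlet_L\<close> is what lets the Riemann Hypothesis speak about it.
\<close>

theorem L_function_structure:
  assumes chi: "dirichlet_character q chi"
  shows "\<exists>f. f holomorphic_on {s. Re s > 0} \<and>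
    (\<forall>s. Re s > 1 \<longrightarrow> (\<lambda>n. chi (int n) * of_nat n powr (-s)) sums (f s / (s - 1) ^ pole_order q chi)) \<and>
    (\<forall>s. Re s \<ge> 1 / 2 \<longrightarrow> norm (f s) \<le> 4 * zeta_three_halves * real q * (norm s + 1)\<^sup>2) \<and>
    (\<forall>s. 0 < Re s \<longrightarrow> Re s < 1 \<longrightarrow> dirichlet_L chi s = f s / (s - 1) ^ pole_order q chi) \<and>
    (chi = principal_char q \<longrightarrow> f 1 \<noteq> 0)"
proof -
  have q: "q \<ge> 1" using chi by (simp add: dirichlet_character_def)
  define c where "c n = chi (int (Suc n))" for n
  \<comment> \<open>The shift by one index makes the period start at \<open>n = 1\<close>, the first term of the Dirichlet series.\<close>
  define \<mu> where "\<mu> = (\<Sum>n<q. c n) / of_nat q"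
  have \<mu>: "\<mu> = (if chi = principal_char q then of_nat (card (unit_residues q)) / of_nat q else 0)"
    unfolding \<mu>_def c_def sum_char_period[OF chi] sum_char_unit_residues[OF chi] by simp
  have cn: "norm (c n) \<le> 1" for n unfolding c_def by (rule norm_char_le[OF chi])
  have \<mu>n: "norm \<mu> \<le> 1"
  proof -
    have "norm (\<Sum>n<q. c n) \<le> (\<Sum>n<q. 1)" by (rule sum_norm_le) (rule cn)
    thus ?thesis using q by (simp add: \<mu>_def norm_divide)
  qed
  define f0 where "f0 n = c n - \<mu>" for n
  have f0p: "f0 (n + q) = f0 n" for n
  proof -
    have "int (Suc (n + q)) = int (Suc n) + int q" by simp
    hence "[int (Suc (n + q)) = int (Suc n)] (mod int q)" by (simp only: cong_def mod_add_self2)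
    from char_cong[OF chi this] show ?thesis by (simp add: f0_def c_def)
  qed
  have f00: "(\<Sum>n<q. f0 n) = 0" using q by (simp add: f0_def sum_subtractf \<mu>_def)
  have f02: "norm (f0 n) \<le> 2" for n
    unfolding f0_def using norm_triangle_ineq4[of "c n" \<mu>] cn[of n] \<mu>n by linarith
  obtain F where F: "F holomorphic_on UNIV"
      "\<And>s. Re s > 1 \<Longrightarrow> (\<lambda>n. f0 n * of_nat (Suc n) powr (-s)) sums F s"
    using mean_zero_series_entire[of f0 q, OF f0p f00 q] by blast
  have Fb: "norm (F s) \<le> 2 * real q * norm s * zeta_three_halves" if "Re s \<ge> 1 / 2" for s
    by (rule mean_zero_series_bound[of f0 q, OF f0p f00 q f02 F that])
  obtain E where E: "E holomorphic_on UNIV"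
      "\<And>s. Re s > 1 \<Longrightarrow> (\<lambda>n. eta_coeff n * of_nat (Suc n) powr (-s)) sums E s"
    using eta_entire by blast
  define L0 where "L0 s = F s + \<mu> * (E s / (1 - 2 powr (1 - s)))" for s
  have L0_sums: "(\<lambda>n. c n * of_nat (Suc n) powr (-s)) sums L0 s" if s: "Re s > 1" for s
  proof -
    define Z where "Z = (\<Sum>n. of_nat (Suc n) powr (-s) :: complex)"
    have Z: "(\<lambda>n. of_nat (Suc n) powr (-s)) sums Z"
      unfolding Z_def by (intro summable_sums summable_norm_cancel[OF zeta_summable[OF s]])
    have "E s = (1 - 2 powr (1 - s)) * Z"
      by (rule sums_unique2[OF E(2)[OF s] eta_zeta_relation[OF s Z]])
    hence "Z = E s / (1 - 2 powr (1 - s))" using one_minus_2_powr_nonzero[of s] s by simp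
    hence "L0 s = F s + \<mu> * Z" by (simp add: L0_def)
    moreover have "(\<lambda>n. f0 n * of_nat (Suc n) powr (-s) + \<mu> * of_nat (Suc n) powr (-s)) sums (F s + \<mu> * Z)"
      by (intro sums_add F(2)[OF s] sums_mult Z)
    moreover have "f0 n * of_nat (Suc n) powr (-s) + \<mu> * of_nat (Suc n) powr (-s) = c n * of_nat (Suc n) powr (-s)" for n
      by (simp only: f0_def left_diff_distrib diff_add_cancel)
    ultimately show ?thesis by (simp only:)
  qed
  have hol0: "L0 holomorphic_on {s. Re s \<noteq> 1}"
    unfolding L0_def using one_minus_2_powr_nonzero
    by (intro holomorphic_intros holomorphic_on_subset[OF F(1)] holomorphic_on_subset[OF E(1)]) auto
  have op: "open {s :: complex. Re s \<noteq> 1}"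
  proof -
    have "{s :: complex. Re s \<noteq> 1} = {s. Re s > 1} \<union> {s. Re s < 1}" by auto
    thus ?thesis by (simp add: open_Un open_halfspace_Re_gt open_halfspace_Re_lt)
  qed
  have an: "L0 analytic_on {s}" if "Re s \<noteq> 1" for s
    using hol0 op that by (meson analytic_at mem_Collect_eq)
  have mero: "L0 meromorphic_on UNIV"
    unfolding L0_def using F(1) E(1)
    by (intro meromorphic_intros analytic_on_imp_meromorphic_on)
       (auto simp: analytic_on_open intro!: holomorphic_intros)
  have "continues_dirichlet_series chi (remove_sings L0)"
    unfolding continues_dirichlet_series_def
  proof (intro conjI allI impI)
    show "remove_sings L0 nicely_meromorphic_on UNIV" by (rule remove_sings_nicely_meromorphic[OF mero])
    fix s :: complex assume s: "1 < Re s"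
    have "remove_sings L0 s = L0 s" by (rule remove_sings_at_analytic[OF an]) (use s in simp)
    thus "(\<lambda>n. chi (int (Suc n)) / of_nat (Suc n) powr s) sums remove_sings L0 s"
      using L0_sums[OF s] by (simp only: c_def powr_minus divide_inverse)
  qed
  hence dL: "dirichlet_L chi s = L0 s" if "Re s \<noteq> 1" for s
    using dirichlet_L_eqI remove_sings_at_analytic[OF an[OF that]] by metis
  define d where "d = pole_order q chi"
  define f where "f s = (if d = 1 then (s - 1) * F s + \<mu> * zeta_reg s else F s)" for s
  have d01: "d = 0 \<or> d = 1" by (simp add: d_def pole_order_def)
  have feq: "L0 s = f s / (s - 1) ^ d" if s: "Re s > 0" "Re s \<noteq> 1" for s
  proof (cases "d = 1")
    case True
    have "s \<noteq> 1" using s by auto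
    have nz: "1 - (2::complex) powr (1 - s) \<noteq> 0" by (rule one_minus_2_powr_nonzero[OF s(2)])
    have "(s - 1) * E s = (1 - 2 powr (1 - s)) * zeta_reg s" by (rule eta_eq_zeta_reg[OF E s(1)])
    hence "E s / (1 - 2 powr (1 - s)) = zeta_reg s / (s - 1)"
      using nz \<open>s \<noteq> 1\<close> by (simp add: divide_simps mult_ac)
    hence "L0 s = F s + \<mu> * (zeta_reg s / (s - 1))" by (simp only: L0_def)
    thus ?thesis using True \<open>s \<noteq> 1\<close> by (simp add: f_def field_simps)
  next
    case False
    hence "\<mu> = 0" using \<mu> by (auto simp: d_def pole_order_def split: if_splits)
    thus ?thesis using False d01 by (simp add: L0_def f_def)
  qed
  have "f holomorphic_on {s. Re s > 0}"
  proof (cases "d = 1")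
    case True
    have "(\<lambda>s. (s - 1) * F s + \<mu> * zeta_reg s) holomorphic_on {s. Re s > 0}"
      by (intro holomorphic_intros zeta_reg_holomorphic holomorphic_on_subset[OF F(1)]) auto
    thus ?thesis using True by (simp add: f_def[abs_def])
  next
    case False
    thus ?thesis using holomorphic_on_subset[OF F(1)] by (simp add: f_def[abs_def])
  qed
  moreover have "(\<lambda>n. chi (int n) * of_nat n powr (-s)) sums (f s / (s - 1) ^ d)" if s: "Re s > 1" for s
  proof (rule sums_Suc_0)
    show "(\<lambda>n. chi (int (Suc n)) * of_nat (Suc n) powr (-s)) sums (f s / (s - 1) ^ d)"
      using L0_sums[OF s] feq[of s] s by (simp only: c_def)
  qed simp
  moreover have "norm (f s) \<le> 4 * zeta_three_halves * real q * (norm s + 1)\<^sup>2" if s: "Re s \<ge> 1 / 2" for s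
  proof -
    define W where "W = (norm s + 1)\<^sup>2"
    have W1: "W \<ge> 1" unfolding W_def by (simp add: one_le_power)
    have s1: "norm (s - 1) \<le> norm s + 1" using norm_triangle_ineq4[of s 1] by simp
    have W2: "norm (s - 1) * norm s \<le> W" unfolding W_def power2_eq_square using s1 by (intro mult_mono) auto
    have W3: "norm s \<le> W" unfolding W_def power2_eq_square
      using mult_mono[of "norm s" "norm s + 1" 1 "norm s + 1"] by simp
    define z where "z = zeta_three_halves"
    have z1: "z \<ge> 1" unfolding z_def by (rule zeta_three_halves_ge_1)
    have q1: "real q \<ge> 1" using q by simp
    have zW: "z * W \<le> z * W * real q" "W \<le> z * W * real q"
    proof -
      show 1: "z * W \<le> z * W * real q" using q1 z1 W1 mult_left_mono[of 1 "real q" "z * W"] by simp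
      have "W \<le> z * W" using z1 W1 mult_right_mono[of 1 z W] by simp
      thus "W \<le> z * W * real q" using 1 by linarith
    qed
    show ?thesis
    proof (cases "d = 1")
      case True
      have "norm (f s) \<le> norm ((s - 1) * F s) + norm (\<mu> * zeta_reg s)"
        using True by (simp add: f_def norm_triangle_ineq)
      also have "norm ((s - 1) * F s) \<le> norm (s - 1) * (2 * real q * norm s * z)"
        unfolding norm_mult z_def by (intro mult_left_mono Fb s) auto
      also have "\<dots> = 2 * real q * z * (norm (s - 1) * norm s)" by simp
      also have "\<dots> \<le> 2 * real q * z * W" using W2 z1 by (intro mult_left_mono) auto
      also have "norm (\<mu> * zeta_reg s) \<le> 1 * (1 + norm (s - 1) * norm s * z)"
        unfolding norm_mult z_def by (intro mult_mono \<mu>n norm_zeta_reg_le s) auto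
      also have "\<dots> \<le> W + z * W"
      proof -
        have "norm (s - 1) * norm s * z \<le> W * z" by (rule mult_right_mono[OF W2]) (use z1 in simp)
        thus ?thesis using W1 by (simp add: mult.commute)
      qed
      finally have "norm (f s) \<le> 2 * real q * z * W + (W + z * W)" by simp
      moreover have "2 * real q * z * W = 2 * (z * W * real q)" "4 * z * real q * W = 4 * (z * W * real q)"
        by simp_all
      ultimately show ?thesis using zW unfolding W_def z_def by linarith
    next
      case False
      have "norm (f s) \<le> 2 * real q * norm s * z"
        using False Fb[OF s] by (simp add: f_def z_def)
      also have "\<dots> \<le> 2 * real q * W * z" using W3 z1 by (intro mult_left_mono mult_right_mono) auto
      also have "\<dots> \<le> 4 * z * real q * W" using z1 W1 q1 by simp
      finally show ?thesis by (simp add: W_def z_def)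
    qed
  qed
  moreover have "dirichlet_L chi s = f s / (s - 1) ^ d" if "0 < Re s" "Re s < 1" for s
    using dL[of s] feq[of s] that by simp
  moreover have "f 1 \<noteq> 0" if "chi = principal_char q"
  proof -
    have "card (unit_residues q) \<noteq> 0" "q \<noteq> 0" using unit_residues_nonempty[OF q] q by linarith+
    hence "\<mu> \<noteq> 0" using that \<mu> by (simp only: if_True) simp
    thus ?thesis using that by (simp add: f_def d_def pole_order_def zeta_reg_at_1)
  qed
  ultimately show ?thesis unfolding d_def by (intro exI[of _ f] conjI allI impI) auto
qed

subsection \<open>Dirichlet series on the half-plane of absolute convergence\<close>

text \<open>
  Absolute convergence permits summing over the fibres of \<open>(d, f) \<mapsto> d f\<close>. At
  index 0 the sum over divisors is infinite, hence 0 by convention, in agreement with the vanishing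
  of \<open>A 0\<close> and \<open>B 0\<close>.
\<close>

lemma dirichlet_convolution_sums:
  fixes A B :: "nat \<Rightarrow> complex"
  assumes A: "summable (\<lambda>n. norm (A n))" "A 0 = 0" and B: "summable (\<lambda>n. norm (B n))" "B 0 = 0"
  shows "(\<lambda>N. \<Sum>d | d dvd N. A d * B (N div d)) sums ((\<Sum>n. A n) * (\<Sum>n. B n))"
proof -
  define SA SB where "SA = (\<Sum>n. A n)" and "SB = (\<Sum>n. B n)"
  have hA: "(A has_sum SA) UNIV" unfolding SA_def
    by (intro norm_summable_imp_has_sum A summable_sums summable_norm_cancel)
  have hB: "(B has_sum SB) UNIV" unfolding SB_def
    by (intro norm_summable_imp_has_sum B summable_sums summable_norm_cancel)
  have nA: "((\<lambda>n. norm (A n)) has_sum (\<Sum>n. norm (A n))) UNIV"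
    by (intro norm_summable_imp_has_sum summable_sums A) (use A in simp)
  have nB: "((\<lambda>n. norm (B n)) has_sum (\<Sum>n. norm (B n))) UNIV"
    by (intro norm_summable_imp_has_sum summable_sums B) (use B in simp)
  define f where "f = (\<lambda>(d, e). A d * B e)"
  have "(\<lambda>p. norm (f p)) summable_on (UNIV \<times> UNIV)"
  proof (rule summable_on_SigmaI)
    show "((\<lambda>y. norm (f (x, y))) has_sum (norm (A x) * (\<Sum>n. norm (B n)))) UNIV" for x
      unfolding f_def by (simp add: norm_mult has_sum_cmult_right[OF nB])
    show "(\<lambda>x. norm (A x) * (\<Sum>n. norm (B n))) summable_on UNIV"
      using has_sum_cmult_left[OF nA] by (auto simp: summable_on_def)
  qed auto
  hence "f summable_on (UNIV \<times> UNIV)" by (rule abs_summable_summable)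
  hence h: "(f has_sum (SA * SB)) (UNIV \<times> UNIV)"
  proof (rule has_sum_SigmaI[rotated 2])
    show "((\<lambda>y. f (x, y)) has_sum (A x * SB)) UNIV" for x
      unfolding f_def by (simp add: has_sum_cmult_right[OF hB])
    show "((\<lambda>x. A x * SB) has_sum (SA * SB)) UNIV" by (rule has_sum_cmult_left[OF hA])
  qed
  have "(f has_sum (SA * SB)) ({0<..} \<times> {0<..})"
  proof (rule iffD1[OF has_sum_cong_neutral h])
    fix x :: "nat \<times> nat" assume "x \<in> UNIV \<times> UNIV - {0<..} \<times> {0<..}"
    thus "f x = 0" using A(2) B(2) by (cases x) (auto simp: f_def)
  qed auto
  moreover have "bij_betw (\<lambda>(N :: nat, d). (d, N div d)) (Sigma {0<..} (\<lambda>N. {d. d dvd N})) ({0<..} \<times> {0<..})"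
    by (rule bij_betw_byWitness[where f' = "\<lambda>(d, e). (d * e, d)"]) (auto elim!: dvdE)
  ultimately have "((\<lambda>x. f ((\<lambda>(N, d). (d, N div d)) x)) has_sum (SA * SB)) (Sigma {0<..} (\<lambda>N. {d. d dvd N}))"
    by (subst has_sum_reindex_bij_betw)
  hence "((\<lambda>N. \<Sum>d | d dvd N. A d * B (N div d)) has_sum (SA * SB)) {0<..}"
  proof (rule has_sum_SigmaD)
    fix N :: nat assume "N \<in> {0<..}"
    hence "finite {d. d dvd N}" by simp
    from has_sum_finite[OF this, of "\<lambda>d. A d * B (N div d)"]
    show "((\<lambda>d. f (case (N, d) of (N, d) \<Rightarrow> (d, N div d))) has_sum (\<Sum>d | d dvd N. A d * B (N div d))) {d. d dvd N}"
      by (simp add: f_def)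
  qed
  hence "((\<lambda>N. \<Sum>d | d dvd N. A d * B (N div d)) has_sum (SA * SB)) UNIV"
  proof (rule iffD1[OF has_sum_cong_neutral, rotated -1])
    fix N :: nat assume "N \<in> UNIV - {0<..}"
    hence "N = 0" by simp
    moreover have "infinite {d :: nat. d dvd 0}" by simp
    ultimately show "(\<Sum>d | d dvd N. A d * B (N div d)) = 0" by (simp only: sum.infinite not_False_eq_True)
  qed auto
  thus ?thesis unfolding SA_def SB_def by (rule has_sum_imp_sums)
qed

lemma ln_le_powr: "x \<ge> 1 \<Longrightarrow> d > 0 \<Longrightarrow> ln x \<le> x powr d / (d :: real)"
  by (rule ln_powr_bound)

lemma norm_nat_powr: "norm (of_nat n powr (-s) :: complex) = real n powr (- Re s)"
  using norm_powr_real_powr[of "of_nat n" "-s"] by simp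

lemma summable_log_coeff:
  fixes a :: "nat \<Rightarrow> complex"
  assumes a: "\<And>n. n \<ge> 1 \<Longrightarrow> norm (a n) \<le> K * ln (real n) + K" and \<sigma>: "\<sigma> > 1" and K: "K \<ge> 0"
  shows "summable (\<lambda>n. norm (a n) * real n powr (- \<sigma>))"
proof -
  define d where "d = (\<sigma> - 1) / 2"
  have d: "d > 0" using \<sigma> by (simp add: d_def)
  show ?thesis
  proof (rule summable_comparison_test'[where N = 1])
    show "summable (\<lambda>n. K * (1 / d + 1) * real n powr (d - \<sigma>))"
      using \<sigma> by (intro summable_mult) (subst summable_real_powr_iff, simp add: d_def field_simps)
    fix n :: nat assume n: "n \<ge> 1"
    have n1: "real n \<ge> 1" using n by simp
    have "1 \<le> real n powr d" using n1 d by (simp add: ge_one_powr_ge_zero)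
    hence "norm (a n) \<le> K * (real n powr d / d) + K * real n powr d"
      using a[OF n] mult_left_mono[OF ln_le_powr[OF n1 d] K] mult_left_mono[of 1 "real n powr d" K] K by simp
    also have "\<dots> = K * (1 / d + 1) * real n powr d" by (simp add: algebra_simps)
    finally have "norm (a n) * real n powr (- \<sigma>) \<le> K * (1 / d + 1) * real n powr d * real n powr (- \<sigma>)"
      by (intro mult_right_mono) auto
    also have "\<dots> = K * (1 / d + 1) * real n powr (d - \<sigma>)"
      by (simp add: powr_diff powr_minus divide_inverse mult.assoc)
    finally show "norm (norm (a n) * real n powr (- \<sigma>)) \<le> K * (1 / d + 1) * real n powr (d - \<sigma>)" by simp
  qed
qed

lemma norm_char_coeff_le:
  assumes "dirichlet_character q chi" "n \<ge> 1"
  shows "norm (chi (int n)) \<le> 1 * ln (real n) + 1"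
proof -
  have "0 \<le> ln (real n)" using assms(2) by (intro ln_ge_zero) simp
  thus ?thesis using norm_char_le[OF assms(1), of "int n"] by linarith
qed

lemma norm_mangoldt_char_coeff_le:
  assumes chi: "dirichlet_character q chi" and n: "n \<ge> 1"
  shows "norm (mangoldt n * chi (int n)) \<le> 1 * ln (real n) + 1"
proof -
  have "norm (mangoldt n * chi (int n)) \<le> mangoldt n * 1"
    unfolding norm_mult using norm_char_le[OF chi] by (intro mult_mono) (auto simp: mangoldt_nonneg)
  also have "\<dots> \<le> ln (real n)" using mangoldt_le[of n] n by simp
  finally show ?thesis by simp
qed

lemma summable_char:
  assumes chi: "dirichlet_character q chi" and \<sigma>: "\<sigma> > 1"
  shows "summable (\<lambda>n. norm (chi (int n)) * real n powr (- \<sigma>))"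
  by (rule summable_log_coeff[OF norm_char_coeff_le[OF chi] \<sigma>]) auto

lemma summable_mangoldt_char:
  assumes chi: "dirichlet_character q chi" and \<sigma>: "\<sigma> > 1"
  shows "summable (\<lambda>n. norm (mangoldt n * chi (int n)) * real n powr (- \<sigma>))"
  by (rule summable_log_coeff[OF norm_mangoldt_char_coeff_le[OF chi] \<sigma>]) auto

lemma dirichlet_series_derivative:
  fixes a :: "nat \<Rightarrow> complex"
  assumes a: "\<And>\<sigma>. \<sigma> > 1 \<Longrightarrow> summable (\<lambda>n. norm (a n) * real n powr (- \<sigma>))" and s: "Re s > 1"
  shows "((\<lambda>s. \<Sum>n. a n * of_nat n powr (-s)) has_field_derivative
     (\<Sum>n. - (of_real (ln (real n)) * a n * of_nat n powr (-s)))) (at s)" (is ?A)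
    and "summable (\<lambda>n. - (of_real (ln (real n)) * a n * of_nat n powr (-s)))" (is ?B)
    and "(\<lambda>n. a n * of_nat n powr (-s)) sums (\<Sum>n. a n * of_nat n powr (-s))" (is ?C)
proof -
  let ?S = "{s :: complex. Re s > 1}"
  let ?f = "\<lambda>n s. a n * of_nat n powr (-s)"
  let ?f' = "\<lambda>n s. - (of_real (ln (real n)) * a n * of_nat n powr (-s))"
  have "\<exists>g g'. \<forall>x\<in>?S. ((\<lambda>n. ?f n x) sums g x) \<and> ((\<lambda>n. ?f' n x) sums g' x) \<and> (g has_field_derivative g' x) (at x)"
  proof (rule series_and_derivative_comparison_local[OF open_Re_gt])
    show "(?f n has_field_derivative ?f' n x) (at x)" if "x \<in> ?S" for n x
    proof (cases "n = 0")
      case False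
      have "((\<lambda>s. of_nat n powr (-s)) has_field_derivative (Ln (of_nat n) * of_nat n powr (-x) * (-1))) (at x)"
        using False by (intro DERIV_chain2[of "\<lambda>z. of_nat n powr z"] derivative_eq_intros refl) auto
      from DERIV_cmult[OF this, of "a n"] show ?thesis
        using False by (simp add: Ln_of_nat mult_ac)
    qed simp
  next
    fix s0 assume s0: "s0 \<in> ?S"
    define d where "d = (Re s0 - 1) / 2"
    have d: "d > 0" using s0 by (simp add: d_def)
    have "norm (?f n y) \<le> norm (a n) * real n powr (- (1 + d))" if y: "y \<in> ball s0 d \<inter> ?S" for n y
    proof -
      have n1: "norm (y - s0) < d" using y by (simp add: dist_norm norm_minus_commute)
      have "Re s0 = 1 + 2 * d" unfolding d_def by (simp add: field_simps)
      hence n2: "Re y \<ge> 1 + d" using abs_le_D2[OF abs_Re_le_cmod[of "y - s0"]] n1 by simp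
      show ?thesis
      proof (cases "n = 0")
        case False
        show ?thesis unfolding norm_mult norm_nat_powr
          using n2 False by (intro mult_left_mono powr_mono) auto
      qed simp
    qed
    moreover have "summable (\<lambda>n. norm (a n) * real n powr (- (1 + d)))"
      using d by (intro a) auto
    ultimately show "\<exists>d h. 0 < d \<and> summable h \<and> (\<forall>\<^sub>F n in sequentially. \<forall>y\<in>ball s0 d \<inter> ?S. norm (?f n y) \<le> h n)"
      using d by (intro exI[of _ d] exI[of _ "\<lambda>n. norm (a n) * real n powr (- (1 + d))"] conjI always_eventually allI ballI)
  qed
  then obtain g g' where g: "\<And>x. x \<in> ?S \<Longrightarrow> (\<lambda>n. ?f n x) sums g x"
    "\<And>x. x \<in> ?S \<Longrightarrow> (\<lambda>n. ?f' n x) sums g' x"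
    "\<And>x. x \<in> ?S \<Longrightarrow> (g has_field_derivative g' x) (at x)" by blast
  have sS: "s \<in> ?S" using s by simp
  have ev: "\<forall>\<^sub>F x in nhds s. (\<Sum>n. ?f n x) = g x"
    using eventually_nhds_in_open[OF open_Re_gt sS] by eventually_elim (metis g(1) sums_unique)
  show ?B using g(2)[OF sS] by (auto simp: summable_def)
  show ?C using g(1)[OF sS] by (simp add: sums_unique[symmetric])
  have "(\<Sum>n. ?f' n s) = g' s" using g(2)[OF sS] by (simp add: sums_unique[symmetric])
  thus ?A using g(3)[OF sS] DERIV_cong_ev[OF refl ev refl] by simp
qed

text \<open>
  \<open>L' = - \<Sum> \<chi>(n) log n n\<^sup>-\<^sup>s\<close>, and \<open>log\<close> is the
  convolution of the von Mangoldt function with 1.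
\<close>

lemma Lser_deriv:
  assumes chi: "dirichlet_character q chi" and s: "Re s > 1"
  shows "(Lser chi has_field_derivative - (Lser chi s * Dser chi s)) (at s)"
proof -
  have d: "(Lser chi has_field_derivative (\<Sum>n. - (of_real (ln (real n)) * chi (int n) * of_nat n powr (-s)))) (at s)"
    unfolding Lser_def[abs_def] by (rule dirichlet_series_derivative(1)[OF summable_char[OF chi] s])
  have sm: "summable (\<lambda>n. - (of_real (ln (real n)) * chi (int n) * of_nat n powr (-s)))"
    by (rule dirichlet_series_derivative(2)[OF summable_char[OF chi] s])
  define A B where "A n = mangoldt n * chi (int n) * of_nat n powr (-s)"
    and "B n = chi (int n) * of_nat n powr (-s)" for n
  have "(\<lambda>N. \<Sum>d | d dvd N. A d * B (N div d)) sums ((\<Sum>n. A n) * (\<Sum>n. B n))"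
  proof (rule dirichlet_convolution_sums)
    show "summable (\<lambda>n. norm (A n))"
      using summable_mangoldt_char[OF chi s]
      by (simp add: A_def norm_mult norm_nat_powr)
    show "summable (\<lambda>n. norm (B n))"
      using summable_char[OF chi s]
      by (simp add: B_def norm_mult norm_nat_powr)
  qed (auto simp: A_def B_def)
  moreover have "(\<Sum>d | d dvd N. A d * B (N div d)) = of_real (ln (real N)) * chi (int N) * of_nat N powr (-s)" for N
  proof (cases "N = 0")
    case True
    have "infinite {d :: nat. d dvd 0}" by simp
    thus ?thesis unfolding True by (simp only: sum.infinite not_False_eq_True) simp
  next
    case False
    have "(\<Sum>d | d dvd N. A d * B (N div d)) = (\<Sum>d | d dvd N. mangoldt d * (chi (int N) * of_nat N powr (-s)))"
    proof (intro sum.cong refl)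
      fix d assume "d \<in> {d. d dvd N}"
      then obtain e where e: "N = d * e" by (auto elim: dvdE)
      have de: "d > 0" "e > 0" using e False by auto
      have "of_nat N powr (-s) = (of_nat d powr (-s) * of_nat e powr (-s) :: complex)"
        unfolding e of_nat_mult by (intro powr_times_real) auto
      moreover have "chi (int N) = chi (int d) * chi (int e)"
        unfolding e of_nat_mult by (rule char_mult[OF chi])
      ultimately show "A d * B (N div d) = mangoldt d * (chi (int N) * of_nat N powr (-s))"
        using de by (simp add: A_def B_def e mult_ac)
    qed
    also have "\<dots> = (\<Sum>d | d dvd N. mangoldt d) * (chi (int N) * of_nat N powr (-s))"
      by (rule sum_distrib_right[symmetric])
    also have "(\<Sum>d | d dvd N. mangoldt d) = complex_of_real (ln (real N))"
      using False by (intro mangoldt_sum) auto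
    finally show ?thesis by (simp add: mult_ac)
  qed
  ultimately have "(\<lambda>N. of_real (ln (real N)) * chi (int N) * of_nat N powr (-s)) sums (Dser chi s * Lser chi s)"
    unfolding Dser_def Lser_def A_def B_def by simp
  from sums_minus[OF this] have "(\<Sum>n. - (of_real (ln (real n)) * chi (int n) * of_nat n powr (-s))) = - (Lser chi s * Dser chi s)"
    by (simp add: sums_unique[symmetric] mult.commute)
  thus ?thesis using d by simp
qed

lemma Dser_sums:
  assumes chi: "dirichlet_character q chi" and s: "Re s > 1"
  shows "(\<lambda>n. mangoldt n * chi (int n) * of_nat n powr (-s)) sums Dser chi s"
  unfolding Dser_def
  by (rule dirichlet_series_derivative(3)[OF summable_mangoldt_char[OF chi] s])

lemma Lser_sums:
  assumes chi: "dirichlet_character q chi" and s: "Re s > 1"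
  shows "(\<lambda>n. chi (int n) * of_nat n powr (-s)) sums Lser chi s"
  unfolding Lser_def
  by (rule dirichlet_series_derivative(3)[OF summable_char[OF chi] s])

lemma Dser_holomorphic:
  assumes chi: "dirichlet_character q chi"
  shows "Dser chi holomorphic_on {s. Re s > 1}"
  unfolding Dser_def[abs_def] holomorphic_on_open[OF open_Re_gt]
  using dirichlet_series_derivative(1)[OF summable_mangoldt_char[OF chi]] by fastforce

lemma sum_inverse_squares_tail:
  "summable (\<lambda>n. real (Suc (Suc n)) powr (-2))" "(\<Sum>n. real (Suc (Suc n)) powr (-2)) \<le> 3 / 4"
proof -
  define b where "b n = real (Suc (Suc n)) powr (-2)" for n
  have b: "b n = 1 / (real n + 2)\<^sup>2" for n
    unfolding b_def by (subst powr_minus_divide) (simp add: powr_numeral add.commute)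
  have "(\<lambda>n. 1 / (real n + 2)) \<longlonglongrightarrow> 0" by real_asymp
  from telescope_sums'[OF this]
  have t: "(\<lambda>n. 1 / (real n + 2) - 1 / (real (Suc n) + 2)) sums (1 / 2)" by simp
  have le: "b (Suc n) \<le> 1 / (real n + 2) - 1 / (real (Suc n) + 2)" for n
  proof -
    have "1 / (real n + 2) - 1 / (real (Suc n) + 2) = 1 / ((real n + 2) * (real n + 3))"
      by (simp add: divide_simps)
    moreover have "(real n + 2) * (real n + 3) \<le> (real n + 3)\<^sup>2"
      unfolding power2_eq_square by (intro mult_right_mono) auto
    ultimately show ?thesis unfolding b by (simp add: frac_le add.commute)
  qed
  have sS: "summable (\<lambda>n. b (Suc n))"
    by (rule summable_comparison_test'[OF sums_summable[OF t], of 0]) (use le in \<open>simp add: b\<close>)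
  hence s: "summable b" by (subst (asm) summable_Suc_iff)
  have "(\<Sum>n. b (Suc n)) \<le> 1 / 2"
    using suminf_le[OF le sS sums_summable[OF t]] sums_unique[OF t] by simp
  hence "suminf b \<le> 3 / 4" using suminf_split_head[OF s] b[of 0] by simp
  thus "(\<Sum>n. real (Suc (Suc n)) powr (-2)) \<le> 3 / 4" unfolding b_def[abs_def] .
  show "summable (\<lambda>n. real (Suc (Suc n)) powr (-2))" using s unfolding b_def[abs_def] .
qed

text \<open>
  The first term is 1 and the rest is at most \<open>\<zeta>(2) - 1 \<le> 3/4\<close>.
\<close>

lemma norm_Lser_ge:
  assumes chi: "dirichlet_character q chi" and s: "Re s \<ge> 2"
  shows "norm (Lser chi s) \<ge> 1 / 4"
proof -
  let ?f = "\<lambda>n. chi (int n) * of_nat n powr (-s)"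
  have sm: "?f sums Lser chi s" by (rule Lser_sums[OF chi]) (use s in simp)
  have "(\<lambda>n. ?f (n + 2)) sums (Lser chi s - (\<Sum>n<2. ?f n))" by (rule sums_split_initial_segment[OF sm])
  moreover have "(\<Sum>n<2. ?f n) = 1" using char_one[OF chi] by (simp add: numeral_2_eq_2)
  ultimately have sm2: "(\<lambda>n. ?f (Suc (Suc n))) sums (Lser chi s - 1)" by simp
  have le: "norm (?f (Suc (Suc n))) \<le> real (Suc (Suc n)) powr (-2)" for n
  proof -
    have "norm (?f (Suc (Suc n))) \<le> 1 * real (Suc (Suc n)) powr (-2)"
      unfolding norm_mult norm_nat_powr using s by (intro mult_mono norm_char_le[OF chi] powr_mono) auto
    thus ?thesis by simp
  qed
  have "norm (Lser chi s - 1) \<le> (\<Sum>n. real (Suc (Suc n)) powr (-2))"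
    unfolding sums_unique[OF sm2] by (rule norm_suminf_le[OF le sum_inverse_squares_tail(1)])
  hence "norm (Lser chi s - 1) \<le> 3 / 4" using sum_inverse_squares_tail(2) by linarith
  thus ?thesis using norm_triangle_ineq2[of 1 "1 - Lser chi s"] by (simp add: norm_minus_commute)
qed

text \<open>
  From \<open>L' = - L D\<close> it follows that \<open>L exp(H)\<close> is constant for a primitive
  \<open>H\<close> of \<open>D\<close>; and \<open>L(2) \<noteq> 0\<close>.
\<close>

lemma Lser_nonzero:
  assumes chi: "dirichlet_character q chi" and s: "Re s > 1"
  shows "Lser chi s \<noteq> 0"
proof -
  let ?S = "{s :: complex. Re s > 1}"
  have "\<exists>H. \<forall>z\<in>?S. (H has_field_derivative Dser chi z) (at z within ?S)"
    by (rule holomorphic_convex_primitive'[OF _ open_Re_gt Dser_holomorphic[OF chi]])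
       (rule convex_halfspace_Re_gt, blast)
  then obtain H where H: "\<And>z. z \<in> ?S \<Longrightarrow> (H has_field_derivative Dser chi z) (at z within ?S)" by blast
  define g where "g z = Lser chi z * exp (H z)" for z
  have "(g has_field_derivative 0) (at z within ?S)" if z: "z \<in> ?S" for z
  proof -
    have "(Lser chi has_field_derivative - (Lser chi z * Dser chi z)) (at z within ?S)"
      by (rule has_field_derivative_at_within[OF Lser_deriv[OF chi]]) (use z in simp)
    moreover have "((\<lambda>z. exp (H z)) has_field_derivative (exp (H z) * Dser chi z)) (at z within ?S)"
      by (rule DERIV_chain2[OF DERIV_exp H[OF z]])
    ultimately have "(g has_field_derivative (- (Lser chi z * Dser chi z) * exp (H z) + exp (H z) * Dser chi z * Lser chi z)) (at z within ?S)"
      unfolding g_def by (rule DERIV_mult)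
    thus ?thesis by (simp add: mult_ac)
  qed
  hence "\<exists>c. \<forall>z\<in>?S. g z = c"
    by (intro has_field_derivative_zero_constant convex_halfspace_Re_gt)
  then obtain c where c: "\<And>z. z \<in> ?S \<Longrightarrow> g z = c" by blast
  have "Lser chi 2 \<noteq> 0" using norm_Lser_ge[OF chi, of 2] by auto
  hence "g 2 \<noteq> 0" by (simp add: g_def)
  hence "c \<noteq> 0" using c[of 2] by simp
  thus ?thesis using c[of s] s by (auto simp: g_def)
qed

section \<open>Non-vanishing on the line \<open>Re s = 1\<close>\<close>

text \<open>
  The function \<open>(s - 1)\<^sup>d L(s, \<chi>)\<close> on \<open>Re s > 0\<close>,
  \<open>d\<close> the pole order, chosen by the properties that are used of it.
\<close>

definition Lfun :: "nat \<Rightarrow> (int \<Rightarrow> complex) \<Rightarrow> complex \<Rightarrow> complex" where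
  "Lfun q chi = (SOME f. f holomorphic_on {s. Re s > 0} \<and>
    (\<forall>s. Re s > 1 \<longrightarrow> (\<lambda>n. chi (int n) * of_nat n powr (-s)) sums (f s / (s - 1) ^ pole_order q chi)) \<and>
    (\<forall>s. Re s \<ge> 1 / 2 \<longrightarrow> norm (f s) \<le> 4 * zeta_three_halves * real q * (norm s + 1)\<^sup>2) \<and>
    (\<forall>s. 0 < Re s \<longrightarrow> Re s < 1 \<longrightarrow> dirichlet_L chi s = f s / (s - 1) ^ pole_order q chi) \<and>
    (chi = principal_char q \<longrightarrow> f 1 \<noteq> 0))"

context
  fixes q :: nat and chi :: "int \<Rightarrow> complex"
  assumes chi: "dirichlet_character q chi"
begin

lemma Lfun_props:
  shows Lfun_holomorphic: "Lfun q chi holomorphic_on {s. Re s > 0}"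
    and Lfun_sums: "Re s > 1 \<Longrightarrow> (\<lambda>n. chi (int n) * of_nat n powr (-s)) sums (Lfun q chi s / (s - 1) ^ pole_order q chi)"
    and Lfun_bound: "Re s \<ge> 1 / 2 \<Longrightarrow> norm (Lfun q chi s) \<le> 4 * zeta_three_halves * real q * (norm s + 1)\<^sup>2"
    and Lfun_dirichlet_L: "0 < Re s \<Longrightarrow> Re s < 1 \<Longrightarrow> dirichlet_L chi s = Lfun q chi s / (s - 1) ^ pole_order q chi"
    and Lfun_at_1: "chi = principal_char q \<Longrightarrow> Lfun q chi 1 \<noteq> 0"
  using someI_ex[OF L_function_structure[OF chi]] unfolding Lfun_def by blast+

lemma Lser_eq_Lfun: "Re s > 1 \<Longrightarrow> Lser chi s = Lfun q chi s / (s - 1) ^ pole_order q chi"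
  unfolding Lser_def using sums_unique[OF Lfun_sums] by simp

lemma Lfun_nonzero_gt_1: "Re s > 1 \<Longrightarrow> Lfun q chi s \<noteq> 0"
  using Lser_nonzero[OF chi, of s] Lser_eq_Lfun[of s] by auto

lemma Lfun_eq_Lser: "Re s > 1 \<Longrightarrow> Lfun q chi s = Lser chi s * (s - 1) ^ pole_order q chi"
  using Lser_eq_Lfun[of s] by auto

lemma Dser_eq_Lfun:
  assumes s: "Re s > 1"
  shows "Dser chi s = - deriv (Lfun q chi) s / Lfun q chi s + of_nat (pole_order q chi) / (s - 1)"
proof -
  define d where "d = pole_order q chi"
  have sS: "s \<in> {s. Re s > 1}" using s by simp
  have s1: "s - 1 \<noteq> 0" using s by auto
  have "(Lser chi has_field_derivative - (Lser chi s * Dser chi s)) (at s)" by (rule Lser_deriv[OF chi s])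
  moreover have "((\<lambda>s. (s - 1) ^ d) has_field_derivative (of_nat d * (s - 1) ^ (d - 1))) (at s)"
    by (auto intro!: derivative_eq_intros)
  ultimately have 1: "((\<lambda>s. Lser chi s * (s - 1) ^ d) has_field_derivative
      (- (Lser chi s * Dser chi s) * (s - 1) ^ d + of_nat d * (s - 1) ^ (d - 1) * Lser chi s)) (at s)"
    by (rule DERIV_mult)
  have ev: "\<forall>\<^sub>F x in nhds s. Lser chi x * (x - 1) ^ d = Lfun q chi x"
    using eventually_nhds_in_open[OF open_Re_gt sS] by eventually_elim (simp add: d_def Lfun_eq_Lser)
  have "(Lfun q chi has_field_derivative
      (- (Lser chi s * Dser chi s) * (s - 1) ^ d + of_nat d * (s - 1) ^ (d - 1) * Lser chi s)) (at s)"
    using 1 DERIV_cong_ev[OF refl ev refl] by simp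
  hence D: "deriv (Lfun q chi) s = - (Lser chi s * Dser chi s) * (s - 1) ^ d + of_nat d * (s - 1) ^ (d - 1) * Lser chi s"
    by (rule DERIV_imp_deriv)
  have L: "Lfun q chi s = Lser chi s * (s - 1) ^ d" using Lfun_eq_Lser[OF s] by (simp add: d_def)
  have d01: "d = 0 \<or> d = 1" by (simp add: d_def pole_order_def)
  have "Lser chi s \<noteq> 0" by (rule Lser_nonzero[OF chi s])
  hence "- deriv (Lfun q chi) s / Lfun q chi s + of_nat d / (s - 1) = Dser chi s"
    unfolding D L using d01 s1 by (auto simp: divide_simps) (simp_all add: algebra_simps)
  thus ?thesis by (simp add: d_def)
qed

lemma Lfun_not_constant_zero: "\<not> (\<forall>s\<in>{s. Re s > 0}. Lfun q chi s = 0)"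
proof
  assume "\<forall>s\<in>{s. Re s > 0}. Lfun q chi s = 0"
  hence "Lfun q chi 2 = 0" by simp
  thus False using Lfun_nonzero_gt_1[of 2] by simp
qed

lemma Lfun_local_order:
  assumes s0: "Re s0 > 0"
  obtains g r m where "r > 0" "ball s0 r \<subseteq> {s. Re s > 0}" "g holomorphic_on ball s0 r"
    "\<And>w. w \<in> ball s0 r \<Longrightarrow> Lfun q chi w = (w - s0) ^ m * g w" "\<And>w. w \<in> ball s0 r \<Longrightarrow> g w \<noteq> 0"
    "m = 0 \<longleftrightarrow> Lfun q chi s0 \<noteq> 0"
proof (cases "Lfun q chi s0 = 0")
  case True
  have nc: "\<not> Lfun q chi constant_on {s. Re s > 0}"
  proof
    assume "Lfun q chi constant_on {s. Re s > 0}"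
    hence "\<forall>s\<in>{s. Re s > 0}. Lfun q chi s = 0" using True s0 by (auto simp: constant_on_def)
    thus False using Lfun_not_constant_zero by blast
  qed
  have "connected {s :: complex. Re s > 0}" by (intro convex_connected convex_halfspace_Re_gt)
  have sS: "s0 \<in> {s. Re s > 0}" using s0 by simp
  show ?thesis
  proof (rule holomorphic_factor_zero_nonconstant[OF Lfun_holomorphic open_Re_gt \<open>connected _\<close> sS True nc])
    fix g r n
    assume "0 < n" "0 < r" "ball s0 r \<subseteq> {s. Re s > 0}" "g holomorphic_on ball s0 r"
      "\<And>w. w \<in> ball s0 r \<Longrightarrow> Lfun q chi w = (w - s0)^n * g w" "\<And>w. w \<in> ball s0 r \<Longrightarrow> g w \<noteq> 0"
    thus ?thesis using True by (intro that[of r g n]) auto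
  qed
next
  case False
  have s0S: "s0 \<in> {s. Re s > 0}" using s0 by simp
  have "isCont (Lfun q chi) s0"
    using holomorphic_on_imp_continuous_on[OF Lfun_holomorphic] open_Re_gt s0S continuous_on_eq_continuous_at by blast
  hence "(Lfun q chi \<longlongrightarrow> Lfun q chi s0) (nhds s0)"
    unfolding isCont_def tendsto_at_iff_tendsto_nhds .
  hence "\<forall>\<^sub>F w in nhds s0. Lfun q chi w \<noteq> 0" by (rule tendsto_imp_eventually_ne[OF _ False])
  moreover have "\<forall>\<^sub>F w in nhds s0. w \<in> {s. Re s > 0}" by (rule eventually_nhds_in_open[OF open_Re_gt s0S])
  ultimately have "\<forall>\<^sub>F w in nhds s0. Lfun q chi w \<noteq> 0 \<and> Re w > 0" by eventually_elim simp
  then obtain r where r: "r > 0" "\<And>w. w \<in> ball s0 r \<Longrightarrow> Lfun q chi w \<noteq> 0 \<and> Re w > 0"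
    unfolding eventually_nhds_metric by (auto simp: dist_commute)
  show ?thesis
  proof (rule that[of r "Lfun q chi" 0])
    show "Lfun q chi holomorphic_on ball s0 r"
      by (rule holomorphic_on_subset[OF Lfun_holomorphic]) (use r(2) in auto)
  qed (use r False in auto)
qed

text \<open>
  Near \<open>s\<^sub>0\<close> write \<open>Lfun = (s - s\<^sub>0)\<^sup>m g\<close> with \<open>g
  \<noteq> 0\<close>; minus the logarithmic derivative has residue \<open>-m\<close>, and a pole of
  \<open>L\<close> at 1 adds its order.
\<close>

lemma Dser_residue:
  assumes t: "Re s0 = 1"
  shows "\<exists>m::nat. ((\<lambda>h. of_real h * Dser chi (s0 + of_real h)) \<longlongrightarrow>
      (if s0 = 1 then of_nat (pole_order q chi) else 0) - of_nat m) (at_right (0::real)) \<and>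
     (m = 0 \<longleftrightarrow> Lfun q chi s0 \<noteq> 0)"
proof -
  have s0: "Re s0 > 0" using t by simp
  show ?thesis
  proof (rule Lfun_local_order[OF s0])
  fix g r m
  assume g: "r > 0" "ball s0 r \<subseteq> {s. Re s > 0}" "g holomorphic_on ball s0 r"
    "\<And>w. w \<in> ball s0 r \<Longrightarrow> Lfun q chi w = (w - s0) ^ m * g w" "\<And>w. w \<in> ball s0 r \<Longrightarrow> g w \<noteq> 0"
    "m = 0 \<longleftrightarrow> Lfun q chi s0 \<noteq> 0"
  define d where "d = pole_order q chi"
  have eq: "of_real h * Dser chi (s0 + of_real h) =
      - of_nat m - of_real h * (deriv g (s0 + of_real h) / g (s0 + of_real h)) + of_nat d * (of_real h / (s0 + of_real h - 1))"
    if h: "0 < h" "h < r" for h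
  proof -
    define w where "w = s0 + complex_of_real h"
    have w: "w \<in> ball s0 r" using h by (simp add: w_def dist_norm)
    have wn: "w - s0 \<noteq> 0" "w - s0 = of_real h" using h by (auto simp: w_def)
    have "(g has_field_derivative deriv g w) (at w)" by (rule holomorphic_derivI[OF g(3) _ w]) simp
    moreover have "((\<lambda>w. (w - s0) ^ m) has_field_derivative (of_nat m * (w - s0) ^ (m - 1))) (at w)"
      by (auto intro!: derivative_eq_intros)
    ultimately have 1: "((\<lambda>w. (w - s0) ^ m * g w) has_field_derivative
        (of_nat m * (w - s0) ^ (m - 1) * g w + deriv g w * (w - s0) ^ m)) (at w)"
      by (rule DERIV_mult[rotated])
    have ev: "\<forall>\<^sub>F x in nhds w. (x - s0) ^ m * g x = Lfun q chi x"
      using eventually_nhds_in_open[OF open_ball w] by eventually_elim (simp add: g(4))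
    have D: "deriv (Lfun q chi) w = of_nat m * (w - s0) ^ (m - 1) * g w + deriv g w * (w - s0) ^ m"
      using 1 DERIV_cong_ev[OF refl ev refl] by (intro DERIV_imp_deriv) simp
    have Rw: "Re w > 1" using h t by (simp add: w_def)
    have "Dser chi w = - (of_nat m * (w - s0) ^ (m - 1) * g w + deriv g w * (w - s0) ^ m) / ((w - s0) ^ m * g w) + of_nat d / (w - 1)"
      unfolding Dser_eq_Lfun[OF Rw] D g(4)[OF w] d_def ..
    also have "(of_nat m * (w - s0) ^ (m - 1) * g w + deriv g w * (w - s0) ^ m) / ((w - s0) ^ m * g w) =
        of_nat m / (w - s0) + deriv g w / g w"
      using wn(1) g(5)[OF w] by (cases m) (simp_all add: field_simps)
    hence "- (of_nat m * (w - s0) ^ (m - 1) * g w + deriv g w * (w - s0) ^ m) / ((w - s0) ^ m * g w) =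
        - (of_nat m / (w - s0) + deriv g w / g w)" by (simp only: minus_divide_left[symmetric])
    finally have "Dser chi w = - (of_nat m / of_real h + deriv g w / g w) + of_nat d / (w - 1)"
      by (simp only: wn(2))
    hence "of_real h * Dser chi w = of_real h * (- (of_nat m / of_real h + deriv g w / g w) + of_nat d / (w - 1))"
      by (simp only:)
    also have "\<dots> = - of_nat m - of_real h * (deriv g w / g w) + of_nat d * (of_real h / (w - 1))"
      using h by (simp add: algebra_simps)
    finally show ?thesis unfolding w_def[symmetric] .
  qed
  have s0b: "s0 \<in> ball s0 r" using g(1) by simp
  have ch: "((\<lambda>h. s0 + complex_of_real h) \<longlongrightarrow> s0) (at_right 0)"
    by (rule tendsto_eq_intros refl | simp)+
  have "isCont (\<lambda>w. deriv g w / g w) s0"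
  proof -
    have "(\<lambda>w. deriv g w / g w) holomorphic_on ball s0 r"
      using g(5) by (intro holomorphic_intros g(3) holomorphic_deriv) auto
    thus ?thesis using holomorphic_on_imp_continuous_on continuous_on_eq_continuous_at[OF open_ball] s0b by blast
  qed
  from isCont_tendsto_compose[OF this ch]
  have l1: "((\<lambda>h. deriv g (s0 + of_real h) / g (s0 + of_real h)) \<longlongrightarrow> deriv g s0 / g s0) (at_right 0)" .
  have h0: "((\<lambda>h. complex_of_real h) \<longlongrightarrow> 0) (at_right 0)"
    by (rule tendsto_eq_intros refl | simp)+
  have l2: "((\<lambda>h. of_real h / (s0 + of_real h - 1)) \<longlongrightarrow> (if s0 = 1 then 1 else 0 :: complex)) (at_right (0::real))"
  proof (cases "s0 = 1")
    case True
    have "\<forall>\<^sub>F h in at_right (0::real). of_real h / (s0 + of_real h - 1) = (1::complex)"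
      using eventually_at_right_less[of 0] by eventually_elim (simp add: True)
    thus ?thesis using True by (simp add: tendsto_eventually)
  next
    case False
    have "((\<lambda>h. s0 + complex_of_real h - 1) \<longlongrightarrow> s0 - 1) (at_right 0)"
      by (intro tendsto_diff ch tendsto_const)
    from tendsto_divide[OF h0 this] show ?thesis using False by simp
  qed
  have "((\<lambda>h. - of_nat m - of_real h * (deriv g (s0 + of_real h) / g (s0 + of_real h)) + of_nat d * (of_real h / (s0 + of_real h - 1)))
     \<longlongrightarrow> - of_nat m - 0 * (deriv g s0 / g s0) + of_nat d * (if s0 = 1 then 1 else 0)) (at_right (0::real))"
    by (intro tendsto_intros l1 l2 h0)
  also have "- of_nat m - 0 * (deriv g s0 / g s0) + of_nat d * (if s0 = 1 then 1 else 0) =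
     (if s0 = 1 then of_nat d else 0) - of_nat m" by simp
  finally have "((\<lambda>h. of_real h * Dser chi (s0 + of_real h)) \<longlongrightarrow> (if s0 = 1 then of_nat d else 0) - of_nat m) (at_right 0)"
  proof (rule Lim_transform_eventually)
    have "\<forall>\<^sub>F h in at_right 0. h \<in> {0<..<r}" using g(1) by (rule eventually_at_right_real)
    thus "\<forall>\<^sub>F h in at_right 0. - of_nat m - of_real h * (deriv g (s0 + of_real h) / g (s0 + of_real h)) + of_nat d * (of_real h / (s0 + of_real h - 1)) =
       of_real h * Dser chi (s0 + of_real h)"
      by eventually_elim (subst eq, auto)
  qed
  thus ?thesis using g(6) unfolding d_def by blast
  qed
qed

end

lemma Re_of_real_mult: "Re (of_real r * z) = r * Re z"
  by simp

text \<open>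
  Termwise, \<open>3 + 4 cos \<alpha> + cos 2\<alpha> = 2 (1 + cos \<alpha>)\<^sup>2 \<ge>
  0\<close>.
\<close>

lemma three_four_one:
  assumes chi: "dirichlet_character q chi" and h: "h > 0"
  shows "Re (3 * Dser (principal_char q) (1 + of_real h) + 4 * Dser chi (1 + \<i> * of_real t + of_real h) +
     Dser (\<lambda>n. chi n * chi n) (1 + \<i> * of_real (2 * t) + of_real h)) \<ge> 0"
proof -
  have q: "q \<ge> 1" using chi by (simp add: dirichlet_character_def)
  note chi0 = dirichlet_character_principal[OF q]
  note chi2 = dirichlet_character_mult[OF chi chi]
  define s where "s = 1 + complex_of_real h"
  define z where "z n = chi (int n) * of_nat n powr (- (\<i> * of_real t))" for n
  have R: "Re s > 1" "Re (1 + \<i> * of_real t + of_real h) > 1" "Re (1 + \<i> * of_real (2 * t) + of_real h) > 1"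
    using h by (auto simp: s_def)
  define T where "T n = 3 * (mangoldt n * principal_char q (int n) * of_nat n powr (- (1 + complex_of_real h))) +
       4 * (mangoldt n * chi (int n) * of_nat n powr (- (1 + \<i> * of_real t + of_real h))) +
       mangoldt n * (chi (int n) * chi (int n)) * of_nat n powr (- (1 + \<i> * of_real (2 * t) + of_real h))" for n
  have "T sums (3 * Dser (principal_char q) (1 + of_real h) + 4 * Dser chi (1 + \<i> * of_real t + of_real h) +
     Dser (\<lambda>n. chi n * chi n) (1 + \<i> * of_real (2 * t) + of_real h))"
    unfolding T_def using R(1)
    by (intro sums_add sums_mult Dser_sums[OF chi0] Dser_sums[OF chi R(2)] Dser_sums[OF chi2 R(3)]) (simp add: s_def)
  from sums_Re[OF this] show ?thesis
  proof (rule sums_le[OF _ sums_zero, rotated])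
    fix n
    show "0 \<le> Re (T n)"
    proof (cases "n > 0 \<and> coprime (int n) (int q)")
      case True
      have e1: "of_nat n powr (- (1 + \<i> * of_real t + of_real h)) = (of_nat n powr (- s) * of_nat n powr (- (\<i> * of_real t)) :: complex)"
        by (simp add: s_def powr_add[symmetric] algebra_simps)
      have e2: "of_nat n powr (- (1 + \<i> * of_real (2 * t) + of_real h)) =
         (of_nat n powr (- s) * (of_nat n powr (- (\<i> * of_real t)) * of_nat n powr (- (\<i> * of_real t))) :: complex)"
        by (simp add: s_def powr_add[symmetric] algebra_simps)
      have p: "(of_nat n powr (- s) :: complex) = of_real (real n powr (- (1 + h)))"
        using powr_of_real[of "real n" "- (1 + h)"] by (simp add: s_def)
      have m: "(mangoldt n :: complex) = of_real (mangoldt n)" by simp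
      have pc: "principal_char q (int n) = 1" using True by (simp add: principal_char_def)
      have nz: "norm (z n) = 1"
        using norm_char[OF chi, of "int n"] True by (simp add: z_def norm_mult norm_nat_powr[of n "\<i> * of_real t"])
      have "T n = of_real (mangoldt n * real n powr (- (1 + h))) * (3 + 4 * z n + z n * z n)"
        unfolding T_def e1 e2 pc s_def[symmetric] p m z_def by (simp add: algebra_simps)
      hence "Re (T n) = mangoldt n * real n powr (- (1 + h)) * Re (3 + 4 * z n + z n * z n)"
        by (simp only: Re_of_real_mult)
      moreover have "Re (3 + 4 * z n + z n * z n) = 2 * (1 + Re (z n))\<^sup>2"
      proof -
        have "(Re (z n))\<^sup>2 + (Im (z n))\<^sup>2 = 1" using nz cmod_power2[of "z n"] by simp
        thus ?thesis by (simp add: power2_eq_square algebra_simps)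
      qed
      ultimately show ?thesis by (simp add: mangoldt_nonneg)
    next
      case False
      hence "T n = 0"
        using char_nz_iff[OF chi, of "int n"] by (auto simp: T_def principal_char_def)
      thus ?thesis by simp
    qed
  qed
qed

text \<open>
  De la Vallee Poussin: multiply the inequality 3-4-1 by \<open>h\<close> and let \<open>h\<close>
  tend to 0 from above. The principal character contributes 3, a zero of order \<open>m\<close>
  contributes \<open>-4 m\<close>, and \<open>\<chi>\<^sup>2\<close> at height \<open>2 t\<close>
  contributes at most 0. This last fails only for \<open>s\<^sub>0 = 1\<close> and
  \<open>\<chi>\<^sup>2\<close> principal, hence for nonprincipal \<open>\<chi>\<close> that case is
  excluded by hypothesis.
\<close>

lemma Lfun_nonzero_line_1:
  assumes chi: "dirichlet_character q chi" and s0: "Re s0 = 1"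
    and nr: "s0 = 1 \<Longrightarrow> (\<lambda>n. chi n * chi n) = principal_char q \<Longrightarrow> chi = principal_char q"
  shows "Lfun q chi s0 \<noteq> 0"
proof (cases "chi = principal_char q \<and> s0 = 1")
  case True
  thus ?thesis using Lfun_at_1[OF chi] by simp
next
  case False
  have q: "q \<ge> 1" using chi by (simp add: dirichlet_character_def)
  note chi0 = dirichlet_character_principal[OF q]
  note chi2 = dirichlet_character_mult[OF chi chi]
  define t where "t = Im s0"
  have s0t: "s0 = 1 + \<i> * of_real t" using s0 by (simp add: t_def complex_eq_iff)
  have po: "pole_order q (principal_char q) = 1" by (simp add: pole_order_def)
  obtain m0 where m0: "((\<lambda>h. of_real h * Dser (principal_char q) (1 + of_real h)) \<longlongrightarrow> 1 - of_nat m0) (at_right (0::real))"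
      "m0 = 0 \<longleftrightarrow> Lfun q (principal_char q) 1 \<noteq> 0"
    using Dser_residue[OF chi0, of 1] unfolding po by auto
  have m00: "m0 = 0" using m0(2) Lfun_at_1[OF chi0] by simp
  obtain m1 where m1: "((\<lambda>h. of_real h * Dser chi (1 + \<i> * of_real t + of_real h)) \<longlongrightarrow>
      (if s0 = 1 then of_nat (pole_order q chi) else 0) - of_nat m1) (at_right (0::real))"
      "m1 = 0 \<longleftrightarrow> Lfun q chi s0 \<noteq> 0"
    using Dser_residue[OF chi s0] unfolding s0t by blast
  have z1: "(if s0 = 1 then of_nat (pole_order q chi) else 0) = (0::complex)"
    using False by (auto simp: pole_order_def)
  have R2: "Re (1 + \<i> * of_real (2 * t)) = 1" by simp
  obtain m2 where m2: "((\<lambda>h. of_real h * Dser (\<lambda>n. chi n * chi n) (1 + \<i> * of_real (2 * t) + of_real h)) \<longlongrightarrow>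
      (if 1 + \<i> * of_real (2 * t) = 1 then of_nat (pole_order q (\<lambda>n. chi n * chi n)) else 0) - of_nat m2) (at_right (0::real))"
    using Dser_residue[OF chi2 R2] by blast
  have z2: "(if 1 + \<i> * of_real (2 * t) = 1 then of_nat (pole_order q (\<lambda>n. chi n * chi n)) else 0) = (0::complex)"
  proof (cases "t = 0")
    case True
    hence "s0 = 1" using s0t by simp
    hence "(\<lambda>n. chi n * chi n) \<noteq> principal_char q" using nr False by blast
    thus ?thesis by (simp add: pole_order_def)
  qed simp
  have lim: "((\<lambda>h. Re (3 * (of_real h * Dser (principal_char q) (1 + of_real h)) + 4 * (of_real h * Dser chi (1 + \<i> * of_real t + of_real h)) +
     of_real h * Dser (\<lambda>n. chi n * chi n) (1 + \<i> * of_real (2 * t) + of_real h))) \<longlongrightarrow>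
     Re (3 * (1 - of_nat m0) + 4 * (0 - of_nat m1) + (0 - of_nat m2))) (at_right (0::real))"
    using m1(1) m2 unfolding z1 z2 by (intro tendsto_intros m0(1))
  have "Re (3 * (1 - of_nat m0) + 4 * (0 - of_nat m1) + (0 - of_nat m2)) \<ge> 0"
  proof (rule tendsto_lowerbound[OF lim])
    show "\<forall>\<^sub>F h in at_right 0. 0 \<le> Re (3 * (of_real h * Dser (principal_char q) (1 + of_real h)) + 4 * (of_real h * Dser chi (1 + \<i> * of_real t + of_real h)) +
     of_real h * Dser (\<lambda>n. chi n * chi n) (1 + \<i> * of_real (2 * t) + of_real h))"
      using eventually_at_right_less[of 0]
    proof eventually_elim
      fix h :: real assume h: "0 < h"
      have "3 * (of_real h * Dser (principal_char q) (1 + of_real h)) + 4 * (of_real h * Dser chi (1 + \<i> * of_real t + of_real h)) +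
         of_real h * Dser (\<lambda>n. chi n * chi n) (1 + \<i> * of_real (2 * t) + of_real h) =
         of_real h * (3 * Dser (principal_char q) (1 + of_real h) + 4 * Dser chi (1 + \<i> * of_real t + of_real h) +
         Dser (\<lambda>n. chi n * chi n) (1 + \<i> * of_real (2 * t) + of_real h))"
        by (simp add: algebra_simps)
      thus "0 \<le> Re (3 * (of_real h * Dser (principal_char q) (1 + of_real h)) + 4 * (of_real h * Dser chi (1 + \<i> * of_real t + of_real h)) +
         of_real h * Dser (\<lambda>n. chi n * chi n) (1 + \<i> * of_real (2 * t) + of_real h))"
        using three_four_one[OF chi h, of t] h by (simp only: Re_of_real_mult) simp
    qed
  qed simp
  hence "4 * real m1 + real m2 \<le> 3" using m00 by simp
  hence "m1 = 0" by linarith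
  thus ?thesis using m1(2) by simp
qed

subsection \<open>Real characters at \<open>s = 1\<close>\<close>

lemma sum_divisors_prime_power_mult:
  fixes e :: "nat \<Rightarrow> real"
  assumes p: "prime p" "\<not> p dvd m" "m > 0" and e: "\<And>a b. e (a * b) = e a * e b" "e 1 = 1"
  shows "(\<Sum>d | d dvd p ^ k * m. e d) = (\<Sum>j\<le>k. e p ^ j) * (\<Sum>d | d dvd m. e d)"
proof -
  have ep: "e (p ^ j) = e p ^ j" for j by (induction j) (simp_all add: e(2)[simplified] e(1))
  have p1: "p > 1" using p(1) prime_gt_1_nat by blast
  have bij: "bij_betw (\<lambda>(j, d). p ^ j * d) ({..k} \<times> {d. d dvd m}) {d. d dvd p ^ k * m}"
  proof (rule bij_betw_byWitness[where f' = "\<lambda>x. (multiplicity p x, x div p ^ multiplicity p x)"])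
    show "\<forall>a\<in>{..k} \<times> {d. d dvd m}. (\<lambda>x. (multiplicity p x, x div p ^ multiplicity p x)) ((\<lambda>(j, d). p ^ j * d) a) = a"
    proof (clarify)
      fix j d assume d: "d dvd m"
      have "\<not> p dvd d" using d p(2) dvd_trans by blast
      moreover have "d \<noteq> 0" using d p(3) by auto
      ultimately have "multiplicity p (p ^ j * d) = j"
        using p p1 by (subst prime_elem_multiplicity_mult_distrib) (auto simp: not_dvd_imp_multiplicity_0 multiplicity_same_power)
      thus "multiplicity p (p ^ j * d) = j \<and> p ^ j * d div p ^ multiplicity p (p ^ j * d) = d"
        using p1 by simp
    qed
    show "\<forall>a\<in>{d. d dvd p ^ k * m}. (\<lambda>(j, d). p ^ j * d) (multiplicity p a, a div p ^ multiplicity p a) = a"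
      by (auto intro!: dvd_mult_div_cancel multiplicity_dvd)
    show "(\<lambda>(j, d). p ^ j * d) ` ({..k} \<times> {d. d dvd m}) \<subseteq> {d. d dvd p ^ k * m}"
      by (auto intro!: mult_dvd_mono le_imp_power_dvd)
    show "(\<lambda>x. (multiplicity p x, x div p ^ multiplicity p x)) ` {d. d dvd p ^ k * m} \<subseteq> {..k} \<times> {d. d dvd m}"
    proof (rule image_subsetI)
      fix x assume "x \<in> {d. d dvd p ^ k * m}"
      hence x: "x dvd p ^ k * m" by simp
      have x0: "x \<noteq> 0"
      proof
        assume "x = 0"
        hence "p ^ k * m = 0" using x by simp
        thus False using p1 p(3) by simp
      qed
      define v where "v = multiplicity p x"
      have "\<not> is_unit p" using p1 by simp
      obtain y where y: "x = p ^ v * y" "\<not> p dvd y"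
        using multiplicity_decompose'[OF x0 \<open>\<not> is_unit p\<close>] unfolding v_def by blast
      have "p ^ v dvd p ^ k * m" using x y(1) dvd_mult_left by metis
      moreover have "coprime (p ^ v) m" using p by (simp add: prime_imp_coprime)
      ultimately have "p ^ v dvd p ^ k" by (simp add: coprime_dvd_mult_left_iff)
      hence v: "v \<le> k" using p1 by (rule power_dvd_imp_le)
      have "y dvd p ^ k * m" using x y(1) dvd_mult_right by metis
      moreover have "coprime y (p ^ k)" using p y(2) by (simp add: prime_imp_coprime coprime_commute)
      ultimately have "y dvd m" by (simp add: coprime_dvd_mult_right_iff)
      moreover have "x div p ^ v = y" using y(1) p1 by simp
      ultimately show "(multiplicity p x, x div p ^ multiplicity p x) \<in> {..k} \<times> {d. d dvd m}"
        using v unfolding v_def[symmetric] by simp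
    qed
  qed
  have "(\<Sum>j\<le>k. e p ^ j) * (\<Sum>d | d dvd m. e d) = (\<Sum>(j, d)\<in>{..k} \<times> {d. d dvd m}. e (p ^ j * d))"
    unfolding sum_product sum.cartesian_product by (intro sum.cong refl) (auto simp: e(1) ep)
  also have "\<dots> = (\<Sum>x\<in>{..k} \<times> {d. d dvd m}. e ((\<lambda>(j, d). p ^ j * d) x))"
    by (intro sum.cong refl) auto
  also have "\<dots> = (\<Sum>d | d dvd p ^ k * m. e d)" by (rule sum.reindex_bij_betw[OF bij])
  finally show ?thesis ..
qed

lemma geometric_sum_sign:
  assumes "e \<in> {-1, 0, 1 :: real}"
  shows "(\<Sum>j\<le>k. e ^ j) \<ge> 0" "even k \<Longrightarrow> (\<Sum>j\<le>k. e ^ j) \<ge> 1"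
proof -
  have 1: "(\<Sum>j\<le>k. (-1) ^ j :: real) = (if even k then 1 else 0)" by (induction k) auto
  have 0: "(\<Sum>j\<le>k. 0 ^ j :: real) = 1" by (induction k) auto
  show "(\<Sum>j\<le>k. e ^ j) \<ge> 0" "even k \<Longrightarrow> (\<Sum>j\<le>k. e ^ j) \<ge> 1"
    using assms 1 0 by auto
qed

text \<open>
  Multiplicativity reduces the sum to prime powers, where it is a sum of powers of
  \<open>-1\<close>, 0 or 1.
\<close>

lemma divisor_sum_sign:
  fixes e :: "nat \<Rightarrow> real"
  assumes e: "\<And>a b. e (a * b) = e a * e b" "e 1 = 1" "\<And>n. e n \<in> {-1, 0, 1}" and n: "n > 0"
  shows "(\<Sum>d | d dvd n. e d) \<ge> 0 \<and> (\<Sum>d | d dvd n\<^sup>2. e d) \<ge> 1"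
  using n
proof (induction n rule: less_induct)
  case (less n)
  show ?case
  proof (cases "n = 1")
    case True
    thus ?thesis using e(2) by simp
  next
    case False
    then obtain p where p: "prime p" "p dvd n" using prime_factor_nat by blast
    have p1: "p > 1" using p(1) prime_gt_1_nat by blast
    have "\<not> is_unit p" using p1 by simp
    moreover have "n \<noteq> 0" using less.prems by simp
    ultimately obtain m where m: "n = p ^ multiplicity p n * m" "\<not> p dvd m"
      using multiplicity_decompose' by blast
    define k where "k = multiplicity p n"
    have n: "n = p ^ k * m" using m(1) by (simp add: k_def)
    have k0: "k > 0" using n p(2) m(2) by (cases k) auto
    have m0: "m > 0" using n less.prems by (cases m) auto
    have "m < n"
    proof -
      have "p ^ k > 1" using p1 k0 by (rule one_less_power)
      thus ?thesis using m0 n by simp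
    qed
    from less.IH[OF this m0] have IH: "(\<Sum>d | d dvd m. e d) \<ge> 0" "(\<Sum>d | d dvd m\<^sup>2. e d) \<ge> 1" by auto
    have 1: "(\<Sum>d | d dvd n. e d) = (\<Sum>j\<le>k. e p ^ j) * (\<Sum>d | d dvd m. e d)"
      unfolding n by (rule sum_divisors_prime_power_mult[OF p(1) m(2) m0 e(1,2)])
    have n2: "n\<^sup>2 = p ^ (2 * k) * m\<^sup>2" unfolding n by (simp add: power_mult_distrib power_mult[symmetric] mult.commute)
    have pm2: "\<not> p dvd m\<^sup>2" using m(2) p(1) prime_dvd_power by blast
    have 2: "(\<Sum>d | d dvd n\<^sup>2. e d) = (\<Sum>j\<le>2 * k. e p ^ j) * (\<Sum>d | d dvd m\<^sup>2. e d)"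
      unfolding n2 by (rule sum_divisors_prime_power_mult[OF p(1) pm2 _ e(1,2)]) (use m0 in simp)
    have "1 * 1 \<le> (\<Sum>j\<le>2 * k. e p ^ j) * (\<Sum>d | d dvd m\<^sup>2. e d)"
      using geometric_sum_sign(2)[OF e(3), of "2 * k" p] IH(2) by (intro mult_mono) auto
    thus ?thesis unfolding 1 2 using geometric_sum_sign(1)[OF e(3), of p k] IH(1) by simp
  qed
qed

lemma summable_times_ln:
  fixes a :: "nat \<Rightarrow> complex"
  assumes a: "\<And>\<sigma>. \<sigma> > 1 \<Longrightarrow> summable (\<lambda>n. norm (a n) * real n powr (- \<sigma>))" and \<sigma>: "\<sigma> > 1"
  shows "summable (\<lambda>n. norm (- (of_real (ln (real n)) * a n)) * real n powr (- \<sigma>))"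
proof -
  define d where "d = (\<sigma> - 1) / 2"
  have d: "d > 0" "\<sigma> - d > 1" using \<sigma> by (simp_all add: d_def field_simps)
  show ?thesis
  proof (rule summable_comparison_test'[where N = 1])
    show "summable (\<lambda>n. 1 / d * (norm (a n) * real n powr (- (\<sigma> - d))))"
      by (intro summable_mult a d)
    fix n :: nat assume n: "n \<ge> 1"
    have n1: "real n \<ge> 1" using n by simp
    have l0: "ln (real n) \<ge> 0" using n1 by simp
    have "ln (real n) * (norm (a n) * real n powr (- \<sigma>)) \<le> (real n powr d / d) * (norm (a n) * real n powr (- \<sigma>))"
      by (intro mult_right_mono ln_le_powr n1 d) auto
    also have "\<dots> = 1 / d * (norm (a n) * (real n powr d * real n powr (- \<sigma>)))" by simp
    also have "real n powr d * real n powr (- \<sigma>) = real n powr (- (\<sigma> - d))"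
      by (simp add: powr_add[symmetric])
    finally show "norm (norm (- (of_real (ln (real n)) * a n)) * real n powr (- \<sigma>)) \<le> 1 / d * (norm (a n) * real n powr (- (\<sigma> - d)))"
      using l0 by (simp add: norm_mult mult.assoc)
  qed
qed

lemma dirichlet_series_higher_deriv:
  fixes a :: "nat \<Rightarrow> complex"
  assumes a: "\<And>\<sigma>. \<sigma> > 1 \<Longrightarrow> summable (\<lambda>n. norm (a n) * real n powr (- \<sigma>))" and s: "Re s > 1"
  shows "(deriv ^^ k) (\<lambda>s. \<Sum>n. a n * of_nat n powr (-s)) s = (\<Sum>n. (- of_real (ln (real n))) ^ k * a n * of_nat n powr (-s))"
    and "\<And>\<sigma>. \<sigma> > 1 \<Longrightarrow> summable (\<lambda>n. norm ((- of_real (ln (real n))) ^ k * a n) * real n powr (- \<sigma>))"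
  using s
proof (induction k arbitrary: s)
  case 0
  { case 1 show ?case by simp }
  { case 2 thus ?case using a by simp }
next
  case (Suc k)
  { case 1
    have sS: "s \<in> {s. Re s > 1}" using 1 by simp
    have ev: "\<forall>\<^sub>F x in nhds s. (deriv ^^ k) (\<lambda>s. \<Sum>n. a n * of_nat n powr (-s)) x =
       (\<Sum>n. (- of_real (ln (real n))) ^ k * a n * of_nat n powr (-x))"
      using eventually_nhds_in_open[OF open_Re_gt sS] by eventually_elim (rule Suc.IH(1), simp)
    have "((\<lambda>s. \<Sum>n. (- of_real (ln (real n))) ^ k * a n * of_nat n powr (-s)) has_field_derivative
       (\<Sum>n. - (of_real (ln (real n)) * ((- of_real (ln (real n))) ^ k * a n) * of_nat n powr (-s)))) (at s)"
      by (rule dirichlet_series_derivative(1)[OF Suc.IH(2) 1]) (use 1 in auto)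
    hence "deriv (\<lambda>s. \<Sum>n. (- of_real (ln (real n))) ^ k * a n * of_nat n powr (-s)) s =
       (\<Sum>n. - (of_real (ln (real n)) * ((- of_real (ln (real n))) ^ k * a n) * of_nat n powr (-s)))"
      by (rule DERIV_imp_deriv)
    hence "deriv ((deriv ^^ k) (\<lambda>s. \<Sum>n. a n * of_nat n powr (-s))) s =
       (\<Sum>n. - (of_real (ln (real n)) * ((- of_real (ln (real n))) ^ k * a n) * of_nat n powr (-s)))"
      using deriv_cong_ev[OF ev refl] by simp
    thus ?case by (simp add: mult.assoc) }
  { case 2
    have "summable (\<lambda>n. norm (- (of_real (ln (real n)) * ((- of_real (ln (real n))) ^ k * a n))) * real n powr (- \<sigma>))"
      by (rule summable_times_ln[OF Suc.IH(2) 2(1)]) (use 2 in auto)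
    thus ?case by (simp add: norm_mult mult.assoc) }
qed

text \<open>
  The Dirichlet series of \<open>\<zeta>\<^sup>2\<close>, a product of two absolutely convergent
  series.
\<close>

lemma summable_divisor_sum:
  assumes \<sigma>: "\<sigma> > 1"
  shows "summable (\<lambda>n. real (card {d. d dvd n}) * real n powr (- \<sigma>))"
proof -
  define A where "A n = complex_of_real (real n powr (- \<sigma>))" for n
  have sm: "summable (\<lambda>n. norm (A n))" using \<sigma> by (simp add: A_def summable_real_powr_iff)
  have "(\<lambda>N. \<Sum>d | d dvd N. A d * A (N div d)) sums ((\<Sum>n. A n) * (\<Sum>n. A n))"
    by (intro dirichlet_convolution_sums sm) (simp_all add: A_def)
  moreover have "(\<Sum>d | d dvd N. A d * A (N div d)) = of_real (real (card {d. d dvd N}) * real N powr (- \<sigma>))" for N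
  proof -
    have "(\<Sum>d | d dvd N. A d * A (N div d)) = (\<Sum>d | d dvd N. A N)"
      by (intro sum.cong refl) (auto simp: A_def powr_mult elim!: dvdE simp flip: of_real_mult)
    thus ?thesis by (simp add: A_def)
  qed
  ultimately have "(\<lambda>N. complex_of_real (real (card {d. d dvd N}) * real N powr (- \<sigma>))) sums ((\<Sum>n. A n) * (\<Sum>n. A n))"
    by (simp only:)
  from sums_Re[OF this] show ?thesis by (simp add: sums_iff)
qed

text \<open>
  Landau's argument. The coefficients \<open>rr(n) = \<Sum>\<^sub>d\<^sub>|\<^sub>n
  \<chi>(d)\<close> of \<open>\<zeta>(s) L(s, \<chi>)\<close> are nonnegative and at least 1 at
  squares. If \<open>L(1, \<chi>) = 0\<close>, the product is holomorphic on \<open>Re s >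
  0\<close>, so its Taylor series at 2 converges at \<open>1/2\<close>. All Taylor terms there are
  nonnegative and can be rearranged into \<open>\<Sum> rr(n)
  n\<^sup>-\<^sup>1\<^sup>/\<^sup>2\<close>, which dominates the harmonic series along the squares.
\<close>

lemma real_character_nonzero_at_1:
  assumes chi: "dirichlet_character q chi" and np: "chi \<noteq> principal_char q"
    and real: "(\<lambda>n. chi n * chi n) = principal_char q"
  shows "Lfun q chi 1 \<noteq> 0"
proof
  assume L1: "Lfun q chi 1 = 0"
  have chi1: "dirichlet_character 1 (principal_char 1)" by (rule dirichlet_character_principal) simp
  have pc1: "principal_char 1 n = 1" for n by (simp add: principal_char_def)
  have po: "pole_order q chi = 0" "pole_order 1 (principal_char 1) = 1" using np by (simp_all add: pole_order_def)
  define e where "e n = Re (chi (int n))" for n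
  have val: "chi n \<in> {-1, 0, 1}" for n
  proof -
    have "chi n * chi n = principal_char q n" using fun_cong[OF real, of n] .
    hence "chi n * chi n = 0 \<or> chi n * chi n = 1" by (simp add: principal_char_def split: if_splits)
    thus ?thesis by (auto simp: square_eq_1_iff)
  qed
  have chie: "chi (int n) = of_real (e n)" for n using val[of "int n"] by (auto simp: e_def)
  have e3: "e n \<in> {-1, 0, 1}" for n using val[of "int n"] by (auto simp: e_def)
  have em: "e (a * b) = e a * e b" for a b
    using char_mult[OF chi, of "int a" "int b"] unfolding of_nat_mult[symmetric] chie of_real_mult[symmetric] of_real_eq_iff .
  have e1: "e 1 = 1" using char_one[OF chi] by (simp add: e_def)
  define rr where "rr n = (\<Sum>d | d dvd n. e d)" for n
  have rr: "rr n \<ge> 0" "n > 0 \<Longrightarrow> rr (n\<^sup>2) \<ge> 1" for n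
  proof -
    show "n > 0 \<Longrightarrow> rr (n\<^sup>2) \<ge> 1" using divisor_sum_sign[of e n, OF em e1 e3] by (simp add: rr_def)
    show "rr n \<ge> 0"
      using divisor_sum_sign[of e n, OF em e1 e3] by (cases "n = 0") (simp_all add: rr_def)
  qed
  define a where "a n = complex_of_real (rr n)" for n
  have asm: "summable (\<lambda>n. norm (a n) * real n powr (- \<sigma>))" if \<sigma>: "\<sigma> > 1" for \<sigma>
  proof (rule summable_comparison_test'[OF summable_divisor_sum[OF \<sigma>], of 0])
    fix n
    have "\<bar>rr n\<bar> \<le> (\<Sum>d | d dvd n. 1)" unfolding rr_def
    proof (rule order_trans[OF sum_abs], rule sum_mono)
      fix i show "\<bar>e i\<bar> \<le> 1" using e3[of i] by auto
    qed
    hence "\<bar>rr n\<bar> * real n powr (- \<sigma>) \<le> real (card {d. d dvd n}) * real n powr (- \<sigma>)"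
      by (intro mult_right_mono) auto
    thus "norm (norm (a n) * real n powr (- \<sigma>)) \<le> real (card {d. d dvd n}) * real n powr (- \<sigma>)"
      by (simp add: a_def)
  qed
  define R where "R s = (\<Sum>n. a n * of_nat n powr (-s))" for s
  have Rprod: "R s = Lser chi s * Lser (principal_char 1) s" if s: "Re s > 1" for s
  proof -
    define A B where "A n = chi (int n) * of_nat n powr (-s)" and "B n = principal_char 1 (int n) * of_nat n powr (-s)" for n
    have "(\<lambda>N. \<Sum>d | d dvd N. A d * B (N div d)) sums ((\<Sum>n. A n) * (\<Sum>n. B n))"
    proof (rule dirichlet_convolution_sums)
      show "summable (\<lambda>n. norm (A n))"
        using summable_char[OF chi s] by (simp add: A_def norm_mult norm_nat_powr)
      show "summable (\<lambda>n. norm (B n))"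
        using summable_char[OF chi1 s] by (simp add: B_def norm_mult norm_nat_powr)
    qed (auto simp: A_def B_def)
    moreover have "(\<Sum>d | d dvd N. A d * B (N div d)) = a N * of_nat N powr (-s)" for N
    proof (cases "N = 0")
      case True
      have "infinite {d :: nat. d dvd 0}" by simp
      thus ?thesis unfolding True by (simp only: sum.infinite not_False_eq_True) simp
    next
      case False
      have "(\<Sum>d | d dvd N. A d * B (N div d)) = (\<Sum>d | d dvd N. of_real (e d) * of_nat N powr (-s))"
      proof (intro sum.cong refl)
        fix d assume "d \<in> {d. d dvd N}"
        then obtain f where f: "N = d * f" by (auto elim: dvdE)
        have df: "d > 0" "f > 0" using f False by auto
        have "of_nat N powr (-s) = (of_nat d powr (-s) * of_nat f powr (-s) :: complex)"
          unfolding f of_nat_mult by (intro powr_times_real) auto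
        thus "A d * B (N div d) = of_real (e d) * of_nat N powr (-s)"
          using df by (simp add: A_def B_def f pc1 pc1[unfolded One_nat_def] chie)
      qed
      thus ?thesis by (simp add: a_def rr_def sum_distrib_right)
    qed
    ultimately have "(\<lambda>N. a N * of_nat N powr (-s)) sums ((\<Sum>n. A n) * (\<Sum>n. B n))"
      by (simp only:)
    from sums_unique[OF this] show ?thesis unfolding R_def Lser_def A_def B_def by simp
  qed
  \<comment> \<open>The zero at 1 cancels the pole of \<open>\<zeta>\<close>.\<close>
  define g where "g s = (if s = 1 then deriv (Lfun q chi) 1 else Lfun q chi s / (s - 1))" for s
  have ghol: "g holomorphic_on {s. Re s > 0}"
    by (rule pole_theorem_open_0[OF Lfun_holomorphic[OF chi] open_Re_gt, where a = 1]) (simp_all add: g_def L1)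
  define H where "H s = Lfun 1 (principal_char 1) s * g s" for s
  have Hhol: "H holomorphic_on {s. Re s > 0}"
    unfolding H_def by (intro holomorphic_intros ghol Lfun_holomorphic[OF chi1])
  have HR: "H s = R s" if s: "Re s > 1" for s
  proof -
    have s1: "s \<noteq> 1" using s by auto
    have e1: "Lser (principal_char 1) s = Lfun 1 (principal_char 1) s / (s - 1)"
      using Lser_eq_Lfun[OF chi1 s] unfolding po power_one_right .
    have e2: "Lser chi s = Lfun q chi s"
      using Lser_eq_Lfun[OF chi s] unfolding po power_0 by simp
    show ?thesis unfolding Rprod[OF s] e1 e2 H_def g_def using s1 by simp
  qed
  have ball: "ball 2 2 \<subseteq> {s :: complex. Re s > 0}"
  proof
    fix s :: complex assume "s \<in> ball 2 2"
    hence "norm (2 - s) < 2" by (simp add: dist_norm)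
    thus "s \<in> {s. Re s > 0}" using abs_Re_le_cmod[of "2 - s"] by simp
  qed
  have derivs: "(deriv ^^ k) H 2 = (\<Sum>n. (- of_real (ln (real n))) ^ k * a n * of_nat n powr (-2))" for k
  proof -
    have Rhol: "R holomorphic_on {s. Re s > 1}"
      unfolding R_def[abs_def] holomorphic_on_open[OF open_Re_gt] using dirichlet_series_derivative(1)[OF asm] by fastforce
    have "(deriv ^^ k) H 2 = (deriv ^^ k) R 2"
      by (rule higher_deriv_transform_within_open[OF holomorphic_on_subset[OF Hhol] Rhol open_Re_gt]) (auto simp: HR)
    thus ?thesis unfolding R_def[abs_def] by (subst (asm) dirichlet_series_higher_deriv(1)[OF asm]) auto
  qed
  define b where "b k n = rr n * ln (real n) ^ k * real n powr (-2)" for k n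
  have bsm: "summable (b k)" for k
  proof -
    have "norm ((- of_real (ln (real n))) ^ k * a n) * real n powr (-2) = b k n" for n
    proof (cases "n = 0")
      case False
      hence "ln (real n) \<ge> 0" by simp
      thus ?thesis using rr(1)[of n] by (simp add: norm_mult norm_power a_def b_def)
    qed (simp add: b_def)
    moreover have "summable (\<lambda>n. norm ((- of_real (ln (real n))) ^ k * a n) * real n powr (-2))"
      by (rule dirichlet_series_higher_deriv(2)[OF asm, of 2]) auto
    ultimately show ?thesis by simp
  qed
  \<comment> \<open>The \<open>k\<close>-th term of the Taylor series at 2, evaluated at \<open>1/2\<close>.\<close>
  define c where "c k = (\<Sum>n. b k n) * (3 / 2) ^ k / fact k" for k
  have "(\<lambda>k. (deriv ^^ k) H 2 / fact k * (1 / 2 - 2) ^ k) sums H (1 / 2)"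
    by (rule holomorphic_power_series[OF holomorphic_on_subset[OF Hhol ball]]) (simp add: dist_norm)
  moreover have "(deriv ^^ k) H 2 / fact k * (1 / 2 - 2) ^ k = of_real (c k)" for k
  proof -
    have "(- of_real (ln (real n))) ^ k * a n * of_nat n powr (-2) = of_real ((-1) ^ k * b k n)" for n
    proof -
      have "of_nat n powr (-2) = complex_of_real (real n powr (-2))"
        using powr_of_real[of "real n" "-2"] by simp
      thus ?thesis by (simp add: b_def a_def power_minus[of "of_real _"] mult_ac)
    qed
    hence "(deriv ^^ k) H 2 = of_real (\<Sum>n. (-1) ^ k * b k n)"
      unfolding derivs by (simp only: suminf_of_real[OF summable_mult[OF bsm]])
    also have "(\<Sum>n. (-1) ^ k * b k n) = (-1) ^ k * (\<Sum>n. b k n)" by (rule suminf_mult[OF bsm])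
    finally have D: "(deriv ^^ k) H 2 = of_real ((-1) ^ k * (\<Sum>n. b k n))" .
    have "(1 / 2 - 2 :: complex) ^ k = of_real ((-1) ^ k * (3 / 2) ^ k)"
    proof -
      have "(1 / 2 - 2 :: complex) = of_real (-1 * (3 / 2))" by simp
      thus ?thesis by (simp only: of_real_power[symmetric] power_mult_distrib[symmetric])
    qed
    moreover have "((-1) ^ k * (-1) ^ k :: real) = 1" by (simp flip: power_mult_distrib)
    ultimately show ?thesis unfolding D c_def by (simp add: field_simps)
  qed
  ultimately have "(\<lambda>k. complex_of_real (c k)) sums H (1 / 2)" by simp
  from sums_Re[OF this] have csums: "c sums Re (H (1 / 2))" by simp
  have bound: "(\<Sum>m=1..M. inverse (real m)) \<le> Re (H (1 / 2))" for M
  proof -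
    \<comment> \<open>Exchange the finite sum over \<open>n \<le> M\<^sup>2\<close> with the Taylor series, which is exponential for each \<open>n\<close>.\<close>
    define N where "N = M\<^sup>2"
    have "(\<lambda>k. \<Sum>n=1..N. b k n * (3 / 2) ^ k / fact k) sums (\<Sum>n=1..N. rr n * real n powr (- 1 / 2))"
    proof (rule sums_sum)
      fix n assume n: "n \<in> {1..N}"
      have 1: "(\<lambda>k. rr n * real n powr (-2) * ((3 / 2 * ln (real n)) ^ k /\<^sub>R fact k)) sums (rr n * real n powr (-2) * exp (3 / 2 * ln (real n)))"
        by (intro sums_mult exp_converges)
      have 2: "exp (3 / 2 * ln (real n)) = real n powr (3 / 2)" using n by (simp add: powr_def)
      have 3: "real n powr (-2) * real n powr (3 / 2) = real n powr (- 1 / 2)"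
        by (simp add: powr_add[symmetric])
      have 4: "rr n * real n powr (-2) * ((3 / 2 * ln (real n)) ^ k /\<^sub>R fact k) = b k n * (3 / 2) ^ k / fact k" for k
        unfolding b_def power_mult_distrib real_scaleR_def divide_inverse by (simp only: mult_ac)
      have 5: "rr n * real n powr (-2) * exp (3 / 2 * ln (real n)) = rr n * real n powr (- 1 / 2)"
        unfolding 2 mult.assoc 3 ..
      show "(\<lambda>k. b k n * (3 / 2) ^ k / fact k) sums (rr n * real n powr (- 1 / 2))"
        using 1 unfolding 4 5 .
    qed
    moreover have "(\<Sum>n=1..N. b k n * (3 / 2) ^ k / fact k) \<le> c k" for k
    proof -
      have "b k n \<ge> 0" for n using rr(1)[of n] by (cases "n = 0") (auto simp: b_def)
      hence "(\<Sum>n\<in>{1..N}. b k n) \<le> (\<Sum>n. b k n)" by (intro sum_le_suminf bsm) auto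
      hence "(\<Sum>n\<in>{1..N}. b k n) * ((3 / 2) ^ k / fact k) \<le> (\<Sum>n. b k n) * ((3 / 2) ^ k / fact k)"
        by (intro mult_right_mono) auto
      hence "(\<Sum>n\<in>{1..N}. b k n * ((3 / 2) ^ k / fact k)) \<le> c k"
        unfolding c_def times_divide_eq_right[symmetric] sum_distrib_right[symmetric] .
      thus ?thesis unfolding times_divide_eq_right .
    qed
    ultimately have le: "(\<Sum>n=1..N. rr n * real n powr (- 1 / 2)) \<le> Re (H (1 / 2))"
      using csums by (meson sums_le)
    have inj: "inj_on (\<lambda>m::nat. m\<^sup>2) {1..M}" by (auto intro!: inj_onI)
    have "(\<Sum>m=1..M. inverse (real m)) \<le> (\<Sum>m=1..M. rr (m\<^sup>2) * real (m\<^sup>2) powr (- 1 / 2))"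
    proof (rule sum_mono)
      fix m assume m: "m \<in> {1..M}"
      have "real (m\<^sup>2) powr (- 1 / 2) = inverse (real m)"
      proof -
        have e: "real (m\<^sup>2) = real m powr 2" using m by (simp add: powr_numeral)
        have "real (m\<^sup>2) powr (- 1 / 2) = real m powr (2 * (- 1 / 2))" unfolding e by (rule powr_powr)
        also have "\<dots> = real m powr (-1)" by simp
        also have "\<dots> = inverse (real m)" using m by (subst powr_minus) simp
        finally show ?thesis .
      qed
      moreover have "1 * inverse (real m) \<le> rr (m\<^sup>2) * inverse (real m)"
        using rr(2)[of m] m by (intro mult_right_mono) auto
      ultimately show "inverse (real m) \<le> rr (m\<^sup>2) * real (m\<^sup>2) powr (- 1 / 2)" by simp
    qed
    also have "\<dots> = (\<Sum>n\<in>(\<lambda>m. m\<^sup>2) ` {1..M}. rr n * real n powr (- 1 / 2))"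
      by (subst sum.reindex[OF inj]) simp
    also have "\<dots> \<le> (\<Sum>n=1..N. rr n * real n powr (- 1 / 2))"
      using rr(1) by (intro sum_mono2) (auto simp: N_def intro!: power_mono)
    finally show ?thesis using le by linarith
  qed
  have "summable (\<lambda>m. inverse (real (Suc m)))"
  proof (rule summableI_nonneg_bounded)
    fix n
    have "(\<Sum>m<n. inverse (real (Suc m))) = (\<Sum>m=1..n. inverse (real m))"
      by (rule sum.reindex_bij_witness[of _ "\<lambda>m. m - 1" Suc]) auto
    thus "(\<Sum>m<n. inverse (real (Suc m))) \<le> Re (H (1 / 2))" using bound[of n] by simp
  qed auto
  hence "summable (\<lambda>m. inverse (real m))" by (subst (asm) summable_Suc_iff)
  thus False using not_summable_harmonic[where 'a = real] by simp
qed

section \<open>A Perron formula\<close>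

lemma contour_integral_rectpath:
  assumes c: "continuous_on (path_image (rectpath a1 a3)) f"
  shows "contour_integral (rectpath a1 a3) f =
     contour_integral (linepath a1 (Complex (Re a3) (Im a1))) f +
     contour_integral (linepath (Complex (Re a3) (Im a1)) a3) f +
     contour_integral (linepath a3 (Complex (Re a1) (Im a3))) f +
     contour_integral (linepath (Complex (Re a1) (Im a3)) a1) f"
proof -
  define a2 a4 where "a2 = Complex (Re a3) (Im a1)" and "a4 = Complex (Re a1) (Im a3)"
  have eq: "rectpath a1 a3 = linepath a1 a2 +++ linepath a2 a3 +++ linepath a3 a4 +++ linepath a4 a1"
    by (simp add: rectpath_def Let_def a2_def a4_def)
  have pi: "path_image (rectpath a1 a3) =
     closed_segment a1 a2 \<union> (closed_segment a2 a3 \<union> (closed_segment a3 a4 \<union> closed_segment a4 a1))"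
    unfolding eq by (simp add: path_image_join)
  have "f contour_integrable_on (linepath u v)" if "closed_segment u v \<subseteq> path_image (rectpath a1 a3)" for u v
    by (intro contour_integrable_continuous_linepath continuous_on_subset[OF c that])
  hence ci: "f contour_integrable_on (linepath a1 a2)" "f contour_integrable_on (linepath a2 a3)"
       "f contour_integrable_on (linepath a3 a4)" "f contour_integrable_on (linepath a4 a1)"
    unfolding pi by blast+
  show ?thesis
    unfolding eq using ci
    by (simp add: contour_integral_join a2_def[symmetric] a4_def[symmetric] contour_integrable_joinI valid_path_join)
qed

lemma norm_contour_integral_linepath_le:
  assumes "continuous_on (closed_segment a b) f" "B \<ge> 0"
    and "\<And>z. z \<in> closed_segment a b \<Longrightarrow> norm (f z) \<le> B"
  shows "norm (contour_integral (linepath a b) f) \<le> B * norm (b - a)"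
  using assms by (intro contour_integral_bound_linepath contour_integrable_continuous_linepath) auto

lemma norm_triangle3: "norm (a + b + c :: complex) \<le> norm a + norm b + norm c"
  using norm_triangle_ineq[of "a + b" c] norm_triangle_ineq[of a b] by linarith

lemma norm_of_real_powr: "x > 0 \<Longrightarrow> norm (complex_of_real x powr s) = x powr Re s"
  by (simp add: norm_powr_real_powr)

text \<open>
  The kernel whose integral along a vertical line is, up to \<open>2 \<pi> i\<close>, the Riesz
  weight \<open>max(0, 1 - 1/y)\<close>. Its quadratic decay makes the integral absolutely
  convergent.
\<close>

definition perron_kernel :: "real \<Rightarrow> complex \<Rightarrow> complex" where
  "perron_kernel y s = of_real y powr s / (s * (s + 1))"

lemma norm_mult_succ_ge_Im:
  "norm (s * (s + 1)) \<ge> \<bar>Im s\<bar>\<^sup>2"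
proof -
  have "\<bar>Im s\<bar> * \<bar>Im s\<bar> \<le> norm s * norm (s + 1)"
    using abs_Im_le_cmod[of s] abs_Im_le_cmod[of "s + 1"] by (intro mult_mono) auto
  thus ?thesis by (simp add: norm_mult power2_eq_square)
qed

lemma norm_mult_succ_ge_Re:
  assumes "c \<ge> 0" "\<bar>Re s\<bar> \<ge> c" "\<bar>Re s + 1\<bar> \<ge> c"
  shows "norm (s * (s + 1)) \<ge> c\<^sup>2"
proof -
  have "c * c \<le> norm s * norm (s + 1)"
    using abs_Re_le_cmod[of s] abs_Re_le_cmod[of "s + 1"] assms by (intro mult_mono) auto
  thus ?thesis by (simp add: norm_mult power2_eq_square)
qed

lemma perron_kernel_le:
  assumes "y > 0" "d > 0" "norm (s * (s + 1)) \<ge> d" "y powr Re s \<le> Y"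
  shows "norm (perron_kernel y s) \<le> Y / d"
proof -
  have "norm (perron_kernel y s) = y powr Re s / norm (s * (s + 1))"
    using assms(1) by (simp add: perron_kernel_def norm_divide norm_of_real_powr)
  also have "\<dots> \<le> Y / d" using assms order_trans[OF powr_ge_zero assms(4)]
    by (intro frac_le) auto
  finally show ?thesis .
qed

lemma perron_kernel_holomorphic:
  assumes "y > 0" "0 \<notin> S" "-1 \<notin> S"
  shows "perron_kernel y holomorphic_on S"
  unfolding perron_kernel_def
  using assms by (intro holomorphic_intros) (auto simp: add_eq_0_iff2)

text \<open>
  Shared by the two kernels below: on the left side \<open>Re s = -T\<close> and on the horizontal
  sides the kernel is dominated by \<open>perron_kernel y\<close>, so that for \<open>y \<ge>
  1\<close> only the right side and the residues remain as \<open>T\<close> grows.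
\<close>

lemma rectangle_left_bound:
  assumes y: "y \<ge> 1" and T: "T \<ge> (2::real)"
    and I: "(k has_contour_integral R) (rectpath (Complex (-T) (-T)) (Complex 2 T))"
    and contk: "continuous_on (path_image (rectpath (Complex (-T) (-T)) (Complex 2 T))) k"
    and le: "\<And>s. Re s = -T \<or> \<bar>Im s\<bar> = T \<Longrightarrow> norm (k s) \<le> norm (perron_kernel y s)"
  shows "norm (contour_integral (linepath (Complex 2 (-T)) (Complex 2 T)) k - R)
     \<le> 2 * (y\<^sup>2 / T\<^sup>2 * (T + 2)) + 2 * T / (T - 1)\<^sup>2"
proof -
  define a1 a3 where "a1 = Complex (-T) (-T)" and "a3 = Complex 2 T"
  have 1: "contour_integral (rectpath a1 a3) k = R"
    using I unfolding a1_def a3_def by (rule contour_integral_unique)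
  have cont: "continuous_on (path_image (rectpath a1 a3)) k" using contk unfolding a1_def a3_def .
  have seg: "closed_segment u v \<subseteq> path_image (rectpath a1 a3)"
    if "(u, v) \<in> {(a1, Complex 2 (-T)), (a3, Complex (-T) T), (Complex (-T) T, a1)}" for u v
    using that by (auto simp: rectpath_def Let_def path_image_join a1_def a3_def)
  have b1: "norm (contour_integral (linepath a1 (Complex 2 (-T))) k) \<le> y\<^sup>2 / T\<^sup>2 * (T + 2)"
  proof -
    have "norm (contour_integral (linepath a1 (Complex 2 (-T))) k) \<le>
      y\<^sup>2 / T\<^sup>2 * norm (Complex 2 (-T) - a1)"
    proof (rule norm_contour_integral_linepath_le)
      show "continuous_on (closed_segment a1 (Complex 2 (- T))) k"
        by (rule continuous_on_subset[OF cont seg]) simp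
      fix s assume s: "s \<in> closed_segment a1 (Complex 2 (- T))"
      have s': "Im s = -T" "Re s \<le> 2"
        using s T by (auto simp: a1_def closed_segment_same_Im closed_segment_eq_real_ivl)
      show "norm (k s) \<le> y\<^sup>2 / T\<^sup>2"
        using norm_mult_succ_ge_Im[of s] s' y T powr_mono[of "Re s" 2 y]
        by (intro order_trans[OF le] perron_kernel_le) auto
    qed auto
    also have "Complex 2 (-T) - a1 = of_real (T + 2)" by (simp add: a1_def complex_eq_iff)
    also have "norm (complex_of_real (T + 2)) = T + 2" using T by (simp only: norm_of_real)
    finally show ?thesis .
  qed
  have b3: "norm (contour_integral (linepath a3 (Complex (-T) T)) k) \<le> y\<^sup>2 / T\<^sup>2 * (T + 2)"
  proof -
    have "norm (contour_integral (linepath a3 (Complex (-T) T)) k) \<le>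
      y\<^sup>2 / T\<^sup>2 * norm (Complex (-T) T - a3)"
    proof (rule norm_contour_integral_linepath_le)
      show "continuous_on (closed_segment a3 (Complex (-T) T)) k"
        by (rule continuous_on_subset[OF cont seg]) simp
      fix s assume s: "s \<in> closed_segment a3 (Complex (-T) T)"
      have s': "Im s = T" "Re s \<le> 2"
        using s T by (auto simp: a3_def closed_segment_same_Im closed_segment_eq_real_ivl)
      show "norm (k s) \<le> y\<^sup>2 / T\<^sup>2"
        using norm_mult_succ_ge_Im[of s] s' y T powr_mono[of "Re s" 2 y]
        by (intro order_trans[OF le] perron_kernel_le) auto
    qed auto
    also have "Complex (-T) T - a3 = of_real (- (T + 2))" by (simp add: a3_def complex_eq_iff)
    also have "norm (complex_of_real (- (T + 2))) = T + 2" using T by (simp only: norm_of_real)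
    finally show ?thesis .
  qed
  have b4: "norm (contour_integral (linepath (Complex (-T) T) a1) k) \<le> 2 * T / (T - 1)\<^sup>2"
  proof -
    have "norm (contour_integral (linepath (Complex (-T) T) a1) k) \<le>
      1 / (T - 1)\<^sup>2 * norm (a1 - Complex (-T) T)"
    proof (rule norm_contour_integral_linepath_le)
      show "continuous_on (closed_segment (Complex (-T) T) a1) k"
        by (rule continuous_on_subset[OF cont seg]) simp
      fix s assume s: "s \<in> closed_segment (Complex (-T) T) a1"
      have s': "Re s = -T"
        using s T by (auto simp: a1_def closed_segment_same_Re)
      show "norm (k s) \<le> 1 / (T - 1)\<^sup>2"
        using norm_mult_succ_ge_Re[of "T - 1" s] s' y T powr_mono[of "Re s" 0 y]
        by (intro order_trans[OF le] perron_kernel_le) auto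
    qed auto
    also have "a1 - Complex (-T) T = of_real (- 2 * T) * \<i>" by (simp add: a1_def complex_eq_iff)
    also have "norm (complex_of_real (- 2 * T) * \<i>) = 2 * T" using T by (simp add: norm_mult)
    finally show ?thesis by simp
  qed
  have a2: "Complex (Re a3) (Im a1) = Complex 2 (-T)" "Complex (Re a1) (Im a3) = Complex (-T) T"
    by (simp_all add: a1_def a3_def)
  let ?I = "\<lambda>u v. contour_integral (linepath u v) k"
  define A B C where "A = ?I a1 (Complex 2 (-T))" and "B = ?I a3 (Complex (-T) T)"
    and "C = ?I (Complex (-T) T) a1"
  have "?I (Complex 2 (-T)) a3 - R = - (A + B + C)"
    using contour_integral_rectpath[OF cont] unfolding 1 a2 A_def B_def C_def by (simp add: algebra_simps)
  hence "norm (?I (Complex 2 (-T)) a3 - R) = norm (A + B + C)"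
    by (simp only: norm_minus_cancel)
  moreover have "norm A + norm B + norm C \<le> 2 * (y\<^sup>2 / T\<^sup>2 * (T + 2)) + 2 * T / (T - 1)\<^sup>2"
    using add_mono[OF add_mono[OF b1 b3] b4] unfolding A_def B_def C_def mult_2 .
  ultimately show ?thesis using norm_triangle3[of A B C] unfolding a3_def by linarith
qed

text \<open>
  The residues at \<open>0\<close> and \<open>-1\<close> are \<open>1\<close> and
  \<open>-1/y\<close>.
\<close>

lemma perron_kernel_integral_ge_1:
  assumes y: "y \<ge> 1" and T: "T \<ge> (2::real)"
  shows "norm (contour_integral (linepath (Complex 2 (-T)) (Complex 2 T)) (perron_kernel y) -
     2 * of_real pi * \<i> * of_real (1 - 1 / y)) \<le> 2 * (y\<^sup>2 / T\<^sup>2 * (T + 2)) + 2 * T / (T - 1)\<^sup>2"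
proof -
  define a1 a3 where "a1 = Complex (-T) (-T)" and "a3 = Complex 2 T"
  have box: "0 \<in> box a1 a3" "-1 \<in> box a1 a3"
    using T by (auto simp: a1_def a3_def in_box_complex_iff)
  have pi: "0 \<notin> path_image (rectpath a1 a3)" "-1 \<notin> path_image (rectpath a1 a3)"
    using box T path_image_rectpath_cbox_minus_box[of a1 a3] by (auto simp: a1_def a3_def)
  have hol: "(\<lambda>s. complex_of_real y powr s) holomorphic_on UNIV" by (intro holomorphic_intros)
  have c: "((\<lambda>w. of_real y powr w / (w - z)) has_contour_integral
       (2 * pi * \<i> * winding_number (rectpath a1 a3) z * of_real y powr z)) (rectpath a1 a3)"
    if "z \<notin> path_image (rectpath a1 a3)" for z
    by (rule Cauchy_integral_formula_convex_simple[OF convex_UNIV hol]) (use that in auto)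
  have "((\<lambda>w. of_real y powr w / (w - 0) - of_real y powr w / (w - (-1))) has_contour_integral
      (2 * pi * \<i> * 1 * of_real y powr 0 - 2 * pi * \<i> * 1 * of_real y powr (-1))) (rectpath a1 a3)"
    using has_contour_integral_diff[OF c[OF pi(1)] c[OF pi(2)]]
    unfolding winding_number_rectpath[OF box(1)] winding_number_rectpath[OF box(2)] .
  moreover have "of_real y powr w / (w - 0) - of_real y powr w / (w - (-1)) = perron_kernel y w"
    if "w \<in> path_image (rectpath a1 a3)" for w
  proof -
    have "w \<noteq> 0" "w + 1 \<noteq> 0" using that pi by (auto simp: add_eq_0_iff2)
    thus ?thesis by (simp add: perron_kernel_def divide_simps) (simp add: algebra_simps)
  qed
  ultimately have I: "(perron_kernel y has_contour_integral
     (2 * pi * \<i> * 1 * of_real y powr 0 - 2 * pi * \<i> * 1 * of_real y powr (-1))) (rectpath a1 a3)"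
    by (rule has_contour_integral_eq)
  have cont: "continuous_on (path_image (rectpath a1 a3)) (perron_kernel y)"
    using y pi by (intro holomorphic_on_imp_continuous_on perron_kernel_holomorphic) auto
  have "(2 * pi * \<i> * 1 * of_real y powr 0 - 2 * pi * \<i> * 1 * of_real y powr (-1)) = 2 * of_real pi * \<i> * of_real (1 - 1 / y)"
    using y by (simp add: powr_minus divide_inverse algebra_simps)
  with I cont show ?thesis unfolding a1_def a3_def by (intro rectangle_left_bound[OF y T]) simp_all
qed

text \<open>
  For \<open>y \<le> 1\<close> the contour is closed to the right, where there is no pole.
\<close>

lemma perron_kernel_integral_le_1:
  assumes y: "0 < y" "y \<le> 1" and T: "T \<ge> (3::real)"
  shows "norm (contour_integral (linepath (Complex 2 (-T)) (Complex 2 T)) (perron_kernel y)) \<le> 4 / T"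
proof -
  define a1 a3 where "a1 = Complex 2 (-T)" and "a3 = Complex T T"
  define S where "S = {s :: complex. Re s > 0}"
  have sub: "path_image (rectpath a1 a3) \<subseteq> S"
  proof -
    have "path_image (rectpath a1 a3) \<subseteq> cbox a1 a3"
      using T by (intro path_image_rectpath_subset_cbox) (auto simp: a1_def a3_def)
    also have "\<dots> \<subseteq> S" by (auto simp: S_def a1_def a3_def in_cbox_complex_iff)
    finally show ?thesis .
  qed
  have hol: "perron_kernel y holomorphic_on S"
    using y by (intro perron_kernel_holomorphic) (auto simp: S_def)
  have cont: "continuous_on (path_image (rectpath a1 a3)) (perron_kernel y)"
    by (intro continuous_on_subset[OF holomorphic_on_imp_continuous_on[OF hol] sub])
  have "(perron_kernel y has_contour_integral 0) (rectpath a1 a3)"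
    by (rule Cauchy_theorem_convex_simple[OF hol _ _ sub]) (auto simp: S_def convex_halfspace_Re_gt)
  hence 1: "contour_integral (rectpath a1 a3) (perron_kernel y) = 0" by (rule contour_integral_unique)
  have seg: "closed_segment u v \<subseteq> path_image (rectpath a1 a3)"
    if "(u, v) \<in> {(a1, Complex T (-T)), (Complex T (-T), a3), (a3, Complex 2 T), (Complex 2 T, a1)}" for u v
    using that by (auto simp: rectpath_def Let_def path_image_join a1_def a3_def)
  have powr1: "y powr Re s \<le> 1" if "Re s \<ge> 0" for s
    using powr_mono2[of "Re s" y 1] that y by simp
  have b1: "norm (contour_integral (linepath a1 (Complex T (-T))) (perron_kernel y)) \<le> 1 / T\<^sup>2 * T"
  proof -
    have "norm (contour_integral (linepath a1 (Complex T (-T))) (perron_kernel y)) \<le>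
      1 / T\<^sup>2 * norm (Complex T (-T) - a1)"
    proof (rule norm_contour_integral_linepath_le)
      show "continuous_on (closed_segment a1 (Complex T (- T))) (perron_kernel y)"
        by (rule continuous_on_subset[OF cont seg]) simp
      fix s assume s: "s \<in> closed_segment a1 (Complex T (- T))"
      have s': "Im s = -T" "Re s \<ge> 2"
        using s T by (auto simp: a1_def closed_segment_same_Im closed_segment_eq_real_ivl)
      show "norm (perron_kernel y s) \<le> 1 / T\<^sup>2"
        using norm_mult_succ_ge_Im[of s] s' y T powr1[of s]
        by (intro perron_kernel_le) auto
    qed auto
    also have "Complex T (-T) - a1 = of_real (T - 2)" by (simp add: a1_def complex_eq_iff)
    also have "norm (complex_of_real (T - 2)) = T - 2" using T by (simp only: norm_of_real)
    also have "1 / T\<^sup>2 * (T - 2) \<le> 1 / T\<^sup>2 * T" by (intro mult_left_mono) auto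
    finally show ?thesis .
  qed
  have b3: "norm (contour_integral (linepath a3 (Complex 2 T)) (perron_kernel y)) \<le> 1 / T\<^sup>2 * T"
  proof -
    have "norm (contour_integral (linepath a3 (Complex 2 T)) (perron_kernel y)) \<le>
      1 / T\<^sup>2 * norm (Complex 2 T - a3)"
    proof (rule norm_contour_integral_linepath_le)
      show "continuous_on (closed_segment a3 (Complex 2 T)) (perron_kernel y)"
        by (rule continuous_on_subset[OF cont seg]) simp
      fix s assume s: "s \<in> closed_segment a3 (Complex 2 T)"
      have s': "Im s = T" "Re s \<ge> 2"
        using s T by (auto simp: a3_def closed_segment_same_Im closed_segment_eq_real_ivl)
      show "norm (perron_kernel y s) \<le> 1 / T\<^sup>2"
        using norm_mult_succ_ge_Im[of s] s' y T powr1[of s]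
        by (intro perron_kernel_le) auto
    qed auto
    also have "Complex 2 T - a3 = of_real (2 - T)" by (simp add: a3_def complex_eq_iff)
    also have "norm (complex_of_real (2 - T)) = T - 2" using T by (simp only: norm_of_real)
    also have "1 / T\<^sup>2 * (T - 2) \<le> 1 / T\<^sup>2 * T" by (intro mult_left_mono) auto
    finally show ?thesis .
  qed
  have b2: "norm (contour_integral (linepath (Complex T (-T)) a3) (perron_kernel y)) \<le> 1 / T\<^sup>2 * (2 * T)"
  proof -
    have "norm (contour_integral (linepath (Complex T (-T)) a3) (perron_kernel y)) \<le>
      1 / T\<^sup>2 * norm (a3 - Complex T (-T))"
    proof (rule norm_contour_integral_linepath_le)
      show "continuous_on (closed_segment (Complex T (-T)) a3) (perron_kernel y)"
        by (rule continuous_on_subset[OF cont seg]) simp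
      fix s assume s: "s \<in> closed_segment (Complex T (-T)) a3"
      have s': "Re s = T"
        using s T by (auto simp: a3_def closed_segment_same_Re)
      show "norm (perron_kernel y s) \<le> 1 / T\<^sup>2"
        using norm_mult_succ_ge_Re[of T s] s' y T powr1[of s]
        by (intro perron_kernel_le) auto
    qed auto
    also have "a3 - Complex T (-T) = of_real (2 * T) * \<i>" by (simp add: a3_def complex_eq_iff)
    also have "norm (complex_of_real (2 * T) * \<i>) = 2 * T" using T by (simp add: norm_mult)
    finally show ?thesis by simp
  qed
  have a2: "Complex (Re a3) (Im a1) = Complex T (-T)" "Complex (Re a1) (Im a3) = Complex 2 T"
    by (simp_all add: a1_def a3_def)
  let ?I = "\<lambda>u v. contour_integral (linepath u v) (perron_kernel y)"
  have rev: "?I (Complex 2 T) a1 = - ?I a1 (Complex 2 T)"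
    by (rule contour_integral_reverse_linepath, rule continuous_on_subset[OF cont], rule seg) simp
  define A B C where "A = ?I a1 (Complex T (-T))" and "B = ?I (Complex T (-T)) a3"
    and "C = ?I a3 (Complex 2 T)"
  have "?I a1 (Complex 2 T) = A + B + C"
    using contour_integral_rectpath[OF cont] unfolding 1 a2 rev A_def B_def C_def by (simp add: algebra_simps)
  moreover have "norm A + norm B + norm C \<le> 1 / T\<^sup>2 * T + 1 / T\<^sup>2 * (2 * T) + 1 / T\<^sup>2 * T"
    using b1 b2 b3 unfolding A_def B_def C_def by simp
  moreover have "1 / T\<^sup>2 * T + 1 / T\<^sup>2 * (2 * T) + 1 / T\<^sup>2 * T = 4 / T"
    using T by (simp add: power2_eq_square field_simps)
  ultimately show ?thesis using norm_triangle3[of A B C] unfolding a1_def by simp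
qed

lemma perron_kernel_limit:
  assumes y: "y > 0"
  shows "(\<lambda>n. contour_integral (linepath (Complex 2 (- real n)) (Complex 2 (real n))) (perron_kernel y))
     \<longlonglongrightarrow> 2 * of_real pi * \<i> * of_real (max 0 (1 - 1 / y))"
proof (cases "y \<ge> 1")
  case True
  have "(\<lambda>n. contour_integral (linepath (Complex 2 (- real n)) (Complex 2 (real n))) (perron_kernel y)
     - 2 * of_real pi * \<i> * of_real (1 - 1 / y)) \<longlonglongrightarrow> 0"
  proof (rule Lim_null_comparison)
    show "\<forall>\<^sub>F n in sequentially. norm (contour_integral (linepath (Complex 2 (- real n)) (Complex 2 (real n))) (perron_kernel y)
     - 2 * of_real pi * \<i> * of_real (1 - 1 / y)) \<le> 2 * (y\<^sup>2 / (real n)\<^sup>2 * (real n + 2)) + 2 * real n / (real n - 1)\<^sup>2"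
      using eventually_ge_at_top[of 2] by eventually_elim (rule perron_kernel_integral_ge_1[OF True], simp)
    show "(\<lambda>n. 2 * (y\<^sup>2 / (real n)\<^sup>2 * (real n + 2)) + 2 * real n / (real n - 1)\<^sup>2) \<longlonglongrightarrow> 0"
      by real_asymp
  qed
  hence "(\<lambda>n. contour_integral (linepath (Complex 2 (- real n)) (Complex 2 (real n))) (perron_kernel y))
     \<longlonglongrightarrow> 2 * of_real pi * \<i> * of_real (1 - 1 / y)" by (rule LIM_zero_cancel)
  moreover have "max 0 (1 - 1 / y) = 1 - 1 / y" using True by simp
  ultimately show ?thesis by simp
next
  case False
  have "(\<lambda>n. contour_integral (linepath (Complex 2 (- real n)) (Complex 2 (real n))) (perron_kernel y)) \<longlonglongrightarrow> 0"
  proof (rule Lim_null_comparison)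
    show "\<forall>\<^sub>F n in sequentially. norm (contour_integral (linepath (Complex 2 (- real n)) (Complex 2 (real n))) (perron_kernel y))
     \<le> 4 / real n"
      using eventually_ge_at_top[of 3] by eventually_elim (rule perron_kernel_integral_le_1, use y False in auto)
    show "(\<lambda>n. 4 / real n) \<longlonglongrightarrow> 0" by real_asymp
  qed
  moreover have "max 0 (1 - 1 / y) = 0" using False y by (simp add: field_simps)
  ultimately show ?thesis by simp
qed

text \<open>
  The contribution of a simple pole at 1 of the Dirichlet series.
\<close>

definition pole_kernel :: "real \<Rightarrow> complex \<Rightarrow> complex" where
  "pole_kernel y s = perron_kernel y s / (s - 1)"

text \<open>
  The residues at \<open>1\<close>, \<open>0\<close> and \<open>-1\<close> are \<open>y/2\<close>,
  \<open>-1\<close> and \<open>1/(2y)\<close>.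
\<close>

lemma pole_kernel_integral:
  assumes y: "y \<ge> 1" and T: "T \<ge> (2::real)"
  shows "norm (contour_integral (linepath (Complex 2 (-T)) (Complex 2 T)) (pole_kernel y) -
     2 * of_real pi * \<i> * of_real (y / 2 - 1 + 1 / (2 * y))) \<le> 2 * (y\<^sup>2 / T\<^sup>2 * (T + 2)) + 2 * T / (T - 1)\<^sup>2"
proof -
  define a1 a3 where "a1 = Complex (-T) (-T)" and "a3 = Complex 2 T"
  have box: "0 \<in> box a1 a3" "-1 \<in> box a1 a3" "1 \<in> box a1 a3"
    using T by (auto simp: a1_def a3_def in_box_complex_iff)
  have pi: "0 \<notin> path_image (rectpath a1 a3)" "-1 \<notin> path_image (rectpath a1 a3)" "1 \<notin> path_image (rectpath a1 a3)"
    using box T path_image_rectpath_cbox_minus_box[of a1 a3] by (auto simp: a1_def a3_def)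
  have hol: "(\<lambda>s. complex_of_real y powr s) holomorphic_on UNIV" by (intro holomorphic_intros)
  have c: "((\<lambda>w. of_real y powr w / (w - z)) has_contour_integral
       (2 * pi * \<i> * winding_number (rectpath a1 a3) z * of_real y powr z)) (rectpath a1 a3)"
    if "z \<notin> path_image (rectpath a1 a3)" for z
    by (rule Cauchy_integral_formula_convex_simple[OF convex_UNIV hol]) (use that in auto)
  have "((\<lambda>w. 1 / 2 * (of_real y powr w / (w - 1)) - of_real y powr w / (w - 0) + 1 / 2 * (of_real y powr w / (w - (-1)))) has_contour_integral
      (1 / 2 * (2 * pi * \<i> * 1 * of_real y powr 1) - 2 * pi * \<i> * 1 * of_real y powr 0 + 1 / 2 * (2 * pi * \<i> * 1 * of_real y powr (-1)))) (rectpath a1 a3)"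
    using has_contour_integral_add[OF has_contour_integral_diff[OF
        has_contour_integral_lmul[OF c[OF pi(3)], of "1 / 2"] c[OF pi(1)]] has_contour_integral_lmul[OF c[OF pi(2)], of "1 / 2"]]
    unfolding winding_number_rectpath[OF box(1)] winding_number_rectpath[OF box(2)] winding_number_rectpath[OF box(3)] .
  moreover have "1 / 2 * (of_real y powr w / (w - 1)) - of_real y powr w / (w - 0) + 1 / 2 * (of_real y powr w / (w - (-1))) = pole_kernel y w"
    if "w \<in> path_image (rectpath a1 a3)" for w
  proof -
    have nz: "w \<noteq> 0" "w + 1 \<noteq> 0" "w - 1 \<noteq> 0" using that pi by (auto simp: add_eq_0_iff2)
    have "2 + w * 2 = 2 * (w + 1)" by (simp add: algebra_simps)
    hence "2 + w * 2 \<noteq> 0" using nz(2) by (simp only: mult_eq_0_iff) simp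
    hence "1 / 2 * (p / (w - 1)) - p / w + 1 / 2 * (p / (w + 1)) = p / (w * (w + 1)) / (w - 1)" for p
      using nz by (simp add: divide_simps) (simp add: algebra_simps)
    thus ?thesis by (simp add: pole_kernel_def perron_kernel_def)
  qed
  ultimately have I: "(pole_kernel y has_contour_integral
     (1 / 2 * (2 * pi * \<i> * 1 * of_real y powr 1) - 2 * pi * \<i> * 1 * of_real y powr 0 + 1 / 2 * (2 * pi * \<i> * 1 * of_real y powr (-1)))) (rectpath a1 a3)"
    by (rule has_contour_integral_eq)
  have cont: "continuous_on (path_image (rectpath a1 a3)) (pole_kernel y)"
    unfolding pole_kernel_def[abs_def] using y pi
    by (intro holomorphic_on_imp_continuous_on holomorphic_intros perron_kernel_holomorphic) auto
  have eq: "(1 / 2 * (2 * pi * \<i> * 1 * of_real y powr 1) - 2 * pi * \<i> * 1 * of_real y powr 0 + 1 / 2 * (2 * pi * \<i> * 1 * of_real y powr (-1))) =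
      2 * of_real pi * \<i> * of_real (y / 2 - 1 + 1 / (2 * y))"
  proof -
    define v where "v = 1 / y"
    have p1: "complex_of_real y powr 1 = of_real y" "complex_of_real y powr 0 = 1"
      "complex_of_real y powr (-1) = of_real v"
      using y by (simp_all add: v_def powr_minus divide_inverse)
    have e: "y / 2 - 1 + 1 / (2 * y) = y / 2 - 1 + v / 2" by (simp add: v_def)
    show ?thesis unfolding p1 e by (simp add: algebra_simps)
  qed
  have le: "norm (pole_kernel y s) \<le> norm (perron_kernel y s)" if "Re s = -T \<or> \<bar>Im s\<bar> = T" for s
  proof -
    have "norm (s - 1) \<ge> 1"
      using that abs_Re_le_cmod[of "s - 1"] abs_Im_le_cmod[of "s - 1"] T by auto
    hence "norm (perron_kernel y s) / norm (s - 1) \<le> norm (perron_kernel y s) / 1"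
      by (intro divide_left_mono) auto
    thus ?thesis by (simp add: pole_kernel_def norm_divide)
  qed
  show ?thesis using I cont unfolding eq a1_def a3_def
    by (intro rectangle_left_bound[OF y T _ _ le]) auto
qed

lemma pole_kernel_limit:
  assumes y: "y \<ge> 1"
  shows "(\<lambda>n. contour_integral (linepath (Complex 2 (- real n)) (Complex 2 (real n))) (pole_kernel y))
     \<longlonglongrightarrow> 2 * of_real pi * \<i> * of_real (y / 2 - 1 + 1 / (2 * y))"
proof -
  have "(\<lambda>n. contour_integral (linepath (Complex 2 (- real n)) (Complex 2 (real n))) (pole_kernel y)
     - 2 * of_real pi * \<i> * of_real (y / 2 - 1 + 1 / (2 * y))) \<longlonglongrightarrow> 0"
  proof (rule Lim_null_comparison)
    show "\<forall>\<^sub>F n in sequentially. norm (contour_integral (linepath (Complex 2 (- real n)) (Complex 2 (real n))) (pole_kernel y)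
     - 2 * of_real pi * \<i> * of_real (y / 2 - 1 + 1 / (2 * y))) \<le> 2 * (y\<^sup>2 / (real n)\<^sup>2 * (real n + 2)) + 2 * real n / (real n - 1)\<^sup>2"
      using eventually_ge_at_top[of 2] by eventually_elim (rule pole_kernel_integral[OF y], simp)
    show "(\<lambda>n. 2 * (y\<^sup>2 / (real n)\<^sup>2 * (real n + 2)) + 2 * real n / (real n - 1)\<^sup>2) \<longlonglongrightarrow> 0"
      by real_asymp
  qed
  thus ?thesis by (rule LIM_zero_cancel)
qed

lemma integral_one_plus_abs_powr:
  assumes T: "T \<ge> (0::real)"
  shows "((\<lambda>t. (1 + \<bar>t\<bar>) powr (- 3 / 2)) has_integral (4 - 4 * (1 + T) powr (- 1 / 2))) {-T..T}"
proof -
  have "((\<lambda>t. (1 + \<bar>t\<bar>) powr (- 3 / 2)) has_integral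
      ((- 2 * (1 + T) powr (- 1 / 2)) - (- 2 * (1 + 0) powr (- 1 / 2)))) {0..T}"
  proof (rule fundamental_theorem_of_calculus[OF T])
    fix t assume t: "t \<in> {0..T}"
    have "((\<lambda>t. - 2 * (1 + t) powr (- 1 / 2)) has_real_derivative (- 2 * ((- 1 / 2) * (1 + t) powr (- 1 / 2 - 1)))) (at t within {0..T})"
      using t by (auto intro!: derivative_eq_intros)
    thus "((\<lambda>t. - 2 * (1 + t) powr (- 1 / 2)) has_vector_derivative (1 + \<bar>t\<bar>) powr (- 3 / 2)) (at t within {0..T})"
      using t by (simp add: has_real_derivative_iff_has_vector_derivative)
  qed
  hence 1: "((\<lambda>t. (1 + \<bar>t\<bar>) powr (- 3 / 2)) has_integral (2 - 2 * (1 + T) powr (- 1 / 2))) {0..T}"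
    by simp
  have "((\<lambda>t. (1 + \<bar>-t\<bar>) powr (- 3 / 2)) has_integral (2 - 2 * (1 + T) powr (- 1 / 2))) {-T..-0}"
    by (subst has_integral_reflect_real) (rule 1)
  hence 2: "((\<lambda>t. (1 + \<bar>t\<bar>) powr (- 3 / 2)) has_integral (2 - 2 * (1 + T) powr (- 1 / 2))) {-T..0}"
    by simp
  from has_integral_combine[OF _ _ 2 1] T show ?thesis by simp
qed

text \<open>
  The weight \<open>(1 + |t|)\<^sup>-\<^sup>3\<^sup>/\<^sup>2\<close> has total integral 4.
\<close>

lemma norm_vertical_integral_le:
  assumes T: "T > 0" and M: "M \<ge> 0"
    and cont: "continuous_on (closed_segment (Complex c (-T)) (Complex c T)) f"
    and le: "\<And>t. \<bar>t\<bar> \<le> T \<Longrightarrow> norm (f (Complex c t)) \<le> M * (1 + \<bar>t\<bar>) powr (- 3 / 2)"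
  shows "norm (contour_integral (linepath (Complex c (-T)) (Complex c T)) f) \<le> 4 * M"
proof -
  have "norm (contour_integral (linepath (Complex c (-T)) (Complex c T)) f) =
      norm (integral {-T..T} (\<lambda>x. f (Complex c x)))"
    using T by (subst contour_integral_linepath_same_Re[of _ c _ "-T" T]) (simp_all add: norm_mult)
  also have "\<dots> \<le> integral {-T..T} (\<lambda>t. M * (1 + \<bar>t\<bar>) powr (- 3 / 2))"
  proof (rule integral_norm_bound_integral)
    have "continuous_on {-T..T} (\<lambda>x. f (Complex c x))"
    proof (rule continuous_on_compose2[OF cont])
      show "continuous_on {-T..T} (Complex c)" unfolding Complex_eq by (intro continuous_intros)
      show "Complex c ` {-T..T} \<subseteq> closed_segment (Complex c (-T)) (Complex c T)"
        using T by (auto simp: closed_segment_same_Re closed_segment_eq_real_ivl)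
    qed
    thus "(\<lambda>x. f (Complex c x)) integrable_on {-T..T}" by (rule integrable_continuous_real)
    show "(\<lambda>t. M * (1 + \<bar>t\<bar>) powr (- 3 / 2)) integrable_on {-T..T}"
      using has_integral_mult_right[OF integral_one_plus_abs_powr[of T], of M] T by (auto simp: integrable_on_def)
    show "norm (f (Complex c x)) \<le> M * (1 + \<bar>x\<bar>) powr (- 3 / 2)" if "x \<in> {-T..T}" for x
      using that by (intro le) auto
  qed
  also have "\<dots> = M * (4 - 4 * (1 + T) powr (- 1 / 2))"
    using has_integral_mult_right[OF integral_one_plus_abs_powr[of T], of M] T by (intro integral_unique) auto
  also have "\<dots> \<le> M * 4" using M by (intro mult_left_mono) auto
  finally show ?thesis by simp
qed

lemma norm_mult_succ_ge_line:
  assumes "Re s \<ge> 11 / 20"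
  shows "norm (s * (s + 1)) \<ge> (1 + \<bar>Im s\<bar>)\<^sup>2 / 5"
proof -
  define t where "t = \<bar>Im s\<bar>"
  have sq: "(1 + t)\<^sup>2 \<le> 2 + 2 * t\<^sup>2"
    using sum_squares_bound[of 1 t] by (simp add: power2_eq_square algebra_simps)
  have t2: "t\<^sup>2 \<ge> 0" by simp
  have "(7 / 20 * (1 + t))\<^sup>2 \<le> (norm s)\<^sup>2"
  proof -
    have "(11 / 20)\<^sup>2 \<le> (Re s)\<^sup>2" using assms by (intro power_mono) auto
    hence "121 / 400 \<le> (Re s)\<^sup>2" by (simp add: power_divide)
    moreover have "t\<^sup>2 = (Im s)\<^sup>2" by (simp add: t_def)
    moreover have "(7 / 20 * (1 + t))\<^sup>2 = 49 / 400 * (1 + t)\<^sup>2" by (simp only: power_mult_distrib) (simp add: power_divide)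
    ultimately show ?thesis using sq t2 unfolding cmod_power2 by linarith
  qed
  hence 1: "7 / 20 * (1 + t) \<le> norm s" by (rule power2_le_imp_le) auto
  have "(7 / 10 * (1 + t))\<^sup>2 \<le> (norm (s + 1))\<^sup>2"
  proof -
    have "1 \<le> (Re (s + 1))\<^sup>2" using assms power_mono[of 1 "Re (s + 1)" 2] by simp
    moreover have "t\<^sup>2 = (Im (s + 1))\<^sup>2" by (simp add: t_def)
    moreover have "(7 / 10 * (1 + t))\<^sup>2 = 49 / 100 * (1 + t)\<^sup>2" by (simp only: power_mult_distrib) (simp add: power_divide)
    ultimately show ?thesis using sq t2 unfolding cmod_power2 by linarith
  qed
  hence 2: "7 / 10 * (1 + t) \<le> norm (s + 1)" by (rule power2_le_imp_le) auto
  have "(7 / 20 * (1 + t)) * (7 / 10 * (1 + t)) \<le> norm s * norm (s + 1)"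
    using 1 2 by (intro mult_mono) (auto simp: t_def)
  moreover have "(7 / 20 * (1 + t)) * (7 / 10 * (1 + t)) = 49 / 200 * (1 + t)\<^sup>2"
    by (simp only: power2_eq_square)
  hence "(1 + t)\<^sup>2 / 5 \<le> (7 / 20 * (1 + t)) * (7 / 10 * (1 + t))"
    using zero_le_power2[of "1 + t"] by linarith
  ultimately show ?thesis by (simp add: norm_mult t_def)
qed

lemma perron_kernel_line_le:
  assumes "y > 0" "Re s \<ge> 11 / 20"
  shows "norm (perron_kernel y s) \<le> 5 * y powr Re s * (1 + \<bar>Im s\<bar>) powr (- 2)"
proof -
  have "norm (perron_kernel y s) \<le> y powr Re s / ((1 + \<bar>Im s\<bar>)\<^sup>2 / 5)"
    using assms norm_mult_succ_ge_line[OF assms(2)] by (intro perron_kernel_le) auto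
  also have "\<dots> = 5 * y powr Re s * (1 + \<bar>Im s\<bar>) powr (- 2)"
  proof -
    have "(1 + \<bar>Im s\<bar>) powr (- 2) = 1 / (1 + \<bar>Im s\<bar>)\<^sup>2"
      by (subst powr_minus_divide) (simp add: powr_numeral)
    thus ?thesis by simp
  qed
  finally show ?thesis .
qed

text \<open>
  Perron's formula on \<open>Re s = 2\<close> for partial sums of the Dirichlet series, whose tail
  is uniformly small there. The pole part \<open>\<delta>/(s - 1)\<close> is integrated exactly; for
  the holomorphic part \<open>G\<close> the line is moved to \<open>Re s = 11/20\<close>, where the
  integrand is at most \<open>5 B x\<^sup>3\<^sup>1\<^sup>/\<^sup>2\<^sup>0 (1 +
  |t|)\<^sup>-\<^sup>3\<^sup>/\<^sup>2\<close>.
\<close>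

theorem riesz_mean_bound:
  fixes a :: "nat \<Rightarrow> complex" and G :: "complex \<Rightarrow> complex" and x :: nat
  assumes sm: "summable (\<lambda>n. norm (a n) * real n powr (-2))"
    and Gs: "\<And>s. Re s = 2 \<Longrightarrow> (\<lambda>n. a n * of_nat n powr (-s)) sums (G s + \<delta> / (s - 1))"
    and hol: "G holomorphic_on {s. Re s > 1 / 2}"
    and bd: "\<And>s. 11 / 20 \<le> Re s \<Longrightarrow> Re s \<le> 2 \<Longrightarrow> norm (G s) \<le> B * (1 + \<bar>Im s\<bar>) powr (1 / 2)"
    and x: "x \<ge> 1"
  shows "norm ((\<Sum>n=1..x. a n * of_real (real x - real n)) - \<delta> * of_real ((real x)\<^sup>2 / 2 - real x + 1 / 2))
    \<le> 4 * B * real x powr (31 / 20)"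
proof -
  define X where "X = real x"
  have X: "X \<ge> 1" using x by (simp add: X_def)
  have B: "B \<ge> 0" using order_trans[OF norm_ge_zero bd[of 1]] by simp
  define S where "S = (\<Sum>n=1..x. a n * of_real (X - real n))"
  define L where "L T = linepath (Complex 2 (- real T)) (Complex 2 (real T))" for T :: nat
  \<comment> \<open>The Riesz weight is \<open>x - n = x (1 - n/x)\<close>, hence the factor \<open>x\<close>.\<close>
  define K where "K s = of_real X * perron_kernel X s" for s
  have Khol: "K holomorphic_on {s. Re s > 1 / 2}"
    unfolding K_def using X by (intro holomorphic_intros perron_kernel_holomorphic) auto
  have K_le: "norm (K s) \<le> 5 * X powr (Re s + 1) * (1 + \<bar>Im s\<bar>) powr (- 2)" if "Re s \<ge> 11 / 20" for s
  proof -
    have "norm (K s) = X * norm (perron_kernel X s)" using X by (simp add: K_def norm_mult)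
    also have "\<dots> \<le> X * (5 * X powr Re s * (1 + \<bar>Im s\<bar>) powr (- 2))"
      using X that by (intro mult_left_mono perron_kernel_line_le) auto
    also have "\<dots> = 5 * X powr (Re s + 1) * (1 + \<bar>Im s\<bar>) powr (- 2)"
      using X by (simp add: powr_add mult_ac)
    finally show ?thesis .
  qed
  define P where "P N s = (\<Sum>n=1..N. a n * of_nat n powr (-s))" for N s
  have Phol: "P N holomorphic_on A" for N A
    unfolding P_def by (intro holomorphic_intros) auto
  define Q where "Q s = \<delta> / (s - 1)" for s
  have Qhol: "Q holomorphic_on {s. Re s > 1}" unfolding Q_def by (intro holomorphic_intros) auto
  have hol1: "G holomorphic_on {s. Re s > 1}" by (rule holomorphic_on_subset[OF hol]) auto
  have Khol1: "K holomorphic_on {s. Re s > 1}" by (rule holomorphic_on_subset[OF Khol]) auto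
  have seg2: "closed_segment (Complex 2 (- real T)) (Complex 2 (real T)) \<subseteq> {s. Re s > 1}" for T
    by (auto simp: closed_segment_same_Re)
  have cont2: "continuous_on (closed_segment (Complex 2 (- real T)) (Complex 2 (real T))) f"
    if "f holomorphic_on {s. Re s > 1}" for f T
    by (intro continuous_on_subset[OF holomorphic_on_imp_continuous_on[OF that] seg2])
  have int2: "f contour_integrable_on L T" if "f holomorphic_on {s. Re s > 1}" for f T
    unfolding L_def by (intro contour_integrable_continuous_linepath cont2 that)
  have lim: "(\<lambda>T. contour_integral (L T) (\<lambda>s. P N s * K s)) \<longlonglongrightarrow> 2 * of_real pi * \<i> * S"
    if N: "N \<ge> x" for N
  proof -
    have kh: "perron_kernel (X / real n) holomorphic_on {s. Re s > 1}" if "n \<in> {1..N}" for n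
      using X that by (intro perron_kernel_holomorphic) auto
    have trm: "a n * of_nat n powr (-s) * K s = a n * of_real X * perron_kernel (X / real n) s"
      if "n \<in> {1..N}" for n s
    proof -
      have "complex_of_real X powr s = (of_real (X / real n) * of_real (real n)) powr s"
        using that by simp
      also have "\<dots> = of_real (X / real n) powr s * of_real (real n) powr s"
        using X by (intro powr_times_real) auto
      finally have "of_real (X / real n) powr s = complex_of_real X powr s * of_nat n powr (-s)"
        using that by (simp add: powr_minus field_simps)
      thus ?thesis by (simp add: K_def perron_kernel_def mult_ac)
    qed
    have eq: "contour_integral (L T) (\<lambda>s. P N s * K s) =
       (\<Sum>n=1..N. a n * of_real X * contour_integral (L T) (perron_kernel (X / real n)))" for T
    proof -
      have "(\<lambda>s. P N s * K s) = (\<lambda>s. \<Sum>n=1..N. a n * of_real X * perron_kernel (X / real n) s)"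
        unfolding P_def sum_distrib_right by (intro ext sum.cong refl trm)
      hence "contour_integral (L T) (\<lambda>s. P N s * K s) =
         contour_integral (L T) (\<lambda>s. \<Sum>n=1..N. a n * of_real X * perron_kernel (X / real n) s)"
        by (simp only:)
      also have "\<dots> = (\<Sum>n=1..N. contour_integral (L T) (\<lambda>s. a n * of_real X * perron_kernel (X / real n) s))"
        by (intro contour_integral_sum contour_integrable_lmul int2 kh) auto
      also have "\<dots> = (\<Sum>n=1..N. a n * of_real X * contour_integral (L T) (perron_kernel (X / real n)))"
        by (intro sum.cong refl contour_integral_lmul int2 kh)
      finally show ?thesis .
    qed
    have "(\<lambda>T. \<Sum>n=1..N. a n * of_real X * contour_integral (L T) (perron_kernel (X / real n)))
       \<longlonglongrightarrow> (\<Sum>n=1..N. a n * of_real X * (2 * of_real pi * \<i> * of_real (max 0 (1 - 1 / (X / real n)))))"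
      unfolding L_def using X by (intro tendsto_sum tendsto_mult_left perron_kernel_limit) auto
    also have "(\<Sum>n=1..N. a n * of_real X * (2 * of_real pi * \<i> * of_real (max 0 (1 - 1 / (X / real n))))) =
       (\<Sum>n=1..N. if n \<in> {1..x} then 2 * of_real pi * \<i> * (a n * of_real (X - real n)) else 0)"
    proof (intro sum.cong refl)
      fix n assume n: "n \<in> {1..N}"
      have "X * max 0 (1 - 1 / (X / real n)) = (if n \<in> {1..x} then X - real n else 0)"
        using n X by (auto simp: max_def X_def field_simps)
      hence "complex_of_real (X * max 0 (1 - 1 / (X / real n))) = (if n \<in> {1..x} then of_real (X - real n) else 0)"
        by (simp only: if_distrib[of complex_of_real] of_real_0)
      hence "complex_of_real X * of_real (max 0 (1 - 1 / (X / real n))) = (if n \<in> {1..x} then of_real (X - real n) else 0)"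
        by (simp only: of_real_mult)
      moreover have "a n * of_real X * (2 * of_real pi * \<i> * of_real (max 0 (1 - 1 / (X / real n)))) =
         2 * of_real pi * \<i> * (a n * (of_real X * of_real (max 0 (1 - 1 / (X / real n)))))"
        by (simp only: mult_ac)
      ultimately show "a n * of_real X * (2 * of_real pi * \<i> * of_real (max 0 (1 - 1 / (X / real n)))) =
         (if n \<in> {1..x} then 2 * of_real pi * \<i> * (a n * of_real (X - real n)) else 0)"
        by (cases "n \<in> {1..x}") (simp_all only: if_True if_False mult_zero_right)
    qed
    also have "\<dots> = (\<Sum>n\<in>{1..x}. 2 * of_real pi * \<i> * (a n * of_real (X - real n)))"
      using N by (intro sum.mono_neutral_cong_right) auto
    also have "\<dots> = 2 * of_real pi * \<i> * S" unfolding S_def by (rule sum_distrib_left[symmetric])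
    finally show ?thesis unfolding eq .
  qed
  define tail where "tail N = (\<Sum>n. norm (a (n + Suc N)) * real (n + Suc N) powr (-2))" for N
  \<comment> \<open>On \<open>Re s = 2\<close> the partial sums approximate the full series uniformly.\<close>
  have tail_le: "norm (G s + Q s - P N s) \<le> tail N" if s: "Re s = 2" for s N
  proof -
    have "(\<lambda>n. a (n + Suc N) * of_nat (n + Suc N) powr (-s)) sums
        (G s + \<delta> / (s - 1) - (\<Sum>n<Suc N. a n * of_nat n powr (-s)))"
      by (rule sums_split_initial_segment[OF Gs[OF s]])
    moreover have "(\<Sum>n<Suc N. a n * of_nat n powr (-s)) = P N s"
      unfolding P_def by (intro sum.mono_neutral_cong_right) (auto simp: Suc_le_eq)
    ultimately have sums: "(\<lambda>n. a (n + Suc N) * of_nat (n + Suc N) powr (-s)) sums (G s + Q s - P N s)" by (simp add: Q_def)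
    have nn: "norm (a (n + Suc N) * of_nat (n + Suc N) powr (-s)) = norm (a (n + Suc N)) * real (n + Suc N) powr (-2)" for n
      using norm_of_real_powr[of "real (n + Suc N)" "-s"] s by (simp add: norm_mult)
    have "summable (\<lambda>n. norm (a (n + Suc N)) * real (n + Suc N) powr (-2))"
      using summable_ignore_initial_segment[OF sm, of "Suc N"] .
    hence "norm (\<Sum>n. a (n + Suc N) * of_nat (n + Suc N) powr (-s)) \<le> tail N"
      unfolding tail_def nn[symmetric] by (rule summable_norm)
    thus ?thesis using sums_unique[OF sums] by simp
  qed
  have powr_mono': "(1 + \<bar>t::real\<bar>) powr (-2) \<le> (1 + \<bar>t\<bar>) powr (- 3 / 2)" for t
    by (intro powr_mono) auto
  have diff_bound: "norm (contour_integral (L T) (\<lambda>s. (G s + Q s - P N s) * K s)) \<le> 4 * (tail N * (5 * X powr 3))"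
    if T: "T > 0" for T N
    unfolding L_def
  proof (rule norm_vertical_integral_le)
    have t0: "tail N \<ge> 0" using order_trans[OF norm_ge_zero tail_le[of 2 N]] by simp
    thus "0 \<le> tail N * (5 * X powr 3)" by simp
    show "continuous_on (closed_segment (Complex 2 (- real T)) (Complex 2 (real T))) (\<lambda>s. (G s + Q s - P N s) * K s)"
      by (intro cont2 holomorphic_intros hol1 Phol Khol1 Qhol)
    fix t
    have "norm ((G (Complex 2 t) + Q (Complex 2 t) - P N (Complex 2 t)) * K (Complex 2 t)) \<le>
       tail N * (5 * X powr 3 * (1 + \<bar>t\<bar>) powr (-2))"
      unfolding norm_mult using K_le[of "Complex 2 t"] t0 by (intro mult_mono tail_le) auto
    also have "\<dots> \<le> tail N * (5 * X powr 3 * (1 + \<bar>t\<bar>) powr (- 3 / 2))"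
      using t0 powr_mono' by (intro mult_left_mono) auto
    finally show "norm ((G (Complex 2 t) + Q (Complex 2 t) - P N (Complex 2 t)) * K (Complex 2 t)) \<le>
       tail N * (5 * X powr 3) * (1 + \<bar>t\<bar>) powr (- 3 / 2)" by (simp add: mult.assoc)
  qed (use T in auto)
  define h where "h T = 4 * B * X powr 3 * 5 * ((1 + real T) powr (1 / 2) * (1 + real T) powr (-2))" for T :: nat
  have h0: "h \<longlonglongrightarrow> 0"
    unfolding h_def by (rule tendsto_mult_right_zero) real_asymp
  \<comment> \<open>Cauchy on the rectangle with sides \<open>Re s = 11/20\<close> and \<open>Re s = 2\<close>; \<open>h T\<close> bounds the horizontal sides.\<close>
  have main: "norm (contour_integral (L T) (\<lambda>s. G s * K s)) \<le> 20 * B * X powr (31 / 20) + h T"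
    if T: "T > 0" for T
  proof -
    define f where "f s = G s * K s" for s
    define a1 a3 where "a1 = Complex (11 / 20) (- real T)" and "a3 = Complex 2 (real T)"
    define U where "U = {s :: complex. Re s > 1 / 2}"
    have convU: "convex U" unfolding U_def by (rule convex_halfspace_Re_gt)
    have fhol: "f holomorphic_on U" unfolding f_def U_def by (intro holomorphic_intros hol Khol)
    have sub: "path_image (rectpath a1 a3) \<subseteq> U"
    proof -
      have "path_image (rectpath a1 a3) \<subseteq> cbox a1 a3"
        using T by (intro path_image_rectpath_subset_cbox) (auto simp: a1_def a3_def)
      also have "\<dots> \<subseteq> U" by (auto simp: U_def a1_def a3_def in_cbox_complex_iff)
      finally show ?thesis .
    qed
    have cont: "continuous_on (path_image (rectpath a1 a3)) f"
      by (intro continuous_on_subset[OF holomorphic_on_imp_continuous_on[OF fhol] sub])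
    have "(f has_contour_integral 0) (rectpath a1 a3)"
      by (rule Cauchy_theorem_convex_simple[OF fhol _ _ sub]) (auto simp: convU)
    hence 0: "contour_integral (rectpath a1 a3) f = 0" by (rule contour_integral_unique)
    have seg: "closed_segment u v \<subseteq> path_image (rectpath a1 a3)"
      if "(u, v) \<in> {(a1, Complex 2 (- real T)), (a3, Complex (11 / 20) (real T)), (Complex (11 / 20) (real T), a1)}" for u v
      using that by (auto simp: rectpath_def Let_def path_image_join a1_def a3_def)
    let ?I = "\<lambda>u v. contour_integral (linepath u v) f"
    have hor: "norm (f s) \<le> h T / 4"
      if "11 / 20 \<le> Re s" "Re s \<le> 2" "\<bar>Im s\<bar> = real T" for s
    proof -
      have "norm (f s) \<le> (B * (1 + real T) powr (1 / 2)) * (5 * X powr (Re s + 1) * (1 + real T) powr (- 2))"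
        unfolding f_def norm_mult using bd[of s] K_le[of s] that B by (intro mult_mono) auto
      also have "\<dots> \<le> (B * (1 + real T) powr (1 / 2)) * (5 * X powr 3 * (1 + real T) powr (- 2))"
        using B X that by (intro mult_left_mono mult_right_mono powr_mono) auto
      finally show ?thesis by (simp add: h_def mult_ac)
    qed
    have hT: "h T \<ge> 0" using B by (simp add: h_def)
    have b1: "norm (?I a1 (Complex 2 (- real T))) \<le> h T / 4 * 2"
    proof -
      have "norm (?I a1 (Complex 2 (- real T))) \<le> h T / 4 * norm (Complex 2 (- real T) - a1)"
      proof (rule norm_contour_integral_linepath_le)
        show "continuous_on (closed_segment a1 (Complex 2 (- real T))) f"
          by (rule continuous_on_subset[OF cont seg]) simp
        show "norm (f s) \<le> h T / 4" if "s \<in> closed_segment a1 (Complex 2 (- real T))" for s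
          using that by (intro hor) (auto simp: a1_def closed_segment_same_Im closed_segment_eq_real_ivl)
      qed (use hT in auto)
      also have "Complex 2 (- real T) - a1 = of_real (29 / 20)" by (simp add: a1_def complex_eq_iff)
      also have "h T / 4 * norm (complex_of_real (29 / 20)) \<le> h T / 4 * 2"
        unfolding norm_of_real using hT by (intro mult_left_mono) auto
      finally show ?thesis .
    qed
    have b3: "norm (?I a3 (Complex (11 / 20) (real T))) \<le> h T / 4 * 2"
    proof -
      have "norm (?I a3 (Complex (11 / 20) (real T))) \<le> h T / 4 * norm (Complex (11 / 20) (real T) - a3)"
      proof (rule norm_contour_integral_linepath_le)
        show "continuous_on (closed_segment a3 (Complex (11 / 20) (real T))) f"
          by (rule continuous_on_subset[OF cont seg]) simp
        show "norm (f s) \<le> h T / 4" if "s \<in> closed_segment a3 (Complex (11 / 20) (real T))" for s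
          using that by (intro hor) (auto simp: a3_def closed_segment_same_Im closed_segment_eq_real_ivl)
      qed (use hT in auto)
      also have "Complex (11 / 20) (real T) - a3 = of_real (- 29 / 20)" by (simp add: a3_def complex_eq_iff)
      also have "h T / 4 * norm (complex_of_real (- 29 / 20)) \<le> h T / 4 * 2"
        unfolding norm_of_real using hT by (intro mult_left_mono) auto
      finally show ?thesis .
    qed
    have b4: "norm (?I a1 (Complex (11 / 20) (real T))) \<le> 4 * (B * (5 * X powr (31 / 20)))"
      unfolding a1_def
    proof (rule norm_vertical_integral_le)
      show "continuous_on (closed_segment (Complex (11 / 20) (- real T)) (Complex (11 / 20) (real T))) f"
        unfolding a1_def[symmetric] by (subst closed_segment_commute, rule continuous_on_subset[OF cont seg]) simp
      fix t
      have "norm (f (Complex (11 / 20) t)) \<le>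
         (B * (1 + \<bar>t\<bar>) powr (1 / 2)) * (5 * X powr (31 / 20) * (1 + \<bar>t\<bar>) powr (- 2))"
        unfolding f_def norm_mult using bd[of "Complex (11 / 20) t"] K_le[of "Complex (11 / 20) t"] B
        by (intro mult_mono) auto
      also have "\<dots> = B * (5 * X powr (31 / 20)) * ((1 + \<bar>t\<bar>) powr (1 / 2) * (1 + \<bar>t\<bar>) powr (- 2))"
        by (simp only: mult_ac)
      also have "(1 + \<bar>t\<bar>) powr (1 / 2) * (1 + \<bar>t\<bar>) powr (- 2) = (1 + \<bar>t\<bar>) powr (- 3 / 2)"
        by (simp add: powr_add[symmetric])
      finally show "norm (f (Complex (11 / 20) t)) \<le> B * (5 * X powr (31 / 20)) * (1 + \<bar>t\<bar>) powr (- 3 / 2)" .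
    qed (use T B in auto)
    have rev: "?I (Complex (11 / 20) (real T)) a1 = - ?I a1 (Complex (11 / 20) (real T))"
      by (rule contour_integral_reverse_linepath, rule continuous_on_subset[OF cont], rule seg) simp
    have a2: "Complex (Re a3) (Im a1) = Complex 2 (- real T)" "Complex (Re a1) (Im a3) = Complex (11 / 20) (real T)"
      by (simp_all add: a1_def a3_def)
    define A B' C where "A = ?I a1 (Complex 2 (- real T))" and "B' = ?I a3 (Complex (11 / 20) (real T))"
      and "C = ?I a1 (Complex (11 / 20) (real T))"
    have "?I (Complex 2 (- real T)) a3 = - A + - B' + C"
      using contour_integral_rectpath[OF cont] unfolding 0 a2 rev A_def B'_def C_def by (simp add: algebra_simps)
    hence "norm (?I (Complex 2 (- real T)) a3) \<le> norm A + norm B' + norm C"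
      using norm_triangle3[of "-A" "-B'" C] by simp
    also have "\<dots> \<le> 20 * B * X powr (31 / 20) + h T"
      using b1 b3 b4 unfolding A_def B'_def C_def by simp
    finally show ?thesis by (simp add: f_def[abs_def] a3_def L_def)
  qed
  define R where "R = X\<^sup>2 / 2 - X + 1 / 2"
  have limQ: "(\<lambda>T. contour_integral (L T) (\<lambda>s. Q s * K s)) \<longlonglongrightarrow> 2 * of_real pi * \<i> * (\<delta> * of_real R)"
  proof -
    have ph: "pole_kernel X holomorphic_on {s. Re s > 1}"
      unfolding pole_kernel_def[abs_def] using X by (intro holomorphic_intros perron_kernel_holomorphic) auto
    have "(\<lambda>s. Q s * K s) = (\<lambda>s. \<delta> * of_real X * pole_kernel X s)"
      by (simp add: Q_def K_def pole_kernel_def fun_eq_iff)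
    hence eq: "contour_integral (L T) (\<lambda>s. Q s * K s) = \<delta> * of_real X * contour_integral (L T) (pole_kernel X)" for T
      using contour_integral_lmul[OF int2[OF ph, of T], where c = "\<delta> * of_real X"] by (simp only:)
    have R: "X * (X / 2 - 1 + 1 / (2 * X)) = R"
      using X by (simp add: R_def power2_eq_square algebra_simps)
    have "(\<lambda>T. \<delta> * of_real X * contour_integral (L T) (pole_kernel X)) \<longlonglongrightarrow>
       \<delta> * of_real X * (2 * of_real pi * \<i> * of_real (X / 2 - 1 + 1 / (2 * X)))"
      unfolding L_def by (intro tendsto_mult_left pole_kernel_limit X)
    also have "\<delta> * of_real X * (2 * of_real pi * \<i> * of_real (X / 2 - 1 + 1 / (2 * X))) =
        2 * of_real pi * \<i> * (\<delta> * of_real (X * (X / 2 - 1 + 1 / (2 * X))))"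
      by (simp only: of_real_mult mult_ac)
    finally show ?thesis unfolding eq R .
  qed
  have fin: "norm (2 * of_real pi * \<i> * (S - \<delta> * of_real R)) \<le> 20 * tail N * X powr 3 + 20 * B * X powr (31 / 20)"
    if N: "N \<ge> x" for N
  proof (rule tendsto_le[OF sequentially_bot])
    show "(\<lambda>T. 20 * tail N * X powr 3 + (20 * B * X powr (31 / 20) + h T)) \<longlonglongrightarrow>
       20 * tail N * X powr 3 + 20 * B * X powr (31 / 20)"
      using tendsto_add[OF tendsto_const tendsto_add[OF tendsto_const h0]] by simp
    show "(\<lambda>T. norm (contour_integral (L T) (\<lambda>s. P N s * K s) - contour_integral (L T) (\<lambda>s. Q s * K s)))
       \<longlonglongrightarrow> norm (2 * of_real pi * \<i> * (S - \<delta> * of_real R))"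
      using tendsto_norm[OF tendsto_diff[OF lim[OF N] limQ]] by (simp only: right_diff_distrib)
    show "\<forall>\<^sub>F T in sequentially. norm (contour_integral (L T) (\<lambda>s. P N s * K s) - contour_integral (L T) (\<lambda>s. Q s * K s)) \<le>
       20 * tail N * X powr 3 + (20 * B * X powr (31 / 20) + h T)"
      using eventually_gt_at_top[of 0]
    proof eventually_elim
      fix T :: nat assume T: "T > 0"
      have i: "(\<lambda>s. G s * K s) contour_integrable_on L T" "(\<lambda>s. Q s * K s) contour_integrable_on L T"
         "(\<lambda>s. (G s + Q s - P N s) * K s) contour_integrable_on L T"
        by (intro int2 holomorphic_intros hol1 Phol Khol1 Qhol)+
      have "(\<lambda>s. P N s * K s) = (\<lambda>s. (G s * K s + Q s * K s) - (G s + Q s - P N s) * K s)"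
        by (simp add: algebra_simps)
      hence "contour_integral (L T) (\<lambda>s. P N s * K s) =
          contour_integral (L T) (\<lambda>s. (G s * K s + Q s * K s) - (G s + Q s - P N s) * K s)" by (simp only:)
      also have "\<dots> = contour_integral (L T) (\<lambda>s. G s * K s) + contour_integral (L T) (\<lambda>s. Q s * K s)
           - contour_integral (L T) (\<lambda>s. (G s + Q s - P N s) * K s)"
        using i by (simp add: contour_integral_diff contour_integral_add contour_integrable_add)
      finally have "contour_integral (L T) (\<lambda>s. P N s * K s) - contour_integral (L T) (\<lambda>s. Q s * K s) =
         contour_integral (L T) (\<lambda>s. G s * K s) - contour_integral (L T) (\<lambda>s. (G s + Q s - P N s) * K s)" by simp
      thus "norm (contour_integral (L T) (\<lambda>s. P N s * K s) - contour_integral (L T) (\<lambda>s. Q s * K s)) \<le>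
         20 * tail N * X powr 3 + (20 * B * X powr (31 / 20) + h T)"
        using diff_bound[OF T, of N] main[OF T]
          norm_triangle_ineq4[of "contour_integral (L T) (\<lambda>s. G s * K s)" "contour_integral (L T) (\<lambda>s. (G s + Q s - P N s) * K s)"]
        by simp
    qed
  qed
  have "2 * pi * norm (S - \<delta> * of_real R) \<le> 20 * B * X powr (31 / 20)"
  proof (rule field_le_epsilon)
    fix e :: real assume e: "e > 0"
    have "e / (20 * X powr 3) > 0" using e X by simp
    from suminf_exist_split[OF this sm] obtain N0 where
      N0: "\<And>n. n \<ge> N0 \<Longrightarrow> norm (\<Sum>i. norm (a (i + n)) * real (i + n) powr (-2)) < e / (20 * X powr 3)" by blast
    define N where "N = max N0 x"
    have "tail N < e / (20 * X powr 3)" 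
    proof -
      have "norm (tail N) < e / (20 * X powr 3)" unfolding tail_def by (rule N0) (simp add: N_def)
      thus ?thesis by simp
    qed
    hence "20 * tail N * X powr 3 \<le> e" using X by (simp add: field_simps)
    thus "2 * pi * norm (S - \<delta> * of_real R) \<le> 20 * B * X powr (31 / 20) + e"
      using fin[of N] by (simp add: N_def norm_mult)
  qed
  moreover have "6 * norm (S - \<delta> * of_real R) \<le> 2 * pi * norm (S - \<delta> * of_real R)" using pi_gt3 by (intro mult_right_mono) auto
  moreover have "20 * B * X powr (31 / 20) \<le> 6 * (4 * B * X powr (31 / 20))"
    using B by (simp add: mult_right_mono)
  ultimately show ?thesis unfolding S_def R_def X_def by linarith
qed

section \<open>Primes weighted by characters under GRH\<close>

text \<open>
  Apply the Schwarz lemma to \<open>h / (2 A - h)\<close>, which maps the disc into the unit disc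
  because \<open>Re h < A\<close>.
\<close>

lemma borel_caratheodory:
  assumes hol: "h holomorphic_on ball z R" and R: "R > 0" and h0: "h z = 0"
    and le: "\<And>w. w \<in> ball z R \<Longrightarrow> Re (h w) < A"
    and w: "norm (w - z) \<le> r" "r < R"
  shows "norm (h w) \<le> 2 * A * r / (R - r)"
proof -
  have A: "A > 0" using le[of z] R h0 by simp
  have r0: "r \<ge> 0" using w(1) norm_ge_zero order_trans by blast
  define k where "k \<zeta> = h (z + of_real R * \<zeta>)" for \<zeta>
  have inb: "z + of_real R * \<zeta> \<in> ball z R" if "\<zeta> \<in> ball 0 1" for \<zeta>
    using that R by (simp add: dist_norm norm_mult)
  have khol: "k holomorphic_on ball 0 1"
    unfolding k_def
    by (rule holomorphic_on_compose_gen[OF _ hol, unfolded o_def]) (auto intro!: holomorphic_intros inb)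
  have kle: "Re (k \<zeta>) < A" if "\<zeta> \<in> ball 0 1" for \<zeta> unfolding k_def by (rule le[OF inb[OF that]])
  have knz: "2 * of_real A - k \<zeta> \<noteq> 0" if "\<zeta> \<in> ball 0 1" for \<zeta>
  proof
    assume "2 * of_real A - k \<zeta> = 0"
    hence "Re (k \<zeta>) = 2 * A" by (simp add: complex_eq_iff)
    thus False using kle[OF that] A by simp
  qed
  define g where "g \<zeta> = k \<zeta> / (2 * of_real A - k \<zeta>)" for \<zeta>
  have lt: "norm (k \<zeta>) < norm (2 * of_real A - k \<zeta>)" if "\<zeta> \<in> ball 0 1" for \<zeta>
  proof -
    have "(norm (2 * of_real A - k \<zeta>))\<^sup>2 - (norm (k \<zeta>))\<^sup>2 = 4 * A * (A - Re (k \<zeta>))"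
      unfolding cmod_power2 by (simp add: power2_eq_square algebra_simps)
    also have "\<dots> > 0" using A kle[OF that] by simp
    finally have "(norm (k \<zeta>))\<^sup>2 < (norm (2 * of_real A - k \<zeta>))\<^sup>2" by simp
    thus ?thesis by (rule power_less_imp_less_base) simp
  qed
  have ghol: "g holomorphic_on ball 0 1"
    unfolding g_def using knz by (intro holomorphic_intros khol) auto
  have g0: "g 0 = 0" by (simp add: g_def k_def h0)
  have glt: "norm (g \<zeta>) < 1" if "norm \<zeta> < 1" for \<zeta>
    using lt[of \<zeta>] that unfolding g_def norm_divide by (subst divide_less_eq_1) auto
  define \<zeta> where "\<zeta> = (w - z) / of_real R"
  have n\<zeta>: "norm \<zeta> = norm (w - z) / R" using R by (simp add: \<zeta>_def norm_divide)
  have n\<zeta>1: "norm \<zeta> < 1" using n\<zeta> w R by simp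
  have "norm (g \<zeta>) \<le> norm \<zeta>" by (rule Schwarz_Lemma(1)[OF ghol g0 glt n\<zeta>1])
  also have "\<dots> \<le> r / R" using n\<zeta> w(1) R by (simp add: divide_right_mono)
  finally have gle: "norm (g \<zeta>) \<le> r / R" .
  have kz: "k \<zeta> = h w" using R by (simp add: k_def \<zeta>_def)
  have \<zeta>b: "\<zeta> \<in> ball 0 1" using n\<zeta>1 by simp
  have "k \<zeta> = g \<zeta> * (2 * of_real A - k \<zeta>)" using knz[OF \<zeta>b] by (simp add: g_def)
  hence "norm (h w) = norm (g \<zeta>) * norm (2 * of_real A - h w)" by (simp only: kz norm_mult[symmetric])
  also have "\<dots> \<le> r / R * (2 * A + norm (h w))"
  proof (rule mult_mono[OF gle])
    show "norm (2 * of_real A - h w) \<le> 2 * A + norm (h w)"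
      using norm_triangle_ineq4[of "2 * of_real A" "h w"] A by (simp add: norm_mult)
  qed (use r0 R in auto)
  finally have "R * norm (h w) \<le> r * (2 * A + norm (h w))" using R by (simp add: field_simps)
  hence "(R - r) * norm (h w) \<le> 2 * A * r" by (simp add: algebra_simps)
  thus ?thesis using w(2) by (simp add: field_simps)
qed

text \<open>
  A zero-free function has a holomorphic logarithm, whose real part is at most \<open>log (4
  M)\<close> after normalisation at the centre; Borel--Caratheodory on the radius
  \<open>147/100\<close> and Cauchy's estimate on a disc of radius \<open>1/50\<close> bound its
  derivative. Here \<open>7350 = 50 * 147\<close>. The radii are those needed for the centre
  \<open>2 + i t\<close>: \<open>2 - 149/100 > 1/2\<close> and \<open>2 - 29/20 = 11/20\<close>.
\<close>

lemma log_deriv_bound_disc: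
  assumes hol: "F holomorphic_on ball z (149 / 100)" and nz: "\<And>w. w \<in> ball z (149 / 100) \<Longrightarrow> F w \<noteq> 0"
    and M: "\<And>w. w \<in> ball z (149 / 100) \<Longrightarrow> norm (F w) \<le> M" and lower: "norm (F z) \<ge> 1 / 4"
    and w: "norm (w - z) \<le> 29 / 20"
  shows "norm (deriv F w / F w) \<le> 7350 * (ln (4 * M) + 1)"
proof -
  let ?B = "ball z (149 / 100)"
  have contr: "contractible ?B" by (intro convex_imp_contractible convex_ball)
  obtain h where h: "h holomorphic_on ?B" "\<And>u. u \<in> ?B \<Longrightarrow> F u = exp (h u)"
    using contractible_imp_holomorphic_log[OF hol contr nz] by metis
  define A where "A = ln (4 * M) + 1"
  define h1 where "h1 u = h u - h z" for u
  have zB: "z \<in> ?B" by simp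
  have Reh: "Re (h u) = ln (norm (F u))" if "u \<in> ?B" for u
    using h(2)[OF that] by simp
  have h1hol: "h1 holomorphic_on ?B" unfolding h1_def by (intro holomorphic_intros h)
  have lt: "Re (h1 u) < A" if u: "u \<in> ?B" for u
  proof -
    have F0: "norm (F u) > 0" using nz[OF u] by simp
    have "Re (h1 u) = ln (norm (F u)) - ln (norm (F z))" by (simp add: h1_def Reh[OF u] Reh[OF zB])
    also have "\<dots> \<le> ln M - ln (1 / 4)"
      using M[OF u] F0 lower by (intro diff_mono ln_mono) auto
    also have "\<dots> = ln (4 * M)"
    proof -
      have "M > 0" using M[OF u] F0 by linarith
      thus ?thesis by (simp add: ln_mult ln_div)
    qed
    finally show ?thesis by (simp add: A_def)
  qed
  have bound: "norm (h1 u) \<le> 147 * A" if u: "norm (u - z) \<le> 147 / 100" for u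
    using borel_caratheodory[OF h1hol _ _ lt u] by (simp add: h1_def)
  have ball_sub: "cball w (1 / 50) \<subseteq> ?B"
  proof
    fix u assume "u \<in> cball w (1 / 50)"
    hence "norm (u - w) \<le> 1 / 50" by (simp add: dist_norm norm_minus_commute)
    hence "norm (u - z) \<le> 1 / 50 + 29 / 20" using norm_triangle_ineq[of "u - w" "w - z"] w by simp
    thus "u \<in> ?B" by (simp add: dist_norm norm_minus_commute)
  qed
  have "norm ((deriv ^^ 1) h1 w) \<le> fact 1 * (147 * A) / (1 / 50) ^ 1"
  proof (rule Cauchy_inequality)
    show "h1 holomorphic_on ball w (1 / 50)"
      by (rule holomorphic_on_subset[OF h1hol]) (use ball_sub ball_subset_cball in blast)
    show "continuous_on (cball w (1 / 50)) h1"
      by (intro continuous_on_subset[OF holomorphic_on_imp_continuous_on[OF h1hol] ball_sub])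
    fix u assume "norm (w - u) = 1 / 50"
    hence "norm (u - w) = 1 / 50" by (simp add: norm_minus_commute)
    hence "norm (u - z) \<le> 1 / 50 + 29 / 20" using norm_triangle_ineq[of "u - w" "w - z"] w by simp
    thus "norm (h1 u) \<le> 147 * A" by (intro bound) simp
  qed simp
  hence d1: "norm (deriv h1 w) \<le> 7350 * A" by simp
  have wB: "w \<in> ?B" by (rule subsetD[OF ball_sub]) simp
  have "(h1 has_field_derivative deriv h1 w) (at w)" by (rule holomorphic_derivI[OF h1hol open_ball wB])
  hence "((\<lambda>u. F z * exp (h1 u)) has_field_derivative (F z * (exp (h1 w) * deriv h1 w))) (at w)"
    by (intro DERIV_cmult DERIV_chain2[OF DERIV_exp])
  moreover have ev: "\<forall>\<^sub>F u in nhds w. F z * exp (h1 u) = F u"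
    using eventually_nhds_in_open[OF open_ball wB]
    by eventually_elim (simp add: h1_def h(2)[OF zB] h(2) exp_diff)
  ultimately have "(F has_field_derivative (F z * (exp (h1 w) * deriv h1 w))) (at w)"
    using DERIV_cong_ev[OF refl ev refl] by simp
  hence "deriv F w = F z * exp (h1 w) * deriv h1 w" by (simp add: DERIV_imp_deriv)
  moreover have "F z * exp (h1 w) = F w" by (simp add: h1_def h(2)[OF zB] h(2)[OF wB] exp_diff)
  ultimately have "deriv F w / F w = deriv h1 w" using nz[OF wB] by simp
  thus ?thesis using d1 by (simp add: A_def)
qed

text \<open>
  In the strip this is the hypothesis; to the right of it, the classical nonvanishing results.
\<close>

lemma Lfun_nonzero_GRH:
  assumes GRH: generalised_riemann_hypothesis and chi: "dirichlet_character q chi" and s: "Re s > 1 / 2"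
  shows "Lfun q chi s \<noteq> 0"
proof -
  consider "Re s < 1" | "Re s = 1" | "Re s > 1" by linarith
  thus ?thesis
  proof cases
    case 1
    show ?thesis
    proof
      assume "Lfun q chi s = 0"
      hence "dirichlet_L chi s = 0" using Lfun_dirichlet_L[OF chi, of s] 1 s by simp
      hence "Re s = 1 / 2" using GRH chi 1 s unfolding generalised_riemann_hypothesis_def by auto
      thus False using s by simp
    qed
  next
    case 2
    show ?thesis
    proof (cases "s = 1 \<and> (\<lambda>n. chi n * chi n) = principal_char q \<and> chi \<noteq> principal_char q")
      case True
      thus ?thesis using real_character_nonzero_at_1[OF chi] by blast
    next
      case False
      show ?thesis by (rule Lfun_nonzero_line_1[OF chi 2]) (use False in blast)
    qed
  next
    case 3
    thus ?thesis by (rule Lfun_nonzero_gt_1[OF chi])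
  qed
qed

lemma one_le_ln_plus_2: "q \<ge> 1 \<Longrightarrow> 1 \<le> ln (real q + 2)"
proof -
  assume "q \<ge> 1"
  hence "exp 1 \<le> real q + 2" using exp_le by linarith
  thus ?thesis by (subst ln_ge_iff) auto
qed

text \<open>
  Under the Riemann Hypothesis the disc of radius \<open>149/100\<close> around \<open>2 + i
  t\<close> contains no zero, and the size of \<open>Lfun\<close> there is polynomial in
  \<open>q\<close> and \<open>t\<close>. The logarithm in \<open>t\<close> is weakened to a square
  root, which the Perron kernel can afford.
\<close>

lemma log_deriv_bound_GRH:
  assumes GRH: generalised_riemann_hypothesis
  obtains K where "K > 0" "\<And>q chi s. dirichlet_character q chi \<Longrightarrow> 11 / 20 \<le> Re s \<Longrightarrow> Re s \<le> 2 \<Longrightarrow>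
     norm (deriv (Lfun q chi) s / Lfun q chi s) \<le> K * ln (real q + 2) * (1 + \<bar>Im s\<bar>) powr (1 / 2)"
proof -
  define c1 where "c1 = ln (16 * zeta_three_halves)"
  have z1: "zeta_three_halves \<ge> 1" by (rule zeta_three_halves_ge_1)
  have c1: "c1 \<ge> 0" unfolding c1_def using z1 by (intro ln_ge_zero) simp
  define K where "K = 7350 * (c1 + 16)"
  have "norm (deriv (Lfun q chi) s / Lfun q chi s) \<le> K * ln (real q + 2) * (1 + \<bar>Im s\<bar>) powr (1 / 2)"
    if chi: "dirichlet_character q chi" and s: "11 / 20 \<le> Re s" "Re s \<le> 2" for q chi s
  proof -
    have q: "q \<ge> 1" using chi by (simp add: dirichlet_character_def)
    define t where "t = \<bar>Im s\<bar>"
    define z where "z = Complex 2 (Im s)"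
    define M where "M = 4 * zeta_three_halves * real q * (t + 5)\<^sup>2"
    have Re_pos: "Re u > 1 / 2" if "u \<in> ball z (149 / 100)" for u
    proof -
      have "norm (z - u) < 149 / 100" using that by (simp add: dist_norm)
      thus ?thesis using abs_Re_le_cmod[of "z - u"] by (simp add: z_def)
    qed
    have nz: "norm z \<le> 2 + t"
      using cmod_le[of z] by (simp add: z_def t_def)
    have "norm (deriv (Lfun q chi) s / Lfun q chi s) \<le> 7350 * (ln (4 * M) + 1)"
    proof (rule log_deriv_bound_disc)
      show "Lfun q chi holomorphic_on ball z (149 / 100)"
        by (rule holomorphic_on_subset[OF Lfun_holomorphic[OF chi]]) (use Re_pos in fastforce)
      show "Lfun q chi u \<noteq> 0" if "u \<in> ball z (149 / 100)" for u
        by (rule Lfun_nonzero_GRH[OF GRH chi Re_pos[OF that]])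
      show "norm (Lfun q chi u) \<le> M" if u: "u \<in> ball z (149 / 100)" for u
      proof -
        have "norm (u - z) < 149 / 100" using u by (simp add: dist_norm norm_minus_commute)
        hence "norm u \<le> 2 + t + 149 / 100" using norm_triangle_ineq2[of u z] nz by simp
        hence u1: "norm u + 1 \<le> t + 5" by simp
        have "norm (Lfun q chi u) \<le> 4 * zeta_three_halves * real q * (norm u + 1)\<^sup>2"
          using Re_pos[OF u] by (intro Lfun_bound[OF chi]) simp
        also have "\<dots> \<le> M" unfolding M_def using u1 z1 by (intro mult_left_mono power_mono) auto
        finally show ?thesis .
      qed
      show "1 / 4 \<le> norm (Lfun q chi z)"
      proof -
        have R: "Re z > 1" "Re z \<ge> 2" by (simp_all add: z_def)
        have "1 \<le> norm (z - 1)" using abs_Re_le_cmod[of "z - 1"] by (simp add: z_def)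
        hence "1 \<le> norm (z - 1) ^ pole_order q chi" by (rule one_le_power)
        hence "1 / 4 * 1 \<le> norm (Lser chi z) * norm (z - 1) ^ pole_order q chi"
          using norm_Lser_ge[OF chi R(2)] by (intro mult_mono) auto
        thus ?thesis unfolding Lfun_eq_Lser[OF chi R(1)] by (simp add: norm_mult norm_power)
      qed
      have "s - z = of_real (Re s - 2)" by (simp add: z_def complex_eq_iff)
      hence "norm (s - z) = \<bar>Re s - 2\<bar>" by (metis norm_of_real real_norm_def)
      thus "norm (s - z) \<le> 29 / 20" using s by simp
    qed
    also have "ln (4 * M) + 1 \<le> (c1 + 16) * (ln (real q + 2) * (1 + t) powr (1 / 2))"
    proof -
      define L W where "L = ln (real q + 2)" and "W = (1 + t) powr (1 / 2)"
      have t0: "t \<ge> 0" by (simp add: t_def)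
      have L1: "L \<ge> 1" unfolding L_def by (rule one_le_ln_plus_2[OF q])
      have W1: "W \<ge> 1" unfolding W_def using t0 by (simp add: ge_one_powr_ge_zero)
      have LW: "L \<le> L * W" "W \<le> L * W" "1 \<le> L * W"
      proof -
        show 1: "L \<le> L * W" "W \<le> L * W"
          using mult_left_mono[OF W1, of L] mult_right_mono[OF L1, of W] L1 W1 by simp_all
        show "1 \<le> L * W" using 1 L1 by linarith
      qed
      have "ln (4 * M) = ln (16 * zeta_three_halves * real q * (t + 5)\<^sup>2)" by (simp add: M_def mult_ac)
      also have "\<dots> = c1 + ln (real q) + 2 * ln (t + 5)"
        unfolding c1_def using z1 q t0 by (simp add: ln_mult ln_realpow)
      finally have e: "ln (4 * M) = c1 + ln (real q) + 2 * ln (t + 5)" .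
      have lq: "ln (real q) \<le> L" unfolding L_def using q by simp
      have "ln (t + 5) \<le> ln (5 * (1 + t))" using t0 by (subst ln_le_cancel_iff) auto
      also have "\<dots> = ln 5 + ln (1 + t)" using t0 by (subst ln_mult) auto
      also have "ln 5 \<le> (5 :: real) - 1" by (rule ln_le_minus_one) simp
      also have "ln (1 + t) \<le> (1 + t) powr (1 / 2) / (1 / 2)" using t0 by (intro ln_powr_bound) auto
      finally have l5: "ln (t + 5) \<le> 4 + 2 * W" by (simp add: W_def)
      have "c1 * 1 \<le> c1 * (L * W)" using c1 LW(3) by (intro mult_left_mono)
      hence "ln (4 * M) + 1 \<le> c1 * (L * W) + 16 * (L * W)" using e lq l5 LW by linarith
      thus ?thesis by (simp add: L_def W_def algebra_simps)
    qed
    finally show ?thesis unfolding K_def t_def by (simp only: mult.assoc)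
  qed
  moreover have "K > 0" using c1 by (simp add: K_def)
  ultimately show ?thesis using that by blast
qed

text \<open>
  A predicate for the estimate with a given constant, uniform in modulus, character and length, so
  that the constant can be obtained once.
\<close>

definition mangoldt_sum_bound :: "real \<Rightarrow> bool" where
  "mangoldt_sum_bound K \<longleftrightarrow> (\<forall>q chi x. dirichlet_character q chi \<longrightarrow> x \<ge> 1 \<longrightarrow>
     norm ((\<Sum>n=1..x. mangoldt n * chi (int n) * of_real (real x - real n)) -
        of_nat (pole_order q chi) * of_real ((real x)\<^sup>2 / 2 - real x + 1 / 2)) \<le> K * ln (real q + 2) * real x powr (31 / 20))"

definition prime_sum_bound :: "real \<Rightarrow> bool" where
  "prime_sum_bound K \<longleftrightarrow> (\<forall>q chi x. dirichlet_character q chi \<longrightarrow> x \<ge> 1 \<longrightarrow>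
     norm ((\<Sum>p | prime p \<and> p \<le> x. of_real (ln (real p) * (real x - real p)) * chi (int p)) -
        of_nat (pole_order q chi) * of_real ((real x)\<^sup>2 / 2)) \<le> K * ln (real q + 2) * real x powr (31 / 20))"

text \<open>
  The Riesz mean bound for \<open>a(n) = \<Lambda>(n) \<chi>(n)\<close>, whose Dirichlet series is
  \<open>- Lfun' / Lfun + d / (s - 1)\<close>.
\<close>

theorem mangoldt_character_sum_GRH:
  assumes GRH: generalised_riemann_hypothesis
  shows "\<exists>K>0. mangoldt_sum_bound K"
proof -
  obtain K where K: "K > 0" "\<And>q chi s. dirichlet_character q chi \<Longrightarrow> 11 / 20 \<le> Re s \<Longrightarrow> Re s \<le> 2 \<Longrightarrow>
     norm (deriv (Lfun q chi) s / Lfun q chi s) \<le> K * ln (real q + 2) * (1 + \<bar>Im s\<bar>) powr (1 / 2)"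
    using log_deriv_bound_GRH[OF GRH] by metis
  have "norm ((\<Sum>n=1..x. mangoldt n * chi (int n) * of_real (real x - real n)) -
        of_nat (pole_order q chi) * of_real ((real x)\<^sup>2 / 2 - real x + 1 / 2)) \<le> (4 * K) * ln (real q + 2) * real x powr (31 / 20)"
    if chi: "dirichlet_character q chi" and x: "x \<ge> 1" for q chi x
  proof -
    define G where "G s = - deriv (Lfun q chi) s / Lfun q chi s" for s
    have "norm ((\<Sum>n=1..x. (mangoldt n * chi (int n)) * of_real (real x - real n)) -
        of_nat (pole_order q chi) * of_real ((real x)\<^sup>2 / 2 - real x + 1 / 2)) \<le> 4 * (K * ln (real q + 2)) * real x powr (31 / 20)"
    proof (rule riesz_mean_bound[where G = G])
      show "summable (\<lambda>n. norm (mangoldt n * chi (int n)) * real n powr (-2))"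
        by (rule summable_mangoldt_char[OF chi]) simp
      show "(\<lambda>n. mangoldt n * chi (int n) * of_nat n powr (-s)) sums (G s + of_nat (pole_order q chi) / (s - 1))"
        if "Re s = 2" for s
        using Dser_sums[OF chi, of s] Dser_eq_Lfun[OF chi, of s] that by (simp add: G_def)
      show "G holomorphic_on {s. Re s > 1 / 2}"
        unfolding G_def using Lfun_nonzero_GRH[OF GRH chi]
        by (intro holomorphic_intros holomorphic_deriv open_Re_gt holomorphic_on_subset[OF Lfun_holomorphic[OF chi]]) auto
      show "norm (G s) \<le> K * ln (real q + 2) * (1 + \<bar>Im s\<bar>) powr (1 / 2)"
        if "11 / 20 \<le> Re s" "Re s \<le> 2" for s
        using K(2)[OF chi that] by (simp add: G_def)
    qed (rule x)
    thus ?thesis by (simp add: mult.assoc)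
  qed
  hence "mangoldt_sum_bound (4 * K)" unfolding mangoldt_sum_bound_def by blast
  moreover have "4 * K > 0" using K by simp
  ultimately show ?thesis by blast
qed

lemma ln_square_le:
  fixes x :: real
  assumes x: "x \<ge> 1"
  shows "(ln x)\<^sup>2 \<le> 1600 * x powr (1 / 20)"
proof -
  have "ln x \<le> x powr (1 / 40) / (1 / 40)" by (rule ln_powr_bound[OF x]) simp
  hence "(ln x)\<^sup>2 \<le> (40 * x powr (1 / 40))\<^sup>2" using x by (intro power_mono) auto
  also have "\<dots> = 1600 * (x powr (1 / 40) * x powr (1 / 40))" by (simp add: power2_eq_square)
  also have "x powr (1 / 40) * x powr (1 / 40) = x powr (1 / 20)" by (simp add: powr_add[symmetric])
  finally show ?thesis .
qed

text \<open>
  Proper prime powers up to \<open>x\<close> have base at most \<open>\<surd>x\<close> and exponent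
  at most \<open>log\<^sub>2 x\<close>.
\<close>

lemma sum_mangoldt_nonprime_le:
  assumes x: "x \<ge> (1::nat)"
  shows "(\<Sum>n | n \<in> {1..x} \<and> \<not> prime n. mangoldt n) \<le> 3200 * real x powr (11 / 20)"
proof -
  define S where "S = {n \<in> {1..x}. \<not> prime n \<and> primepow n}"
  define a where "a = nat \<lfloor>sqrt (real x)\<rfloor>"
  define b where "b = nat \<lfloor>log 2 (real x)\<rfloor>"
  have lx: "log 2 (real x) \<ge> 0" using x by simp
  have "S \<subseteq> (\<lambda>(p, k). p ^ k) ` ({1..a} \<times> {1..b})"
  proof
    fix n assume n: "n \<in> S"
    then obtain p k where pk: "prime p" "k > 0" "n = p ^ k" by (auto simp: S_def primepow_def)
    have nx: "n \<le> x" "\<not> prime n" using n by (auto simp: S_def)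
    have "k \<noteq> 1" using pk nx(2) by auto
    hence k2: "k \<ge> 2" using pk(2) by linarith
    have p2: "p \<ge> 2" using pk(1) prime_ge_2_nat by blast
    have "p ^ 2 \<le> p ^ k" using k2 p2 by (intro power_increasing) auto
    hence "p\<^sup>2 \<le> x" using nx(1) pk(3) by simp
    hence "(real p)\<^sup>2 \<le> real x" by (metis of_nat_le_iff of_nat_power)
    hence "real p \<le> sqrt (real x)" by (rule real_le_rsqrt)
    hence pa: "p \<le> a" unfolding a_def by (simp add: le_nat_floor)
    have "2 ^ k \<le> p ^ k" using p2 by (intro power_mono) auto
    hence "(2::real) ^ k \<le> real x" using nx(1) pk(3) by (metis of_nat_le_iff of_nat_numeral of_nat_power order_trans)
    hence "real k \<le> log 2 (real x)" using x by (simp add: le_log_iff powr_realpow)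
    hence "k \<le> b" unfolding b_def by (simp add: le_nat_floor)
    thus "n \<in> (\<lambda>(p, k). p ^ k) ` ({1..a} \<times> {1..b})" using pa pk(2,3) p2 by (intro image_eqI[of _ _ "(p, k)"]) auto
  qed
  hence "card S \<le> card ((\<lambda>(p, k). p ^ k) ` ({1..a} \<times> {1..b}))" by (intro card_mono) auto
  also have "\<dots> \<le> card ({1..a} \<times> {1..b})" by (rule card_image_le) auto
  finally have "card S \<le> a * b" by simp
  hence "real (card S) \<le> real a * real b" by (metis of_nat_le_iff of_nat_mult)
  also have "\<dots> \<le> sqrt (real x) * log 2 (real x)"
    unfolding a_def b_def using lx by (intro mult_mono) auto
  finally have cS: "real (card S) \<le> sqrt (real x) * log 2 (real x)" .
  have "(\<Sum>n | n \<in> {1..x} \<and> \<not> prime n. mangoldt n :: real) = (\<Sum>n\<in>S. mangoldt n)"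
    unfolding S_def by (intro sum.mono_neutral_right) (auto simp: mangoldt_def)
  also have "\<dots> \<le> (\<Sum>n\<in>S. ln (real x))"
  proof (rule sum_mono)
    fix n assume "n \<in> S"
    hence n: "n \<ge> 1" "n \<le> x" by (auto simp: S_def)
    have "mangoldt n \<le> ln (real n)" using mangoldt_le[of n] n by simp
    also have "\<dots> \<le> ln (real x)" using n by simp
    finally show "mangoldt n \<le> ln (real x)" .
  qed
  also have "\<dots> = real (card S) * ln (real x)" by simp
  also have "\<dots> \<le> sqrt (real x) * log 2 (real x) * ln (real x)" using cS x by (intro mult_right_mono) auto
  also have "\<dots> = sqrt (real x) * ((ln (real x))\<^sup>2 / ln 2)" by (simp add: log_def power2_eq_square)
  also have "\<dots> \<le> sqrt (real x) * (1600 * real x powr (1 / 20) / (1 / 2))"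
  proof (intro mult_left_mono frac_le ln_square_le)
    show "1 / 2 \<le> ln (2 :: real)" using ln_le_minus_one[of "1 / 2 :: real"] by (simp add: ln_div)
  qed (use x in auto)
  also have "\<dots> = 3200 * (real x powr (1 / 2) * real x powr (1 / 20))" by (simp add: powr_half_sqrt)
  also have "real x powr (1 / 2) * real x powr (1 / 20) = real x powr (11 / 20)" by (simp add: powr_add[symmetric])
  finally show ?thesis .
qed

text \<open>
  Proper prime powers and the lower-order part of the main term are absorbed in the error.
\<close>

theorem prime_character_sum_GRH:
  assumes GRH: generalised_riemann_hypothesis
  shows "\<exists>K>0. prime_sum_bound K"
proof -
  obtain K where K0: "K > 0" "mangoldt_sum_bound K"
    using mangoldt_character_sum_GRH[OF GRH] by blast
  have K: "norm ((\<Sum>n=1..x. mangoldt n * chi (int n) * of_real (real x - real n)) -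
        of_nat (pole_order q chi) * of_real ((real x)\<^sup>2 / 2 - real x + 1 / 2)) \<le> K * ln (real q + 2) * real x powr (31 / 20)"
    if "dirichlet_character q chi" "x \<ge> 1" for q chi x
    using K0(2) that unfolding mangoldt_sum_bound_def by blast
  have "norm ((\<Sum>p | prime p \<and> p \<le> x. of_real (ln (real p) * (real x - real p)) * chi (int p)) -
        of_nat (pole_order q chi) * of_real ((real x)\<^sup>2 / 2)) \<le> (K + 3201) * ln (real q + 2) * real x powr (31 / 20)"
    if chi: "dirichlet_character q chi" and x: "x \<ge> 1" for q chi x
  proof -
    have q: "q \<ge> 1" using chi by (simp add: dirichlet_character_def)
    define L where "L = ln (real q + 2)"
    define X where "X = real x powr (31 / 20)"
    define d where "d = (of_nat (pole_order q chi) :: complex)"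
    define f where "f n = mangoldt n * chi (int n) * of_real (real x - real n)" for n
    define A where "A = (\<Sum>p | prime p \<and> p \<le> x. of_real (ln (real p) * (real x - real p)) * chi (int p))"
    define B where "B = (\<Sum>n | n \<in> {1..x} \<and> \<not> prime n. f n)"
    have L1: "L \<ge> 1" unfolding L_def by (rule one_le_ln_plus_2[OF q])
    have x1: "real x \<ge> 1" using x by simp
    have xX: "real x \<le> X" unfolding X_def using powr_mono[of 1 "31 / 20" "real x"] x1 by simp
    have split: "(\<Sum>n=1..x. f n) = A + B"
    proof -
      have "(\<Sum>n=1..x. f n) = (\<Sum>n | n \<in> {1..x} \<and> prime n. f n) + B"
        unfolding B_def by (subst sum.union_disjoint[symmetric]) (auto intro!: sum.cong)
      also have "{n. n \<in> {1..x} \<and> prime n} = {p. prime p \<and> p \<le> x}"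
        using prime_ge_1_nat by auto
      also have "(\<Sum>n | prime n \<and> n \<le> x. f n) = A"
        unfolding A_def f_def by (intro sum.cong refl) (auto simp: mult_ac)
      finally show ?thesis .
    qed
    have "norm B \<le> (\<Sum>n | n \<in> {1..x} \<and> \<not> prime n. mangoldt n * real x)"
      unfolding B_def
    proof (rule sum_norm_le)
      fix n assume "n \<in> {n. n \<in> {1..x} \<and> \<not> prime n}"
      hence n: "n \<ge> 1" "n \<le> x" by auto
      have "norm (f n) = mangoldt n * norm (chi (int n)) * \<bar>real x - real n\<bar>"
        by (simp add: f_def norm_mult flip: of_real_diff)
      also have "\<dots> \<le> mangoldt n * 1 * real x"
        using n by (intro mult_mono norm_char_le[OF chi]) (auto simp: mangoldt_nonneg)
      finally show "norm (f n) \<le> mangoldt n * real x" by simp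
    qed
    also have "\<dots> = (\<Sum>n | n \<in> {1..x} \<and> \<not> prime n. mangoldt n) * real x" by (simp add: sum_distrib_right)
    also have "\<dots> \<le> 3200 * real x powr (11 / 20) * real x"
      using sum_mangoldt_nonprime_le[OF x] by (intro mult_right_mono) auto
    also have "\<dots> = 3200 * X"
      unfolding X_def using x1 powr_add[of "real x" "11 / 20" 1] by simp
    finally have B: "norm B \<le> 3200 * X" .
    have dn: "norm d \<le> 1" by (simp add: d_def pole_order_def)
    have "norm (d * of_real (real x - 1 / 2)) \<le> 1 * real x"
      unfolding norm_mult norm_of_real using dn x1 by (intro mult_mono) auto
    hence C: "norm (d * of_real (real x - 1 / 2)) \<le> X" using xX by simp
    have eq: "A - d * of_real ((real x)\<^sup>2 / 2) =
      ((\<Sum>n=1..x. f n) - d * of_real ((real x)\<^sup>2 / 2 - real x + 1 / 2)) + (- B) + (- (d * of_real (real x - 1 / 2)))"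
      unfolding split by (simp add: algebra_simps)
    have "norm ((\<Sum>n=1..x. f n) - d * of_real ((real x)\<^sup>2 / 2 - real x + 1 / 2)) \<le> K * L * X"
      using K[OF chi x] by (simp only: f_def d_def L_def X_def)
    hence "norm (A - d * of_real ((real x)\<^sup>2 / 2)) \<le> K * L * X + 3200 * X + X"
      unfolding eq using norm_triangle3[of "(\<Sum>n=1..x. f n) - d * of_real ((real x)\<^sup>2 / 2 - real x + 1 / 2)" "-B" "- (d * of_real (real x - 1 / 2))"] B C
      by simp
    also have "\<dots> \<le> (K + 3201) * L * X"
    proof -
      have "1 * X \<le> L * X" using L1 by (intro mult_right_mono) (auto simp: X_def)
      thus ?thesis by (simp add: algebra_simps)
    qed
    finally show ?thesis by (simp only: A_def d_def L_def X_def)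
  qed
  hence "prime_sum_bound (K + 3201)" unfolding prime_sum_bound_def by blast
  moreover have "K + 3201 > 0" using K0 by simp
  ultimately show ?thesis by blast
qed

section \<open>Exponential sums\<close>

definition ee :: "real \<Rightarrow> complex" where "ee x = cis (2 * pi * x)"

lemma ee_add: "ee (x + y) = ee x * ee y"
  by (simp add: ee_def cis_mult distrib_left)

lemma ee_0 [simp]: "ee 0 = 1" by (simp add: ee_def)

lemma norm_ee [simp]: "norm (ee x) = 1" by (simp add: ee_def)

lemma ee_minus: "ee (- x) = cnj (ee x)" by (simp add: ee_def cis_cnj)

lemma ee_of_int [simp]: "ee (of_int n) = 1"
  by (simp add: ee_def cis_multiple_2pi)

lemma ee_cong:
  assumes "q \<ge> (1::nat)" "[x = y] (mod int q)"
  shows "ee (of_int x / real q) = ee (of_int y / real q)"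
proof -
  obtain c where "y = x + int q * c" using assms(2) by (metis cong_iff_lin)
  hence "of_int y / real q = of_int x / real q + of_int c" using assms(1) by (simp add: field_simps)
  thus ?thesis by (simp add: ee_add)
qed

lemma ee_eq_1_imp_dvd:
  assumes "q \<ge> (1::nat)" "ee (of_int a / real q) = 1"
  shows "int q dvd a"
proof -
  have "cos (2 * pi * (of_int a / real q)) = 1"
    using arg_cong[OF assms(2), of Re] by (simp add: ee_def)
  then obtain n :: int where "2 * pi * (of_int a / real q) = of_int n * 2 * pi"
    using cos_one_2pi_int by auto
  hence "2 * pi * (of_int a / real q - of_int n) = 0" by (simp add: algebra_simps)
  hence "of_int a / real q = of_int n" by (simp only: mult_eq_0_iff) simp
  hence "real_of_int a = real_of_int (n * int q)" using assms(1) by (simp add: field_simps)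
  hence "a = n * int q" by (simp only: of_int_eq_iff)
  thus ?thesis by simp
qed

lemma norm_ee_minus_1_le: "norm (ee x - 1) \<le> 8 * \<bar>x\<bar>"
proof -
  have "ee x - 1 = ee (x / 2) * (ee (x / 2) - cnj (ee (x / 2)))"
    using ee_add[of "x / 2" "x / 2"] complex_norm_square[of "ee (x / 2)"] by (simp add: right_diff_distrib)
  hence "norm (ee x - 1) = norm (ee (x / 2) - cnj (ee (x / 2)))" by (simp only: norm_mult norm_ee mult_1)
  also have "ee (x / 2) - cnj (ee (x / 2)) = 2 * \<i> * of_real (sin (pi * x))"
    by (simp add: ee_def complex_eq_iff)
  also have "norm \<dots> = 2 * \<bar>sin (pi * x)\<bar>" by (simp add: norm_mult)
  also have "\<dots> \<le> 2 * \<bar>pi * x\<bar>" using abs_sin_x_le_abs_x[of "pi * x"] by simp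
  also have "\<dots> = 2 * (pi * \<bar>x\<bar>)" by (simp add: abs_mult)
  also have "pi * \<bar>x\<bar> \<le> 4 * \<bar>x\<bar>" using pi_less_4 by (intro mult_right_mono) auto
  finally show ?thesis by simp
qed

lemma sum_period_shift:
  fixes f :: "int \<Rightarrow> complex"
  assumes q: "q \<ge> (1::nat)" and f: "\<And>x y. [x = y] (mod int q) \<Longrightarrow> f x = f y"
  shows "(\<Sum>u\<in>{0..<int q}. f (u + r)) = (\<Sum>u\<in>{0..<int q}. f u)"
proof -
  have inj: "inj_on (\<lambda>u. (u + r) mod int q) {0..<int q}"
  proof (rule inj_onI)
    fix x y assume *: "x \<in> {0..<int q}" "y \<in> {0..<int q}" "(x + r) mod int q = (y + r) mod int q"
    hence "[x + r = y + r] (mod int q)" by (simp add: cong_def)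
    hence "[x = y] (mod int q)" by (simp add: cong_add_rcancel)
    thus "x = y" using * by (auto simp: cong_def)
  qed
  have "(\<lambda>u. (u + r) mod int q) ` {0..<int q} \<subseteq> {0..<int q}" using q by auto
  hence im: "(\<lambda>u. (u + r) mod int q) ` {0..<int q} = {0..<int q}"
    by (intro endo_inj_surj inj) auto
  have "(\<Sum>u\<in>{0..<int q}. f u) = (\<Sum>u\<in>(\<lambda>u. (u + r) mod int q) ` {0..<int q}. f u)" by (simp only: im)
  also have "\<dots> = (\<Sum>u\<in>{0..<int q}. f ((u + r) mod int q))" by (rule sum.reindex_cong[OF inj refl refl])
  also have "\<dots> = (\<Sum>u\<in>{0..<int q}. f (u + r))" by (intro sum.cong refl f) (simp add: cong_def)
  finally show ?thesis ..
qed

lemma sum_ee_period: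
  assumes q: "q \<ge> (1::nat)"
  shows "(\<Sum>v\<in>{0..<int q}. ee (of_int (a * v) / real q)) = (if int q dvd a then of_nat q else 0)"
proof (cases "int q dvd a")
  case True
  have "ee (of_int (a * v) / real q) = 1" for v
  proof -
    have "[a * v = 0] (mod int q)" using True by (simp add: cong_0_iff)
    from ee_cong[OF q this] show ?thesis by simp
  qed
  thus ?thesis using True by simp
next
  case False
  let ?f = "\<lambda>v. ee (of_int (a * v) / real q)"
  have per: "?f x = ?f y" if "[x = y] (mod int q)" for x y
    by (rule ee_cong[OF q]) (rule cong_scalar_left[OF that])
  have "?f (u + 1) = ee (of_int a / real q) * ?f u" for u
    by (simp add: ee_add[symmetric] add_divide_distrib[symmetric] algebra_simps)
  hence "ee (of_int a / real q) * (\<Sum>v\<in>{0..<int q}. ?f v) = (\<Sum>v\<in>{0..<int q}. ?f (v + 1))"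
    by (simp only: sum_distrib_left)
  also have "\<dots> = (\<Sum>v\<in>{0..<int q}. ?f v)" by (rule sum_period_shift[OF q per])
  finally have "(ee (of_int a / real q) - 1) * (\<Sum>v\<in>{0..<int q}. ?f v) = 0" by (simp add: algebra_simps)
  moreover have "ee (of_int a / real q) \<noteq> 1" using ee_eq_1_imp_dvd[OF q] False by blast
  ultimately show ?thesis using False by simp
qed

subsection \<open>Positive definite functions\<close>

text \<open>
  Nonnegative combinations of additive characters modulo \<open>q\<close>, that is, the functions
  with nonnegative Fourier coefficients. As a cone closed under products it is more convenient than
  a condition on coefficients.
\<close>

inductive pos_def :: "nat \<Rightarrow> (int \<Rightarrow> complex) \<Rightarrow> bool" for q where
  pos_def_ee: "pos_def q (\<lambda>v. ee (of_int (k * v) / real q))"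
| pos_def_add: "pos_def q f \<Longrightarrow> pos_def q g \<Longrightarrow> pos_def q (\<lambda>v. f v + g v)"
| pos_def_scale: "r \<ge> 0 \<Longrightarrow> pos_def q f \<Longrightarrow> pos_def q (\<lambda>v. of_real r * f v)"

lemma pos_def_1: "pos_def q (\<lambda>_. 1)"
  using pos_def_ee[of q 0] by simp

lemma pos_def_0: "pos_def q (\<lambda>_. 0)"
  using pos_def_scale[OF order_refl pos_def_1, of q] by simp

lemma pos_def_sum: "finite I \<Longrightarrow> (\<And>i. i \<in> I \<Longrightarrow> pos_def q (f i)) \<Longrightarrow> pos_def q (\<lambda>v. \<Sum>i\<in>I. f i v)"
  by (induction I rule: finite_induct) (auto intro: pos_def_0 pos_def_add)

lemma pos_def_mult_ee:
  assumes "pos_def q f" shows "pos_def q (\<lambda>v. ee (of_int (k * v) / real q) * f v)"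
  using assms
proof induction
  case (pos_def_ee j)
  have "ee (of_int (k * v) / real q) * ee (of_int (j * v) / real q) = ee (of_int ((k + j) * v) / real q)" for v
    by (simp add: ee_add[symmetric] add_divide_distrib[symmetric] algebra_simps)
  thus ?case using pos_def.pos_def_ee[of q "k + j"] by simp
next
  case (pos_def_add f g)
  thus ?case using pos_def.pos_def_add[OF pos_def_add.IH] by (simp add: distrib_left)
next
  case (pos_def_scale r f)
  thus ?case using pos_def.pos_def_scale[OF pos_def_scale.hyps(1) pos_def_scale.IH] by (simp add: mult.left_commute)
qed

lemma pos_def_mult:
  assumes "pos_def q f" "pos_def q g" shows "pos_def q (\<lambda>v. f v * g v)"
  using assms(1)
proof induction
  case (pos_def_ee k)
  show ?case by (rule pos_def_mult_ee[OF assms(2)])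
next
  case (pos_def_add f1 f2)
  thus ?case using pos_def.pos_def_add[OF pos_def_add.IH] by (simp add: distrib_right)
next
  case (pos_def_scale r f)
  thus ?case using pos_def.pos_def_scale[OF pos_def_scale.hyps(1) pos_def_scale.IH] by (simp add: mult.assoc)
qed

lemma pos_def_prod: "finite I \<Longrightarrow> (\<And>i. i \<in> I \<Longrightarrow> pos_def q (f i)) \<Longrightarrow> pos_def q (\<lambda>v. \<Prod>i\<in>I. f i v)"
  by (induction I rule: finite_induct) (auto intro: pos_def_1 pos_def_mult)

text \<open>
  The sum is \<open>q\<close> times a Fourier coefficient.
\<close>

lemma pos_def_sum_nonneg:
  assumes q: "q \<ge> 1" and f: "pos_def q f"
  shows "\<exists>r\<ge>0. (\<Sum>v\<in>{0..<int q}. f v * ee (of_int (a * v) / real q)) = of_real r"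
  using f
proof induction
  case (pos_def_ee k)
  have "ee (of_int (k * v) / real q) * ee (of_int (a * v) / real q) = ee (of_int ((k + a) * v) / real q)" for v
    by (simp add: ee_add[symmetric] add_divide_distrib[symmetric] algebra_simps)
  hence "(\<Sum>v\<in>{0..<int q}. ee (of_int (k * v) / real q) * ee (of_int (a * v) / real q)) =
    (if int q dvd k + a then of_nat q else 0)"
    using sum_ee_period[OF q, of "k + a"] by (simp only:)
  thus ?case by (intro exI[of _ "if int q dvd k + a then real q else 0"]) simp
next
  case (pos_def_add f g)
  then obtain r s where rs: "r \<ge> 0" "(\<Sum>v\<in>{0..<int q}. f v * ee (of_int (a * v) / real q)) = of_real r"
    "s \<ge> 0" "(\<Sum>v\<in>{0..<int q}. g v * ee (of_int (a * v) / real q)) = of_real s" by blast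
  have "(\<Sum>v\<in>{0..<int q}. (f v + g v) * ee (of_int (a * v) / real q)) = of_real (r + s)"
    unfolding distrib_right sum.distrib rs(2,4) by simp
  thus ?case using rs(1,3) by (intro exI[of _ "r + s"]) simp
next
  case (pos_def_scale c f)
  then obtain r where r: "r \<ge> 0" "(\<Sum>v\<in>{0..<int q}. f v * ee (of_int (a * v) / real q)) = of_real r" by blast
  have "(\<Sum>v\<in>{0..<int q}. (of_real c * f v) * ee (of_int (a * v) / real q)) = of_real (c * r)"
    unfolding mult.assoc sum_distrib_left[symmetric] r(2) by simp
  thus ?case using r(1) pos_def_scale.hyps by (intro exI[of _ "c * r"]) simp
qed

text \<open>
  The Fourier coefficients of \<open>2 [l | v] - [l | v - 1] - [l | v + 1]\<close> are \<open>(2 - 2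
  cos (2 \<pi> k / l)) / l\<close>.
\<close>

lemma pos_def_dvd_indicator_combination:
  assumes q: "q \<ge> 1" and l: "l dvd q"
  shows "pos_def q (\<lambda>v. of_real (1 + 2 * (if int l dvd v then 1 else 0) - (if int l dvd v - 1 then 1 else 0) - (if int l dvd v + 1 then 1 else 0)))"
proof -
  have l1: "l \<ge> 1" using l q by (cases l) auto
  obtain m where m: "q = l * m" using l by (auto elim: dvdE)
  have m1: "m \<ge> 1" using m q by (cases m) auto
  define w where "w b = (2 - 2 * cos (2 * pi * (of_int b / real l))) / real l" for b :: int
  have w0: "w b \<ge> 0" for b unfolding w_def by simp
  have rescale: "ee (of_int (b * v) / real l) = ee (of_int ((b * int m) * v) / real q)" for b v
    using m1 l1 by (simp add: m field_simps)
  have "pos_def q (\<lambda>v. 1 + (\<Sum>b\<in>{0..<int l}. of_real (w b) * ee (of_int (b * v) / real l)))"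
    unfolding rescale by (intro pos_def_add pos_def_1 pos_def_sum pos_def_scale w0 pos_def_ee) simp
  moreover have "1 + (\<Sum>b\<in>{0..<int l}. of_real (w b) * ee (of_int (b * v) / real l)) =
    of_real (1 + 2 * (if int l dvd v then 1 else 0) - (if int l dvd v - 1 then 1 else 0) - (if int l dvd v + 1 then 1 else 0))" for v
  proof -
    have "of_real (real l) * (of_real (w b) * ee (of_int (b * v) / real l)) =
      2 * ee (of_int (v * b) / real l) - ee (of_int ((v + 1) * b) / real l) - ee (of_int ((v - 1) * b) / real l)" for b
    proof -
      have c: "of_real (2 * cos (2 * pi * (of_int b / real l))) = ee (of_int b / real l) + ee (- (of_int b / real l))"
        by (simp add: ee_def complex_eq_iff)
      have 1: "ee (of_int ((v + 1) * b) / real l) = ee (of_int (v * b) / real l) * ee (of_int b / real l)"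
        by (simp add: ee_add[symmetric] add_divide_distrib[symmetric] algebra_simps)
      have 2: "ee (of_int ((v - 1) * b) / real l) = ee (of_int (v * b) / real l) * ee (- (of_int b / real l))"
        by (simp add: ee_add[symmetric] diff_divide_distrib[symmetric] algebra_simps)
      have "real l * w b = 2 - 2 * cos (2 * pi * (of_int b / real l))" using l1 by (simp add: w_def)
      hence "of_real (real l) * complex_of_real (w b) = 2 - of_real (2 * cos (2 * pi * (of_int b / real l)))"
        by (simp only: of_real_mult[symmetric] of_real_diff of_real_numeral)
      hence "of_real (real l) * (of_real (w b) * ee (of_int (b * v) / real l)) =
        (2 - of_real (2 * cos (2 * pi * (of_int b / real l)))) * ee (of_int (b * v) / real l)"
        by (simp only: mult.assoc[symmetric])
      thus ?thesis unfolding c 1 2 by (simp add: algebra_simps)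
    qed
    hence "of_real (real l) * (\<Sum>b\<in>{0..<int l}. of_real (w b) * ee (of_int (b * v) / real l)) =
      (\<Sum>b\<in>{0..<int l}. 2 * ee (of_int (v * b) / real l) - ee (of_int ((v + 1) * b) / real l) - ee (of_int ((v - 1) * b) / real l))"
      by (simp only: sum_distrib_left)
    also have "\<dots> = of_real (real l) * of_real (2 * (if int l dvd v then 1 else 0) - (if int l dvd v - 1 then 1 else 0) - (if int l dvd v + 1 then 1 else 0))"
      unfolding sum_subtractf sum_distrib_left[symmetric] sum_ee_period[OF l1] by auto
    finally have "(\<Sum>b\<in>{0..<int l}. of_real (w b) * ee (of_int (b * v) / real l)) =
      (of_real (2 * (if int l dvd v then 1 else 0) - (if int l dvd v - 1 then 1 else 0) - (if int l dvd v + 1 then 1 else 0)) :: complex)"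
      using l1 by simp
    thus ?thesis by (simp only: of_real_add of_real_diff of_real_1) simp
  qed
  hence "(\<lambda>v. 1 + (\<Sum>b\<in>{0..<int l}. of_real (w b) * ee (of_int (b * v) / real l))) = (\<lambda>v. of_real (1 + 2 * (if int l dvd v then 1 else 0) - (if int l dvd v - 1 then 1 else 0) - (if int l dvd v + 1 then 1 else 0)))"
    by (intro ext)
  ultimately show ?thesis by (simp only:)
qed

text \<open>
  The indicator of even numbers is \<open>(1 + (-1)\<^sup>v) / 2\<close>.
\<close>

lemma pos_def_even_indicator:
  assumes q: "q \<ge> 1" and l: "2 dvd q"
  shows "pos_def q (\<lambda>v. of_real (if even v then 1 else 0))"
proof -
  obtain m where m: "q = 2 * m" using l by (auto elim: dvdE)
  have m1: "m \<ge> 1" using m q by (cases m) auto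
  have "pos_def q (\<lambda>v. of_real (1 / 2) * (1 + ee (of_int (int m * v) / real q)))"
    by (intro pos_def_scale pos_def_add pos_def_1 pos_def_ee) simp
  moreover have "of_real (1 / 2) * (1 + ee (of_int (int m * v) / real q)) = of_real (if even v then 1 else 0)" for v
  proof -
    have v2: "of_int (int m * v) / real q = of_int v / 2" using m1 by (simp add: m)
    have e: "ee (of_int (int m * v) / real q) = cis (pi * of_int v)" unfolding v2 by (simp add: ee_def)
    have "cis (pi * of_int v) = (if even v then 1 else -1)"
      by (auto simp: cis_conv_exp complex_eq_iff Re_exp Im_exp cos_int_times_real sin_int_times_real mult.commute elim!: evenE oddE simp: cos_npi_int sin_zero_iff_int2)
    thus ?thesis unfolding e by simp
  qed
  ultimately show ?thesis by simp
qed

subsection \<open>Combinations of arithmetic progressions\<close>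

text \<open>
  Linear combinations of indicators of arithmetic progressions whose differences divide
  \<open>q\<close>; the real argument is the sum of the absolute values of the coefficients.
\<close>

inductive ap_comb :: "nat \<Rightarrow> real \<Rightarrow> (int \<Rightarrow> complex) \<Rightarrow> bool" for q where
  ap_comb_ap: "d dvd q \<Longrightarrow> ap_comb q 1 (\<lambda>v. if [v = r] (mod int d) then 1 else 0)"
| ap_comb_add: "ap_comb q X f \<Longrightarrow> ap_comb q Y g \<Longrightarrow> ap_comb q (X + Y) (\<lambda>v. f v + g v)"
| ap_comb_scale: "ap_comb q X f \<Longrightarrow> ap_comb q (\<bar>c\<bar> * X) (\<lambda>v. of_real c * f v)"

lemma ap_comb_0: "ap_comb q 0 (\<lambda>_. 0)"
  using ap_comb_scale[OF ap_comb_ap[of 1 q 0], of 0] by simp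

lemma ap_comb_1: "ap_comb q 1 (\<lambda>_. 1)"
  using ap_comb_ap[of 1 q 0] by simp

lemma ap_comb_nonneg: "ap_comb q X f \<Longrightarrow> X \<ge> 0"
  by (induction rule: ap_comb.induct) auto

text \<open>
  Two progressions with differences \<open>d\<close> and \<open>d'\<close> are disjoint or meet in a
  progression of difference \<open>lcm d d'\<close>, again a divisor of \<open>q\<close>.
\<close>

lemma ap_comb_mult_ap:
  assumes d: "d dvd q" and f: "ap_comb q X f"
  shows "\<exists>Z\<le>X. ap_comb q Z (\<lambda>v. (if [v = r] (mod int d) then 1 else 0) * f v)"
  using f
proof induction
  case (ap_comb_ap d' r')
  show ?case
  proof (cases "\<exists>w. [w = r] (mod int d) \<and> [w = r'] (mod int d')")
    case True
    then obtain w where w: "[w = r] (mod int d)" "[w = r'] (mod int d')" by blast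
    have "[v = r] (mod int d) \<and> [v = r'] (mod int d') \<longleftrightarrow> [v = w] (mod int (lcm d d'))" for v
    proof -
      have "[v = r] (mod int d) \<longleftrightarrow> [v = w] (mod int d)" using w(1) by (metis cong_sym cong_trans)
      moreover have "[v = r'] (mod int d') \<longleftrightarrow> [v = w] (mod int d')" using w(2) by (metis cong_sym cong_trans)
      moreover have "[v = w] (mod int (lcm d d')) \<longleftrightarrow> [v = w] (mod int d) \<and> [v = w] (mod int d')"
        by (simp add: cong_iff_dvd_diff lcm_least_iff flip: lcm_int_int_eq)
      ultimately show ?thesis by blast
    qed
    hence "(\<lambda>v. (if [v = r] (mod int d) then 1 else 0) * (if [v = r'] (mod int d') then 1 else 0)) =
        (\<lambda>v. if [v = w] (mod int (lcm d d')) then 1 else (0::complex))"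
      by (auto simp: fun_eq_iff)
    moreover have "lcm d d' dvd q" using d ap_comb_ap by simp
    ultimately show ?thesis using ap_comb.ap_comb_ap[of "lcm d d'" q w] by (intro exI[of _ 1]) simp
  next
    case False
    hence "(\<lambda>v. (if [v = r] (mod int d) then 1 else 0) * (if [v = r'] (mod int d') then 1 else 0)) =
        (\<lambda>v. 0 :: complex)" by (auto simp: fun_eq_iff)
    thus ?thesis using ap_comb_0[of q] by (intro exI[of _ 0]) simp
  qed
next
  case (ap_comb_add X f Y g)
  then obtain Z W where "Z \<le> X" "ap_comb q Z (\<lambda>v. (if [v = r] (mod int d) then 1 else 0) * f v)"
    "W \<le> Y" "ap_comb q W (\<lambda>v. (if [v = r] (mod int d) then 1 else 0) * g v)" by blast
  thus ?case using ap_comb.ap_comb_add[of q Z _ W] unfolding distrib_left by (intro exI[of _ "Z + W"]) simp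
next
  case (ap_comb_scale X f c)
  then obtain Z where Z: "Z \<le> X" "ap_comb q Z (\<lambda>v. (if [v = r] (mod int d) then 1 else 0) * f v)" by blast
  have eq: "(if [v = r] (mod int d) then 1 else 0) * (of_real c * f v) = of_real c * ((if [v = r] (mod int d) then 1 else 0) * f v)" for v
    by simp
  show ?case unfolding eq using ap_comb.ap_comb_scale[OF Z(2), of c] Z(1)
    by (intro exI[of _ "\<bar>c\<bar> * Z"]) (simp add: mult_left_mono)
qed

lemma ap_comb_mult:
  assumes f: "ap_comb q X f" and g: "ap_comb q Y g"
  shows "\<exists>Z\<le>X * Y. ap_comb q Z (\<lambda>v. f v * g v)"
  using f
proof induction
  case (ap_comb_ap d r)
  thus ?case using ap_comb_mult_ap[OF ap_comb_ap g, of r] by simp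
next
  case (ap_comb_add X1 f1 X2 f2)
  then obtain Z W where "Z \<le> X1 * Y" "ap_comb q Z (\<lambda>v. f1 v * g v)"
    "W \<le> X2 * Y" "ap_comb q W (\<lambda>v. f2 v * g v)" by blast
  thus ?case using ap_comb.ap_comb_add[of q Z _ W] unfolding distrib_right by (intro exI[of _ "Z + W"]) simp
next
  case (ap_comb_scale X f c)
  then obtain Z where Z: "Z \<le> X * Y" "ap_comb q Z (\<lambda>v. f v * g v)" by blast
  show ?case unfolding mult.assoc using ap_comb.ap_comb_scale[OF Z(2), of c] Z(1)
    by (intro exI[of _ "\<bar>c\<bar> * Z"]) (simp add: mult_left_mono mult.assoc)
qed

lemma ap_comb_prod:
  assumes "finite I" "\<And>i. i \<in> I \<Longrightarrow> \<exists>Z\<le>K. ap_comb q Z (f i)" "K \<ge> 0"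
  shows "\<exists>Z\<le>K ^ card I. ap_comb q Z (\<lambda>v. \<Prod>i\<in>I. f i v)"
  using assms(1,2)
proof (induction I rule: finite_induct)
  case empty
  show ?case using ap_comb_1[of q] by (intro exI[of _ 1]) simp
next
  case (insert i I)
  obtain Z where Z: "Z \<le> K" "ap_comb q Z (f i)" using insert.prems by blast
  obtain W where W: "W \<le> K ^ card I" "ap_comb q W (\<lambda>v. \<Prod>i\<in>I. f i v)" using insert.IH insert.prems by blast
  obtain V where V: "V \<le> Z * W" "ap_comb q V (\<lambda>v. f i v * (\<Prod>i\<in>I. f i v))" using ap_comb_mult[OF Z(2) W(2)] by blast
  have "Z * W \<le> K * K ^ card I" using Z(1) W(1) ap_comb_nonneg[OF W(2)] assms(3) by (intro mult_mono) auto
  thus ?case using V insert.hyps by (intro exI[of _ V]) simp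
qed

text \<open>
  For a progression of difference \<open>d\<close> the sum is 0 unless \<open>q/d\<close> divides
  \<open>a\<close>, which for \<open>a\<close> prime to \<open>q\<close> forces \<open>d =
  q\<close>, a single term.
\<close>

lemma ap_comb_sum_le:
  assumes q: "q \<ge> 1" and a: "coprime a (int q)" and f: "ap_comb q X f"
  shows "norm (\<Sum>v\<in>{0..<int q}. f v * ee (of_int (a * v) / real q)) \<le> X"
  using f
proof induction
  case (ap_comb_ap d r)
  have d1: "d \<ge> 1" using ap_comb_ap q by (cases d) auto
  obtain m where m: "q = d * m" using ap_comb_ap by (auto elim: dvdE)
  define f where "f v = (if [v = r] (mod int d) then 1 else 0) * ee (of_int (a * v) / real q)" for v
  have per: "f x = f y" if "[x = y] (mod int q)" for x y
  proof -
    have "[x = y] (mod int d)" using that m by (auto intro: cong_dvd_modulus)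
    hence "[x = r] (mod int d) \<longleftrightarrow> [y = r] (mod int d)" by (metis cong_sym cong_trans)
    moreover have "ee (of_int (a * x) / real q) = ee (of_int (a * y) / real q)"
      by (rule ee_cong[OF q]) (rule cong_scalar_left[OF that])
    ultimately show ?thesis by (simp add: f_def)
  qed
  show ?case
  proof (cases "m = 1")
    case True
    have "(\<Sum>v\<in>{0..<int q}. f v) = (\<Sum>v\<in>{0..<int q}. if v = r mod int q then ee (of_int (a * v) / real q) else 0)"
    proof (intro sum.cong refl)
      fix v assume "v \<in> {0..<int q}"
      hence "[v = r] (mod int d) \<longleftrightarrow> v = r mod int q" using True m by (auto simp: cong_def)
      thus "f v = (if v = r mod int q then ee (of_int (a * v) / real q) else 0)" by (simp add: f_def)
    qed
    hence "norm (\<Sum>v\<in>{0..<int q}. f v) = norm (if r mod int q \<in> {0..<int q} then ee (of_int (a * (r mod int q)) / real q) else 0)"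
      by (subst (asm) sum.delta) auto
    thus ?thesis by (simp add: f_def)
  next
    case False
    have "f (u + int d) = ee (of_int (a * int d) / real q) * f u" for u
    proof -
      have "[u + int d = r] (mod int d) \<longleftrightarrow> [u = r] (mod int d)" by (simp add: cong_def)
      thus ?thesis by (simp add: f_def ee_add[symmetric] add_divide_distrib[symmetric] algebra_simps)
    qed
    hence "ee (of_int (a * int d) / real q) * (\<Sum>v\<in>{0..<int q}. f v) = (\<Sum>v\<in>{0..<int q}. f (v + int d))"
      by (simp only: sum_distrib_left)
    also have "\<dots> = (\<Sum>v\<in>{0..<int q}. f v)" by (rule sum_period_shift[OF q per])
    finally have "(ee (of_int (a * int d) / real q) - 1) * (\<Sum>v\<in>{0..<int q}. f v) = 0" by (simp add: algebra_simps)
    moreover have "\<not> int q dvd a * int d"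
    proof
      assume "int q dvd a * int d"
      moreover have "coprime (int q) a" using a by (simp add: coprime_commute)
      ultimately have "int q dvd int d" by (simp add: coprime_dvd_mult_right_iff)
      hence "q dvd d" by simp
      hence "m = 1" using m d1 by (auto simp: dvd_mult_cancel1)
      thus False using False by simp
    qed
    hence "ee (of_int (a * int d) / real q) \<noteq> 1" using ee_eq_1_imp_dvd[OF q] by blast
    ultimately have "(\<Sum>v\<in>{0..<int q}. f v) = 0" by simp
    thus ?thesis by (simp add: f_def)
  qed
next
  case (ap_comb_add X f Y g)
  have "(\<Sum>v\<in>{0..<int q}. (f v + g v) * ee (of_int (a * v) / real q)) =
    (\<Sum>v\<in>{0..<int q}. f v * ee (of_int (a * v) / real q)) + (\<Sum>v\<in>{0..<int q}. g v * ee (of_int (a * v) / real q))"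
    by (simp add: distrib_right sum.distrib)
  thus ?case using ap_comb_add.IH
      norm_triangle_ineq[of "\<Sum>v\<in>{0..<int q}. f v * ee (of_int (a * v) / real q)" "\<Sum>v\<in>{0..<int q}. g v * ee (of_int (a * v) / real q)"]
    by simp
next
  case (ap_comb_scale X f c)
  have "(\<Sum>v\<in>{0..<int q}. of_real c * f v * ee (of_int (a * v) / real q)) =
    of_real c * (\<Sum>v\<in>{0..<int q}. f v * ee (of_int (a * v) / real q))"
    by (simp add: sum_distrib_left mult.assoc)
  thus ?case using ap_comb_scale.IH by (simp add: norm_mult mult_left_mono)
qed

subsection \<open>Summation by parts with second differences\<close>

text \<open>
  A second difference at \<open>k \<ge> 1\<close>; at \<open>k = 0\<close> truncated subtraction
  makes the value meaningless.
\<close>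

definition second_diff :: "(nat \<Rightarrow> complex) \<Rightarrow> nat \<Rightarrow> complex" where
  "second_diff F k = F (k + 1) - 2 * F k + F (k - 1)"

lemma second_diff_kernel:
  "(\<Sum>j=1..J. of_nat j * second_diff F (n + j)) = F n + of_nat J * F (n + J + 1) - of_nat (J + 1) * F (n + J)"
proof (induction J)
  case (Suc J)
  have "(\<Sum>j=1..Suc J. of_nat j * second_diff F (n + j)) =
     (\<Sum>j=1..J. of_nat j * second_diff F (n + j)) + of_nat (Suc J) * second_diff F (n + Suc J)" by simp
  thus ?case unfolding Suc by (simp add: second_diff_def algebra_simps)
qed simp

text \<open>
  Double summation by parts: the weights of \<open>a\<close> smoothed as in a Riesz mean are paired
  with second differences. The boundary terms vanish because \<open>F X = F (X + 1) = 0\<close>.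
\<close>

lemma sum_second_diff:
  fixes a F :: "nat \<Rightarrow> complex"
  assumes F: "F X = 0" "F (X + 1) = 0"
  shows "(\<Sum>k=1..X. (\<Sum>n\<le>k. a n * of_nat (k - n)) * second_diff F k) = (\<Sum>n<X. a n * F n)"
proof -
  have "(\<Sum>k=1..X. (\<Sum>n\<le>k. a n * of_nat (k - n)) * second_diff F k) =
      (\<Sum>k=1..X. \<Sum>n\<le>k. a n * (of_nat (k - n) * second_diff F k))"
    by (simp add: sum_distrib_right mult.assoc)
  also have "\<dots> = (\<Sum>k=1..X. \<Sum>n<X. if n < k then a n * (of_nat (k - n) * second_diff F k) else 0)"
  proof (rule sum.cong[OF refl])
    fix k assume k: "k \<in> {1..X}"
    have "(\<Sum>n<X. if n < k then a n * (of_nat (k - n) * second_diff F k) else 0) =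
        (\<Sum>n<k. a n * (of_nat (k - n) * second_diff F k))"
      using k by (intro sum.mono_neutral_cong_right) auto
    also have "\<dots> = (\<Sum>n\<le>k. a n * (of_nat (k - n) * second_diff F k))"
      by (intro sum.mono_neutral_left) auto
    finally show "(\<Sum>n\<le>k. a n * (of_nat (k - n) * second_diff F k)) =
       (\<Sum>n<X. if n < k then a n * (of_nat (k - n) * second_diff F k) else 0)" ..
  qed
  also have "\<dots> = (\<Sum>n<X. \<Sum>k=1..X. if n < k then a n * (of_nat (k - n) * second_diff F k) else 0)"
    by (rule sum.swap)
  also have "\<dots> = (\<Sum>n<X. a n * F n)"
  proof (intro sum.cong refl)
    fix n assume n: "n \<in> {..<X}"
    have "(\<Sum>k=1..X. if n < k then a n * (of_nat (k - n) * second_diff F k) else 0) =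
       (\<Sum>k\<in>{n+1..X}. a n * (of_nat (k - n) * second_diff F k))"
      by (intro sum.mono_neutral_cong_right) auto
    also have "\<dots> = (\<Sum>j=1..X - n. a n * (of_nat j * second_diff F (n + j)))"
      by (rule sum.reindex_bij_witness[of _ "\<lambda>j. n + j" "\<lambda>k. k - n"]) auto
    also have "\<dots> = a n * (\<Sum>j=1..X - n. of_nat j * second_diff F (n + j))" by (rule sum_distrib_left[symmetric])
    also have "(\<Sum>j=1..X - n. of_nat j * second_diff F (n + j)) = F n"
      unfolding second_diff_kernel using n F by simp
    finally show "(\<Sum>k=1..X. if n < k then a n * (of_nat (k - n) * second_diff F k) else 0) = a n * F n" .
  qed
  finally show ?thesis .
qed

text \<open>
  The main term \<open>k\<^sup>2/2\<close> is itself a smoothed sum, of the sequence \<open>1/2, 1,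
  1, \<dots>\<close>.
\<close>

lemma sum_second_diff_quadratic:
  assumes F: "F X = 0" "F (X + 1) = (0::complex)" and X: "X \<ge> 1"
  shows "(\<Sum>k=1..X. of_nat k ^ 2 / 2 * second_diff F k) = (\<Sum>n=1..<X. F n) + F 0 / 2"
proof -
  define a where "a n = (if n = 0 then 1 / 2 else 1 :: complex)" for n :: nat
  have e: "(\<Sum>n\<le>k. a n * of_nat (k - n)) = of_nat k ^ 2 / 2" for k
  proof -
    have "(\<Sum>n\<le>k. of_nat (k - n) :: complex) = (\<Sum>n\<le>k. of_nat n)"
      by (rule sum.reindex_bij_witness[of _ "\<lambda>n. k - n" "\<lambda>n. k - n"]) auto
    also have "\<dots> = of_nat k * (of_nat k + 1) / 2"
      by (induction k) (simp_all add: field_simps)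
    finally have 1: "(\<Sum>n\<le>k. of_nat (k - n) :: complex) = of_nat k * (of_nat k + 1) / 2" .
    have "(\<Sum>n\<le>k. a n * of_nat (k - n)) = (\<Sum>n\<le>k. of_nat (k - n) - (if n = 0 then of_nat k / 2 else 0))"
      by (intro sum.cong refl) (simp add: a_def)
    also have "\<dots> = of_nat k * (of_nat k + 1) / 2 - of_nat k / 2" unfolding sum_subtractf 1 by simp
    finally show ?thesis by (simp add: power2_eq_square algebra_simps add_divide_distrib)
  qed
  have "(\<Sum>k=1..X. of_nat k ^ 2 / 2 * second_diff F k) = (\<Sum>n<X. a n * F n)"
    using sum_second_diff[of F X a, OF F] unfolding e .
  also have "\<dots> = (\<Sum>n\<in>insert 0 {1..<X}. a n * F n)" using X by (intro sum.cong) auto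
  also have "\<dots> = F 0 / 2 + (\<Sum>n=1..<X. F n)" by (subst sum.insert) (auto simp: a_def)
  finally show ?thesis by (simp add: add.commute)
qed

text \<open>
  The triangular weight twisted by \<open>e(n b)\<close>. Up to its term at 0 its sum is half a
  Fejer kernel, whence positivity.
\<close>

definition tent :: "nat \<Rightarrow> real \<Rightarrow> nat \<Rightarrow> complex" where
  "tent X b n = of_nat (X - n) * ee (real n * b)"

text \<open>
  In the interior the second difference is \<open>(X - k) u (w - 1)\<^sup>2 - u (w\<^sup>2 -
  1)\<close> with \<open>u, w\<close> on the unit circle and \<open>|w - 1| \<le> 8 |b|\<close>; the
  corner at \<open>X\<close> contributes 1.
\<close>

lemma tent_second_diff_sum_le:
  assumes X: "X \<ge> 1"
  shows "(\<Sum>k=1..X. norm (second_diff (tent X b) k)) \<le> 64 * (1 + real X * \<bar>b\<bar>)\<^sup>2"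
proof -
  define T where "T = \<bar>b\<bar>"
  have bound: "norm (second_diff (tent X b) k) \<le> real X * (64 * T\<^sup>2) + 16 * T" if k: "k \<in> {1..<X}" for k
  proof -
    obtain j where j: "k = Suc j" using k by (cases k) auto
    define u where "u = ee (real j * b)"
    define w where "w = ee b"
    have e1: "ee (real k * b) = u * w" by (simp add: u_def w_def j ee_add[symmetric] algebra_simps)
    have e2: "ee (real (k + 1) * b) = u * w * w" by (simp add: u_def w_def j ee_add[symmetric] algebra_simps)
    have n1: "(of_nat (X - (k + 1)) :: complex) = of_nat (X - k) - 1"
      using k by (simp add: of_nat_diff)
    have n2: "(of_nat (X - j) :: complex) = of_nat (X - k) + 1"
      using k j by (simp add: of_nat_diff)
    have "second_diff (tent X b) k = of_nat (X - (k + 1)) * ee (real (k + 1) * b) - 2 * (of_nat (X - k) * ee (real k * b)) + of_nat (X - j) * u"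
      by (simp add: second_diff_def tent_def j u_def)
    also have "\<dots> = of_nat (X - k) * (u * (w - 1)\<^sup>2) - u * ((w - 1) * (w + 1))"
      unfolding e1 e2 n1 n2 by (simp add: power2_eq_square algebra_simps)
    finally have "norm (second_diff (tent X b) k) \<le> norm (of_nat (X - k) * (u * (w - 1)\<^sup>2)) + norm (u * ((w - 1) * (w + 1)))"
      using norm_triangle_ineq4 by metis
    also have "norm (of_nat (X - k) * (u * (w - 1)\<^sup>2)) = real (X - k) * (norm (w - 1))\<^sup>2"
      by (simp add: norm_mult norm_power u_def)
    also have "\<dots> \<le> real X * (8 * T)\<^sup>2"
      unfolding w_def T_def by (intro mult_mono power_mono norm_ee_minus_1_le) auto
    also have "norm (u * ((w - 1) * (w + 1))) = norm (w - 1) * norm (w + 1)" by (simp add: norm_mult u_def)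
    also have "\<dots> \<le> (8 * T) * 2"
      unfolding T_def w_def using norm_triangle_ineq[of "ee b" 1] by (intro mult_mono norm_ee_minus_1_le) auto
    finally show ?thesis by (simp add: power_mult_distrib)
  qed
  have last: "norm (second_diff (tent X b) X) = 1"
  proof -
    have "X - (X - 1) = 1" using X by simp
    thus ?thesis by (simp add: second_diff_def tent_def norm_mult del: One_nat_def)
  qed
  have "{1..X} = insert X {1..<X}" using X by auto
  hence "(\<Sum>k=1..X. norm (second_diff (tent X b) k)) = 1 + (\<Sum>k=1..<X. norm (second_diff (tent X b) k))"
    using last by simp
  also have "(\<Sum>k=1..<X. norm (second_diff (tent X b) k)) \<le> (\<Sum>k=1..<X. real X * (64 * T\<^sup>2) + 16 * T)"
    by (intro sum_mono bound)
  also have "\<dots> = real (X - 1) * (real X * (64 * T\<^sup>2) + 16 * T)" by simp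
  also have "\<dots> \<le> real X * (real X * (64 * T\<^sup>2) + 16 * T)" by (intro mult_right_mono) (auto simp: T_def)
  also have "1 + real X * (real X * (64 * T\<^sup>2) + 16 * T) \<le> 64 * (1 + real X * T)\<^sup>2"
  proof -
    have "real X * T \<ge> 0" by (simp add: T_def)
    thus ?thesis by (simp add: power2_eq_square algebra_simps)
  qed
  finally show ?thesis by (simp add: T_def)
qed

text \<open>
  The Fejer kernel is the squared modulus of a geometric sum.
\<close>

lemma fejer_identity:
  "real X + 2 * Re (\<Sum>n=1..<X. tent X b n) = (norm (\<Sum>j<X. ee (real j * b)))\<^sup>2"
proof (induction X)
  case (Suc X)
  define G where "G = (\<Sum>j<X. ee (real j * b))"
  have s1: "(\<Sum>n=1..<Suc X. tent (Suc X) b n) = (\<Sum>n=1..<X. tent X b n) + (\<Sum>n=1..X. ee (real n * b))"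
  proof -
    have "(\<Sum>n=1..<Suc X. tent (Suc X) b n) = (\<Sum>n=1..X. tent X b n + ee (real n * b))"
      by (intro sum.cong) (auto simp: tent_def Suc_diff_le algebra_simps)
    also have "\<dots> = (\<Sum>n=1..X. tent X b n) + (\<Sum>n=1..X. ee (real n * b))" by (rule sum.distrib)
    also have "(\<Sum>n=1..X. tent X b n) = (\<Sum>n=1..<X. tent X b n)"
      by (intro sum.mono_neutral_right) (auto simp: tent_def)
    finally show ?thesis .
  qed
  have s2: "cnj G * ee (real X * b) = (\<Sum>n=1..X. ee (real n * b))"
  proof -
    have "cnj G * ee (real X * b) = (\<Sum>j<X. ee (real (X - j) * b))"
      unfolding G_def cnj_sum sum_distrib_right
      by (intro sum.cong refl) (simp add: ee_minus[symmetric] ee_add[symmetric] of_nat_diff algebra_simps)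
    also have "\<dots> = (\<Sum>n=1..X. ee (real n * b))"
      by (rule sum.reindex_bij_witness[of _ "\<lambda>n. X - n" "\<lambda>j. X - j"]) auto
    finally show ?thesis .
  qed
  have "(norm (\<Sum>j<Suc X. ee (real j * b)))\<^sup>2 = (norm (G + ee (real X * b)))\<^sup>2" by (simp add: G_def)
  also have "\<dots> = (norm G)\<^sup>2 + 2 * Re (cnj G * ee (real X * b)) + (norm (ee (real X * b)))\<^sup>2"
    unfolding cmod_power2 by (simp add: power2_eq_square algebra_simps)
  also have "(norm G)\<^sup>2 = real X + 2 * Re (\<Sum>n=1..<X. tent X b n)" using Suc by (simp add: G_def)
  finally show ?case unfolding s1 s2 by simp
qed simp

lemma fejer_nonneg: "Re ((\<Sum>n=1..<X. tent X b n) + tent X b 0 / 2) \<ge> 0"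
proof -
  have "Re ((\<Sum>n=1..<X. tent X b n) + tent X b 0 / 2) = (real X + 2 * Re (\<Sum>n=1..<X. tent X b n)) / 2"
    by (simp add: tent_def)
  thus ?thesis unfolding fejer_identity by (simp only:) simp
qed

lemma norm_tent_sum_le: "X \<ge> 1 \<Longrightarrow> norm ((\<Sum>n=1..<X. tent X b n) + tent X b 0 / 2) \<le> (real X)\<^sup>2"
proof -
  assume X: "X \<ge> 1"
  have nt: "norm (tent X b n) \<le> real X" for n by (simp add: tent_def norm_mult)
  have "norm (\<Sum>n=1..<X. tent X b n) \<le> (\<Sum>n=1..<X. real X)" by (intro sum_norm_le nt)
  also have "\<dots> = (real X - 1) * real X" using X by (simp add: of_nat_diff)
  finally have "norm (\<Sum>n=1..<X. tent X b n) \<le> (real X - 1) * real X" .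
  moreover have "norm (tent X b 0 / 2) \<le> real X" using nt[of 0] by (simp add: norm_divide)
  ultimately show ?thesis
    using norm_triangle_ineq[of "\<Sum>n=1..<X. tent X b n" "tent X b 0 / 2"] by (simp add: power2_eq_square algebra_simps)
qed

lemma tent_sum_at_0: "X \<ge> 1 \<Longrightarrow> (\<Sum>n=1..<X. tent X 0 n) + tent X 0 0 / 2 = of_real ((real X)\<^sup>2 / 2)"
proof -
  assume X: "X \<ge> 1"
  have "(\<Sum>n=1..<X. tent X 0 n) = of_nat X * of_nat (X - 1) / 2"
  proof -
    have "(\<Sum>n=1..<X. tent X 0 n) = (\<Sum>n=1..<X. of_nat n)"
      unfolding tent_def by (rule sum.reindex_bij_witness[of _ "\<lambda>n. X - n" "\<lambda>n. X - n"]) auto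
    also have "\<dots> = of_nat X * of_nat (X - 1) / 2"
      using X
    proof (induction X rule: nat_induct_at_least)
      case (Suc n)
      thus ?case by (cases n) (simp_all add: field_simps)
    qed simp
    finally show ?thesis .
  qed
  thus ?thesis using X by (simp add: tent_def power2_eq_square of_nat_diff algebra_simps diff_divide_distrib)
qed

section \<open>The local model\<close>

text \<open>
  Chosen so that \<open>1 + local_weight l v\<close> is \<open>1 - 1/l\<close> times \<open>1 + 2 [l
  | v] - [l | v + 1]\<close> and so that the mean over \<open>v\<close> not congruent to 1 is zero.
\<close>

definition local_weight :: "nat \<Rightarrow> int \<Rightarrow> real" where
  "local_weight l v = - 1 / real l + (1 - 1 / real l) * (2 * (if int l dvd v then 1 else 0) - (if int l dvd v + 1 then 1 else 0))"

definition weight_on :: "nat set \<Rightarrow> int \<Rightarrow> real" where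
  "weight_on P v = (\<Prod>l\<in>P. local_weight l v)"

text \<open>
  The density of primes in residue classes turns a function of period \<open>m\<close>, summed over
  primes, into this average.
\<close>

definition unit_average :: "nat \<Rightarrow> (int \<Rightarrow> complex) \<Rightarrow> complex" where
  "unit_average m c = (\<Sum>u\<in>unit_residues m. c u) / of_nat (card (unit_residues m))"

lemma local_weight_cong: "[v = w] (mod int l) \<Longrightarrow> local_weight l v = local_weight l w"
  unfolding local_weight_def using cong_dvd_iff[of v w "int l"] cong_dvd_iff[of "v + 1" "w + 1" "int l"] cong_add[of v w "int l" 1 1]
  by simp

lemma weight_on_cong:
  assumes "\<And>l. l \<in> P \<Longrightarrow> l dvd q" "[v = w] (mod int q)"
  shows "weight_on P v = weight_on P w"
  unfolding weight_on_def
  by (intro prod.cong refl local_weight_cong cong_dvd_modulus[OF assms(2)]) (use assms(1) in simp)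

text \<open>
  At most one of \<open>v\<close> and \<open>v + 1\<close> is divisible by \<open>l\<close>.
\<close>

lemma abs_local_weight_le:
  assumes "l \<ge> 2" shows "\<bar>local_weight l v\<bar> \<le> 2"
proof -
  have nb: "\<not> (int l dvd v \<and> int l dvd v + 1)"
  proof
    assume "int l dvd v \<and> int l dvd v + 1"
    hence "int l dvd (v + 1) - v" by (intro dvd_diff) auto
    thus False using assms by simp
  qed
  have x: "0 \<le> 1 / real l" "1 / real l \<le> 1" using assms by simp_all
  show ?thesis
  proof (cases "int l dvd v")
    case True
    hence "local_weight l v = - 1 / real l + (1 - 1 / real l) * 2" using nb by (simp add: local_weight_def)
    also have "\<dots> = 2 - 3 * (1 / real l)" by (simp add: left_diff_distrib)
    finally have e: "local_weight l v = 2 - 3 * (1 / real l)" .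
    show ?thesis unfolding e using x by (intro abs_leI; linarith)
  next
    case nv: False
    show ?thesis
    proof (cases "int l dvd v + 1")
      case True
      hence "local_weight l v = - 1" using nv by (simp add: local_weight_def)
      thus ?thesis by simp
    next
      case False
      hence e: "local_weight l v = - (1 / real l)" using nv by (simp add: local_weight_def)
      show ?thesis unfolding e using x by (intro abs_leI; linarith)
    qed
  qed
qed

lemma abs_weight_on_le:
  assumes "finite P" "\<And>l. l \<in> P \<Longrightarrow> l \<ge> 2" shows "\<bar>weight_on P v\<bar> \<le> 2 ^ card P"
proof -
  have "\<bar>weight_on P v\<bar> = (\<Prod>l\<in>P. \<bar>local_weight l v\<bar>)" by (simp add: weight_on_def abs_prod)
  also have "\<dots> \<le> (\<Prod>l\<in>P. 2)" by (intro prod_mono) (use assms abs_local_weight_le in auto)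
  finally show ?thesis using assms(1) by simp
qed

lemma unit_residues_prime: "prime l \<Longrightarrow> unit_residues l = {1..<int l}"
proof -
  assume l: "prime l"
  have "coprime a (int l) \<longleftrightarrow> a \<noteq> 0" if "a \<in> {0..<int l}" for a
  proof
    assume "coprime a (int l)" thus "a \<noteq> 0" using prime_gt_1_nat[OF l] by auto
  next
    assume "a \<noteq> 0"
    hence "\<not> int l dvd a" using that zdvd_not_zless[of a "int l"] by auto
    moreover have "prime (int l)" using l by simp
    ultimately show "coprime a (int l)" using prime_imp_coprime[of "int l" a] by (simp add: coprime_commute)
  qed
  thus ?thesis by (auto simp: unit_residues_def)
qed

text \<open>
  Among the \<open>l - 1\<close> units, exactly one has \<open>l | u + 1\<close> and exactly one has
  \<open>l | u + 2\<close>; the latter requires \<open>l \<ge> 3\<close>.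
\<close>

lemma sum_local_weight_zero:
  assumes l: "prime l" "odd l"
  shows "(\<Sum>i\<in>unit_residues l. local_weight l (i + 1)) = 0"
proof -
  have l3: "l \<ge> 3" using l prime_ge_2_nat[OF l(1)] by (cases "l = 2") auto
  have d1: "int l dvd i + 1 \<longleftrightarrow> i = int l - 1" if "i \<in> {1..<int l}" for i
    using that zdvd_imp_le[of "int l" "i + 1"] by (auto dest: zdvd_imp_le)
  have d2: "int l dvd i + 1 + 1 \<longleftrightarrow> i = int l - 2" if i: "i \<in> {1..<int l}" for i
  proof
    assume d: "int l dvd i + 1 + 1"
    obtain k where "i + 1 + 1 = int l * k" using d by (rule dvdE)
    hence k: "i + 2 = int l * k" by simp
    have "k \<ge> 1" using k i by (smt (verit) atLeastLessThan_iff mult_nonneg_nonpos of_nat_0_le_iff)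
    moreover have "k < 2"
    proof (rule ccontr)
      assume "\<not> k < 2"
      hence "int l * 2 \<le> int l * k" by (intro mult_left_mono) auto
      hence "int l * 2 \<le> i + 2" unfolding k .
      moreover have "i < int l" using i by simp
      moreover have "int l \<ge> 3" using l3 by simp
      ultimately show False by linarith
    qed
    ultimately have "k = 1" by simp
    thus "i = int l - 2" using k by simp
  qed simp
  have "(\<Sum>i\<in>unit_residues l. local_weight l (i + 1)) =
    (\<Sum>i\<in>{1..<int l}. - 1 / real l + (1 - 1 / real l) * (2 * (if i = int l - 1 then 1 else 0) - (if i = int l - 2 then 1 else 0)))"
    unfolding unit_residues_prime[OF l(1)] local_weight_def by (intro sum.cong refl) (simp only: d1 d2)
  also have "\<dots> = (real l - 1) * (- 1 / real l) + (1 - 1 / real l) * (2 * 1 - 1)"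
    unfolding sum.distrib sum_distrib_left[symmetric] sum_subtractf using l3 by (simp add: of_nat_diff)
  also have "\<dots> = 0" using l3 by (simp add: field_simps)
  finally show ?thesis .
qed

lemma unit_residues_crt:
  assumes co: "coprime (l::nat) m" and l: "l \<ge> 1" and m: "m \<ge> 1"
  shows "bij_betw (\<lambda>u. (u mod int l, u mod int m)) (unit_residues (l * m)) (unit_residues l \<times> unit_residues m)"
proof (rule bij_betw_imageI)
  have co': "coprime (int l) (int m)" using co by simp
  show "inj_on (\<lambda>u. (u mod int l, u mod int m)) (unit_residues (l * m))"
  proof (rule inj_onI)
    fix x y assume *: "x \<in> unit_residues (l * m)" "y \<in> unit_residues (l * m)"
      "(x mod int l, x mod int m) = (y mod int l, y mod int m)"
    hence "[x = y] (mod int l)" "[x = y] (mod int m)" by (simp_all add: cong_def)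
    hence "[x = y] (mod int l * int m)" using co' by (rule coprime_cong_mult)
    thus "x = y" using * by (auto simp: cong_def unit_residues_def)
  qed
  show "(\<lambda>u. (u mod int l, u mod int m)) ` unit_residues (l * m) = unit_residues l \<times> unit_residues m"
  proof (intro equalityI subsetI)
    fix z assume "z \<in> (\<lambda>u. (u mod int l, u mod int m)) ` unit_residues (l * m)"
    then obtain u where u: "u \<in> unit_residues (l * m)" "z = (u mod int l, u mod int m)" by blast
    thus "z \<in> unit_residues l \<times> unit_residues m"
      using mod_in_unit_residues[OF l, of u] mod_in_unit_residues[OF m, of u] by (simp add: unit_residues_def)
  next
    fix z assume "z \<in> unit_residues l \<times> unit_residues m"
    then obtain a b where ab: "z = (a, b)" "a \<in> unit_residues l" "b \<in> unit_residues m" by blast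
    obtain x where x: "[x = a] (mod int l)" "[x = b] (mod int m)"
      using binary_chinese_remainder_int[OF co'] by blast
    have xa: "x mod int l = a" "x mod int m = b" using x ab by (auto simp: cong_def unit_residues_def)
    have "coprime x (int l)" "coprime x (int m)"
      using ab xa coprime_mod_modulus[OF l, of x] coprime_mod_modulus[OF m, of x] by (auto simp: unit_residues_def)
    hence cx: "coprime x (int (l * m))" by simp
    have lm: "l * m \<ge> 1" using l m by simp
    have "x mod int (l * m) \<in> unit_residues (l * m)" by (rule mod_in_unit_residues[OF lm cx])
    moreover have "(x mod int (l * m)) mod int l = a" "(x mod int (l * m)) mod int m = b"
      using xa by (simp_all add: mod_mod_cancel)
    ultimately show "z \<in> (\<lambda>u. (u mod int l, u mod int m)) ` unit_residues (l * m)"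
      using ab(1) by (intro image_eqI[of _ _ "x mod int (l * m)"]) simp_all
  qed
qed

text \<open>
  By the Chinese remainder theorem the sum over units modulo \<open>l m\<close> factors, and the
  factor at \<open>l\<close> is the mean-zero sum of the local weight.
\<close>

lemma unit_average_zero:
  assumes l: "prime l" "odd l" and co: "coprime l m" and m: "m \<ge> 1"
    and g: "\<And>x y. [x = y] (mod int m) \<Longrightarrow> g x = g y"
  shows "unit_average (l * m) (\<lambda>u. of_real (local_weight l (u + 1)) * g u) = 0"
proof -
  have l1: "l \<ge> 1" using prime_ge_1_nat[OF l(1)] .
  define h where "h = (\<lambda>(i, w). of_real (local_weight l (i + 1)) * g w)"
  have "(\<Sum>u\<in>unit_residues (l * m). of_real (local_weight l (u + 1)) * g u) =
      (\<Sum>u\<in>unit_residues (l * m). h (u mod int l, u mod int m))"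
  proof (intro sum.cong refl)
    fix u
    have "local_weight l (u + 1) = local_weight l (u mod int l + 1)"
      by (intro local_weight_cong cong_add) (simp_all add: cong_def)
    moreover have "g u = g (u mod int m)" by (rule g) (simp add: cong_def)
    ultimately show "of_real (local_weight l (u + 1)) * g u = h (u mod int l, u mod int m)" by (simp add: h_def)
  qed
  also have "\<dots> = (\<Sum>z\<in>unit_residues l \<times> unit_residues m. h z)"
    by (rule sum.reindex_bij_betw[OF unit_residues_crt[OF co l1 m]])
  also have "\<dots> = (\<Sum>i\<in>unit_residues l. of_real (local_weight l (i + 1))) * (\<Sum>w\<in>unit_residues m. g w)"
    unfolding h_def sum_product sum.cartesian_product ..
  also have "(\<Sum>i\<in>unit_residues l. complex_of_real (local_weight l (i + 1))) = of_real (\<Sum>i\<in>unit_residues l. local_weight l (i + 1))"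
    by simp
  also have "\<dots> = 0" by (simp add: sum_local_weight_zero[OF l])
  finally show ?thesis by (simp add: unit_average_def)
qed

section \<open>Counting prime sets\<close>

text \<open>
  Elements larger than \<open>K\<^sup>1\<^sup>/\<^sup>\<epsilon>\<close> pay for their factor
  \<open>K\<close> by themselves; the others are boundedly many.
\<close>

lemma power_card_le_prod_powr:
  fixes K \<epsilon> :: real
  assumes K: "K \<ge> 1" and \<epsilon>: "\<epsilon> > 0"
  shows "\<exists>C>0. \<forall>P. finite P \<and> (\<forall>l\<in>P. l \<ge> (1::nat)) \<longrightarrow> K ^ card P \<le> C * real (\<Prod>P) powr \<epsilon>"
proof -
  \<comment> \<open>Beyond \<open>M\<close> one has \<open>K \<le> l\<^sup>\<epsilon>\<close>.\<close>
  define M where "M = nat \<lceil>K powr (1 / \<epsilon>)\<rceil>"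
  have big: "K \<le> real l powr \<epsilon>" if "l > M" for l
  proof -
    have "K powr (1 / \<epsilon>) \<le> real l" using that by (simp add: M_def) linarith
    hence "(K powr (1 / \<epsilon>)) powr \<epsilon> \<le> real l powr \<epsilon>" using \<epsilon> by (intro powr_mono2) auto
    thus ?thesis using K \<epsilon> by (simp add: powr_powr)
  qed
  have "K ^ card P \<le> K ^ Suc M * real (\<Prod>P) powr \<epsilon>" if P: "finite P" "\<forall>l\<in>P. l \<ge> 1" for P
  proof -
    define P1 where "P1 = P \<inter> {..M}"
    define P2 where "P2 = P - {..M}"
    have fin: "finite P1" "finite P2" using P by (auto simp: P1_def P2_def)
    have "P = P1 \<union> P2" by (auto simp: P1_def P2_def)
    moreover have "P1 \<inter> P2 = {}" by (auto simp: P1_def P2_def)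
    ultimately have "card P = card P1 + card P2" using fin by (simp add: card_Un_disjoint)
    hence 1: "K ^ card P = K ^ card P1 * (\<Prod>l\<in>P2. K)" by (simp add: power_add)
    have 2: "K ^ card P1 \<le> K ^ Suc M"
    proof -
      have "card P1 \<le> card {..M}" unfolding P1_def by (intro card_mono) auto
      thus ?thesis using K by (simp del: power_Suc add: power_increasing)
    qed
    have "(\<Prod>l\<in>P2. K) \<le> (\<Prod>l\<in>P2. real l powr \<epsilon>)"
      using big K by (intro prod_mono) (auto simp: P2_def)
    also have "\<dots> \<le> (\<Prod>l\<in>P. real l powr \<epsilon>)"
    proof (rule prod_mono2)
      fix l assume "l \<in> P - P2"
      hence "real l \<ge> 1" using P by auto
      thus "1 \<le> real l powr \<epsilon>" using \<epsilon> by (simp add: ge_one_powr_ge_zero)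
    qed (use P in \<open>auto simp: P2_def\<close>)
    also have "\<dots> = real (\<Prod>P) powr \<epsilon>" by (simp add: prod_powr_distrib)
    finally have 3: "(\<Prod>l\<in>P2. K) \<le> real (\<Prod>P) powr \<epsilon>" .
    show ?thesis unfolding 1 using K by (intro mult_mono 2 3 prod_nonneg) auto
  qed
  moreover have "K ^ Suc M > 0" using K by simp
  ultimately show ?thesis by blast
qed

definition sieve_sets :: "real \<Rightarrow> nat set set" where
  "sieve_sets R = {P. finite P \<and> (\<forall>l\<in>P. prime l \<and> odd l) \<and> real (\<Prod>P) \<le> R}"

lemma sieve_setsD:
  assumes "P \<in> sieve_sets R" shows "finite P" "\<And>l. l \<in> P \<Longrightarrow> prime l" "\<And>l. l \<in> P \<Longrightarrow> odd l" "real (\<Prod>P) \<le> R" "\<Prod>P \<ge> 1"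
proof -
  show *: "finite P" "\<And>l. l \<in> P \<Longrightarrow> prime l" "\<And>l. l \<in> P \<Longrightarrow> odd l" "real (\<Prod>P) \<le> R"
    using assms by (auto simp: sieve_sets_def)
  have "\<Prod>P > 0" using * by (intro prod_pos) (auto simp: prime_gt_0_nat)
  thus "\<Prod>P \<ge> 1" by simp
qed

lemma prime_dvd_prod_primes_iff:
  assumes "finite P" "\<And>l. l \<in> P \<Longrightarrow> prime l" "prime (p::nat)"
  shows "p dvd \<Prod>P \<longleftrightarrow> p \<in> P"
proof
  assume "p dvd \<Prod>P"
  then obtain l where "l \<in> P" "p dvd l" using prime_dvd_prod_iff[OF assms(1,3), of "\<lambda>x. x"] by auto
  moreover from this have "p = l" using assms(2) by (intro primes_dvd_imp_eq[OF assms(3)])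
  ultimately show "p \<in> P" by simp
next
  assume "p \<in> P" thus "p dvd \<Prod>P" using assms(1) by (rule dvd_prodI[of P p "\<lambda>x. x", rotated])
qed

lemma inj_on_Prod_sieve_sets: "inj_on Prod (sieve_sets R)"
proof (rule inj_onI)
  fix P Q assume P: "P \<in> sieve_sets R" and Q: "Q \<in> sieve_sets R" and eq: "\<Prod>P = \<Prod>Q"
  have "p \<in> P \<longleftrightarrow> p \<in> Q" for p
    using prime_dvd_prod_primes_iff[OF sieve_setsD(1,2)[OF P], of p]
      prime_dvd_prod_primes_iff[OF sieve_setsD(1,2)[OF Q], of p]
      sieve_setsD(2)[OF P, of p] sieve_setsD(2)[OF Q, of p] unfolding eq by blast
  thus "P = Q" by blast
qed

text \<open>
  A set of primes is determined by its product, which is an integer in \<open>[1, R]\<close>.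
\<close>

lemma sieve_sets_card:
  assumes R: "R \<ge> 0" shows "finite (sieve_sets R)" "real (card (sieve_sets R)) \<le> R"
proof -
  have sub: "Prod ` sieve_sets R \<subseteq> {1..nat \<lfloor>R\<rfloor>}"
  proof
    fix x assume "x \<in> Prod ` sieve_sets R"
    then obtain P where P: "P \<in> sieve_sets R" "x = \<Prod>P" by blast
    thus "x \<in> {1..nat \<lfloor>R\<rfloor>}" using sieve_setsD(4,5)[OF P(1)] by (simp add: le_nat_floor)
  qed
  show fin: "finite (sieve_sets R)"
    using finite_imageD[OF finite_subset[OF sub] inj_on_Prod_sieve_sets] by simp
  have "card (sieve_sets R) \<le> card {1..nat \<lfloor>R\<rfloor>}"
    using card_mono[OF _ sub] card_image[OF inj_on_Prod_sieve_sets, of R] by simp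
  thus "real (card (sieve_sets R)) \<le> R" using R by simp linarith
qed

lemma prod_prime_factors_le: "q \<ge> 1 \<Longrightarrow> P \<subseteq> prime_factors q \<Longrightarrow> \<Prod>P \<le> (q::nat)"
proof -
  assume q: "q \<ge> 1" and P: "P \<subseteq> prime_factors q"
  have "\<Prod>P dvd \<Prod>(prime_factors q)" by (rule prod_dvd_prod_subset[OF _ P]) simp
  also have "\<Prod>(prime_factors q) dvd (\<Prod>p\<in>prime_factors q. p ^ multiplicity p q)"
  proof (rule prod_dvd_prod)
    fix p assume p: "p \<in> prime_factors q"
    hence "multiplicity p q \<noteq> 0" using q by (simp add: prime_factors_multiplicity)
    thus "p dvd p ^ multiplicity p q" by (intro dvd_power) simp
  qed
  also have "(\<Prod>p\<in>prime_factors q. p ^ multiplicity p q) = q" using prod_prime_factors[of q] q by simp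
  finally show ?thesis using q by (intro dvd_imp_le) auto
qed

section \<open>Complete exponential sums\<close>

lemma coprime_iff_prime_factors:
  assumes q: "q \<ge> (1::nat)"
  shows "coprime w (int q) \<longleftrightarrow> (\<forall>l\<in>prime_factors q. \<not> int l dvd w)"
proof
  assume c: "coprime w (int q)"
  show "\<forall>l\<in>prime_factors q. \<not> int l dvd w"
  proof (intro ballI notI)
    fix l assume l: "l \<in> prime_factors q" "int l dvd w"
    hence "int l dvd int q" by (simp add: in_prime_factors_iff)
    hence "is_unit (int l)" using c l(2) by (meson coprime_common_divisor)
    thus False using l(1) by (auto simp: in_prime_factors_iff)
  qed
next
  assume *: "\<forall>l\<in>prime_factors q. \<not> int l dvd w"
  show "coprime w (int q)"
  proof (rule ccontr)
    assume n: "\<not> coprime w (int q)"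
    have "nat (gcd w (int q)) \<noteq> 1"
    proof
      assume "nat (gcd w (int q)) = 1"
      hence "gcd w (int q) = 1" by linarith
      thus False using n by (simp add: coprime_iff_gcd_eq_1)
    qed
    then obtain p where p: "prime p" "p dvd nat (gcd w (int q))" using prime_factor_nat by blast
    have "int p dvd int (nat (gcd w (int q)))" using p(2) by (simp only: int_dvd_int_iff)
    hence g: "int p dvd gcd w (int q)" by simp
    have "int p dvd w" "int p dvd int q" by (rule dvd_trans[OF g gcd_dvd1], rule dvd_trans[OF g gcd_dvd2])
    thus False using * p(1) q by (auto simp: in_prime_factors_iff)
  qed
qed

definition coprime_factor :: "nat \<Rightarrow> int \<Rightarrow> real" where
  "coprime_factor l v = (if int l dvd v - 1 then 0 else 1)"

lemma prod_coprime_factor: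
  assumes q: "q \<ge> (1::nat)"
  shows "(\<Prod>l\<in>prime_factors q. coprime_factor l v) = (if coprime (v - 1) (int q) then 1 else 0)"
proof (cases "coprime (v - 1) (int q)")
  case True
  thus ?thesis using coprime_iff_prime_factors[OF q, of "v - 1"] by (auto simp: coprime_factor_def intro!: prod.neutral)
next
  case False
  then obtain l where "l \<in> prime_factors q" "int l dvd v - 1" using coprime_iff_prime_factors[OF q, of "v - 1"] by blast
  thus ?thesis using False by (auto simp: coprime_factor_def)
qed

text \<open>
  In the variable \<open>v = u + 1\<close> a sum over units becomes a complete sum with local
  factors.
\<close>

lemma sum_unit_residues_shift:
  fixes g :: "int \<Rightarrow> complex"
  assumes q: "q \<ge> (1::nat)" and g: "\<And>x y. [x = y] (mod int q) \<Longrightarrow> g x = g y"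
  shows "(\<Sum>u\<in>unit_residues q. g (u + 1)) =
    (\<Sum>v\<in>{0..<int q}. of_real (\<Prod>l\<in>prime_factors q. coprime_factor l v) * g v)"
proof -
  define f where "f v = (if coprime (v - 1) (int q) then g v else 0)" for v
  have per: "f x = f y" if xy: "[x = y] (mod int q)" for x y
  proof -
    have "[x - 1 = y - 1] (mod int q)" using xy by (intro cong_diff) auto
    hence "coprime (x - 1) (int q) \<longleftrightarrow> coprime (y - 1) (int q)"
      by (metis cong_imp_coprime cong_sym)
    thus ?thesis using g[OF xy] by (simp add: f_def)
  qed
  have "(\<Sum>u\<in>unit_residues q. g (u + 1)) = (\<Sum>u\<in>{0..<int q}. f (u + 1))"
    unfolding unit_residues_def by (intro sum.mono_neutral_cong_left) (auto simp: f_def)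
  also have "\<dots> = (\<Sum>v\<in>{0..<int q}. f v)" by (rule sum_period_shift[OF q per])
  also have "\<dots> = (\<Sum>v\<in>{0..<int q}. of_real (\<Prod>l\<in>prime_factors q. coprime_factor l v) * g v)"
    by (rule sum.cong[OF refl]) (simp add: prod_coprime_factor[OF q] f_def)
  finally show ?thesis .
qed

lemma ap_comb_dvd_shift: "l dvd q \<Longrightarrow> ap_comb q 1 (\<lambda>v. if int l dvd v + r then 1 else 0)"
proof -
  assume l: "l dvd q"
  have "(if int l dvd v + r then 1 else 0 :: complex) = (if [v = - r] (mod int l) then 1 else 0)" for v
    by (simp add: cong_iff_dvd_diff)
  thus ?thesis using ap_comb_ap[OF l, of "- r"] by simp
qed

lemma ap_comb_coprime_factor:
  assumes l: "l dvd q" shows "ap_comb q 2 (\<lambda>v. of_real (coprime_factor l v))"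
proof -
  have "ap_comb q (1 + \<bar>-1\<bar> * 1) (\<lambda>v. 1 + of_real (-1) * (if int l dvd v + (-1) then 1 else 0))"
    by (intro ap_comb_add ap_comb_1 ap_comb_scale ap_comb_dvd_shift l)
  moreover have "(\<lambda>v. 1 + of_real (-1) * (if int l dvd v + (-1) then 1 else 0 :: complex)) = (\<lambda>v. of_real (coprime_factor l v))"
    by (simp add: coprime_factor_def fun_eq_iff)
  ultimately show ?thesis by simp
qed

lemma ap_comb_local_weight:
  assumes l: "l dvd q" "l \<ge> 1" shows "\<exists>Z\<le>3. ap_comb q Z (\<lambda>v. of_real (local_weight l v))"
proof -
  define x where "x = 1 / real l"
  have x: "0 \<le> x" "x \<le> 1" using l(2) by (auto simp: x_def)
  have "ap_comb q (\<bar>- x\<bar> * 1 + (\<bar>2 * (1 - x)\<bar> * 1 + \<bar>- (1 - x)\<bar> * 1))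
    (\<lambda>v. of_real (- x) * 1 + (of_real (2 * (1 - x)) * (if int l dvd v + 0 then 1 else 0) +
       of_real (- (1 - x)) * (if int l dvd v + 1 then 1 else 0)))"
    by (rule ap_comb_add ap_comb_scale ap_comb_1 ap_comb_dvd_shift l)+
  moreover have "(\<lambda>v. of_real (- x) * 1 + (of_real (2 * (1 - x)) * (if int l dvd v + 0 then 1 else 0) +
       of_real (- (1 - x)) * (if int l dvd v + 1 then 1 else 0 :: complex))) = (\<lambda>v. of_real (local_weight l v))"
    by (simp add: local_weight_def x_def[symmetric] fun_eq_iff algebra_simps)
  moreover have "\<bar>- x\<bar> * 1 + (\<bar>2 * (1 - x)\<bar> * 1 + \<bar>- (1 - x)\<bar> * 1) \<le> 3" using x by simp
  ultimately show ?thesis by auto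
qed

text \<open>
  Every prime of \<open>q\<close> contributes a factor that is a combination of progressions of
  total weight at most \<open>2 * 3\<close>.
\<close>

lemma norm_unit_sum_weight_le:
  assumes q: "q \<ge> 1" and a: "coprime a (int q)" and P: "P \<subseteq> prime_factors q"
  shows "norm (\<Sum>u\<in>unit_residues q. of_real (weight_on P (u + 1)) * ee (of_int (a * (u + 1)) / real q)) \<le> 6 ^ card (prime_factors q)"
proof -
  define z where "z l v = complex_of_real (coprime_factor l v) * (if l \<in> P then of_real (local_weight l v) else 1)" for l v
  have lq: "l dvd q" "l \<ge> 1" if "l \<in> prime_factors q" for l
    using that prime_ge_1_nat by (auto simp: in_prime_factors_iff)
  have P': "\<And>l. l \<in> P \<Longrightarrow> l dvd q" using P lq by auto
  have per: "of_real (weight_on P x) * ee (of_int (a * x) / real q) = of_real (weight_on P y) * ee (of_int (a * y) / real q)"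
    if "[x = y] (mod int q)" for x y
    using weight_on_cong[OF P' that] ee_cong[OF q cong_scalar_left[OF that]] by simp
  have "(\<Sum>u\<in>unit_residues q. of_real (weight_on P (u + 1)) * ee (of_int (a * (u + 1)) / real q)) =
    (\<Sum>v\<in>{0..<int q}. of_real (\<Prod>l\<in>prime_factors q. coprime_factor l v) * (of_real (weight_on P v) * ee (of_int (a * v) / real q)))"
    by (rule sum_unit_residues_shift[OF q per])
  also have "\<dots> = (\<Sum>v\<in>{0..<int q}. (\<Prod>l\<in>prime_factors q. z l v) * ee (of_int (a * v) / real q))"
  proof (rule sum.cong[OF refl])
    fix v
    have "weight_on P v = (\<Prod>l\<in>prime_factors q. if l \<in> P then local_weight l v else 1)"
      unfolding weight_on_def by (rule prod.mono_neutral_cong_left) (use P in auto)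
    hence "of_real (weight_on P v) = (\<Prod>l\<in>prime_factors q. if l \<in> P then complex_of_real (local_weight l v) else 1)"
      by (simp add: of_real_prod if_distrib cong: if_cong)
    thus "of_real (\<Prod>l\<in>prime_factors q. coprime_factor l v) * (of_real (weight_on P v) * ee (of_int (a * v) / real q)) =
      (\<Prod>l\<in>prime_factors q. z l v) * ee (of_int (a * v) / real q)"
      unfolding z_def prod.distrib by simp
  qed
  finally have eq: "(\<Sum>u\<in>unit_residues q. of_real (weight_on P (u + 1)) * ee (of_int (a * (u + 1)) / real q)) =
    (\<Sum>v\<in>{0..<int q}. (\<Prod>l\<in>prime_factors q. z l v) * ee (of_int (a * v) / real q))" .
  have zl: "\<exists>Z\<le>6. ap_comb q Z (z l)" if l: "l \<in> prime_factors q" for l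
  proof (cases "l \<in> P")
    case True
    obtain Y where Y: "Y \<le> 3" "ap_comb q Y (\<lambda>v. of_real (local_weight l v))" using ap_comb_local_weight[OF lq[OF l]] by blast
    obtain Z where Z: "Z \<le> 2 * Y" "ap_comb q Z (\<lambda>v. of_real (coprime_factor l v) * of_real (local_weight l v))"
      using ap_comb_mult[OF ap_comb_coprime_factor[OF lq(1)[OF l]] Y(2)] by blast
    have "z l = (\<lambda>v. of_real (coprime_factor l v) * of_real (local_weight l v))" using True by (simp add: z_def fun_eq_iff)
    thus ?thesis using Y(1) Z by (intro exI[of _ Z]) simp
  next
    case False
    hence "z l = (\<lambda>v. of_real (coprime_factor l v))" by (simp add: z_def fun_eq_iff)
    thus ?thesis using ap_comb_coprime_factor[OF lq(1)[OF l]] by (intro exI[of _ 2]) simp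
  qed
  have "\<exists>Z\<le>6 ^ card (prime_factors q). ap_comb q Z (\<lambda>v. \<Prod>l\<in>prime_factors q. z l v)"
    by (rule ap_comb_prod) (auto intro: zl)
  then obtain Z where Z: "Z \<le> 6 ^ card (prime_factors q)" "ap_comb q Z (\<lambda>v. \<Prod>l\<in>prime_factors q. z l v)" by blast
  show ?thesis unfolding eq using ap_comb_sum_le[OF q a Z(2)] Z(1) by linarith
qed

lemma card_unit_residues: "q \<ge> 1 \<Longrightarrow> card (unit_residues q) = totient q"
proof -
  assume q: "q \<ge> 1"
  show ?thesis
  proof (cases "q = 1")
    case True
    have "unit_residues 1 = {0}" by (auto simp: unit_residues_def)
    thus ?thesis using True by simp
  next
    case False
    have "unit_residues q = int ` totatives q"
    proof (intro equalityI subsetI)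
      fix u assume u: "u \<in> unit_residues q"
      hence u': "0 \<le> u" "u < int q" "coprime u (int q)" by (auto simp: unit_residues_def)
      have "u \<noteq> 0" using u'(3) False by auto
      moreover have "coprime (nat u) q" using u' by (simp add: coprime_int_iff[symmetric])
      ultimately have "nat u \<in> totatives q" using u' by (auto simp: totatives_def)
      thus "u \<in> int ` totatives q" using u' by (intro image_eqI[of _ _ "nat u"]) auto
    next
      fix u assume "u \<in> int ` totatives q"
      then obtain k where k: "u = int k" "k \<in> totatives q" by blast
      have "k \<noteq> q" using k False by (auto simp: totatives_def)
      thus "u \<in> unit_residues q" using k by (auto simp: totatives_def unit_residues_def)
    qed
    thus ?thesis by (simp add: totient_def card_image)
  qed
qed

text \<open>
  Each factor \<open>1 - 1/p\<close> of \<open>\<phi>(q)/q\<close> is at least \<open>1/2\<close>.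
\<close>

lemma card_unit_residues_ge:
  assumes q: "q \<ge> 1" shows "real q / 2 ^ card (prime_factors q) \<le> real (card (unit_residues q))"
proof -
  have "(1 / 2) ^ card (prime_factors q) = (\<Prod>p\<in>prime_factors q. 1 / 2 :: real)" by simp
  also have "\<dots> \<le> (\<Prod>p\<in>prime_factors q. 1 - 1 / real p)"
  proof (rule prod_mono)
    fix p assume "p \<in> prime_factors q"
    hence "real p \<ge> 2" using prime_ge_2_nat[of p] by (auto simp: in_prime_factors_iff)
    thus "0 \<le> (1 / 2 :: real) \<and> 1 / 2 \<le> 1 - 1 / real p" by (simp add: field_simps)
  qed
  finally have "real q * (1 / 2) ^ card (prime_factors q) \<le> real q * (\<Prod>p\<in>prime_factors q. 1 - 1 / real p)"
    by (intro mult_left_mono) auto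
  thus ?thesis unfolding card_unit_residues[OF q] totient_formula2 by (simp add: power_one_over field_simps)
qed

lemma norm_unit_average_weight_le:
  assumes q: "q \<ge> 1" and a: "coprime a (int q)" and P: "P \<subseteq> prime_factors q"
  shows "norm (unit_average q (\<lambda>u. of_real (weight_on P (u + 1)) * ee (of_int (a * (u + 1)) / real q))) \<le> 12 ^ card (prime_factors q) / real q"
proof -
  define k where "k = card (prime_factors q)"
  have "norm (unit_average q (\<lambda>u. of_real (weight_on P (u + 1)) * ee (of_int (a * (u + 1)) / real q))) \<le> 6 ^ k / real (card (unit_residues q))"
    unfolding unit_average_def norm_divide k_def using norm_unit_sum_weight_le[OF assms] by (simp add: divide_right_mono)
  also have "\<dots> \<le> 6 ^ k / (real q / 2 ^ k)"
    using card_unit_residues_ge[OF q] q by (intro divide_left_mono mult_pos_pos) (auto simp: k_def unit_residues_nonempty)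
  also have "\<dots> = (6 * 2) ^ k / real q" unfolding power_mult_distrib by simp
  finally show ?thesis by (simp add: k_def)
qed

definition odd_prime_factors :: "nat \<Rightarrow> nat set" where
  "odd_prime_factors q = {l \<in> prime_factors q. odd l}"

text \<open>
  The sum over all sets of odd primes of \<open>q\<close> is the expansion of \<open>\<Prod>(1 +
  local_weight l v)\<close>. Multiplied by the indicator that \<open>v - 1\<close> is a unit, each
  factor becomes \<open>1 - 1/l\<close> times a function with nonnegative Fourier coefficients; the
  prime 2, if it divides \<open>q\<close>, contributes the indicator of even \<open>v\<close>.
\<close>

lemma sum_unit_average_nonneg:
  assumes q: "q \<ge> 1"
  shows "\<exists>r\<ge>0. (\<Sum>P\<in>Pow (odd_prime_factors q). unit_average q (\<lambda>u. of_real (weight_on P (u + 1)) * ee (of_int (a * (u + 1)) / real q))) = of_real r"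
proof -
  define D where "D = odd_prime_factors q"
  have finD: "finite D" by (simp add: D_def odd_prime_factors_def)
  have Dq: "D \<subseteq> prime_factors q" by (auto simp: D_def odd_prime_factors_def)
  have lD: "l dvd q" "prime l" "l \<ge> 3" if "l \<in> D" for l
  proof -
    show *: "l dvd q" "prime l" using that by (auto simp: D_def odd_prime_factors_def in_prime_factors_iff)
    have "odd l" using that by (simp add: D_def odd_prime_factors_def)
    thus "l \<ge> 3" using prime_ge_2_nat[OF *(2)] by (cases "l = 2") auto
  qed
  define G where "G v = (\<Prod>l\<in>D. 1 + local_weight l v)" for v
  define H where "H l v = 1 + 2 * (if int l dvd v then 1 else 0) - (if int l dvd v - 1 then 1 else 0) - (if int l dvd v + 1 then 1 else 0 :: real)" for l v
  define E where "E v = (if 2 dvd q then (if even v then 1 else 0) else 1 :: real)" for v :: int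
  define g where "g v = of_real (G v) * ee (of_int (a * v) / real q)" for v
  have per: "g x = g y" if xy: "[x = y] (mod int q)" for x y
  proof -
    have "local_weight l x = local_weight l y" if "l \<in> D" for l
      by (rule local_weight_cong[OF cong_dvd_modulus[OF xy]]) (use lD(1)[OF that] in simp)
    hence "G x = G y" unfolding G_def by (intro prod.cong refl) simp
    thus ?thesis using ee_cong[OF q cong_scalar_left[OF xy]] by (simp add: g_def)
  qed
  have expand: "(\<Sum>P\<in>Pow D. weight_on P v) = G v" for v
    unfolding G_def weight_on_def using prod_add[OF finD, of "\<lambda>l. local_weight l v" "\<lambda>_. 1"]
    by (simp add: add.commute)
  \<comment> \<open>This identity of local factors is what the local weight is designed for.\<close>
  have loc: "coprime_factor l v * (1 + local_weight l v) = (1 - 1 / real l) * H l v" if l: "l \<in> D" for l v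
  proof (cases "int l dvd v - 1")
    case True
    have "\<not> int l dvd v"
    proof
      assume "int l dvd v"
      hence "int l dvd v - (v - 1)" using True by (rule dvd_diff)
      thus False using lD(3)[OF l] by simp
    qed
    moreover have "\<not> int l dvd v + 1"
    proof
      assume "int l dvd v + 1"
      hence "int l dvd (v + 1) - (v - 1)" using True by (rule dvd_diff)
      hence "int l dvd 2" by simp
      thus False using lD(3)[OF l] zdvd_imp_le[of "int l" 2] by simp
    qed
    ultimately show ?thesis using True by (simp add: H_def coprime_factor_def)
  next
    case False
    thus ?thesis by (simp add: H_def coprime_factor_def local_weight_def algebra_simps)
  qed
  have fac: "(\<Prod>l\<in>prime_factors q. coprime_factor l v) * G v = E v * (\<Prod>l\<in>D. (1 - 1 / real l) * H l v)" for v
  proof -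
    have "(\<Prod>l\<in>prime_factors q. coprime_factor l v) = (\<Prod>l\<in>prime_factors q - D. coprime_factor l v) * (\<Prod>l\<in>D. coprime_factor l v)"
      by (rule prod.subset_diff[OF Dq]) simp
    also have "(\<Prod>l\<in>prime_factors q - D. coprime_factor l v) = E v"
    proof (cases "2 dvd q")
      case True
      have "prime_factors q - D = {2}"
      proof -
        have "l = 2" if "prime l" "even l" for l :: nat using that primes_dvd_imp_eq two_is_prime_nat by blast
        thus ?thesis using True q by (auto simp: D_def odd_prime_factors_def in_prime_factors_iff)
      qed
      thus ?thesis using True by (simp add: E_def coprime_factor_def)
    next
      case False
      have e: "prime_factors q - D = {}"
        using False by (auto simp: D_def odd_prime_factors_def in_prime_factors_iff dest: dvd_trans)
      show ?thesis unfolding e using False by (simp add: E_def)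
    qed
    finally have "(\<Prod>l\<in>prime_factors q. coprime_factor l v) * G v = E v * (\<Prod>l\<in>D. coprime_factor l v * (1 + local_weight l v))"
      unfolding G_def prod.distrib by simp
    also have "(\<Prod>l\<in>D. coprime_factor l v * (1 + local_weight l v)) = (\<Prod>l\<in>D. (1 - 1 / real l) * H l v)"
      by (intro prod.cong refl loc)
    finally show ?thesis .
  qed
  define W where "W v = complex_of_real (E v) * (\<Prod>l\<in>D. of_real (1 - 1 / real l) * of_real (H l v))" for v
  have "pos_def q (\<lambda>v. complex_of_real (E v))"
    using pos_def_even_indicator[OF q] pos_def_1[of q] by (cases "2 dvd q") (simp_all add: E_def)
  moreover have "pos_def q (\<lambda>v. \<Prod>l\<in>D. complex_of_real (1 - 1 / real l) * of_real (H l v))"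
  proof (rule pos_def_prod[OF finD])
    fix l assume l: "l \<in> D"
    show "pos_def q (\<lambda>v. complex_of_real (1 - 1 / real l) * of_real (H l v))"
      unfolding H_def
      by (rule pos_def_scale[OF _ pos_def_dvd_indicator_combination[OF q lD(1)[OF l]]]) (use lD(3)[OF l] in simp)
  qed
  ultimately have "pos_def q W" unfolding W_def by (rule pos_def_mult)
  then obtain s where s: "s \<ge> 0" "(\<Sum>v\<in>{0..<int q}. W v * ee (of_int (a * v) / real q)) = of_real s"
    using pos_def_sum_nonneg[OF q] by blast
  have "(\<Sum>P\<in>Pow D. unit_average q (\<lambda>u. of_real (weight_on P (u + 1)) * ee (of_int (a * (u + 1)) / real q))) =
     (\<Sum>P\<in>Pow D. \<Sum>u\<in>unit_residues q. of_real (weight_on P (u + 1)) * ee (of_int (a * (u + 1)) / real q)) / of_nat (card (unit_residues q))"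
    unfolding unit_average_def sum_divide_distrib ..
  also have "(\<Sum>P\<in>Pow D. \<Sum>u\<in>unit_residues q. of_real (weight_on P (u + 1)) * ee (of_int (a * (u + 1)) / real q)) =
     (\<Sum>u\<in>unit_residues q. \<Sum>P\<in>Pow D. of_real (weight_on P (u + 1)) * ee (of_int (a * (u + 1)) / real q))"
    by (rule sum.swap)
  also have "\<dots> = (\<Sum>u\<in>unit_residues q. g (u + 1))"
    unfolding g_def expand[symmetric] of_real_sum sum_distrib_right ..
  also have "\<dots> = (\<Sum>v\<in>{0..<int q}. of_real (\<Prod>l\<in>prime_factors q. coprime_factor l v) * g v)"
    by (rule sum_unit_residues_shift[OF q per])
  also have "\<dots> = (\<Sum>v\<in>{0..<int q}. W v * ee (of_int (a * v) / real q))"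
  proof (rule sum.cong[OF refl])
    fix v
    have "of_real (\<Prod>l\<in>prime_factors q. coprime_factor l v) * g v =
       of_real ((\<Prod>l\<in>prime_factors q. coprime_factor l v) * G v) * ee (of_int (a * v) / real q)"
      unfolding g_def of_real_mult mult.assoc ..
    also have "of_real ((\<Prod>l\<in>prime_factors q. coprime_factor l v) * G v) = W v"
      unfolding fac W_def of_real_mult of_real_prod ..
    finally show "of_real (\<Prod>l\<in>prime_factors q. coprime_factor l v) * g v = W v * ee (of_int (a * v) / real q)" .
  qed
  also have "\<dots> = of_real s" by (rule s(2))
  finally show ?thesis unfolding D_def[symmetric] using s(1)
    by (intro exI[of _ "s / real (card (unit_residues q))"]) simp
qed

section \<open>Primes weighted by a periodic function\<close>

text \<open>
  The product of the primes dividing \<open>m\<close> is at most \<open>m\<close>.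
\<close>

lemma sum_ln_prime_divisors_le:
  assumes m: "m \<ge> (1::nat)"
  shows "(\<Sum>p\<in>prime_factors m. ln (real p)) \<le> ln (real m)"
proof -
  have pos: "real p > 0" if "p \<in> prime_factors m" for p
    using that prime_gt_0_nat[of p] by (simp add: in_prime_factors_iff)
  have "(\<Sum>p\<in>prime_factors m. ln (real p)) = ln (\<Prod>p\<in>prime_factors m. real p)"
    using pos by (subst ln_prod) auto
  also have "\<dots> = ln (real (\<Prod>(prime_factors m)))" by simp
  also have "\<dots> \<le> ln (real m)"
  proof -
    have "\<Prod>(prime_factors m) > 0" using pos by (intro prod_pos) auto
    moreover have "\<Prod>(prime_factors m) \<le> m" using prod_prime_factors_le[OF m order_refl] .
    ultimately show ?thesis by (subst ln_le_cancel_iff) (simp_all only: of_nat_0_less_iff of_nat_le_iff)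
  qed
  finally show ?thesis .
qed

lemma char_coeff_principal: "char_coeff m c (principal_char m) = unit_average m c"
  unfolding char_coeff_def unit_average_def
  by (rule arg_cong[of _ _ "\<lambda>x. x / _"], rule sum.cong[OF refl]) (simp add: principal_char_def unit_residues_def)

text \<open>
  Expand \<open>c\<close> on the units into characters. The principal character gives the main term,
  the errors add up to at most \<open>B \<surd>m\<close> times the error for one character, and the
  primes dividing \<open>m\<close>, which the characters do not see, contribute at most \<open>B k
  log m\<close>.
\<close>

lemma periodic_prime_sum:
  assumes K: "prime_sum_bound K" "K > 0"
    and m: "m \<ge> 1" and c: "\<And>x y. [x = y] (mod int m) \<Longrightarrow> c x = c y" and B: "\<And>v. norm (c v) \<le> B" and k: "k \<ge> 1"
  shows "norm ((\<Sum>p | prime p \<and> p \<le> k. of_real (ln (real p) * (real k - real p)) * c (int p)) -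
      unit_average m c * of_real ((real k)\<^sup>2 / 2)) \<le> (K + 1) * B * sqrt (real m) * ln (real m + 2) * real k powr (31 / 20)"
proof -
  define S where "S = {p. prime p \<and> p \<le> k}"
  define w where "w p = ln (real p) * (real k - real p)" for p
  define T where "T chi = (\<Sum>p\<in>S. of_real (w p) * chi (int p))" for chi :: "int \<Rightarrow> complex"
  define Y where "Y = ln (real m + 2) * real k powr (31 / 20)"
  define D where "D = (\<Sum>p\<in>S. if p dvd m then of_real (w p) * c (int p) else 0)"
  have finS: "finite S" unfolding S_def by (rule finite_subset[of _ "{..k}"]) auto
  have pS: "prime p" "p \<le> k" "p \<ge> 1" if "p \<in> S" for p using that prime_ge_1_nat by (auto simp: S_def)
  have B0: "B \<ge> 0" using B[of 0] norm_ge_zero[of "c 0"] by linarith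
  have Y0: "Y \<ge> 0" unfolding Y_def by (intro mult_nonneg_nonneg) auto
  have point: "of_real (w p) * c (int p) = (\<Sum>chi\<in>characters m. char_coeff m c chi * (of_real (w p) * chi (int p))) +
      (if p dvd m then of_real (w p) * c (int p) else 0)" if p: "p \<in> S" for p
  proof (cases "p dvd m")
    case True
    hence nc: "\<not> coprime (int p) (int m)" using pS(1)[OF p] by (auto simp: coprime_absorb_left)
    have "(\<Sum>chi\<in>characters m. char_coeff m c chi * (of_real (w p) * chi (int p))) = 0"
    proof (rule sum.neutral, rule ballI)
      fix chi assume "chi \<in> characters m"
      hence "chi (int p) = 0" using nc unfolding characters_def dirichlet_character_def by blast
      thus "char_coeff m c chi * (of_real (w p) * chi (int p)) = 0" by simp
    qed
    thus ?thesis using True by simp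
  next
    case False
    hence "coprime p m" using pS(1)[OF p] by (rule prime_imp_coprime[rotated])
    hence cop: "coprime (int p) (int m)" by simp
    have "c (int p) = (\<Sum>chi\<in>characters m. char_coeff m c chi * chi (int p))" by (rule char_expansion[OF m _ cop]) (rule c)
    hence "of_real (w p) * c (int p) = (\<Sum>chi\<in>characters m. char_coeff m c chi * (of_real (w p) * chi (int p)))"
      by (simp only: sum_distrib_left mult.left_commute)
    thus ?thesis using False by simp
  qed
  have "(\<Sum>p\<in>S. of_real (w p) * c (int p)) =
      (\<Sum>p\<in>S. (\<Sum>chi\<in>characters m. char_coeff m c chi * (of_real (w p) * chi (int p))) +
      (if p dvd m then of_real (w p) * c (int p) else 0))"
    by (rule sum.cong[OF refl point])
  also have "\<dots> = (\<Sum>p\<in>S. \<Sum>chi\<in>characters m. char_coeff m c chi * (of_real (w p) * chi (int p))) + D"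
    unfolding D_def by (rule sum.distrib)
  also have "(\<Sum>p\<in>S. \<Sum>chi\<in>characters m. char_coeff m c chi * (of_real (w p) * chi (int p))) =
      (\<Sum>chi\<in>characters m. char_coeff m c chi * T chi)"
    unfolding T_def sum_distrib_left by (rule sum.swap)
  finally have expand: "(\<Sum>p\<in>S. of_real (w p) * c (int p)) = (\<Sum>chi\<in>characters m. char_coeff m c chi * T chi) + D" .
  have main: "(\<Sum>chi\<in>characters m. char_coeff m c chi * (of_nat (pole_order m chi) * of_real ((real k)\<^sup>2 / 2))) =
      unit_average m c * of_real ((real k)\<^sup>2 / 2)"
  proof -
    have "principal_char m \<in> characters m" using dirichlet_character_principal[OF m] by (simp add: characters_def)
    moreover have "(\<Sum>chi\<in>characters m. char_coeff m c chi * (of_nat (pole_order m chi) * of_real ((real k)\<^sup>2 / 2))) =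
      (\<Sum>chi\<in>characters m. if chi = principal_char m then char_coeff m c chi * of_real ((real k)\<^sup>2 / 2) else 0)"
      by (rule sum.cong[OF refl]) (simp add: pole_order_def)
    ultimately show ?thesis using finite_characters by (simp add: char_coeff_principal)
  qed
  have Tb: "norm (T chi - of_nat (pole_order m chi) * of_real ((real k)\<^sup>2 / 2)) \<le> K * Y" if "chi \<in> characters m" for chi
  proof -
    have "dirichlet_character m chi" using that by (simp add: characters_def)
    thus ?thesis using K(1) k unfolding prime_sum_bound_def T_def S_def w_def Y_def mult.assoc by blast
  qed
  define Z where "Z = (\<Sum>chi\<in>characters m. char_coeff m c chi * (T chi - of_nat (pole_order m chi) * of_real ((real k)\<^sup>2 / 2)))"
  have Z: "norm Z \<le> B * sqrt (real m) * (K * Y)"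
  proof -
    have "norm Z \<le> (\<Sum>chi\<in>characters m. norm (char_coeff m c chi) * (K * Y))"
      unfolding Z_def by (rule sum_norm_le) (use Tb in \<open>simp add: norm_mult mult_left_mono\<close>)
    also have "\<dots> = (\<Sum>chi\<in>characters m. norm (char_coeff m c chi)) * (K * Y)" by (simp only: sum_distrib_right)
    also have "\<dots> \<le> B * sqrt (real m) * (K * Y)"
      using K(2) Y0 by (intro mult_right_mono sum_norm_char_coeff_le[OF m B]) auto
    finally show ?thesis .
  qed
  have D: "norm D \<le> B * sqrt (real m) * Y"
  proof -
    have "norm D \<le> (\<Sum>p\<in>S. if p dvd m then ln (real p) * (real k * B) else 0)"
      unfolding D_def
    proof (rule sum_norm_le)
      fix p assume p: "p \<in> S"
      have l: "ln (real p) \<ge> 0" using pS(3)[OF p] by simp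
      have "norm (complex_of_real (w p)) \<le> ln (real p) * real k"
        unfolding norm_of_real w_def abs_mult using l pS(2)[OF p] by (intro mult_mono) auto
      hence "norm (of_real (w p) * c (int p)) \<le> ln (real p) * real k * B"
        unfolding norm_mult using B B0 l by (intro mult_mono) auto
      thus "norm (if p dvd m then of_real (w p) * c (int p) else 0) \<le> (if p dvd m then ln (real p) * (real k * B) else 0)"
        by (simp add: mult.assoc)
    qed
    also have "\<dots> = (\<Sum>p\<in>S \<inter> {p. p dvd m}. ln (real p) * (real k * B))"
      using finS by (simp add: sum.inter_restrict)
    also have "\<dots> \<le> (\<Sum>p\<in>prime_factors m. ln (real p) * (real k * B))"
      by (rule sum_mono2) (use m B0 in \<open>auto simp: S_def in_prime_factors_iff prime_ge_1_nat\<close>)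
    also have "\<dots> = (\<Sum>p\<in>prime_factors m. ln (real p)) * (real k * B)" by (simp only: sum_distrib_right)
    also have "\<dots> \<le> ln (real m) * (real k * B)"
      using B0 by (intro mult_right_mono sum_ln_prime_divisors_le m) auto
    also have "\<dots> \<le> ln (real m + 2) * (real k powr (31 / 20) * (B * sqrt (real m)))"
    proof (intro mult_mono)
      show "real k \<le> real k powr (31 / 20)" using powr_mono[of 1 "31 / 20" "real k"] k by simp
      show "B \<le> B * sqrt (real m)" using B0 m mult_left_mono[of 1 "sqrt (real m)" B] by simp
    qed (use m B0 in auto)
    finally show ?thesis by (simp add: Y_def mult_ac)
  qed
  have "(\<Sum>p\<in>S. of_real (w p) * c (int p)) - unit_average m c * of_real ((real k)\<^sup>2 / 2) = Z + D"
    unfolding expand main[symmetric] Z_def right_diff_distrib sum_subtractf by simp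
  hence "norm ((\<Sum>p\<in>S. of_real (w p) * c (int p)) - unit_average m c * of_real ((real k)\<^sup>2 / 2)) \<le>
      B * sqrt (real m) * (K * Y) + B * sqrt (real m) * Y"
    using norm_triangle_mono[OF Z D] by simp
  also have "\<dots> = (K + 1) * B * sqrt (real m) * Y" by (simp add: algebra_simps)
  finally show ?thesis unfolding S_def w_def Y_def by (simp only: mult.assoc)
qed

section \<open>The exponential sum near a rational\<close>

definition prime_exp_sum :: "nat \<Rightarrow> nat set \<Rightarrow> real \<Rightarrow> complex" where
  "prime_exp_sum X P \<theta> = (\<Sum>n | n < X \<and> prime n.
     of_real (ln (real n) * weight_on P (int n + 1) * (real X - real n)) * ee (real (n + 1) * \<theta>))"

definition tent_sum :: "nat \<Rightarrow> real \<Rightarrow> complex" where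
  "tent_sum X b = (\<Sum>n=1..<X. tent X b n) + tent X b 0 / 2"

text \<open>
  Double summation by parts turns the smoothed sums of \<open>periodic_prime_sum\<close> into the
  twisted sum. The factor \<open>ee b\<close> comes from the shift \<open>n + 1\<close> in the
  phase.
\<close>

lemma prime_exp_sum_approx:
  fixes a :: int
  assumes K: "prime_sum_bound K" "K > 0" and X: "X \<ge> 1"
    and m: "m \<ge> 1" and q: "q \<ge> 1" "q dvd m" and P: "finite P" "\<And>l. l \<in> P \<Longrightarrow> l dvd m" "\<And>l. l \<in> P \<Longrightarrow> l \<ge> 2"
  defines "c \<equiv> (\<lambda>u. of_real (weight_on P (u + 1)) * ee (of_int (a * (u + 1)) / real q))"
  shows "norm (prime_exp_sum X P (of_int a / real q + b) - ee b * unit_average m c * tent_sum X b) \<le>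
     64 * (K + 1) * 2 ^ card P * sqrt (real m) * ln (real m + 2) * real X powr (31 / 20) * (1 + real X * \<bar>b\<bar>)\<^sup>2"
proof -
  define E where "E = (K + 1) * 2 ^ card P * sqrt (real m) * ln (real m + 2) * real X powr (31 / 20)"
  define A where "A = unit_average m c"
  define f where "f n = (if prime n then of_real (ln (real n)) * c (int n) else 0)" for n :: nat
  define F where "F = tent X b"
  have F0: "F X = 0" "F (X + 1) = 0" by (simp_all add: F_def tent_def)
  have per: "c x = c y" if xy: "[x = y] (mod int m)" for x y
  proof -
    have xy1: "[x + 1 = y + 1] (mod int m)" using xy by (intro cong_add) auto
    hence xq: "[x + 1 = y + 1] (mod int q)" by (rule cong_dvd_modulus) (use q in simp)
    show ?thesis unfolding c_def using weight_on_cong[OF P(2) xy1] ee_cong[OF q(1) cong_scalar_left[OF xq]] by simp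
  qed
  have nc: "norm (c v) \<le> 2 ^ card P" for v
    using abs_weight_on_le[OF P(1,3), of "v + 1"] by (simp add: c_def norm_mult)
  have Tk: "norm ((\<Sum>n\<le>k. f n * of_nat (k - n)) - A * (of_nat k ^ 2 / 2)) \<le> E" if k: "k \<in> {1..X}" for k
  proof -
    have "(\<Sum>n\<le>k. f n * of_nat (k - n)) = (\<Sum>p | prime p \<and> p \<le> k. of_real (ln (real p) * (real k - real p)) * c (int p))"
      by (rule sum.mono_neutral_cong_right) (auto simp: f_def of_nat_diff)
    hence "norm ((\<Sum>n\<le>k. f n * of_nat (k - n)) - A * (of_nat k ^ 2 / 2)) \<le>
      (K + 1) * 2 ^ card P * sqrt (real m) * ln (real m + 2) * real k powr (31 / 20)"
      using periodic_prime_sum[OF K m per nc, where k = k] k by (simp add: A_def)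
    also have "\<dots> \<le> E" unfolding E_def using k K(2) by (intro mult_left_mono powr_mono2) auto
    finally show ?thesis .
  qed
  have "(\<Sum>n<X. f n * F n) - A * tent_sum X b =
     (\<Sum>k=1..X. (\<Sum>n\<le>k. f n * of_nat (k - n)) * second_diff F k) - A * (\<Sum>k=1..X. of_nat k ^ 2 / 2 * second_diff F k)"
    unfolding sum_second_diff[of F X f, OF F0] sum_second_diff_quadratic[OF F0 X] by (simp add: tent_sum_def F_def)
  also have "\<dots> = (\<Sum>k=1..X. ((\<Sum>n\<le>k. f n * of_nat (k - n)) - A * (of_nat k ^ 2 / 2)) * second_diff F k)"
    by (simp only: sum_distrib_left left_diff_distrib sum_subtractf mult.assoc)
  finally have "norm ((\<Sum>n<X. f n * F n) - A * tent_sum X b) =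
    norm (\<Sum>k=1..X. ((\<Sum>n\<le>k. f n * of_nat (k - n)) - A * (of_nat k ^ 2 / 2)) * second_diff F k)" by simp
  also have "\<dots> \<le> (\<Sum>k=1..X. E * norm (second_diff F k))"
    by (rule sum_norm_le) (use Tk in \<open>simp add: norm_mult mult_right_mono\<close>)
  also have "\<dots> = E * (\<Sum>k=1..X. norm (second_diff F k))" by (simp only: sum_distrib_left)
  also have "\<dots> \<le> E * (64 * (1 + real X * \<bar>b\<bar>)\<^sup>2)"
    unfolding F_def using K(2) by (intro mult_left_mono tent_second_diff_sum_le[OF X]) (simp add: E_def)
  finally have n: "norm ((\<Sum>n<X. f n * F n) - A * tent_sum X b) \<le> E * (64 * (1 + real X * \<bar>b\<bar>)\<^sup>2)" .
  have "prime_exp_sum X P (of_int a / real q + b) = (\<Sum>n<X. ee b * (f n * F n))"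
    unfolding prime_exp_sum_def
  proof (rule sum.mono_neutral_cong_left)
    fix n assume n: "n \<in> {n. n < X \<and> prime n}"
    have "ee (real (n + 1) * (of_int a / real q + b)) = ee (of_int (a * (int n + 1)) / real q) * (ee (real n * b) * ee b)"
      unfolding ee_add[symmetric] by (rule arg_cong[of _ _ ee]) (simp add: algebra_simps add_divide_distrib)
    thus "of_real (ln (real n) * weight_on P (int n + 1) * (real X - real n)) * ee (real (n + 1) * (of_int a / real q + b)) =
       ee b * (f n * F n)"
      using n by (simp add: f_def F_def c_def tent_def of_nat_diff)
  qed (auto simp: f_def)
  also have "\<dots> = ee b * (\<Sum>n<X. f n * F n)" by (simp only: sum_distrib_left)
  finally have "prime_exp_sum X P (of_int a / real q + b) - ee b * unit_average m c * tent_sum X b =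
     ee b * ((\<Sum>n<X. f n * F n) - A * tent_sum X b)" by (simp add: A_def right_diff_distrib)
  hence "norm (prime_exp_sum X P (of_int a / real q + b) - ee b * unit_average m c * tent_sum X b) =
     norm ((\<Sum>n<X. f n * F n) - A * tent_sum X b)" by (simp add: norm_mult)
  also note n
  finally show ?thesis by (simp only: E_def mult_ac)
qed

lemma rational_approx:
  fixes \<theta> Q :: real
  assumes Q: "Q \<ge> 1"
  shows "\<exists>a q b. \<theta> = of_int a / real q + b \<and> coprime a (int q) \<and> q \<ge> 1 \<and> real q \<le> Q \<and> \<bar>b\<bar> \<le> 2 / (real q * Q)"
proof -
  \<comment> \<open>The integer part loses at most a factor 2, which is the 2 in the conclusion.\<close>
  define N where "N = nat \<lfloor>Q\<rfloor>"
  have "\<lfloor>Q\<rfloor> \<ge> 1" using Q by (simp add: le_floor_iff)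
  hence "real N = of_int \<lfloor>Q\<rfloor>" "real N \<ge> 1" by (simp_all add: N_def)
  hence N: "N > 0" "real N \<le> Q" "Q \<le> 2 * real N" using floor_correct[of Q] by linarith+
  show ?thesis
  proof (rule Dirichlet_approx_coprime[OF N(1), of \<theta>])
    fix h k :: int assume hk: "coprime h k" "0 < k" "k \<le> int N" "\<bar>of_int k * \<theta> - of_int h\<bar> < 1 / real N"
    define q where "q = nat k"
    have q: "int q = k" "real q = of_int k" "q \<ge> 1" using hk(2) by (simp_all add: q_def)
    define b where "b = \<theta> - of_int h / real q"
    have q0: "real q > 0" using q(3) by simp
    have "\<bar>real q * b\<bar> < 1 / real N" using hk(4) q(2) q0 by (simp add: b_def right_diff_distrib)
    also have "1 / real N \<le> 2 / Q" using N Q by (simp add: field_simps)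
    finally have "real q * \<bar>b\<bar> \<le> 2 / Q" using q0 by (simp add: abs_mult)
    hence "\<bar>b\<bar> \<le> 2 / (real q * Q)" using q0 Q by (simp add: field_simps)
    moreover have "real q \<le> Q" using hk(3) q(2) N(2) by linarith
    moreover have "coprime h (int q)" unfolding q(1) by (rule hk(1))
    moreover have "\<theta> = of_int h / real q + b" by (simp add: b_def)
    ultimately show ?thesis using q(3) by blast
  qed
qed

lemma norm_tent_sum: "X \<ge> 1 \<Longrightarrow> norm (tent_sum X b) \<le> (real X)\<^sup>2"
  unfolding tent_sum_def by (rule norm_tent_sum_le)

text \<open>
  The bookkeeping of exponents. Writing \<open>x\<close> for \<open>N\<close>, the factors
  \<open>2\<^sup>k\<close> and \<open>\<surd>m / \<surd>q\<close> cost \<open>1/120\<close> each and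
  the logarithm \<open>1/200\<close>. The product of \<open>\<surd>q\<close> and \<open>(1 + x
  |b|)\<^sup>2\<close> costs \<open>2/5\<close>: with \<open>t = x\<^sup>1\<^sup>/\<^sup>5\<close>
  one has \<open>\<surd>q \<le> t\<^sup>2\<close> and \<open>x |b| \<le> 2 t / q\<close>. Together
  with \<open>31/20\<close> this leaves room for the \<open>1/60\<close> that the number of sets
  \<open>P\<close> costs later.
\<close>

lemma error_term_bound:
  fixes b :: real and N q m d :: nat
  assumes N: "N \<ge> 1" and K: "K > 0" and C: "C > 0"
    and q: "q \<ge> 1" "real q \<le> real N powr (4 / 5)" and b: "\<bar>b\<bar> \<le> 2 / (real q * real N powr (4 / 5))"
    and pi: "real d \<le> real N powr (1 / 60)" and u: "2 ^ k \<le> C * real d powr (1 / 2)" and m: "m \<le> q * d"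
  shows "64 * (K + 1) * 2 ^ k * sqrt (real m) * ln (real m + 2) * real N powr (31 / 20) * (1 + real N * \<bar>b\<bar>)\<^sup>2
    \<le> 384000 * (K + 1) * C * real N powr (179 / 90 - 1 / 60)"
proof -
  define x where "x = real N"
  have x: "x \<ge> 1" using N by (simp add: x_def)
  have "real d powr (1 / 2) \<le> (x powr (1 / 60)) powr (1 / 2)" using pi by (intro powr_mono2) (auto simp: x_def)
  also have "\<dots> = x powr (1 / 120)" by (simp add: powr_powr)
  finally have p: "real d powr (1 / 2) \<le> x powr (1 / 120)" .
  have e1: "2 ^ k \<le> C * x powr (1 / 120)" using u mult_left_mono[OF p, of C] C by linarith
  have m': "real m \<le> real q * real d" using m by (metis of_nat_le_iff of_nat_mult)
  have "sqrt (real m) \<le> sqrt (real q * real d)" using m' by simp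
  also have "\<dots> = sqrt (real q) * real d powr (1 / 2)" by (simp add: real_sqrt_mult powr_half_sqrt)
  also have "\<dots> \<le> sqrt (real q) * x powr (1 / 120)" using p by (intro mult_left_mono) auto
  finally have e2: "sqrt (real m) \<le> sqrt (real q) * x powr (1 / 120)" .
  have e3: "ln (real m + 2) \<le> 600 * x powr (1 / 200)"
  proof -
    have "real m \<le> x powr (4 / 5) * x powr (1 / 60)"
      using m' mult_mono[OF q(2) pi] by (simp add: x_def)
    also have "\<dots> = x powr (4 / 5 + 1 / 60)" by (simp only: powr_add)
    also have "\<dots> \<le> x powr 1" using x by (intro powr_mono) auto
    finally have "real m + 2 \<le> 3 * x" using x by simp
    hence "ln (real m + 2) \<le> ln (3 * x)" by simp
    also have "\<dots> \<le> (3 * x) powr (1 / 200) / (1 / 200)" using x by (intro ln_powr_bound) auto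
    also have "\<dots> = 200 * (3 powr (1 / 200) * x powr (1 / 200))" using x by (simp add: powr_mult)
    also have "\<dots> \<le> 200 * (3 * x powr (1 / 200))"
      using powr_mono[of "1 / 200" 1 "3 :: real"] by (intro mult_left_mono mult_right_mono) auto
    finally show ?thesis by simp
  qed
  have e4: "sqrt (real q) * (1 + x * \<bar>b\<bar>)\<^sup>2 \<le> 10 * x powr (2 / 5)"
  proof -
    define y where "y = real q"
    have y: "y \<ge> 1" using q by (simp add: y_def)
    define t where "t = x powr (1 / 5)"
    have t0: "t > 0" using x by (simp add: t_def)
    have t2: "t\<^sup>2 = x powr (2 / 5)" unfolding t_def power2_eq_square powr_add[symmetric] by simp
    have "x * \<bar>b\<bar> \<le> x * (2 / (y * x powr (4 / 5)))" using b x by (intro mult_left_mono) (auto simp: x_def y_def)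
    also have "\<dots> = 2 * (x powr 1 / x powr (4 / 5)) / y" using x by (simp add: mult_ac)
    also have "x powr 1 / x powr (4 / 5) = t" unfolding powr_diff[symmetric] t_def by simp
    finally have xb: "x * \<bar>b\<bar> \<le> 2 * t / y" .
    have "(1 + x * \<bar>b\<bar>)\<^sup>2 \<le> (1 + 2 * t / y)\<^sup>2" using xb x by (intro power_mono) auto
    also have "\<dots> \<le> 2 + 2 * (2 * t / y)\<^sup>2"
      using zero_le_power2[of "1 - 2 * t / y"] by (simp add: power2_diff power2_sum)
    also have "2 + 2 * (2 * t / y)\<^sup>2 = 2 + 8 * t\<^sup>2 / y\<^sup>2" by (simp add: power_divide power_mult_distrib)
    finally have "sqrt y * (1 + x * \<bar>b\<bar>)\<^sup>2 \<le> sqrt y * (2 + 8 * t\<^sup>2 / y\<^sup>2)" using y by (intro mult_left_mono) auto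
    also have "\<dots> = 2 * sqrt y + 8 * t\<^sup>2 * (sqrt y / y\<^sup>2)" by (simp add: algebra_simps)
    finally have s0: "sqrt y * (1 + x * \<bar>b\<bar>)\<^sup>2 \<le> 2 * sqrt y + 8 * t\<^sup>2 * (sqrt y / y\<^sup>2)" .
    have s1: "sqrt y \<le> t\<^sup>2"
    proof -
      have "sqrt y = y powr (1 / 2)" using y by (simp add: powr_half_sqrt)
      also have "\<dots> \<le> (x powr (4 / 5)) powr (1 / 2)" using q y by (intro powr_mono2) (auto simp: x_def y_def)
      also have "\<dots> = t\<^sup>2" unfolding t2 by (simp add: powr_powr)
      finally show ?thesis .
    qed
    have s2: "8 * t\<^sup>2 * (sqrt y / y\<^sup>2) \<le> 8 * t\<^sup>2 * 1"
    proof (rule mult_left_mono)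
      have "y ^ 1 \<le> y ^ 4" using y by (intro power_increasing) auto
      hence "sqrt y \<le> y\<^sup>2" using y by (intro real_le_lsqrt) (simp_all add: power_mult[symmetric])
      thus "sqrt y / y\<^sup>2 \<le> 1" using y by simp
    qed simp
    have "sqrt y * (1 + x * \<bar>b\<bar>)\<^sup>2 \<le> 10 * t\<^sup>2" using s0 s1 s2 by linarith
    thus ?thesis by (simp only: t2 y_def)
  qed
  define Y where "Y = x powr (31 / 20)"
  have Y0: "Y \<ge> 0" by (simp add: Y_def)
  have m2: "ln (real m + 2) \<ge> 0" by simp
  have "2 ^ k * sqrt (real m) \<le> (C * x powr (1 / 120)) * (sqrt (real q) * x powr (1 / 120))"
    using C by (intro mult_mono e1 e2) auto
  hence "2 ^ k * sqrt (real m) * ln (real m + 2) \<le> (C * x powr (1 / 120)) * (sqrt (real q) * x powr (1 / 120)) * (600 * x powr (1 / 200))"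
    by (rule mult_mono[OF _ e3]) (use C m2 in auto)
  hence "2 ^ k * sqrt (real m) * ln (real m + 2) * (1 + x * \<bar>b\<bar>)\<^sup>2 \<le>
     (C * x powr (1 / 120)) * (sqrt (real q) * x powr (1 / 120)) * (600 * x powr (1 / 200)) * (1 + x * \<bar>b\<bar>)\<^sup>2"
    by (intro mult_right_mono) auto
  also have "\<dots> = 600 * C * (x powr (1 / 120) * x powr (1 / 120) * x powr (1 / 200)) * (sqrt (real q) * (1 + x * \<bar>b\<bar>)\<^sup>2)"
    by (simp only: mult_ac)
  also have "\<dots> \<le> 600 * C * (x powr (1 / 120) * x powr (1 / 120) * x powr (1 / 200)) * (10 * x powr (2 / 5))"
    using C by (intro mult_left_mono e4) auto
  finally have "2 ^ k * sqrt (real m) * ln (real m + 2) * (1 + x * \<bar>b\<bar>)\<^sup>2 \<le> 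
     600 * C * (x powr (1 / 120) * x powr (1 / 120) * x powr (1 / 200)) * (10 * x powr (2 / 5))" .
  hence "64 * (K + 1) * Y * (2 ^ k * sqrt (real m) * ln (real m + 2) * (1 + x * \<bar>b\<bar>)\<^sup>2) \<le>
     64 * (K + 1) * Y * (600 * C * (x powr (1 / 120) * x powr (1 / 120) * x powr (1 / 200)) * (10 * x powr (2 / 5)))"
    using K Y0 by (intro mult_left_mono) auto
  also have "\<dots> = 384000 * (K + 1) * C * (x powr (1 / 120) * x powr (1 / 120) * x powr (1 / 200) * x powr (2 / 5) * Y)"
    by simp
  also have "x powr (1 / 120) * x powr (1 / 120) * x powr (1 / 200) * x powr (2 / 5) * Y =
     x powr (1 / 120 + 1 / 120 + 1 / 200 + 2 / 5 + 31 / 20)" by (simp only: Y_def powr_add)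
  also have "384000 * (K + 1) * C * x powr (1 / 120 + 1 / 120 + 1 / 200 + 2 / 5 + 31 / 20) \<le> 384000 * (K + 1) * C * x powr (179 / 90 - 1 / 60)"
    using x K C by (intro mult_left_mono powr_mono) auto
  finally show ?thesis by (simp only: Y_def x_def mult_ac)
qed

text \<open>
  A common period of \<open>weight_on P\<close> and of \<open>e(a v/q)\<close>. When all primes of
  \<open>P\<close> divide \<open>q\<close> it is \<open>q\<close> itself, so that the averages for
  different such \<open>P\<close> can be added; otherwise a prime \<open>l \<in> P\<close> not
  dividing \<open>q\<close> divides the period exactly once.
\<close>

definition sieve_modulus :: "nat \<Rightarrow> nat set \<Rightarrow> nat" where
  "sieve_modulus q P = (if P \<subseteq> prime_factors q then q else q * \<Prod>P)"

definition sieve_average :: "int \<Rightarrow> nat \<Rightarrow> nat set \<Rightarrow> complex" where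
  "sieve_average a q P = unit_average (sieve_modulus q P) (\<lambda>u. of_real (weight_on P (u + 1)) * ee (of_int (a * (u + 1)) / real q))"

text \<open>
  Split off a prime of \<open>P\<close> that does not divide \<open>q\<close>.
\<close>

lemma sieve_average_zero:
  assumes q: "q \<ge> 1" and P: "P \<in> sieve_sets R" and n: "\<not> P \<subseteq> prime_factors q"
  shows "sieve_average a q P = 0"
proof -
  obtain l where l: "l \<in> P" "l \<notin> prime_factors q" using n by blast
  note P' = sieve_setsD[OF P]
  have pl: "prime l" "odd l" using P'(2,3) l(1) by auto
  define D where "D = P - {l}"
  define m where "m = q * \<Prod>D"
  have D: "finite D" "\<And>r. r \<in> D \<Longrightarrow> prime r" "l \<notin> D" using P' by (auto simp: D_def)
  have ins: "P = insert l D" using l by (auto simp: D_def)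
  have D0: "\<Prod>D > 0" using D by (intro prod_pos) (auto simp: prime_gt_0_nat)
  have m1: "m \<ge> 1" using q D0 by (simp add: m_def)
  have "sieve_modulus q P = q * \<Prod>P" using n by (simp add: sieve_modulus_def)
  also have "\<Prod>P = l * \<Prod>D" unfolding ins using D by simp
  finally have sm: "sieve_modulus q P = l * m" by (simp only: m_def mult.left_commute)
  have "\<not> l dvd q" using l(2) pl(1) q by (simp add: in_prime_factors_iff)
  moreover have "\<not> l dvd \<Prod>D" using prime_dvd_prod_primes_iff[OF D(1,2) pl(1)] D(3) by blast
  ultimately have "\<not> l dvd m" using pl(1) by (simp add: m_def prime_dvd_mult_iff)
  hence co: "coprime l m" using pl(1) by (simp add: prime_imp_coprime)
  define g where "g u = complex_of_real (weight_on D (u + 1)) * ee (of_int (a * (u + 1)) / real q)" for u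
  have dv: "r dvd m" if "r \<in> D" for r
    using that D(1) dvd_prodI[of D r "\<lambda>x. x"] by (simp add: m_def dvd_mult)
  have per: "g x = g y" if xy: "[x = y] (mod int m)" for x y
  proof -
    have xy1: "[x + 1 = y + 1] (mod int m)" using xy by (intro cong_add) auto
    hence xq: "[x + 1 = y + 1] (mod int q)" by (rule cong_dvd_modulus) (simp add: m_def)
    show ?thesis unfolding g_def using weight_on_cong[OF dv xy1] ee_cong[OF q cong_scalar_left[OF xq]] by simp
  qed
  have "weight_on P v = local_weight l v * weight_on D v" for v
    unfolding weight_on_def ins using D by simp
  hence "sieve_average a q P = unit_average (l * m) (\<lambda>u. of_real (local_weight l (u + 1)) * g u)"
    unfolding sieve_average_def sm g_def by (simp add: mult.assoc)
  also have "\<dots> = 0" by (rule unit_average_zero[OF pl co m1 per])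
  finally show ?thesis .
qed

lemma sum_sieve_average:
  assumes q: "q \<ge> 1" and R: "R \<ge> 0"
  shows "(\<Sum>P\<in>sieve_sets R. sieve_average a q P) =
    (\<Sum>P\<in>sieve_sets R \<inter> Pow (odd_prime_factors q). unit_average q (\<lambda>u. of_real (weight_on P (u + 1)) * ee (of_int (a * (u + 1)) / real q)))"
proof (rule sum.mono_neutral_cong_right)
  show "finite (sieve_sets R)" by (rule sieve_sets_card[OF R])
  show "\<forall>P\<in>sieve_sets R - sieve_sets R \<inter> Pow (odd_prime_factors q). sieve_average a q P = 0"
  proof
    fix P assume P: "P \<in> sieve_sets R - sieve_sets R \<inter> Pow (odd_prime_factors q)"
    hence PR: "P \<in> sieve_sets R" by blast
    have "\<not> P \<subseteq> prime_factors q" using P sieve_setsD(3)[OF PR] by (auto simp: odd_prime_factors_def)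
    thus "sieve_average a q P = 0" by (rule sieve_average_zero[OF q PR])
  qed
  fix P assume "P \<in> sieve_sets R \<inter> Pow (odd_prime_factors q)"
  hence "P \<subseteq> prime_factors q" by (auto simp: odd_prime_factors_def)
  thus "sieve_average a q P = unit_average q (\<lambda>u. of_real (weight_on P (u + 1)) * ee (of_int (a * (u + 1)) / real q))"
    by (simp add: sieve_average_def sieve_modulus_def)
qed auto

lemma norm_sum_sieve_average_le:
  assumes q: "q \<ge> 1" and a: "coprime a (int q)" and R: "R \<ge> 0"
  shows "norm (\<Sum>P\<in>sieve_sets R. sieve_average a q P) \<le> 24 ^ card (prime_factors q) / real q"
proof -
  define k where "k = card (prime_factors q)"
  have "norm (\<Sum>P\<in>sieve_sets R. sieve_average a q P) \<le> (\<Sum>P\<in>sieve_sets R \<inter> Pow (odd_prime_factors q). 12 ^ k / real q)"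
    unfolding sum_sieve_average[OF q R] k_def
    by (rule sum_norm_le, rule norm_unit_average_weight_le[OF q a]) (auto simp: odd_prime_factors_def)
  also have "\<dots> = real (card (sieve_sets R \<inter> Pow (odd_prime_factors q))) * (12 ^ k / real q)" by simp
  also have "\<dots> \<le> 2 ^ k * (12 ^ k / real q)"
  proof (rule mult_right_mono)
    have "card (sieve_sets R \<inter> Pow (odd_prime_factors q)) \<le> card (Pow (prime_factors q))"
      by (rule card_mono) (auto simp: odd_prime_factors_def)
    also have "\<dots> = 2 ^ k" by (simp add: card_Pow k_def)
    finally show "real (card (sieve_sets R \<inter> Pow (odd_prime_factors q))) \<le> 2 ^ k"
      by (metis of_nat_le_iff of_nat_numeral of_nat_power)
  qed simp
  also have "\<dots> = (2 * 12) ^ k / real q" unfolding power_mult_distrib by simp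
  finally show ?thesis by (simp add: k_def)
qed

text \<open>
  For \<open>q \<le> R\<close> every set of odd primes of \<open>q\<close> has product at most
  \<open>R\<close>, so the full expansion is present.
\<close>

lemma sum_sieve_average_nonneg:
  assumes q: "q \<ge> 1" and R: "real q \<le> R"
  shows "\<exists>r\<ge>0. (\<Sum>P\<in>sieve_sets R. sieve_average a q P) = of_real r"
proof -
  have R0: "R \<ge> 0" using R by (rule order_trans[rotated]) simp
  have "Pow (odd_prime_factors q) \<subseteq> sieve_sets R"
  proof
    fix P assume "P \<in> Pow (odd_prime_factors q)"
    hence P: "P \<subseteq> odd_prime_factors q" by simp
    hence P2: "P \<subseteq> prime_factors q" by (auto simp: odd_prime_factors_def)
    have "real (\<Prod>P) \<le> real q" using prod_prime_factors_le[OF q P2] by (simp only: of_nat_le_iff)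
    moreover have "finite P" using P2 by (rule finite_subset) simp
    moreover have "\<forall>l\<in>P. prime l \<and> odd l" using P by (auto simp: odd_prime_factors_def in_prime_factors_iff)
    ultimately show "P \<in> sieve_sets R" unfolding sieve_sets_def using order_trans[OF _ R] by blast
  qed
  hence "sieve_sets R \<inter> Pow (odd_prime_factors q) = Pow (odd_prime_factors q)" by blast
  thus ?thesis using sum_unit_average_nonneg[OF q, of a] unfolding sum_sieve_average[OF q R0] by simp
qed

lemma sum_sieve_average_trivial:
  assumes R: "R \<ge> 1" shows "(\<Sum>P\<in>sieve_sets R. sieve_average 0 1 P) = 1"
proof -
  have "odd_prime_factors 1 = {}" by (simp add: odd_prime_factors_def)
  moreover have "{} \<in> sieve_sets R" using R by (simp add: sieve_sets_def)
  ultimately have e: "sieve_sets R \<inter> Pow (odd_prime_factors 1) = {{}}" by auto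
  have "unit_residues 1 = {0}" by (auto simp: unit_residues_def)
  moreover have R0: "R \<ge> 0" using R by simp
  ultimately show ?thesis
    unfolding sum_sieve_average[OF order_refl R0] e by (simp add: unit_average_def weight_on_def)
qed

definition sieved_prime_sum :: "nat \<Rightarrow> real \<Rightarrow> complex" where
  "sieved_prime_sum N \<theta> = (\<Sum>P\<in>sieve_sets (real N powr (1 / 60)). prime_exp_sum N P \<theta>)"

lemma sieved_prime_sum_approx:
  assumes K: "prime_sum_bound K" "K > 0"
  shows "\<exists>C>0. \<forall>N q a b. N \<ge> 1 \<longrightarrow> q \<ge> 1 \<longrightarrow> real q \<le> real N powr (4 / 5) \<longrightarrow> \<bar>b\<bar> \<le> 2 / (real q * real N powr (4 / 5)) \<longrightarrow>
    norm (sieved_prime_sum N (of_int a / real q + b) - ee b * (\<Sum>P\<in>sieve_sets (real N powr (1 / 60)). sieve_average a q P) * tent_sum N b)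
      \<le> C * real N powr (179 / 90)"
proof -
  have "\<exists>C>0. \<forall>P. finite P \<and> (\<forall>l\<in>P. l \<ge> (1::nat)) \<longrightarrow> (2::real) ^ card P \<le> C * real (\<Prod>P) powr (1 / 2)"
    by (rule power_card_le_prod_powr) simp_all
  then obtain C1 where C1: "C1 > 0" "\<forall>P. finite P \<and> (\<forall>l\<in>P. l \<ge> (1::nat)) \<longrightarrow> (2::real) ^ card P \<le> C1 * real (\<Prod>P) powr (1 / 2)"
    by (elim exE conjE) (rule that)
  define C where "C = 384000 * (K + 1) * C1"
  have "C > 0" using K C1 by (simp add: C_def)
  moreover have "norm (sieved_prime_sum N (of_int a / real q + b) - ee b * (\<Sum>P\<in>sieve_sets (real N powr (1 / 60)). sieve_average a q P) * tent_sum N b)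
      \<le> C * real N powr (179 / 90)"
    if N: "N \<ge> 1" and q: "q \<ge> 1" "real q \<le> real N powr (4 / 5)" and b: "\<bar>b\<bar> \<le> 2 / (real q * real N powr (4 / 5))"
    for N q a b
  proof -
    define R where "R = real N powr (1 / 60)"
    have R0: "R \<ge> 0" by (simp add: R_def)
    have each: "norm (prime_exp_sum N P (of_int a / real q + b) - ee b * sieve_average a q P * tent_sum N b)
        \<le> C * real N powr (179 / 90 - 1 / 60)" if P: "P \<in> sieve_sets R" for P
    proof -
      note P' = sieve_setsD[OF P]
      define m where "m = sieve_modulus q P"
      have m: "m \<ge> 1" "q dvd m" "m \<le> q * \<Prod>P"
        using q(1) P'(5) by (simp_all add: m_def sieve_modulus_def)
      have lm: "l dvd m" if "l \<in> P" for l
        using that P'(1) dvd_prodI[of P l "\<lambda>x. x"] by (auto simp: m_def sieve_modulus_def in_prime_factors_iff)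
      have l2: "l \<ge> 2" if "l \<in> P" for l using P'(2)[OF that] by (rule prime_ge_2_nat)
      have u: "(2::real) ^ card P \<le> C1 * real (\<Prod>P) powr (1 / 2)"
      proof -
        have "\<forall>l\<in>P. l \<ge> 1" using l2 by fastforce
        thus ?thesis using C1(2) P'(1) by blast
      qed
      have "norm (prime_exp_sum N P (of_int a / real q + b) - ee b * sieve_average a q P * tent_sum N b) \<le>
        64 * (K + 1) * 2 ^ card P * sqrt (real m) * ln (real m + 2) * real N powr (31 / 20) * (1 + real N * \<bar>b\<bar>)\<^sup>2"
        unfolding sieve_average_def m_def[symmetric] by (rule prime_exp_sum_approx[OF K N m(1) q(1) m(2) P'(1) lm l2])
      also have "\<dots> \<le> 384000 * (K + 1) * C1 * real N powr (179 / 90 - 1 / 60)"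
        by (rule error_term_bound[OF N K(2) C1(1) q b P'(4)[unfolded R_def] u m(3)])
      finally show ?thesis by (simp only: C_def)
    qed
    have "sieved_prime_sum N (of_int a / real q + b) - ee b * (\<Sum>P\<in>sieve_sets R. sieve_average a q P) * tent_sum N b =
       (\<Sum>P\<in>sieve_sets R. prime_exp_sum N P (of_int a / real q + b) - ee b * sieve_average a q P * tent_sum N b)"
      unfolding sieved_prime_sum_def R_def[symmetric] sum_subtractf sum_distrib_left sum_distrib_right ..
    also have "norm \<dots> \<le> (\<Sum>P\<in>sieve_sets R. C * real N powr (179 / 90 - 1 / 60))" by (rule sum_norm_le[OF each])
    also have "\<dots> = real (card (sieve_sets R)) * (C * real N powr (179 / 90 - 1 / 60))" by simp
    also have "\<dots> \<le> R * (C * real N powr (179 / 90 - 1 / 60))"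
      using \<open>C > 0\<close> by (intro mult_right_mono sieve_sets_card[OF R0]) auto
    also have "\<dots> = C * (real N powr (1 / 60) * real N powr (179 / 90 - 1 / 60))" by (simp add: R_def)
    also have "real N powr (1 / 60) * real N powr (179 / 90 - 1 / 60) = real N powr (179 / 90)"
      unfolding powr_add[symmetric] by simp
    finally show ?thesis by (simp only: R_def)
  qed
  ultimately show ?thesis by blast
qed

text \<open>
  The factor \<open>24\<^sup>k\<close>, \<open>k\<close> the number of prime factors of
  \<open>q\<close>, is at most a constant times the cube root of \<open>q\<close>.
\<close>

lemma norm_sum_sieve_average_powr:
  "\<exists>C>0. \<forall>q a R. q \<ge> 1 \<longrightarrow> coprime a (int q) \<longrightarrow> R \<ge> 0 \<longrightarrow> norm (\<Sum>P\<in>sieve_sets R. sieve_average a q P) \<le> C * real q powr (- 2 / 3)"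
proof -
  have "\<exists>C>0. \<forall>P. finite P \<and> (\<forall>l\<in>P. l \<ge> (1::nat)) \<longrightarrow> (24::real) ^ card P \<le> C * real (\<Prod>P) powr (1 / 3)"
    by (rule power_card_le_prod_powr) simp_all
  then obtain C where C: "C > 0" "\<forall>P. finite P \<and> (\<forall>l\<in>P. l \<ge> (1::nat)) \<longrightarrow> (24::real) ^ card P \<le> C * real (\<Prod>P) powr (1 / 3)"
    by (elim exE conjE) (rule that)
  have "norm (\<Sum>P\<in>sieve_sets R. sieve_average a q P) \<le> C * real q powr (- 2 / 3)"
    if q: "q \<ge> 1" and a: "coprime a (int q)" and R: "R \<ge> 0" for q a R
  proof -
    have f: "\<forall>l\<in>prime_factors q. l \<ge> 1" using prime_ge_1_nat by (auto simp: in_prime_factors_iff)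
    have "24 ^ card (prime_factors q) \<le> C * real (\<Prod>(prime_factors q)) powr (1 / 3)" using C(2) f by blast
    also have "\<dots> \<le> C * real q powr (1 / 3)"
    proof (intro mult_left_mono powr_mono2)
      show "real (\<Prod>(prime_factors q)) \<le> real q" using prod_prime_factors_le[OF q order_refl] by (simp only: of_nat_le_iff)
      show "0 \<le> real (\<Prod>(prime_factors q))" by (rule of_nat_0_le_iff)
      show "0 \<le> C" using C(1) by simp
    qed simp
    finally have "24 ^ card (prime_factors q) / real q \<le> C * real q powr (1 / 3) / real q" by (rule divide_right_mono) simp
    also have "\<dots> = C * (real q powr (1 / 3) / real q powr 1)" using q by simp
    also have "real q powr (1 / 3) / real q powr 1 = real q powr (- 2 / 3)" unfolding powr_diff[symmetric] by simp
    finally show ?thesis using norm_sum_sieve_average_le[OF q a R] by linarith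
  qed
  thus ?thesis using C(1) by blast
qed

text \<open>
  At a frequency near \<open>a/q\<close> the main term is \<open>ee b * U * T\<close>, where
  \<open>U\<close> is the sum of the averages and \<open>T\<close> is half a Fejer kernel. For
  \<open>q \<le> R\<close> the number \<open>U\<close> is nonnegative and bounded, so that only
  \<open>ee b - 1\<close> can produce a negative real part; for \<open>q > R\<close> the number
  \<open>U\<close> is small.
\<close>

lemma sieved_prime_sum_lower:
  assumes K: "prime_sum_bound K" "K > 0"
  shows "\<exists>C>0. \<forall>N\<ge>1. (\<forall>\<theta>. Re (sieved_prime_sum N \<theta>) \<ge> - C * real N powr (179 / 90)) \<and>
     Re (sieved_prime_sum N 0) \<ge> (real N)\<^sup>2 / 2 - C * real N powr (179 / 90)"
proof -
  obtain C1 where C1: "C1 > 0" "\<forall>N q a b. N \<ge> 1 \<longrightarrow> q \<ge> 1 \<longrightarrow> real q \<le> real N powr (4 / 5) \<longrightarrow> \<bar>b\<bar> \<le> 2 / (real q * real N powr (4 / 5)) \<longrightarrow>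
    norm (sieved_prime_sum N (of_int a / real q + b) - ee b * (\<Sum>P\<in>sieve_sets (real N powr (1 / 60)). sieve_average a q P) * tent_sum N b)
      \<le> C1 * real N powr (179 / 90)" using sieved_prime_sum_approx[OF K] by blast
  obtain C2 where C2: "C2 > 0" "\<forall>q a R. q \<ge> 1 \<longrightarrow> coprime a (int q) \<longrightarrow> R \<ge> 0 \<longrightarrow> norm (\<Sum>P\<in>sieve_sets R. sieve_average a q P) \<le> C2 * real q powr (- 2 / 3)"
    using norm_sum_sieve_average_powr by blast
  define C where "C = C1 + 16 * C2"
  have C0: "C > 0" using C1(1) C2(1) by (simp add: C_def)
  have lower: "Re (sieved_prime_sum N \<theta>) \<ge> - C * real N powr (179 / 90)" if N: "N \<ge> 1" for N \<theta>
  proof -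
    define x where "x = real N"
    define Q where "Q = x powr (4 / 5)"
    define R where "R = x powr (1 / 60)"
    define Y where "Y = x powr (179 / 90)"
    have x: "x \<ge> 1" using N by (simp add: x_def)
    have Y0: "Y \<ge> 0" by (simp add: Y_def)
    have Q: "Q \<ge> 1" using x by (simp add: Q_def ge_one_powr_ge_zero)
    have R: "R \<ge> 1" using x by (simp add: R_def ge_one_powr_ge_zero)
    obtain a q b where ab: "\<theta> = of_int a / real q + b" "coprime a (int q)" "q \<ge> 1" "real q \<le> Q" "\<bar>b\<bar> \<le> 2 / (real q * Q)"
      using rational_approx[OF Q, of \<theta>] by blast
    define U where "U = (\<Sum>P\<in>sieve_sets R. sieve_average a q P)"
    define T where "T = tent_sum N b"
    have R0: "R \<ge> 0" using R by simp
    have U: "norm U \<le> C2 * real q powr (- 2 / 3)" unfolding U_def using C2(2) ab(2,3) R0 by blast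
    have T: "norm T \<le> x\<^sup>2" unfolding T_def x_def by (rule norm_tent_sum[OF N])
    have app: "norm (sieved_prime_sum N \<theta> - ee b * U * T) \<le> C1 * Y"
      using C1(2) N ab unfolding U_def T_def R_def Q_def Y_def x_def by blast
    have x2: "x\<^sup>2 = x powr 2" using x by simp
    have main: "Re (ee b * U * T) \<ge> - (16 * C2 * Y)"
    proof (cases "real q \<le> R")
      case True
      obtain r where r: "r \<ge> 0" "U = of_real r" unfolding U_def using sum_sieve_average_nonneg[OF ab(3) True, of a] by blast
      have "real q powr (- 2 / 3) \<le> real q powr 0" using ab(3) by (intro powr_mono) auto
      also have "real q powr 0 = 1" using ab(3) by simp
      finally have "C2 * real q powr (- 2 / 3) \<le> C2 * 1" using C2(1) by (intro mult_left_mono) auto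
      hence "norm U \<le> C2" using U by linarith
      hence rC: "r \<le> C2" using r by simp
      have "Re (U * T) \<ge> 0" unfolding r(2) T_def tent_sum_def using fejer_nonneg[of N b] r(1) by simp
      moreover have "norm ((ee b - 1) * U * T) \<le> 16 * C2 * Y"
      proof -
        have "\<bar>b\<bar> \<le> 2 / Q"
        proof -
          have "1 * Q \<le> real q * Q" using ab(3) Q by (intro mult_right_mono) auto
          hence "2 / (real q * Q) \<le> 2 / Q" using Q by (intro divide_left_mono) auto
          thus ?thesis using ab(5) by linarith
        qed
        hence "norm (ee b - 1) \<le> 8 * (2 / Q)" using norm_ee_minus_1_le[of b] by linarith
        hence "norm ((ee b - 1) * U * T) \<le> 8 * (2 / Q) * C2 * x\<^sup>2"
          unfolding norm_mult using \<open>norm U \<le> C2\<close> T C2(1) Q by (intro mult_mono) auto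
        also have "\<dots> = 16 * C2 * (x powr 2 / x powr (4 / 5))" by (simp add: x2 Q_def)
        also have "x powr 2 / x powr (4 / 5) = x powr (6 / 5)" unfolding powr_diff[symmetric] by simp
        also have "16 * C2 * x powr (6 / 5) \<le> 16 * C2 * Y"
          unfolding Y_def using C2(1) x by (intro mult_left_mono powr_mono) auto
        finally show ?thesis .
      qed
      moreover have "Re (ee b * U * T) = Re (U * T) + Re ((ee b - 1) * U * T)"
        unfolding plus_complex.sel(1)[symmetric] by (rule arg_cong[of _ _ Re]) (simp add: algebra_simps)
      ultimately show ?thesis using abs_Re_le_cmod[of "(ee b - 1) * U * T"] by linarith
    next
      case False
      have "norm (ee b * U * T) \<le> (C2 * real q powr (- 2 / 3)) * x\<^sup>2"
        unfolding norm_mult norm_ee using U T C2(1) by (simp add: mult_mono)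
      also have "real q powr (- 2 / 3) \<le> R powr (- 2 / 3)" using False R by (intro powr_mono2') auto
      also have "R powr (- 2 / 3) = x powr (- 1 / 90)" by (simp add: R_def powr_powr)
      finally have "norm (ee b * U * T) \<le> C2 * x powr (- 1 / 90) * x\<^sup>2" using C2(1) by (simp add: mult_right_mono mult_left_mono)
      also have "\<dots> = C2 * (x powr (- 1 / 90) * x powr 2)" by (simp add: x2)
      also have "x powr (- 1 / 90) * x powr 2 = Y" unfolding powr_add[symmetric] Y_def by simp
      finally have "norm (ee b * U * T) \<le> C2 * Y" .
      also have "\<dots> \<le> 16 * C2 * Y" using C2(1) Y0 by (intro mult_right_mono) auto
      finally show ?thesis using abs_Re_le_cmod[of "ee b * U * T"] by linarith
    qed
    have "\<bar>Re (sieved_prime_sum N \<theta>) - Re (ee b * U * T)\<bar> \<le> C1 * Y"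
      using app abs_Re_le_cmod[of "sieved_prime_sum N \<theta> - ee b * U * T"] by simp
    hence "Re (sieved_prime_sum N \<theta>) \<ge> - (C1 * Y) - 16 * C2 * Y" using main by linarith
    also have "- (C1 * Y) - 16 * C2 * Y = - C * Y" by (simp add: C_def algebra_simps)
    finally show ?thesis by (simp only: Y_def x_def)
  qed
  have "Re (sieved_prime_sum N 0) \<ge> (real N)\<^sup>2 / 2 - C * real N powr (179 / 90)" if N: "N \<ge> 1" for N
  proof -
    define Y where "Y = real N powr (179 / 90)"
    have R1: "real N powr (1 / 60) \<ge> 1" using N by (simp add: ge_one_powr_ge_zero)
    have Q1: "real 1 \<le> real N powr (4 / 5)" using N by (simp add: ge_one_powr_ge_zero)
    have T0: "tent_sum N 0 = of_real ((real N)\<^sup>2 / 2)" unfolding tent_sum_def by (rule tent_sum_at_0[OF N])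
    have "\<bar>0\<bar> \<le> 2 / (real 1 * real N powr (4 / 5))" by simp
    hence "norm (sieved_prime_sum N (of_int 0 / real 1 + 0) - ee 0 * (\<Sum>P\<in>sieve_sets (real N powr (1 / 60)). sieve_average 0 1 P) * tent_sum N 0) \<le> C1 * Y"
      unfolding Y_def using C1(2) N Q1 order_refl[of "1 :: nat"] by blast
    hence "norm (sieved_prime_sum N 0 - of_real ((real N)\<^sup>2 / 2)) \<le> C1 * Y"
      unfolding sum_sieve_average_trivial[OF R1] T0 by simp
    hence "Re (sieved_prime_sum N 0) \<ge> (real N)\<^sup>2 / 2 - C1 * Y"
      using abs_Re_le_cmod[of "sieved_prime_sum N 0 - of_real ((real N)\<^sup>2 / 2)"] by simp
    moreover have "C1 * Y \<le> C * Y" using C2(1) by (intro mult_right_mono) (auto simp: C_def Y_def)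
    ultimately show ?thesis unfolding Y_def by linarith
  qed
  thus ?thesis using C0 lower by blast
qed

section \<open>From exponential sums to difference sets\<close>

text \<open>
  The choice \<open>M = 2 N + 1\<close> makes \<open>n + 1 + (a - a')\<close> divisible by
  \<open>M\<close> only if it is zero. Adding \<open>E\<close> to the real part of \<open>S\<close>
  makes all terms of the sum over frequencies nonnegative, and it is then bounded below by the term
  at frequency 0.
\<close>

lemma card_le_of_exponential_sum:
  fixes A :: "int set" and w :: "nat \<Rightarrow> real"
  assumes A: "A \<subseteq> {1..int N}" and w: "\<And>n. n < N \<Longrightarrow> w n \<noteq> 0 \<Longrightarrow> int n + 1 \<notin> difference_set A"
    and E: "\<And>\<theta>. Re (\<Sum>n<N. of_real (w n) * ee (real (n + 1) * \<theta>)) \<ge> - E" "E \<ge> 0"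
  shows "real (card A) * (\<Sum>n<N. w n) \<le> real (2 * N + 1) * E"
proof -
  define M where "M = 2 * N + 1"
  have M: "M \<ge> 1" by (simp add: M_def)
  have finA: "finite A" by (rule finite_subset[OF A]) simp
  define I where "I = {0..<int M}"
  define F where "F r = (\<Sum>a\<in>A. ee (of_int (a * r) / real M))" for r :: int
  define G where "G r = (\<Sum>n<N. of_real (w n) * ee (real (n + 1) * (of_int r / real M)))" for r :: int
  have sq: "of_real ((norm (F r))\<^sup>2) = (\<Sum>a\<in>A. \<Sum>a'\<in>A. ee (of_int ((a - a') * r) / real M))" for r
  proof -
    have "of_real ((norm (F r))\<^sup>2) = F r * cnj (F r)" by (rule complex_norm_square)
    also have "\<dots> = (\<Sum>a\<in>A. \<Sum>a'\<in>A. ee (of_int (a * r) / real M) * cnj (ee (of_int (a' * r) / real M)))"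
      unfolding F_def cnj_sum by (rule sum_product)
    also have "\<dots> = (\<Sum>a\<in>A. \<Sum>a'\<in>A. ee (of_int ((a - a') * r) / real M))"
      by (rule sum.cong[OF refl], rule sum.cong[OF refl])
         (simp add: ee_minus[symmetric] ee_add[symmetric] left_diff_distrib diff_divide_distrib)
    finally show ?thesis .
  qed
  have par: "(\<Sum>r\<in>I. (norm (F r))\<^sup>2) = real M * real (card A)"
  proof -
    have "complex_of_real (\<Sum>r\<in>I. (norm (F r))\<^sup>2) = (\<Sum>r\<in>I. \<Sum>a\<in>A. \<Sum>a'\<in>A. ee (of_int ((a - a') * r) / real M))"
      by (simp only: of_real_sum sq)
    also have "\<dots> = (\<Sum>a\<in>A. \<Sum>a'\<in>A. \<Sum>r\<in>I. ee (of_int ((a - a') * r) / real M))"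
      by (subst sum.swap, rule sum.cong[OF refl], rule sum.swap)
    also have "\<dots> = (\<Sum>a\<in>A. \<Sum>a'\<in>A. if a' = a then of_nat M else 0)"
    proof (rule sum.cong[OF refl], rule sum.cong[OF refl])
      fix a a' assume a: "a \<in> A" "a' \<in> A"
      have "int M dvd a - a' \<longleftrightarrow> a' = a"
      proof
        assume d: "int M dvd a - a'"
        have "1 \<le> a" "a \<le> int N" "1 \<le> a'" "a' \<le> int N" using a A by auto
        hence "\<bar>a - a'\<bar> < int M" by (simp add: M_def abs_less_iff)
        thus "a' = a" using d zdvd_not_zless[of "\<bar>a - a'\<bar>" "int M"] by (cases "a = a'") auto
      qed simp
      thus "(\<Sum>r\<in>I. ee (of_int ((a - a') * r) / real M)) = (if a' = a then of_nat M else 0)"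
        unfolding I_def sum_ee_period[OF M] by simp
    qed
    also have "\<dots> = of_real (real M * real (card A))" using finA by simp
    finally show ?thesis by (simp only: of_real_eq_iff)
  qed
  have zero: "(\<Sum>r\<in>I. G r * of_real ((norm (F r))\<^sup>2)) = 0"
  proof -
    have "(\<Sum>r\<in>I. G r * of_real ((norm (F r))\<^sup>2)) =
      (\<Sum>r\<in>I. \<Sum>n<N. \<Sum>a\<in>A. \<Sum>a'\<in>A. of_real (w n) * ee (of_int ((int n + 1 + (a - a')) * r) / real M))"
    proof (rule sum.cong[OF refl])
      fix r
      have "ee (real (n + 1) * (of_int r / real M)) * ee (of_int ((a - a') * r) / real M) =
         ee (of_int ((int n + 1 + (a - a')) * r) / real M)" for n a a'
        unfolding ee_add[symmetric] by (rule arg_cong[of _ _ ee]) (simp add: algebra_simps add_divide_distrib diff_divide_distrib)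
      thus "G r * of_real ((norm (F r))\<^sup>2) =
         (\<Sum>n<N. \<Sum>a\<in>A. \<Sum>a'\<in>A. of_real (w n) * ee (of_int ((int n + 1 + (a - a')) * r) / real M))"
        unfolding sq G_def sum_distrib_right unfolding sum_distrib_left mult.assoc by simp
    qed
    also have "\<dots> = (\<Sum>n<N. \<Sum>r\<in>I. \<Sum>a\<in>A. \<Sum>a'\<in>A. of_real (w n) * ee (of_int ((int n + 1 + (a - a')) * r) / real M))"
      by (rule sum.swap)
    also have "\<dots> = (\<Sum>n<N. 0)"
    proof (rule sum.cong[OF refl])
      fix n assume n: "n \<in> {..<N}"
      have "(\<Sum>r\<in>I. \<Sum>a\<in>A. \<Sum>a'\<in>A. of_real (w n) * ee (of_int ((int n + 1 + (a - a')) * r) / real M)) =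
        (\<Sum>a\<in>A. \<Sum>a'\<in>A. \<Sum>r\<in>I. of_real (w n) * ee (of_int ((int n + 1 + (a - a')) * r) / real M))"
        by (subst sum.swap, rule sum.cong[OF refl], rule sum.swap)
      also have "\<dots> = (\<Sum>a\<in>A. \<Sum>a'\<in>A. 0)"
      proof (rule sum.cong[OF refl], rule sum.cong[OF refl])
        fix a a' assume a: "a \<in> A" "a' \<in> A"
        have "w n = 0 \<or> \<not> int M dvd int n + 1 + (a - a')"
        proof (rule ccontr)
          assume c: "\<not> (w n = 0 \<or> \<not> int M dvd int n + 1 + (a - a'))"
          have "1 \<le> a" "a \<le> int N" "1 \<le> a'" "a' \<le> int N" "int n < int N" using a A n by auto
          hence "\<bar>int n + 1 + (a - a')\<bar> < int M" by (simp add: M_def abs_less_iff)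
          hence "int n + 1 + (a - a') = 0"
            using c zdvd_not_zless[of "\<bar>int n + 1 + (a - a')\<bar>" "int M"] by (cases "int n + 1 + (a - a') = 0") auto
          hence "int n + 1 = a' - a" by simp
          hence "int n + 1 \<in> difference_set A" using a unfolding difference_set_def by blast
          thus False using w[of n] n c by auto
        qed
        thus "(\<Sum>r\<in>I. of_real (w n) * ee (of_int ((int n + 1 + (a - a')) * r) / real M)) = 0"
          unfolding sum_distrib_left[symmetric] I_def sum_ee_period[OF M] by auto
      qed
      finally show "(\<Sum>r\<in>I. \<Sum>a\<in>A. \<Sum>a'\<in>A. of_real (w n) * ee (of_int ((int n + 1 + (a - a')) * r) / real M)) = 0" by simp
    qed
    finally show ?thesis by simp
  qed
  define g where "g r = (Re (G r) + E) * (norm (F r))\<^sup>2" for r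
  have g0: "g r \<ge> 0" for r
    unfolding g_def using E(1)[of "of_int r / real M"] by (intro mult_nonneg_nonneg) (auto simp: G_def)
  have "(\<Sum>r\<in>I. Re (G r) * (norm (F r))\<^sup>2) = 0"
    using arg_cong[OF zero, of Re] by (simp add: Re_sum)
  hence sg: "(\<Sum>r\<in>I. g r) = E * (real M * real (card A))"
    unfolding g_def distrib_right sum.distrib sum_distrib_left[symmetric] par by simp
  have "g 0 \<le> (\<Sum>r\<in>I. g r)" by (rule member_le_sum) (auto simp: I_def M_def g0)
  moreover have "g 0 = ((\<Sum>n<N. w n) + E) * (real (card A))\<^sup>2"
    by (simp add: g_def G_def F_def)
  ultimately have le: "((\<Sum>n<N. w n) + E) * (real (card A))\<^sup>2 \<le> E * (real M * real (card A))" using sg by simp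
  have "(\<Sum>n<N. w n) * (real (card A))\<^sup>2 \<le> ((\<Sum>n<N. w n) + E) * (real (card A))\<^sup>2"
    using E(2) by (intro mult_right_mono) auto
  hence "((\<Sum>n<N. w n) * real (card A)) * real (card A) \<le> (E * real M) * real (card A)"
    using le by (simp add: power2_eq_square mult_ac)
  hence "(\<Sum>n<N. w n) * real (card A) \<le> E * real M \<or> card A = 0" by auto
  thus ?thesis using E(2) by (auto simp: M_def mult.commute)
qed

lemma sieved_prime_sum_weights:
  "\<exists>w. (\<forall>n. w n \<noteq> 0 \<longrightarrow> prime n) \<and> (\<forall>\<theta>. sieved_prime_sum N \<theta> = (\<Sum>n<N. of_real (w n) * ee (real (n + 1) * \<theta>)))"
proof -
  define w where "w n = (if prime n then (\<Sum>P\<in>sieve_sets (real N powr (1 / 60)). ln (real n) * weight_on P (int n + 1) * (real N - real n)) else 0)" for n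
  have "sieved_prime_sum N \<theta> = (\<Sum>n<N. of_real (w n) * ee (real (n + 1) * \<theta>))" for \<theta>
  proof -
    have "sieved_prime_sum N \<theta> = (\<Sum>n | n < N \<and> prime n. \<Sum>P\<in>sieve_sets (real N powr (1 / 60)).
       of_real (ln (real n) * weight_on P (int n + 1) * (real N - real n)) * ee (real (n + 1) * \<theta>))"
      unfolding sieved_prime_sum_def prime_exp_sum_def by (rule sum.swap)
    also have "\<dots> = (\<Sum>n | n < N \<and> prime n. of_real (w n) * ee (real (n + 1) * \<theta>))"
    proof (rule sum.cong[OF refl])
      fix n assume "n \<in> {n. n < N \<and> prime n}"
      hence "w n = (\<Sum>P\<in>sieve_sets (real N powr (1 / 60)). ln (real n) * weight_on P (int n + 1) * (real N - real n))"
        by (simp add: w_def)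
      thus "(\<Sum>P\<in>sieve_sets (real N powr (1 / 60)). of_real (ln (real n) * weight_on P (int n + 1) * (real N - real n)) * ee (real (n + 1) * \<theta>)) =
         of_real (w n) * ee (real (n + 1) * \<theta>)"
        by (simp only: of_real_sum sum_distrib_right)
    qed
    also have "\<dots> = (\<Sum>n<N. of_real (w n) * ee (real (n + 1) * \<theta>))"
      by (rule sum.mono_neutral_left) (auto simp: w_def)
    finally show ?thesis .
  qed
  moreover have "\<forall>n. w n \<noteq> 0 \<longrightarrow> prime n" by (simp add: w_def)
  ultimately show ?thesis by blast
qed

theorem theorem1p1:
  assumes "generalised_riemann_hypothesis"
  shows "\<forall>\<epsilon>::real. \<epsilon> > 0 \<longrightarrow>
    (\<exists>C::real. C > 0 \<and>
      (\<forall>N::nat. N \<ge> 1 \<longrightarrow>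
        (\<forall>A::int set. A \<subseteq> {1..int N} \<and> \<not> (\<exists>p::int. prime p \<and> p + 1 \<in> difference_set A) \<longrightarrow>
           real (card A) \<le> C * real N powr (89 / 90 + \<epsilon>))))"
proof (intro allI impI)
  fix \<epsilon> :: real assume \<epsilon>: "\<epsilon> > 0"
  obtain K where K: "K > 0" "prime_sum_bound K" using prime_character_sum_GRH[OF assms] by blast
  obtain C where C: "C > 0" "\<forall>N\<ge>1. (\<forall>\<theta>. Re (sieved_prime_sum N \<theta>) \<ge> - C * real N powr (179 / 90)) \<and>
     Re (sieved_prime_sum N 0) \<ge> (real N)\<^sup>2 / 2 - C * real N powr (179 / 90)"
    using sieved_prime_sum_lower[OF K(2,1)] by blast
  \<comment> \<open>The first summand covers \<open>N \<le> (4 C)\<^sup>9\<^sup>0\<close> trivially; beyond it the error is at most half of the main term.\<close>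
  define B where "B = (4 * C) powr 90 + 12 * C"
  have B0: "B > 0" using C(1) by (simp add: B_def add_nonneg_pos)
  have "real (card A) \<le> B * real N powr (89 / 90 + \<epsilon>)"
    if N: "N \<ge> 1" and A: "A \<subseteq> {1..int N} \<and> \<not> (\<exists>p::int. prime p \<and> p + 1 \<in> difference_set A)" for N A
  proof -
    define x where "x = real N"
    have x: "x \<ge> 1" using N by (simp add: x_def)
    define Y where "Y = x powr (179 / 90)"
    have Y0: "Y \<ge> 0" by (simp add: Y_def)
    have cN: "real (card A) \<le> x"
      using card_mono[of "{1..int N}" A] A by (simp add: x_def)
    have "real (card A) \<le> B * x powr (89 / 90)"
    proof (cases "x \<le> (4 * C) powr 90")
      case True
      hence "real (card A) \<le> B * 1" using cN C(1) by (simp add: B_def)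
      also have "\<dots> \<le> B * x powr (89 / 90)" using x B0 by (intro mult_left_mono ge_one_powr_ge_zero) auto
      finally show ?thesis .
    next
      case False
      have "((4 * C) powr 90) powr (1 / 90) \<le> x powr (1 / 90)" using False by (intro powr_mono2) auto
      moreover have "((4 * C) powr 90) powr (1 / 90) = 4 * C" unfolding powr_powr using C(1) by simp
      ultimately have "4 * C \<le> x powr (1 / 90)" by (simp only:)
      hence "4 * C * Y \<le> x powr (1 / 90) * Y" using Y0 by (rule mult_right_mono)
      also have "\<dots> = x powr 2" unfolding Y_def powr_add[symmetric] by simp
      also have "x powr 2 = x\<^sup>2" using x by simp
      finally have CY: "C * Y \<le> x\<^sup>2 / 4" by simp
      obtain w where w: "\<forall>n. w n \<noteq> 0 \<longrightarrow> prime n" "\<forall>\<theta>. sieved_prime_sum N \<theta> = (\<Sum>n<N. of_real (w n) * ee (real (n + 1) * \<theta>))"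
        using sieved_prime_sum_weights[of N] by blast
      have "sieved_prime_sum N 0 = of_real (\<Sum>n<N. w n)" using w(2) by simp
      hence W: "x\<^sup>2 / 4 \<le> (\<Sum>n<N. w n)" using C(2) N CY unfolding x_def Y_def by fastforce
      have "real (card A) * (\<Sum>n<N. w n) \<le> real (2 * N + 1) * (C * Y)"
      proof (rule card_le_of_exponential_sum)
        show "A \<subseteq> {1..int N}" using A by blast
        fix n assume "w n \<noteq> 0"
        hence "prime (int n)" using w(1) by simp
        thus "int n + 1 \<notin> difference_set A" using A by blast
      next
        fix \<theta>
        have "- C * real N powr (179 / 90) \<le> Re (sieved_prime_sum N \<theta>)" using C(2) N by blast
        thus "- (C * Y) \<le> Re (\<Sum>n<N. of_real (w n) * ee (real (n + 1) * \<theta>))"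
          unfolding w(2)[rule_format, symmetric] Y_def x_def by simp
      qed (use C(1) Y0 in simp)
      also have "\<dots> \<le> (3 * x) * (C * Y)" using x C(1) Y0 by (intro mult_right_mono) (auto simp: x_def)
      finally have "real (card A) * (\<Sum>n<N. w n) \<le> 3 * x * (C * Y)" .
      hence "real (card A) * (x\<^sup>2 / 4) \<le> 3 * x * (C * Y)" using W mult_left_mono[OF W, of "real (card A)"] by linarith
      hence "real (card A) * x \<le> 12 * C * Y" using x by (simp add: power2_eq_square field_simps)
      hence "real (card A) \<le> 12 * C * (Y / x powr 1)" using x by (simp add: field_simps)
      also have "Y / x powr 1 = x powr (89 / 90)" unfolding Y_def powr_diff[symmetric] by simp
      also have "12 * C * x powr (89 / 90) \<le> B * x powr (89 / 90)" by (intro mult_right_mono) (auto simp: B_def)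
      finally show ?thesis .
    qed
    also have "\<dots> \<le> B * x powr (89 / 90 + \<epsilon>)" using x B0 \<epsilon> by (intro mult_left_mono powr_mono) auto
    finally show ?thesis by (simp only: x_def)
  qed
  thus "\<exists>C>0. \<forall>N\<ge>1. \<forall>A. A \<subseteq> {1..int N} \<and> \<not> (\<exists>p::int. prime p \<and> p + 1 \<in> difference_set A) \<longrightarrow>
           real (card A) \<le> C * real N powr (89 / 90 + \<epsilon>)" using B0 by blast
qed

end
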